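(* The subalgebras $\mathfrak A_p^{\mathbb Z_p^*}$ of $C^*_r(P,P_0)$ mutually commute for different primes $p$, and $$C^*_r(P,P_0)^{\hat{\mathbb Z}^*}\cong\bigotimes_{p\in\mathcal P}\mathfrak A_p^{\mathbb Z_p^*},$$ where $\mathcal P$ is the set of prime numbers.
   Context: $\mathbb A_f$ is the ring of finite adeles of $\mathbb Q$ and $\hat{\mathbb Z}=\prod_p\mathbb Z_p$. $P$ is the group of $4\times4$ block matrices $\begin{pmatrix}1&m\\0&g\end{pmatrix}$ with $m\in\operatorname{Mat}_2(\mathbb Q)$ and $g\in\operatorname{GL}_2^+(\mathbb Q)=\{g\in\operatorname{GL}_2(\mathbb Q):\det g>0\}$, and $P_0$ is the subgroup with $m\in\operatorname{Mat}_2(\mathbb Z)$, $g\in\operatorname{SL}_2(\mathbb Z)$; $(P,P_0)$ is a Hecke pair. For a Hecke pair $(N,N_0)$ (every double coset of $N_0$ in $N$ contains finitely many left and right $N_0$-cosets), the Hecke algebra $\mathcal H(N,N_0)$ consists of the complex $N_0$-biinvariant functions on $N$ supported on finitely many double cosets, with $(f_1*f_2)(x)=\sum_{y\in N_0\backslash N}f_1(xy^{-1})f_2(y)$, $f^*(x)=\overline{f(x^{-1})}$. The reduced Hecke C$^*$-algebra $C^*_r(N,N_0)$ is the closure of its image under $(\lambda(f)\xi)(x)=\sum_{y\in N_0\backslash N}f(xy^{-1})\xi(y)$ on $\ell^2(N_0\backslash N)$. Symmetries: let $\bar P$ be the group of matrices $\begin{pmatrix}1&m\\0&g\end{pmatrix}$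 with $m\in\operatorname{Mat}_2(\mathbb A_f)$, $g\in\operatorname{GL}_2^+(\mathbb A_f)=\{g\in\operatorname{GL}_2(\mathbb A_f):\det g\in\mathbb Q_+^*\}$, and $\bar P_0$ its subgroup with $m\in\operatorname{Mat}_2(\hat{\mathbb Z})$, $g\in\operatorname{SL}_2(\hat{\mathbb Z})$. Then $P$ is dense in $\bar P$, $P\cap\bar P_0=P_0$, and restriction of functions from $\bar P$ to $P$ identifies $\mathcal H(\bar P,\bar P_0)$ with $\mathcal H(P,P_0)$. For $r\in\operatorname{GL}_2(\hat{\mathbb Z})$ let $\theta_r$ be the automorphism $x\mapsto\begin{pmatrix}1&0\\0&r\end{pmatrix}x\begin{pmatrix}1&0\\0&r^{-1}\end{pmatrix}$ of $\bar P$, which preserves $\bar P_0$; it defines the automorphism $\alpha_r(f)=f\circ\theta_r^{-1}$ of the Hecke algebra, which extends to $C^*_r(P,P_0)$. Since $\alpha_r$ is trivial for $r\in\operatorname{SL}_2(\hat{\mathbb Z})$, this gives an action of $\operatorname{GL}_2(\hat{\mathbb Z})/\operatorname{SL}_2(\hat{\mathbb Z})\cong\hat{\mathbb Z}^*$ (via $\det$) on $C^*_r(P,P_0)$; $C^*_r(P,P_0)^{\hat{\mathbb Z}^*}$ is its fixed point algebra. For a prime $p$ let $G_p=\operatorname{GL}_2^+(\mathbb Z[p^{-1}])=\operatorname{GL}_2(\mathbb Z[p^{-1}])\cap\operatorname{GL}_2^+(\mathbb Q)$ and let $\mathfrak A_p=C^*_r(\operatorname{Mat}_2(\mathbb Z[p^{-1}])\rtimes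 G_p,\operatorname{Mat}_2(\mathbb Z)\rtimes\operatorname{SL}_2(\mathbb Z))$, where $\operatorname{Mat}_2(\mathbb Z[p^{-1}])\rtimes G_p$ is the subgroup of $P$ of matrices $\begin{pmatrix}1&m\\0&g\end{pmatrix}$ with $m\in\operatorname{Mat}_2(\mathbb Z[p^{-1}])$, $g\in G_p$. $\mathfrak A_p$ is regarded as a subalgebra of $C^*_r(P,P_0)$, namely the closure of the functions in $\mathcal H(P,P_0)$ supported on that subgroup. It is invariant under the $\hat{\mathbb Z}^*$-action, and on it the action factors through the projection $\hat{\mathbb Z}^*\to\mathbb Z_p^*$; $\mathfrak A_p^{\mathbb Z_p^*}$ is the fixed point algebra. The infinite tensor product is the C$^*$-tensor product of unital C$^*$-algebras with respect to the spatial (minimal) norm. *)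

theory Defs
  imports "HOL-Analysis.Analysis" "HOL-Algebra.Coset" "HOL-Computational_Algebra.Primes"
begin

section \<open>The ring of finite adeles of the rationals\<close>

definition padic_abs :: "nat \<Rightarrow> rat \<Rightarrow> real" where
  "padic_abs p x = (if x = 0 then 0 else
     real p powi (int (multiplicity (int p) (snd (quotient_of x)))
                - int (multiplicity (int p) (fst (quotient_of x)))))"

lemma padic_abs_frac:
  assumes p: "prime p" and "a \<noteq> 0" "b \<noteq> 0"
  shows "padic_abs p (of_int a / of_int b) =
    real p powi (int (multiplicity (int p) b) - int (multiplicity (int p) a))"
proof -
  obtain c d where q: "quotient_of (of_int a / of_int b) = (c, d)" by force
  have d: "d > 0" using quotient_of_denom_pos[OF q] .
  have e: "(of_int a / of_int b :: rat) = of_int c / of_int d" using quotient_of_div[OF q] .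
  have c: "c \<noteq> 0" using e assms d by auto
  have "(of_int (a * d) :: rat) = of_int (c * b)"
    using e assms d by (simp add: field_simps)
  then have "a * d = c * b" by (simp only: of_int_eq_iff)
  moreover have "prime_elem (int p)" using p by simp
  ultimately have "multiplicity (int p) a + multiplicity (int p) d
      = multiplicity (int p) c + multiplicity (int p) b"
    using prime_elem_multiplicity_mult_distrib[of "int p"] assms c d
    by (metis less_irrefl)
  then have "int (multiplicity (int p) d) - int (multiplicity (int p) c)
     = int (multiplicity (int p) b) - int (multiplicity (int p) a)" by linarith
  then show ?thesis using q assms by (simp add: padic_abs_def)
qed

lemma rat_common_denom:
  fixes x y :: rat
  obtains a c b where "b \<noteq> 0" "x = (of_int a / of_int b :: rat)" "y = of_int c / of_int b"
proof -
  obtain a1 b1 where 1: "quotient_of x = (a1, b1)" by force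
  obtain a2 b2 where 2: "quotient_of y = (a2, b2)" by force
  have "b1 > 0" "b2 > 0" using quotient_of_denom_pos 1 2 by auto
  then show thesis
    using that[of "b1 * b2" "a1 * b2" "a2 * b1"] quotient_of_div[OF 1] quotient_of_div[OF 2]
    by simp
qed

lemma padic_abs_0 [simp]: "padic_abs p 0 = 0"
  by (simp add: padic_abs_def)

lemma padic_abs_1 [simp]: "padic_abs p 1 = 1"
  by (simp add: padic_abs_def)

lemma padic_abs_nonneg [simp]: "padic_abs p x \<ge> 0"
  by (simp add: padic_abs_def)

lemma padic_abs_mult:
  assumes p: "prime p"
  shows "padic_abs p (x * y) = padic_abs p x * padic_abs p y"
proof (cases "x = 0 \<or> y = 0")
  case False
  obtain a c b where b: "b \<noteq> 0" and x: "x = of_int a / of_int b" and y: "y = of_int c / of_int b"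
    by (rule rat_common_denom)
  have ac: "a \<noteq> 0" "c \<noteq> 0" using False x y by auto
  have xy: "x * y = of_int (a * c) / of_int (b * b)" by (simp add: x y)
  have pe: "prime_elem (int p)" and p0: "real p \<noteq> 0" using p by auto
  let ?m = "\<lambda>x. int (multiplicity (int p) x)"
  have "padic_abs p (x * y) = real p powi (?m (b * b) - ?m (a * c))"
    unfolding xy using ac b by (intro padic_abs_frac p) auto
  also have "?m (b * b) - ?m (a * c) = (?m b - ?m a) + (?m b - ?m c)"
    using ac b by (simp add: prime_elem_multiplicity_mult_distrib[OF pe])
  also have "real p powi \<dots> = real p powi (?m b - ?m a) * real p powi (?m b - ?m c)"
    using p0 by (intro power_int_add) simp
  also have "\<dots> = padic_abs p x * padic_abs p y"
    using ac b by (simp add: x y padic_abs_frac[OF p])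
  finally show ?thesis .
qed auto

lemma padic_abs_minus [simp]: "padic_abs p (- x) = padic_abs p x"
proof -
  have "multiplicity (int p) (- c) = multiplicity (int p) c" for c
    by (simp add: multiplicity_def)
  then show ?thesis
    by (simp add: padic_abs_def rat_uminus_code split: prod.splits)
qed

lemma padic_abs_minus_commute: "padic_abs p (x - y) = padic_abs p (y - x)"
  using padic_abs_minus[of p "x - y"] by simp

lemma padic_abs_add:
  assumes p: "prime p"
  shows "padic_abs p (x + y) \<le> max (padic_abs p x) (padic_abs p y)"
proof (cases "x = 0 \<or> y = 0 \<or> x + y = 0")
  case True
  then show ?thesis by (auto simp: le_max_iff_disj)
next
  case False
  obtain a c b where b: "b \<noteq> 0" and x: "x = of_int a / of_int b" and y: "y = of_int c / of_int b"
    by (rule rat_common_denom)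
  have ac: "a \<noteq> 0" "c \<noteq> 0" using False x y by auto
  have xy: "x + y = of_int (a + c) / of_int b" by (simp add: x y add_divide_distrib)
  have acs: "a + c \<noteq> 0" using False xy by auto
  have p1: "real p \<ge> 1" using prime_ge_1_nat[OF p] by simp
  let ?m = "multiplicity (int p)"
  let ?k = "min (?m a) (?m c)"
  have "int p ^ ?k dvd a" "int p ^ ?k dvd c"
    by (auto intro: multiplicity_dvd')
  then have "int p ^ ?k dvd a + c" by simp
  moreover have "\<not> is_unit (int p)" using p
    by (metis not_prime_unit prime_nat_int_transfer)
  ultimately have "?k \<le> ?m (a + c)"
    using acs by (intro multiplicity_geI) auto
  then have "real p powi (int (?m b) - int (?m (a + c)))
      \<le> real p powi (int (?m b) - int ?k)"
    using p1 by (intro power_int_increasing) auto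
  also have "\<dots> \<le> max (real p powi (int (?m b) - int (?m a)))
                     (real p powi (int (?m b) - int (?m c)))"
    by (auto simp: min_def)
  finally show ?thesis
    using padic_abs_frac[OF p acs b] padic_abs_frac[OF p ac(1) b] padic_abs_frac[OF p ac(2) b]
      x y xy by simp
qed

lemma padic_abs_diff:
  assumes "prime p"
  shows "padic_abs p (x - y) \<le> max (padic_abs p x) (padic_abs p y)"
  using padic_abs_add[OF assms, of x "- y"] by simp

definition padic_cauchy :: "nat \<Rightarrow> (nat \<Rightarrow> rat) \<Rightarrow> bool" where
  "padic_cauchy p s \<longleftrightarrow> (\<forall>e>0. \<exists>N. \<forall>m\<ge>N. \<forall>n\<ge>N. padic_abs p (s m - s n) < e)"

definition padic_null :: "nat \<Rightarrow> (nat \<Rightarrow> rat) \<Rightarrow> bool" where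
  "padic_null p s \<longleftrightarrow> (\<lambda>n. padic_abs p (s n)) \<longlonglongrightarrow> 0"

text \<open>The \<open>p\<close>-adic numbers are the \<open>p\<close>-adic Cauchy sequences of rationals modulo the null
  sequences.  By the ultrametric inequality the absolute values along a Cauchy sequence are
  eventually constant or tend to \<open>0\<close>, so the following says that the limit lies in the ring
  of \<open>p\<close>-adic integers.\<close>

definition padic_int_seq :: "nat \<Rightarrow> (nat \<Rightarrow> rat) \<Rightarrow> bool" where
  "padic_int_seq p s \<longleftrightarrow> (\<forall>\<^sub>F n in sequentially. padic_abs p (s n) \<le> 1)"

lemma padic_null_diff_cauchy:
  assumes p: "prime p" and s: "padic_cauchy p s" and n: "padic_null p (\<lambda>n. s n - t n)"
  shows "padic_cauchy p t"
  unfolding padic_cauchy_def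
proof (intro allI impI)
  fix e :: real assume e: "e > 0"
  obtain N1 where N1: "\<And>m n. m \<ge> N1 \<Longrightarrow> n \<ge> N1 \<Longrightarrow> padic_abs p (s m - s n) < e"
    using s e unfolding padic_cauchy_def by blast
  obtain N2 where N2: "\<And>n. n \<ge> N2 \<Longrightarrow> padic_abs p (s n - t n) < e"
    using n e unfolding padic_null_def LIMSEQ_def by (auto simp: dist_real_def)
  have "padic_abs p (t m - t n) < e" if "m \<ge> max N1 N2" "n \<ge> max N1 N2" for m n
  proof -
    have "t m - t n = ((s m - s n) - (s m - t m)) + (s n - t n)" by simp
    then have "padic_abs p (t m - t n)
        \<le> max (max (padic_abs p (s m - s n)) (padic_abs p (s m - t m))) (padic_abs p (s n - t n))"
      using padic_abs_add[OF p, of "(s m - s n) - (s m - t m)" "s n - t n"]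
        padic_abs_diff[OF p, of "s m - s n" "s m - t m"] by simp
    also have "\<dots> < e" using N1 N2 that by simp
    finally show ?thesis .
  qed
  then show "\<exists>N. \<forall>m\<ge>N. \<forall>n\<ge>N. padic_abs p (t m - t n) < e" by blast
qed

lemma padic_cauchy_const [simp]: "padic_cauchy p (\<lambda>n. c)"
  by (simp add: padic_cauchy_def)

lemma padic_cauchy_bounded:
  assumes p: "prime p" and s: "padic_cauchy p s"
  obtains B where "B > 0" "\<And>n. padic_abs p (s n) \<le> B"
proof -
  obtain N where N: "\<And>m n. m \<ge> N \<Longrightarrow> n \<ge> N \<Longrightarrow> padic_abs p (s m - s n) < 1"
    using s zero_less_one unfolding padic_cauchy_def by blast
  define B where "B = Max ((\<lambda>n. padic_abs p (s n)) ` {..N}) + 1"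
  have M: "padic_abs p (s n) \<le> B - 1" if "n \<le> N" for n
    unfolding B_def using that by auto
  have B1: "B \<ge> 1" using M[of N] padic_abs_nonneg[of p "s N"] by linarith
  have "padic_abs p (s n) \<le> B" for n
  proof (cases "n \<le> N")
    case True then show ?thesis using M by fastforce
  next
    case False
    have "padic_abs p (s n) \<le> max (padic_abs p (s n - s N)) (padic_abs p (s N))"
      using padic_abs_add[OF p, of "s n - s N" "s N"] by simp
    also have "\<dots> \<le> B" using N[of n N] False M[of N] B1 by simp
    finally show ?thesis .
  qed
  with B1 show thesis by (intro that[of B]) auto
qed

lemma padic_cauchy_add:
  assumes p: "prime p" and s: "padic_cauchy p s" and t: "padic_cauchy p t"
  shows "padic_cauchy p (\<lambda>n. s n + t n)"
  unfolding padic_cauchy_def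
proof (intro allI impI)
  fix e :: real assume e: "e > 0"
  obtain N1 where N1: "\<And>m n. m \<ge> N1 \<Longrightarrow> n \<ge> N1 \<Longrightarrow> padic_abs p (s m - s n) < e"
    using s e unfolding padic_cauchy_def by blast
  obtain N2 where N2: "\<And>m n. m \<ge> N2 \<Longrightarrow> n \<ge> N2 \<Longrightarrow> padic_abs p (t m - t n) < e"
    using t e unfolding padic_cauchy_def by blast
  have "padic_abs p (s m + t m - (s n + t n)) < e" if "m \<ge> max N1 N2" "n \<ge> max N1 N2" for m n
  proof -
    have "padic_abs p (s m + t m - (s n + t n))
        \<le> max (padic_abs p (s m - s n)) (padic_abs p (t m - t n))"
      using padic_abs_add[OF p, of "s m - s n" "t m - t n"] by (simp add: algebra_simps)
    also have "\<dots> < e" using N1 N2 that by simp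
    finally show ?thesis .
  qed
  then show "\<exists>N. \<forall>m\<ge>N. \<forall>n\<ge>N. padic_abs p (s m + t m - (s n + t n)) < e" by blast
qed

lemma padic_cauchy_minus:
  assumes "padic_cauchy p s"
  shows "padic_cauchy p (\<lambda>n. - s n)"
proof -
  have "padic_abs p (- s m - - s n) = padic_abs p (s m - s n)" for m n
    using padic_abs_minus_commute[of p "s n" "s m"] by simp
  with assms show ?thesis unfolding padic_cauchy_def by presburger
qed

lemma padic_null_add:
  assumes p: "prime p" and s: "padic_null p s" and t: "padic_null p t"
  shows "padic_null p (\<lambda>n. s n + t n)"
  unfolding padic_null_def
proof (rule tendsto_sandwich[OF _ _ tendsto_const])
  show "(\<lambda>n. padic_abs p (s n) + padic_abs p (t n)) \<longlonglongrightarrow> 0"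
    using tendsto_add[OF s[unfolded padic_null_def] t[unfolded padic_null_def]] by simp
  have "padic_abs p (s n + t n) \<le> padic_abs p (s n) + padic_abs p (t n)" for n
    by (rule order_trans[OF padic_abs_add[OF p]]) simp
  then show "\<forall>\<^sub>F n in sequentially. padic_abs p (s n + t n) \<le> padic_abs p (s n) + padic_abs p (t n)"
    by simp
qed simp

lemma padic_null_minus: "padic_null p s \<Longrightarrow> padic_null p (\<lambda>n. - s n)"
  by (simp add: padic_null_def)

lemma padic_null_mult:
  assumes p: "prime p" and s: "padic_cauchy p s" and t: "padic_null p t"
  shows "padic_null p (\<lambda>n. s n * t n)"
proof -
  obtain B where B: "B > 0" "\<And>n. padic_abs p (s n) \<le> B"
    using padic_cauchy_bounded[OF p s] by blast
  show ?thesis unfolding padic_null_def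
  proof (rule tendsto_sandwich[OF _ _ tendsto_const])
    show "(\<lambda>n. B * padic_abs p (t n)) \<longlonglongrightarrow> 0"
      using tendsto_mult[OF tendsto_const[of B] t[unfolded padic_null_def]] by simp
    show "\<forall>\<^sub>F n in sequentially. padic_abs p (s n * t n) \<le> B * padic_abs p (t n)"
      using B by (simp add: padic_abs_mult[OF p] mult_right_mono)
  qed simp
qed

lemma padic_cauchy_mult:
  assumes p: "prime p" and s: "padic_cauchy p s" and t: "padic_cauchy p t"
  shows "padic_cauchy p (\<lambda>n. s n * t n)"
  unfolding padic_cauchy_def
proof (intro allI impI)
  fix e :: real assume e: "e > 0"
  obtain A where A: "A > 0" "\<And>n. padic_abs p (s n) \<le> A"
    using padic_cauchy_bounded[OF p s] by blast
  obtain B where B: "B > 0" "\<And>n. padic_abs p (t n) \<le> B"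
    using padic_cauchy_bounded[OF p t] by blast
  obtain N1 where N1: "\<And>m n. m \<ge> N1 \<Longrightarrow> n \<ge> N1 \<Longrightarrow> padic_abs p (s m - s n) < e / B"
    using s e B unfolding padic_cauchy_def by (meson divide_pos_pos)
  obtain N2 where N2: "\<And>m n. m \<ge> N2 \<Longrightarrow> n \<ge> N2 \<Longrightarrow> padic_abs p (t m - t n) < e / A"
    using t e A unfolding padic_cauchy_def by (meson divide_pos_pos)
  have "padic_abs p (s m * t m - s n * t n) < e" if "m \<ge> max N1 N2" "n \<ge> max N1 N2" for m n
  proof -
    have "s m * t m - s n * t n = s m * (t m - t n) + (s m - s n) * t n"
      by (simp add: algebra_simps)
    then have le: "padic_abs p (s m * t m - s n * t n)
        \<le> max (padic_abs p (s m) * padic_abs p (t m - t n)) (padic_abs p (s m - s n) * padic_abs p (t n))"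
      using padic_abs_add[OF p, of "s m * (t m - t n)" "(s m - s n) * t n"]
      by (simp add: padic_abs_mult[OF p])
    have "padic_abs p (s m) * padic_abs p (t m - t n) \<le> A * padic_abs p (t m - t n)"
      using A by (simp add: mult_right_mono)
    also have "\<dots> < e" using N2[of m n] that A by (simp add: field_simps)
    finally have 1: "padic_abs p (s m) * padic_abs p (t m - t n) < e" .
    have "padic_abs p (s m - s n) * padic_abs p (t n) \<le> padic_abs p (s m - s n) * B"
      using B by (simp add: mult_left_mono)
    also have "\<dots> < e" using N1[of m n] that B by (simp add: field_simps)
    finally have 2: "padic_abs p (s m - s n) * padic_abs p (t n) < e" .
    show ?thesis using le 1 2 by simp
  qed
  then show "\<exists>N. \<forall>m\<ge>N. \<forall>n\<ge>N. padic_abs p (s m * t m - s n * t n) < e" by blast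
qed

lemma padic_int_seq_add:
  assumes p: "prime p" and "padic_int_seq p s" "padic_int_seq p t"
  shows "padic_int_seq p (\<lambda>n. s n + t n)"
  using assms(2,3) unfolding padic_int_seq_def
proof eventually_elim
  case (elim n)
  then show ?case using padic_abs_add[OF p, of "s n" "t n"] by simp
qed

lemma padic_int_seq_minus: "padic_int_seq p s \<Longrightarrow> padic_int_seq p (\<lambda>n. - s n)"
  by (simp add: padic_int_seq_def)

lemma padic_int_seq_mult:
  assumes p: "prime p" and "padic_int_seq p s" "padic_int_seq p t"
  shows "padic_int_seq p (\<lambda>n. s n * t n)"
  using assms(2,3) unfolding padic_int_seq_def
  by eventually_elim (simp add: padic_abs_mult[OF p] mult_le_one)

lemma padic_null_diff_int_seq:
  assumes p: "prime p" and s: "padic_int_seq p s" and n: "padic_null p (\<lambda>n. s n - t n)"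
  shows "padic_int_seq p t"
proof -
  have "\<forall>\<^sub>F n in sequentially. padic_abs p (s n - t n) < 1"
    using n unfolding padic_null_def by (rule order_tendstoD) simp
  with s show ?thesis unfolding padic_int_seq_def
  proof eventually_elim
    case (elim n)
    then show ?case using padic_abs_diff[OF p, of "s n" "s n - t n"] by simp
  qed
qed

lemma finite_not_padic_int_const: "finite {p. prime p \<and> \<not> padic_int_seq p (\<lambda>n. c)}"
proof (cases "c = 0")
  case False
  obtain a b where q: "quotient_of c = (a, b)" by force
  have b: "b > 0" using quotient_of_denom_pos[OF q] .
  have "p dvd nat b" if "prime p" "\<not> padic_int_seq p (\<lambda>n. c)" for p
  proof (rule ccontr)
    assume "\<not> p dvd nat b"
    then have "\<not> int p dvd b" using b int_dvd_int_iff[of p "nat b"] by simp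
    then have "multiplicity (int p) b = 0" by (rule not_dvd_imp_multiplicity_0)
    then have "padic_abs p c = real p powi (- int (multiplicity (int p) a))"
      using q False by (simp add: padic_abs_def)
    also have "\<dots> \<le> real p powi 0"
      using prime_ge_1_nat[OF that(1)] by (intro power_int_increasing) auto
    finally show False using that by (simp add: padic_int_seq_def)
  qed
  then have "{p. prime p \<and> \<not> padic_int_seq p (\<lambda>n. c)} \<subseteq> {p. p dvd nat b}" by blast
  moreover have "finite {p. p dvd nat b}" using b by (intro finite_divisors_nat) simp
  ultimately show ?thesis by (rule finite_subset)
qed (simp add: padic_int_seq_def)

text \<open>The finite adeles are the restricted product of the fields of \<open>p\<close>-adic numbers with
  respect to the rings of \<open>p\<close>-adic integers.  An adele is represented by a family of
  \<open>p\<close>-adic Cauchy sequences; the components at non-prime indices are disregarded.\<close>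

definition preadele :: "(nat \<Rightarrow> nat \<Rightarrow> rat) \<Rightarrow> bool" where
  "preadele a \<longleftrightarrow> (\<forall>p. prime p \<longrightarrow> padic_cauchy p (a p)) \<and>
     finite {p. prime p \<and> \<not> padic_int_seq p (a p)}"

definition adele_rel :: "(nat \<Rightarrow> nat \<Rightarrow> rat) \<Rightarrow> (nat \<Rightarrow> nat \<Rightarrow> rat) \<Rightarrow> bool" where
  "adele_rel a b \<longleftrightarrow> preadele a \<and> preadele b \<and>
     (\<forall>p. prime p \<longrightarrow> padic_null p (\<lambda>n. a p n - b p n))"

lemma preadele_const: "preadele (\<lambda>p n. c)"
  by (simp add: preadele_def finite_not_padic_int_const)

lemma preadele_add:
  assumes "preadele a" "preadele b"
  shows "preadele (\<lambda>p n. a p n + b p n)"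
proof -
  have "{p. prime p \<and> \<not> padic_int_seq p (\<lambda>n. a p n + b p n)}
      \<subseteq> {p. prime p \<and> \<not> padic_int_seq p (a p)} \<union> {p. prime p \<and> \<not> padic_int_seq p (b p)}"
    using padic_int_seq_add by blast
  then show ?thesis
    using assms unfolding preadele_def
    by (intro conjI allI impI padic_cauchy_add) (auto intro: finite_subset)
qed

lemma preadele_mult:
  assumes "preadele a" "preadele b"
  shows "preadele (\<lambda>p n. a p n * b p n)"
proof -
  have "{p. prime p \<and> \<not> padic_int_seq p (\<lambda>n. a p n * b p n)}
      \<subseteq> {p. prime p \<and> \<not> padic_int_seq p (a p)} \<union> {p. prime p \<and> \<not> padic_int_seq p (b p)}"
    using padic_int_seq_mult by blast
  then show ?thesis
    using assms unfolding preadele_def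
    by (intro conjI allI impI padic_cauchy_mult) (auto intro: finite_subset)
qed

lemma preadele_minus: "preadele a \<Longrightarrow> preadele (\<lambda>p n. - a p n)"
  unfolding preadele_def by (simp add: padic_cauchy_minus) (simp add: padic_int_seq_def)

lemma adele_rel_refl: "preadele a \<Longrightarrow> adele_rel a a"
  by (simp add: adele_rel_def padic_null_def)

quotient_type adele = "nat \<Rightarrow> nat \<Rightarrow> rat" / partial: adele_rel
proof (rule part_equivpI)
  show "\<exists>x. adele_rel x x"
    using adele_rel_refl[OF preadele_const] by blast
  show "symp adele_rel"
    by (auto intro!: sympI simp: adele_rel_def padic_null_def padic_abs_minus_commute)
  show "transp adele_rel"
  proof (rule transpI)
    fix a b c assume *: "adele_rel a b" "adele_rel b c"
    have "padic_null p (\<lambda>n. a p n - c p n)" if p: "prime p" for p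
    proof -
      have "padic_null p (\<lambda>n. (a p n - b p n) + (b p n - c p n))"
        using * p by (intro padic_null_add) (simp_all add: adele_rel_def)
      then show ?thesis by simp
    qed
    with * show "adele_rel a c" by (simp add: adele_rel_def)
  qed
qed

instantiation adele :: comm_ring_1
begin

lift_definition zero_adele :: adele is "\<lambda>p n. 0"
  by (simp add: adele_rel_refl preadele_const)

lift_definition one_adele :: adele is "\<lambda>p n. 1"
  by (simp add: adele_rel_refl preadele_const)

lift_definition plus_adele :: "adele \<Rightarrow> adele \<Rightarrow> adele" is "\<lambda>a b p n. a p n + b p n"
proof -
  fix a a' b b' assume *: "adele_rel a a'" "adele_rel b b'"
  have "padic_null p (\<lambda>n. (a p n + b p n) - (a' p n + b' p n))" if p: "prime p" for p
  proof -
    have "padic_null p (\<lambda>n. (a p n - a' p n) + (b p n - b' p n))"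
      using * p by (intro padic_null_add) (simp_all add: adele_rel_def)
    then show ?thesis by (simp add: algebra_simps)
  qed
  with * show "adele_rel (\<lambda>p n. a p n + b p n) (\<lambda>p n. a' p n + b' p n)"
    by (simp add: adele_rel_def preadele_add)
qed

lift_definition uminus_adele :: "adele \<Rightarrow> adele" is "\<lambda>a p n. - a p n"
proof -
  fix a a' assume *: "adele_rel a a'"
  have "padic_null p (\<lambda>n. - a p n - - a' p n)" if p: "prime p" for p
    using padic_null_minus[of p "\<lambda>n. a p n - a' p n"] * p
    by (simp add: adele_rel_def algebra_simps)
  with * show "adele_rel (\<lambda>p n. - a p n) (\<lambda>p n. - a' p n)"
    by (simp add: adele_rel_def preadele_minus)
qed

definition minus_adele :: "adele \<Rightarrow> adele \<Rightarrow> adele" where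
  "minus_adele x y = x + (- y)"

lift_definition times_adele :: "adele \<Rightarrow> adele \<Rightarrow> adele" is "\<lambda>a b p n. a p n * b p n"
proof -
  fix a a' b b' assume *: "adele_rel a a'" "adele_rel b b'"
  have "padic_null p (\<lambda>n. a p n * b p n - a' p n * b' p n)" if p: "prime p" for p
  proof -
    have "padic_null p (\<lambda>n. a p n * (b p n - b' p n))" "padic_null p (\<lambda>n. b' p n * (a p n - a' p n))"
      using * p by (auto simp: adele_rel_def preadele_def intro!: padic_null_mult)
    from padic_null_add[OF p this] show ?thesis by (simp add: algebra_simps)
  qed
  with * show "adele_rel (\<lambda>p n. a p n * b p n) (\<lambda>p n. a' p n * b' p n)"
    by (simp add: adele_rel_def preadele_mult)
qed

instance
proof
  fix a b c :: adele
  show "a * b * c = a * (b * c)"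
    by transfer (simp add: adele_rel_refl preadele_mult adele_rel_def mult.assoc padic_null_def)
  show "a * b = b * a"
    by transfer (simp add: adele_rel_refl preadele_mult adele_rel_def mult.commute padic_null_def)
  show "1 * a = a"
    by transfer simp
  show "a + b + c = a + (b + c)"
    by transfer (simp add: adele_rel_refl preadele_add adele_rel_def add.assoc padic_null_def)
  show "a + b = b + a"
    by transfer (simp add: adele_rel_refl preadele_add adele_rel_def add.commute padic_null_def)
  show "0 + a = a"
    by transfer simp
  show "- a + a = 0"
    by transfer (simp add: adele_rel_def preadele_const padic_null_def)
  show "a - b = a + - b" by (simp add: minus_adele_def)
  show "(a + b) * c = a * c + b * c"
    by transfer (simp add: adele_rel_refl preadele_add preadele_mult adele_rel_def
        algebra_simps padic_null_def)
  show "(0::adele) \<noteq> 1"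
  proof (transfer, rule notI)
    assume "adele_rel (\<lambda>p n. 0) (\<lambda>p n. 1)"
    then have "padic_null 2 (\<lambda>n. 0 - 1)" unfolding adele_rel_def using two_is_prime_nat by blast
    then show False by (simp add: padic_null_def LIMSEQ_const_iff)
  qed
qed

end

lift_definition adele_of_rat :: "rat \<Rightarrow> adele" is "\<lambda>q p n. q"
  by (simp add: adele_rel_refl preadele_const)

lift_definition adele_integral_at :: "nat \<Rightarrow> adele \<Rightarrow> bool" is
  "\<lambda>p a. prime p \<longrightarrow> padic_int_seq p (a p)"
proof -
  fix p a b assume ab: "adele_rel a b"
  then have "prime p \<longrightarrow> padic_null p (\<lambda>n. a p n - b p n)" by (simp add: adele_rel_def)
  moreover from ab have "prime p \<longrightarrow> padic_null p (\<lambda>n. b p n - a p n)"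
    by (simp add: adele_rel_def padic_null_def padic_abs_minus_commute)
  ultimately show "(prime p \<longrightarrow> padic_int_seq p (a p)) = (prime p \<longrightarrow> padic_int_seq p (b p))"
    using padic_null_diff_int_seq by blast
qed

definition zhat :: "adele set" where
  "zhat = {x. \<forall>p. prime p \<longrightarrow> adele_integral_at p x}"

section \<open>The groups\<close>

definition Mat2 :: "'a set \<Rightarrow> ('a^2^2) set" where
  "Mat2 R = {m. \<forall>i j. m $ i $ j \<in> R}"

definition GL2 :: "'a::comm_ring_1 set \<Rightarrow> ('a^2^2) set" where
  "GL2 R = {g \<in> Mat2 R. \<exists>h\<in>Mat2 R. g ** h = mat 1 \<and> h ** g = mat 1}"

definition SL2 :: "'a::comm_ring_1 set \<Rightarrow> ('a^2^2) set" where
  "SL2 R = {g \<in> Mat2 R. det g = 1}"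

definition block_mat :: "'a^2^2 \<Rightarrow> 'a^2^2 \<Rightarrow> 'a::comm_ring_1^(2+2)^(2+2)" where
  "block_mat m g = (\<chi> i j. case i of
      Inl a \<Rightarrow> (case j of Inl b \<Rightarrow> mat 1 $ a $ b | Inr b \<Rightarrow> m $ a $ b)
    | Inr a \<Rightarrow> (case j of Inl b \<Rightarrow> 0 | Inr b \<Rightarrow> g $ a $ b))"

definition block_set :: "('a^2^2) set \<Rightarrow> ('a^2^2) set \<Rightarrow> ('a::comm_ring_1^(2+2)^(2+2)) set" where
  "block_set M S = {block_mat m g | m g. m \<in> M \<and> g \<in> S}"

definition matrix_group :: "('a::comm_ring_1^'n^'n) set \<Rightarrow> ('a^'n^'n) monoid" where
  "matrix_group S = \<lparr>carrier = S, monoid.mult = (**), one = mat 1\<rparr>"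

definition GL2Q_pos :: "(rat^2^2) set" where
  "GL2Q_pos = {g \<in> GL2 UNIV. det g > 0}"

definition P_grp :: "(rat^(2+2)^(2+2)) monoid" where
  "P_grp = matrix_group (block_set UNIV GL2Q_pos)"

definition P0 :: "(rat^(2+2)^(2+2)) set" where
  "P0 = block_set (Mat2 \<int>) (SL2 \<int>)"

definition GL2Af_pos :: "(adele^2^2) set" where
  "GL2Af_pos = {g \<in> GL2 UNIV. \<exists>q>0. det g = adele_of_rat q}"

definition Pbar_grp :: "(adele^(2+2)^(2+2)) monoid" where
  "Pbar_grp = matrix_group (block_set UNIV GL2Af_pos)"

definition Pbar0 :: "(adele^(2+2)^(2+2)) set" where
  "Pbar0 = block_set (Mat2 zhat) (SL2 zhat)"

definition P_embed :: "rat^(2+2)^(2+2) \<Rightarrow> adele^(2+2)^(2+2)" where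
  "P_embed x = (\<chi> i j. adele_of_rat (x $ i $ j))"

definition Z_inv :: "nat \<Rightarrow> rat set" where
  "Z_inv p = {of_int a / of_nat p ^ k | a k. True}"

definition P_at :: "nat \<Rightarrow> (rat^(2+2)^(2+2)) set" where
  "P_at p = block_set (Mat2 (Z_inv p)) (GL2 (Z_inv p) \<inter> GL2Q_pos)"

section \<open>Square-summable functions and operators on them\<close>

typedef 'a ell2 = "{f :: 'a \<Rightarrow> complex. (\<lambda>x. (cmod (f x))\<^sup>2) summable_on UNIV}"
  morphisms ell2_apply Abs_ell2
  by (rule exI[of _ "\<lambda>x. 0"]) simp

setup_lifting type_definition_ell2

lemma L2_set_le_infsum:
  fixes f :: "'a \<Rightarrow> complex"
  assumes "(\<lambda>x. (cmod (f x))\<^sup>2) summable_on UNIV" "finite F"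
  shows "L2_set (\<lambda>x. cmod (f x)) F \<le> sqrt (\<Sum>\<^sub>\<infinity>x. (cmod (f x))\<^sup>2)"
  unfolding L2_set_def using assms by (intro real_sqrt_le_mono finite_sum_le_infsum) auto

lemma ell2_sum_le:
  fixes f g :: "'a \<Rightarrow> complex"
  assumes f: "(\<lambda>x. (cmod (f x))\<^sup>2) summable_on UNIV"
    and g: "(\<lambda>x. (cmod (g x))\<^sup>2) summable_on UNIV" and F: "finite F"
  shows "(\<Sum>x\<in>F. (cmod (f x + g x))\<^sup>2)
    \<le> (sqrt (\<Sum>\<^sub>\<infinity>x. (cmod (f x))\<^sup>2) + sqrt (\<Sum>\<^sub>\<infinity>x. (cmod (g x))\<^sup>2))\<^sup>2"
proof -
  have "L2_set (\<lambda>x. cmod (f x + g x)) F \<le> L2_set (\<lambda>x. cmod (f x) + cmod (g x)) F"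
    by (intro L2_set_mono norm_triangle_ineq) simp
  also have "\<dots> \<le> L2_set (\<lambda>x. cmod (f x)) F + L2_set (\<lambda>x. cmod (g x)) F"
    by (rule L2_set_triangle_ineq)
  also have "\<dots> \<le> sqrt (\<Sum>\<^sub>\<infinity>x. (cmod (f x))\<^sup>2) + sqrt (\<Sum>\<^sub>\<infinity>x. (cmod (g x))\<^sup>2)"
    using f g F by (intro add_mono L2_set_le_infsum)
  finally have "(L2_set (\<lambda>x. cmod (f x + g x)) F)\<^sup>2
      \<le> (sqrt (\<Sum>\<^sub>\<infinity>x. (cmod (f x))\<^sup>2) + sqrt (\<Sum>\<^sub>\<infinity>x. (cmod (g x))\<^sup>2))\<^sup>2"
    by (intro power_mono) simp_all
  then show ?thesis by (simp add: L2_set_def sum_nonneg)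
qed

lemma ell2_add_summable:
  fixes f g :: "'a \<Rightarrow> complex"
  assumes "(\<lambda>x. (cmod (f x))\<^sup>2) summable_on UNIV" "(\<lambda>x. (cmod (g x))\<^sup>2) summable_on UNIV"
  shows "(\<lambda>x. (cmod (f x + g x))\<^sup>2) summable_on UNIV"
  by (rule nonneg_bounded_partial_sums_imp_summable_on
        [where C = "(sqrt (\<Sum>\<^sub>\<infinity>x. (cmod (f x))\<^sup>2) + sqrt (\<Sum>\<^sub>\<infinity>x. (cmod (g x))\<^sup>2))\<^sup>2"])
     (auto intro: eventually_finite_subsets_at_top_weakI ell2_sum_le[OF assms])

instantiation ell2 :: (type) real_normed_vector
begin

lift_definition zero_ell2 :: "'a ell2" is "\<lambda>x. 0" by simp

lift_definition plus_ell2 :: "'a ell2 \<Rightarrow> 'a ell2 \<Rightarrow> 'a ell2" is "\<lambda>f g x. f x + g x"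
  by (rule ell2_add_summable)

lift_definition uminus_ell2 :: "'a ell2 \<Rightarrow> 'a ell2" is "\<lambda>f x. - f x" by simp

definition minus_ell2 :: "'a ell2 \<Rightarrow> 'a ell2 \<Rightarrow> 'a ell2" where
  "minus_ell2 x y = x + (- y)"

lift_definition scaleR_ell2 :: "real \<Rightarrow> 'a ell2 \<Rightarrow> 'a ell2" is "\<lambda>r f x. r *\<^sub>R f x"
  by (simp add: power_mult_distrib summable_on_cmult_right)

lift_definition norm_ell2 :: "'a ell2 \<Rightarrow> real" is "\<lambda>f. sqrt (\<Sum>\<^sub>\<infinity>x. (cmod (f x))\<^sup>2)" .

definition sgn_ell2 :: "'a ell2 \<Rightarrow> 'a ell2" where
  "sgn_ell2 x = inverse (norm x) *\<^sub>R x"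

definition dist_ell2 :: "'a ell2 \<Rightarrow> 'a ell2 \<Rightarrow> real" where
  "dist_ell2 x y = norm (x - y)"

definition uniformity_ell2 :: "('a ell2 \<times> 'a ell2) filter" where
  "uniformity_ell2 = (INF e\<in>{0<..}. principal {(x, y). dist x y < e})"

definition open_ell2 :: "'a ell2 set \<Rightarrow> bool" where
  "open_ell2 U \<longleftrightarrow> (\<forall>x\<in>U. \<forall>\<^sub>F (x', y) in uniformity. x' = x \<longrightarrow> y \<in> U)"

instance
proof
  fix x y z :: "'a ell2" and a b :: real
  show "x + y + z = x + (y + z)" by transfer (simp add: add.assoc)
  show "x + y = y + x" by transfer (simp add: add.commute)
  show "0 + x = x" by transfer simp
  show "- x + x = 0" by transfer simp
  show "x - y = x + - y" by (simp add: minus_ell2_def)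
  show "a *\<^sub>R (x + y) = a *\<^sub>R x + a *\<^sub>R y" by transfer (simp add: algebra_simps)
  show "(a + b) *\<^sub>R x = a *\<^sub>R x + b *\<^sub>R x" by transfer (simp add: algebra_simps)
  show "a *\<^sub>R b *\<^sub>R x = (a * b) *\<^sub>R x" by transfer simp
  show "1 *\<^sub>R x = x" by transfer simp
  show "dist x y = norm (x - y)" by (simp add: dist_ell2_def)
  show "sgn x = inverse (norm x) *\<^sub>R x" by (simp add: sgn_ell2_def)
  show "uniformity = (INF e\<in>{0<..}. principal {(x, y). dist x y < (e::real)} :: ('a ell2 \<times> 'a ell2) filter)"
    by (rule uniformity_ell2_def)
  show "open U \<longleftrightarrow> (\<forall>x\<in>U. \<forall>\<^sub>F (x', y) in uniformity. x' = x \<longrightarrow> y \<in> U)" for U :: "'a ell2 set"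
    by (rule open_ell2_def)
  show "norm x = 0 \<longleftrightarrow> x = 0"
  proof transfer
    fix f :: "'a \<Rightarrow> complex" assume s: "(\<lambda>x. (cmod (f x))\<^sup>2) summable_on UNIV"
    show "sqrt (\<Sum>\<^sub>\<infinity>x. (cmod (f x))\<^sup>2) = 0 \<longleftrightarrow> f = (\<lambda>x. 0)"
    proof
      assume 0: "sqrt (\<Sum>\<^sub>\<infinity>x. (cmod (f x))\<^sup>2) = 0"
      have "f x = 0" for x
        using L2_set_le_infsum[OF s, of "{x}"] 0 by (simp add: L2_set_def)
      then show "f = (\<lambda>x. 0)" by blast
    qed simp
  qed
  show "norm (x + y) \<le> norm x + norm y"
  proof transfer
    fix f g :: "'a \<Rightarrow> complex"
    assume fg: "(\<lambda>x. (cmod (f x))\<^sup>2) summable_on UNIV" "(\<lambda>x. (cmod (g x))\<^sup>2) summable_on UNIV"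
    have "(\<Sum>\<^sub>\<infinity>x. (cmod (f x + g x))\<^sup>2)
        \<le> (sqrt (\<Sum>\<^sub>\<infinity>x. (cmod (f x))\<^sup>2) + sqrt (\<Sum>\<^sub>\<infinity>x. (cmod (g x))\<^sup>2))\<^sup>2"
      by (intro infsum_le_finite_sums ell2_add_summable fg ell2_sum_le)
    then show "sqrt (\<Sum>\<^sub>\<infinity>x. (cmod (f x + g x))\<^sup>2)
        \<le> sqrt (\<Sum>\<^sub>\<infinity>x. (cmod (f x))\<^sup>2) + sqrt (\<Sum>\<^sub>\<infinity>x. (cmod (g x))\<^sup>2)"
      by (intro real_le_lsqrt add_nonneg_nonneg) (simp_all add: infsum_nonneg)
  qed
  show "norm (a *\<^sub>R x) = \<bar>a\<bar> * norm x"
    by transfer (simp add: power_mult_distrib infsum_cmult_right' real_sqrt_mult)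
qed

end

lift_definition ket :: "'a \<Rightarrow> 'a ell2" is "\<lambda>x y. if y = x then 1 else 0"
  by (rule finite_nonzero_values_imp_summable_on) simp

lift_definition scaleC :: "complex \<Rightarrow> 'a ell2 \<Rightarrow> 'a ell2" is "\<lambda>c f x. c * f x"
  by (simp add: norm_mult power_mult_distrib summable_on_cmult_right)

lift_definition cinner :: "'a ell2 \<Rightarrow> 'a ell2 \<Rightarrow> complex" is
  "\<lambda>f g. \<Sum>\<^sub>\<infinity>x. f x * cnj (g x)" .

lemma norm_scaleC: "norm (scaleC c x) = cmod c * norm x"
  by transfer (simp add: norm_mult power_mult_distrib infsum_cmult_right' real_sqrt_mult)

lift_definition scaleC_op :: "complex \<Rightarrow> 'a ell2 \<Rightarrow>\<^sub>L 'a ell2" is scaleC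
proof (rule bounded_linear_intro)
  fix c r and x y :: "'a ell2"
  show "scaleC c (x + y) = scaleC c x + scaleC c y"
    by transfer (simp add: algebra_simps)
  show "scaleC c (r *\<^sub>R x) = r *\<^sub>R scaleC c x"
    by transfer simp
  show "norm (scaleC c x) \<le> norm x * cmod c"
    by (simp add: norm_scaleC)
qed

type_synonym 'a op = "'a ell2 \<Rightarrow>\<^sub>L 'a ell2"

definition op_scale :: "complex \<Rightarrow> 'a op \<Rightarrow> 'a op" where
  "op_scale c T = scaleC_op c o\<^sub>L T"

definition op_adj :: "'a op \<Rightarrow> 'a op" where
  "op_adj T = (THE S :: 'a op. \<forall>x y. cinner (T x) y = cinner x (S y))"

definition coef :: "'a op \<Rightarrow> 'a \<Rightarrow> 'a \<Rightarrow> complex" where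
  "coef T y x = ell2_apply (T (ket x)) y"

text \<open>\<open>span\<close> is the real linear span.\<close>

definition complex_span :: "'a op set \<Rightarrow> 'a op set" where
  "complex_span A = span {op_scale c T | c T. T \<in> A}"

definition star_isomorphic :: "'a op set \<Rightarrow> 'b op set \<Rightarrow> bool" where
  "star_isomorphic A B \<longleftrightarrow> (\<exists>\<phi>. bij_betw \<phi> A B \<and>
     (\<forall>S\<in>A. \<forall>T\<in>A. \<phi> (S + T) = \<phi> S + \<phi> T \<and> \<phi> (S o\<^sub>L T) = \<phi> S o\<^sub>L \<phi> T) \<and>
     (\<forall>c. \<forall>T\<in>A. \<phi> (op_scale c T) = op_scale c (\<phi> T)) \<and>
     (\<forall>T\<in>A. \<phi> (op_adj T) = op_adj (\<phi> T)))"

section \<open>Spatial tensor products\<close>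

text \<open>Let \<open>A i\<close> be a C*-algebra of operators on the Hilbert space of square-summable functions
  on the set \<open>X i\<close>, containing its identity operator; such an operator is viewed as an operator
  on all functions of the ambient type by extending it by \<open>0\<close>.  The tensor product of these
  Hilbert spaces along the unit vectors \<open>ket (b i)\<close> is the space of square-summable functions
  on the set of families that differ from \<open>b\<close> in finitely many places.  An elementary tensor has
  components from the \<open>A i\<close> at the places of a finite set and the identity elsewhere, and the
  closed linear span of the elementary tensors is the inductive limit of the finite spatial
  tensor products under the maps that append tensor factors \<open>1\<close>.  The spatial norm does not
  depend on the faithful representations in which the \<open>A i\<close> are given.\<close>

definition restricted_families :: "'i set \<Rightarrow> ('i \<Rightarrow> 'x set) \<Rightarrow> ('i \<Rightarrow> 'x) \<Rightarrow> ('i \<Rightarrow> 'x) set" where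
  "restricted_families I X b = {x \<in> Pi\<^sub>E I X. finite {i \<in> I. x i \<noteq> b i}}"

definition elementary_tensors ::
    "'i set \<Rightarrow> ('i \<Rightarrow> 'x set) \<Rightarrow> ('i \<Rightarrow> 'x) \<Rightarrow> ('i \<Rightarrow> 'x op set) \<Rightarrow> ('i \<Rightarrow> 'x) op set" where
  "elementary_tensors I X b A = {T. \<exists>F a. finite F \<and> F \<subseteq> I \<and> (\<forall>i\<in>F. a i \<in> A i) \<and>
     (\<forall>c \<xi>. blinfun_apply T (scaleC c \<xi>) = scaleC c (blinfun_apply T \<xi>)) \<and>
     (\<forall>x y. coef T y x =
        (if x \<in> restricted_families I X b \<and> y \<in> restricted_families I X b \<and> (\<forall>i\<in>I - F. x i = y i)
         then \<Prod>i\<in>F. coef (a i) (y i) (x i) else 0))}"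

definition spatial_tensor ::
    "'i set \<Rightarrow> ('i \<Rightarrow> 'x set) \<Rightarrow> ('i \<Rightarrow> 'x) \<Rightarrow> ('i \<Rightarrow> 'x op set) \<Rightarrow> ('i \<Rightarrow> 'x) op set" where
  "spatial_tensor I X b A = closure (complex_span (elementary_tensors I X b A))"

section \<open>Hecke algebras\<close>

text \<open>Functions on a group are represented as functions on the ambient type that vanish
  outside of the carrier.\<close>

definition hecke_algebra :: "('g, 'm) monoid_scheme \<Rightarrow> 'g set \<Rightarrow> ('g \<Rightarrow> complex) set" where
  "hecke_algebra G H = {f. (\<forall>x. x \<notin> carrier G \<longrightarrow> f x = 0) \<and>
     (\<forall>x\<in>carrier G. \<forall>h\<in>H. \<forall>k\<in>H. f (h \<otimes>\<^bsub>G\<^esub> x \<otimes>\<^bsub>G\<^esub> k) = f x) \<and>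
     finite {(H #>\<^bsub>G\<^esub> x) <#>\<^bsub>G\<^esub> H | x. x \<in> carrier G \<and> f x \<noteq> 0}}"

text \<open>Vectors are functions on the set of right cosets.  For biinvariant \<open>f\<close> the value
  \<open>f (x \<otimes> inv y)\<close> depends only on the right cosets of \<open>x\<close> and \<open>y\<close>, so any choice of
  representatives can be used.\<close>

definition hecke_rep :: "('g, 'm) monoid_scheme \<Rightarrow> 'g set \<Rightarrow> ('g \<Rightarrow> complex) \<Rightarrow> 'g set op" where
  "hecke_rep G H f = (THE T :: 'g set op. \<forall>\<xi> C. ell2_apply (T \<xi>) C =
     (if C \<in> rcosets\<^bsub>G\<^esub> H
      then \<Sum>\<^sub>\<infinity>D\<in>rcosets\<^bsub>G\<^esub> H. f ((SOME x. x \<in> C) \<otimes>\<^bsub>G\<^esub> inv\<^bsub>G\<^esub> (SOME y. y \<in> D)) * ell2_apply \<xi> D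
      else 0))"

definition reduced_hecke_algebra :: "('g, 'm) monoid_scheme \<Rightarrow> 'g set \<Rightarrow> 'g set op set" where
  "reduced_hecke_algebra G H = closure (hecke_rep G H ` hecke_algebra G H)"

section \<open>The symmetries and their fixed points\<close>

definition diag_mat :: "'a^2^2 \<Rightarrow> 'a::comm_ring_1^(2+2)^(2+2)" where
  "diag_mat r = block_mat 0 r"

definition theta :: "adele^2^2 \<Rightarrow> adele^(2+2)^(2+2) \<Rightarrow> adele^(2+2)^(2+2)" where
  "theta r x = diag_mat r ** x ** diag_mat (matrix_inv r)"

text \<open>The identification of the Hecke algebras of the two pairs: the inverse of restriction
  along \<open>P_embed\<close>.\<close>

definition P_extend :: "(rat^(2+2)^(2+2) \<Rightarrow> complex) \<Rightarrow> adele^(2+2)^(2+2) \<Rightarrow> complex" where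
  "P_extend f = (THE F. F \<in> hecke_algebra Pbar_grp Pbar0 \<and> (\<forall>x\<in>carrier P_grp. F (P_embed x) = f x))"

definition alpha_fun ::
    "adele^2^2 \<Rightarrow> (rat^(2+2)^(2+2) \<Rightarrow> complex) \<Rightarrow> rat^(2+2)^(2+2) \<Rightarrow> complex" where
  "alpha_fun r f x = (if x \<in> carrier P_grp
     then (P_extend f \<circ> inv_into UNIV (theta r)) (P_embed x) else 0)"

definition CrP :: "(rat^(2+2)^(2+2)) set op set" where
  "CrP = reduced_hecke_algebra P_grp P0"

text \<open>The extension by continuity of \<open>alpha_fun r\<close> to the completion.\<close>

definition alpha :: "adele^2^2 \<Rightarrow> (rat^(2+2)^(2+2)) set op \<Rightarrow> (rat^(2+2)^(2+2)) set op" where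
  "alpha r = (THE \<Phi>. \<Phi> \<in> extensional CrP \<and> continuous_on CrP \<Phi> \<and>
     (\<forall>f\<in>hecke_algebra P_grp P0. \<Phi> (hecke_rep P_grp P0 f) = hecke_rep P_grp P0 (alpha_fun r f)))"

text \<open>A unit of the profinite integers acts by \<open>alpha r\<close> for any \<open>r\<close> of that determinant,
  and on \<open>Afr p\<close> a unit of the \<open>p\<close>-adic integers acts by any of its lifts.  As every
  \<open>p\<close>-adic unit has a lift, the fixed points are in both cases those of all \<open>alpha r\<close>.\<close>

definition fixed_points :: "(rat^(2+2)^(2+2)) set op set \<Rightarrow> (rat^(2+2)^(2+2)) set op set" where
  "fixed_points A = {T \<in> A. \<forall>r\<in>GL2 zhat. alpha r T = T}"

definition Afr :: "nat \<Rightarrow> (rat^(2+2)^(2+2)) set op set" where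
  "Afr p = closure (hecke_rep P_grp P0 ` {f \<in> hecke_algebra P_grp P0. \<forall>x. f x \<noteq> 0 \<longrightarrow> x \<in> P_at p})"

end

theory Submission
  imports Defs
begin

text \<open>For a prime \<open>p\<close> let \<open>K\<^sub>p\<close> be the subgroup of the elements of \<open>P\<close> that are integral at
  \<open>p\<close>, so that \<open>P\<^sub>0\<close> is the intersection of all \<open>K\<^sub>p\<close>, and call two elements of \<open>P\<close> locally
  equivalent if for every \<open>p\<close> they lie in the same double coset of \<open>K\<^sub>p\<close>.  By strong approximation
  the orbits of the symmetries on the double cosets of \<open>P\<^sub>0\<close> are the local equivalence classes;
  these are finite unions of double cosets, hence averaging over a finite orbit identifies the
  fixed point algebra with the closure of the Hecke functions that are constant on the classes.
  The indicator functions of the classes multiply like a product over the primes: the class of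
  \<open>y u\<close> is the convolution of those of \<open>y\<close> and \<open>u\<close> when at every prime one of them is integral.
  This gives the commutation relations.

  The coset space \<open>P\<close> modulo \<open>P\<^sub>0\<close> is the restricted product of the spaces \<open>P\<close> modulo \<open>K\<^sub>p\<close>, whereas the
  tensor product acts on the restricted product of one copy of all of \<open>P\<close> modulo \<open>P\<^sub>0\<close> for each \<open>p\<close>.
  The latter is in bijection with \<open>P\<close> modulo \<open>P\<^sub>0\<close> times a set \<open>Z\<close> of superfluous coordinates on which the
  algebra acts trivially, so \<open>T \<mapsto> T \<otimes> 1\<close> is the required isomorphism.\<close>

section \<open>Operators on square-summable functions\<close>

text \<open>The local data at all primes determine a double coset of \<open>P0\<close> only up to
  the symmetries, so a product structure over the primes can be expected only for functions constant
  on the classes. Multiplying two class indicators is still an infinite matrix product; but if at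
  every prime one factor is integral, each intermediate coset is pinned down there by one of its two
  neighbours. A single term survives, and no structure constants have to be computed.

  The automorphisms \<open>theta r\<close> live on the adelic group and need not preserve the image
  of P. On P they are visible only through coset representatives, so the abstract symmetries satisfy
  all their laws only up to \<open>P0\<close>. The abstract part rests on one approximation
  property, \<open>local_decomp\<close>: an element can be matched at one place by an element
  integral at all others. The arithmetic behind it and behind the adelic statements is triangular
  reduction of rational matrices at p and surjectivity of SL2(Z) onto SL2(Z/N).\<close>

lemma infsum_single:
  fixes f :: "'a \<Rightarrow> 'b::{comm_monoid_add,t2_space}"
  assumes "\<And>j. j \<noteq> i \<Longrightarrow> f j = 0"
  shows "infsum f UNIV = f i"
proof -
  have "infsum f UNIV = infsum f {i}"
    by (rule infsum_cong_neutral) (use assms in auto)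
  then show ?thesis by simp
qed

lemma ell2_eqI: "(\<And>x. ell2_apply \<xi> x = ell2_apply \<eta> x) \<Longrightarrow> \<xi> = \<eta>"
  by (metis ell2_apply_inject ext)

lemma ell2_apply_simps [simp]:
  "ell2_apply (\<xi> + \<eta>) x = ell2_apply \<xi> x + ell2_apply \<eta> x"
  "ell2_apply (\<xi> - \<eta>) x = ell2_apply \<xi> x - ell2_apply \<eta> x"
  "ell2_apply 0 x = 0"
  "ell2_apply (- \<xi>) x = - ell2_apply \<xi> x"
  "ell2_apply (r *\<^sub>R \<xi>) x = r *\<^sub>R ell2_apply \<xi> x"
  "ell2_apply (scaleC c \<xi>) x = c * ell2_apply \<xi> x"
proof -
  show add: "ell2_apply (\<xi> + \<eta>) x = ell2_apply \<xi> x + ell2_apply \<eta> x" for \<eta>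
    by (simp add: plus_ell2.rep_eq)
  show minus: "ell2_apply (- \<xi>) x = - ell2_apply \<xi> x" for \<xi>
    by (simp add: uminus_ell2.rep_eq)
  show "ell2_apply (\<xi> - \<eta>) x = ell2_apply \<xi> x - ell2_apply \<eta> x"
    by (subst minus_ell2_def, subst add, subst minus, simp)
qed (simp_all add: zero_ell2.rep_eq scaleR_ell2.rep_eq scaleC.rep_eq)

lemma ell2_apply_sum [simp]: "ell2_apply (\<Sum>i\<in>F. f i) x = (\<Sum>i\<in>F. ell2_apply (f i) x)"
  by (induction F rule: infinite_finite_induct) simp_all

lemma ell2_apply_ket: "ell2_apply (ket x) y = (if y = x then 1 else 0)"
  by (simp add: ket.rep_eq)

lemma ell2_summable: "(\<lambda>x. (cmod (ell2_apply \<xi> x))\<^sup>2) summable_on UNIV"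
  using ell2_apply[of \<xi>] by simp

lemma norm_ell2_sq: "(norm \<xi>)\<^sup>2 = (\<Sum>\<^sub>\<infinity>x. (cmod (ell2_apply \<xi> x))\<^sup>2)"
  by (simp add: norm_ell2.rep_eq infsum_nonneg)

lemma sum_cmod_le_norm_ell2: "finite F \<Longrightarrow> (\<Sum>x\<in>F. (cmod (ell2_apply \<xi> x))\<^sup>2) \<le> (norm \<xi>)\<^sup>2"
  unfolding norm_ell2_sq by (rule finite_sum_le_infsum[OF ell2_summable]) auto

lemma cmod_ell2_apply_le: "cmod (ell2_apply \<xi> x) \<le> norm \<xi>"
  by (rule power2_le_imp_le) (use sum_cmod_le_norm_ell2[of "{x}" \<xi>] in simp_all)

lemma ell2_exists:
  assumes "\<And>F. finite F \<Longrightarrow> (\<Sum>x\<in>F. (cmod (f x))\<^sup>2) \<le> B\<^sup>2" and "B \<ge> 0"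
  obtains \<xi> where "ell2_apply \<xi> = f" "norm \<xi> \<le> B"
proof -
  have s: "(\<lambda>x. (cmod (f x))\<^sup>2) summable_on UNIV"
    by (rule nonneg_bounded_partial_sums_imp_summable_on[where C = "B\<^sup>2"])
       (auto intro: eventually_finite_subsets_at_top_weakI assms)
  then have e: "ell2_apply (Abs_ell2 f) = f" by (simp add: Abs_ell2_inverse)
  have "(norm (Abs_ell2 f))\<^sup>2 \<le> B\<^sup>2"
    unfolding norm_ell2_sq e by (intro infsum_le_finite_sums s assms)
  then have "norm (Abs_ell2 f) \<le> B" using assms(2) by (rule power2_le_imp_le)
  with e that show thesis by blast
qed

text \<open>The common source of the operators built below (adjoints, slices, amplifications,
  convolutions, permutations): a real linear coordinate formula with bounded finite partial sums is
  already an operator, so no further convergence has to be discussed.\<close>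

lemma blinfun_ell2_exists:
  fixes g :: "'a ell2 \<Rightarrow> 'b \<Rightarrow> complex"
  assumes add: "\<And>\<xi> \<eta> y. g (\<xi> + \<eta>) y = g \<xi> y + g \<eta> y"
    and scale: "\<And>r \<xi> y. g (r *\<^sub>R \<xi>) y = r *\<^sub>R g \<xi> y"
    and bound: "\<And>\<xi> F. finite F \<Longrightarrow> (\<Sum>y\<in>F. (cmod (g \<xi> y))\<^sup>2) \<le> (B * norm \<xi>)\<^sup>2"
    and B: "B \<ge> 0"
  obtains T :: "'a ell2 \<Rightarrow>\<^sub>L 'b ell2" where "\<And>\<xi>. ell2_apply (T \<xi>) = g \<xi>" "norm T \<le> B"
proof -
  have "\<exists>\<eta>. ell2_apply \<eta> = g \<xi> \<and> norm \<eta> \<le> B * norm \<xi>" for \<xi>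
    by (rule ell2_exists[of "g \<xi>" "B * norm \<xi>"]) (use bound B in auto)
  then obtain t where t: "\<And>\<xi>. ell2_apply (t \<xi>) = g \<xi>" "\<And>\<xi>. norm (t \<xi>) \<le> B * norm \<xi>"
    by metis
  have bl: "bounded_linear t"
    by (rule bounded_linear_intro[where K = B])
       (auto intro!: ell2_eqI simp: t add scale mult.commute[of _ B])
  have T: "blinfun_apply (Blinfun t) = t" by (rule bounded_linear_Blinfun_apply[OF bl])
  have "norm (Blinfun t) \<le> B" by (rule norm_blinfun_bound) (simp_all add: T t B)
  with T t that show thesis by metis
qed

section \<open>Complex linear operators and their matrix coefficients\<close>

definition trunc :: "'a set \<Rightarrow> 'a ell2 \<Rightarrow> 'a ell2" where
  "trunc F \<xi> = (\<Sum>x\<in>F. scaleC (ell2_apply \<xi> x) (ket x))"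

lemma ell2_apply_trunc:
  "finite F \<Longrightarrow> ell2_apply (trunc F \<xi>) x = (if x \<in> F then ell2_apply \<xi> x else 0)"
  by (simp add: trunc_def ell2_apply_ket if_distrib[where f = "\<lambda>z. _ * z"] sum.delta cong: if_cong)

text \<open>The squared distance to the truncation is \<open>(norm \<xi>)\<^sup>2\<close> minus the
  finite sum over F, and this difference tends to 0.\<close>

lemma trunc_tendsto: "((\<lambda>F. trunc F \<xi>) \<longlongrightarrow> \<xi>) (finite_subsets_at_top UNIV)"
proof -
  let ?n = "\<lambda>x. (cmod (ell2_apply \<xi> x))\<^sup>2"
  have eq: "(norm (trunc F \<xi> - \<xi>))\<^sup>2 = (norm \<xi>)\<^sup>2 - sum ?n F" if F: "finite F" for F
  proof -
    have "(norm (trunc F \<xi> - \<xi>))\<^sup>2 = (\<Sum>\<^sub>\<infinity>x. (cmod (ell2_apply (trunc F \<xi> - \<xi>) x))\<^sup>2)"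
      by (rule norm_ell2_sq)
    also have "\<dots> = infsum ?n (UNIV - F)"
      by (rule infsum_cong_neutral) (auto simp: ell2_apply_trunc F)
    also have "\<dots> = infsum ?n UNIV - infsum ?n F"
      by (rule infsum_Diff) (use ell2_summable F in auto)
    finally show ?thesis by (simp add: F norm_ell2_sq)
  qed
  have "(sum ?n \<longlongrightarrow> (norm \<xi>)\<^sup>2) (finite_subsets_at_top UNIV)"
    using infsum_tendsto[OF ell2_summable, of \<xi>] by (simp add: norm_ell2_sq)
  then have "((\<lambda>F. (norm \<xi>)\<^sup>2 - sum ?n F) \<longlongrightarrow> (norm \<xi>)\<^sup>2 - (norm \<xi>)\<^sup>2) (finite_subsets_at_top UNIV)"
    by (intro tendsto_intros)
  then have "((\<lambda>F. sqrt ((norm \<xi>)\<^sup>2 - sum ?n F)) \<longlongrightarrow> sqrt 0) (finite_subsets_at_top UNIV)"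
    by (intro tendsto_real_sqrt) simp
  moreover have "\<forall>\<^sub>F F in finite_subsets_at_top UNIV.
      sqrt ((norm \<xi>)\<^sup>2 - sum ?n F) = norm (trunc F \<xi> - \<xi>)"
    by (rule eventually_finite_subsets_at_top_weakI) (simp flip: eq)
  ultimately have "((\<lambda>F. norm (trunc F \<xi> - \<xi>)) \<longlongrightarrow> 0) (finite_subsets_at_top UNIV)"
    by (simp add: tendsto_cong)
  then show ?thesis by (simp add: tendsto_norm_zero_iff LIM_zero_iff)
qed

text \<open>The operator type is only real linear, so compatibility with complex scalars has to be
  carried along. It is what makes an operator determined by its matrix coefficients and what
  provides an adjoint.\<close>

definition complex_linear :: "('a ell2 \<Rightarrow>\<^sub>L 'b ell2) \<Rightarrow> bool" where
  "complex_linear T \<longleftrightarrow> (\<forall>c \<xi>. T (scaleC c \<xi>) = scaleC c (T \<xi>))"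

lemma complex_linear_trunc:
  assumes "complex_linear T"
  shows "T (trunc F \<xi>) = (\<Sum>x\<in>F. scaleC (ell2_apply \<xi> x) (T (ket x)))"
  using assms by (simp add: trunc_def complex_linear_def blinfun.sum_right)

lemma complex_linear_sums:
  assumes "complex_linear T"
  shows "((\<lambda>F. \<Sum>x\<in>F. scaleC (ell2_apply \<xi> x) (T (ket x))) \<longlongrightarrow> T \<xi>) (finite_subsets_at_top UNIV)"
  unfolding complex_linear_trunc[OF assms, symmetric]
  by (intro tendsto_intros trunc_tendsto)

lemma complex_linear_eqI:
  fixes S T :: "'a ell2 \<Rightarrow>\<^sub>L 'b ell2"
  assumes "complex_linear S" "complex_linear T" and "\<And>x. S (ket x) = T (ket x)"
  shows "S = T"
proof (rule blinfun_eqI)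
  fix \<xi>
  show "S \<xi> = T \<xi>"
    using complex_linear_sums[OF assms(1), of \<xi>] complex_linear_sums[OF assms(2), of \<xi>]
    unfolding assms(3) by (rule tendsto_unique[rotated]) simp
qed

lemma complex_linear_coef_eqI:
  fixes S T :: "'a op"
  assumes "complex_linear S" "complex_linear T" "\<And>x y. coef S y x = coef T y x"
  shows "S = T"
  using assms(3) by (intro complex_linear_eqI assms ell2_eqI) (simp add: coef_def)

lemma tendsto_ell2_apply:
  assumes "(f \<longlongrightarrow> \<xi>) F"
  shows "((\<lambda>i. ell2_apply (f i) y) \<longlongrightarrow> ell2_apply \<xi> y) F"
proof -
  have "((\<lambda>i. norm (f i - \<xi>)) \<longlongrightarrow> 0) F"
    using assms by (simp add: tendsto_norm_zero_iff LIM_zero_iff)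
  moreover have "\<forall>\<^sub>F i in F. norm (ell2_apply (f i) y - ell2_apply \<xi> y) \<le> norm (f i - \<xi>)"
    using cmod_ell2_apply_le[of "f _ - \<xi>" y] by simp
  ultimately have "((\<lambda>i. ell2_apply (f i) y - ell2_apply \<xi> y) \<longlongrightarrow> 0) F"
    by (rule Lim_null_comparison[rotated])
  then show ?thesis by (simp add: LIM_zero_iff)
qed

lemma has_sum_coef:
  fixes T :: "'a op"
  assumes "complex_linear T"
  shows "((\<lambda>x. coef T y x * ell2_apply \<xi> x) has_sum ell2_apply (T \<xi>) y) UNIV"
  using tendsto_ell2_apply[OF complex_linear_sums[OF assms, of \<xi>], of y]
  unfolding has_sum_def by (simp add: coef_def mult.commute)

text \<open>Products of Hecke operators and of amplified operators are evaluated in this way: at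
  most one intermediate index contributes, so no infinite sum has to be manipulated.\<close>

lemma coef_compose_single:
  fixes S T :: "'a op"
  assumes "complex_linear S" and "\<And>z. z \<noteq> w \<Longrightarrow> coef S y z * coef T z x = 0"
  shows "coef (S o\<^sub>L T) y x = coef S y w * coef T w x"
proof -
  have "coef (S o\<^sub>L T) y x = (\<Sum>\<^sub>\<infinity>z. coef S y z * coef T z x)"
    using infsumI[OF has_sum_coef[OF assms(1), of y "T (ket x)"]] by (simp add: coef_def)
  also have "\<dots> = coef S y w * coef T w x"
    by (subst infsum_single[where i = w]) (use assms in auto)
  finally show ?thesis .
qed

lemma cmod_coef_le: "cmod (coef T y x) \<le> norm T"
proof -
  have "(norm (ket x))\<^sup>2 = (\<Sum>\<^sub>\<infinity>y. (cmod (ell2_apply (ket x) y))\<^sup>2)" by (rule norm_ell2_sq)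
  also have "\<dots> = 1" by (subst infsum_single[where i = x]) (auto simp: ell2_apply_ket)
  finally have "norm (ket x) = 1"
    by (metis norm_ge_zero power2_eq_1_iff linorder_not_less neg_less_0_iff_less zero_less_one)
  then show ?thesis
    using cmod_ell2_apply_le[of "T (ket x)" y] norm_blinfun[of T "ket x"] by (simp add: coef_def)
qed

lemma coef_simps [simp]:
  "coef (S + T) y x = coef S y x + coef T y x"
  "coef (S - T) y x = coef S y x - coef T y x"
  "coef 0 y x = 0"
  "coef (r *\<^sub>R S) y x = r *\<^sub>R coef S y x"
  "coef (op_scale c S) y x = c * coef S y x"
  by (simp_all add: coef_def blinfun.add_left blinfun.diff_left blinfun.scaleR_left op_scale_def
      scaleC_op.rep_eq)

lemma coef_sum [simp]: "coef (\<Sum>i\<in>F. f i) y x = (\<Sum>i\<in>F. coef (f i) y x)"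
  by (induction F rule: infinite_finite_induct) simp_all

text \<open>Makes equations between matrix coefficients closed conditions, so that facts about Hecke
  functions pass to the completed algebras.\<close>

lemma bounded_linear_coef: "bounded_linear (\<lambda>T. coef T y x)"
  by (rule bounded_linear_intro[where K = 1]) (simp_all add: cmod_coef_le)

lemma bounded_linear_op_scale: "bounded_linear (op_scale c)"
  unfolding op_scale_def by (rule bounded_bilinear.bounded_linear_right[OF bounded_bilinear_blinfun_compose])

lemma op_scale_apply [simp]: "blinfun_apply (op_scale c T) \<xi> = scaleC c (T \<xi>)"
  by (simp add: op_scale_def scaleC_op.rep_eq)

lemma scaleC_simps:
  "scaleC c (\<xi> + \<eta>) = scaleC c \<xi> + scaleC c \<eta>"
  "scaleC c (r *\<^sub>R \<xi>) = r *\<^sub>R scaleC c \<xi>"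
  "scaleC c (scaleC d \<xi>) = scaleC (c * d) \<xi>"
  "scaleC (complex_of_real r) \<xi> = r *\<^sub>R \<xi>"
  "scaleC c 0 = 0"
  by (auto intro!: ell2_eqI simp: algebra_simps scaleR_conv_of_real)

lemma complex_linear_simps:
  fixes S T :: "'a ell2 \<Rightarrow>\<^sub>L 'b ell2" and R :: "'a op"
  shows "complex_linear S \<Longrightarrow> complex_linear T \<Longrightarrow> complex_linear (S + T)"
    and "complex_linear R \<Longrightarrow> complex_linear (op_scale c R)"
    and "complex_linear S \<Longrightarrow> complex_linear (r *\<^sub>R S)"
    and "complex_linear (0 :: 'a ell2 \<Rightarrow>\<^sub>L 'b ell2)"
  by (simp_all add: complex_linear_def blinfun.add_left blinfun.scaleR_left scaleC_simps
      mult.commute)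

lemma complex_linear_compose:
  "complex_linear S \<Longrightarrow> complex_linear T \<Longrightarrow> complex_linear (S o\<^sub>L T)"
  by (simp add: complex_linear_def)

lemma complex_linear_sum: "(\<And>i. i \<in> F \<Longrightarrow> complex_linear (f i)) \<Longrightarrow> complex_linear (\<Sum>i\<in>F. f i)"
  by (induction F rule: infinite_finite_induct) (auto intro: complex_linear_simps)

lemma closed_complex_linear: "closed {T :: 'a ell2 \<Rightarrow>\<^sub>L 'b ell2. complex_linear T}"
proof -
  have eq: "{T :: 'a ell2 \<Rightarrow>\<^sub>L 'b ell2. complex_linear T} =
      (\<Inter>c. \<Inter>\<xi>. {T :: 'a ell2 \<Rightarrow>\<^sub>L 'b ell2. blinfun_apply T (scaleC c \<xi>) = scaleC_op c (blinfun_apply T \<xi>)})"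
    by (auto simp: complex_linear_def scaleC_op.rep_eq)
  show ?thesis unfolding eq
    by (intro closed_INT ballI closed_Collect_eq continuous_intros)
qed

subsection \<open>Adjoints\<close>

lemma cinner_finite_bound:
  assumes "finite F"
  shows "(\<Sum>x\<in>F. cmod (ell2_apply \<xi> x * cnj (ell2_apply \<eta> x))) \<le> norm \<xi> * norm \<eta>"
proof -
  have L: "L2_set (\<lambda>x. cmod (ell2_apply \<zeta> x)) F \<le> norm \<zeta>" for \<zeta> :: "'a ell2"
    unfolding L2_set_def by (rule real_le_lsqrt) (simp_all add: sum_cmod_le_norm_ell2 assms sum_nonneg)
  have "(\<Sum>x\<in>F. cmod (ell2_apply \<xi> x * cnj (ell2_apply \<eta> x)))
      = (\<Sum>x\<in>F. \<bar>cmod (ell2_apply \<xi> x)\<bar> * \<bar>cmod (ell2_apply \<eta> x)\<bar>)"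
    by (simp add: norm_mult)
  also have "\<dots> \<le> L2_set (\<lambda>x. cmod (ell2_apply \<xi> x)) F * L2_set (\<lambda>x. cmod (ell2_apply \<eta> x)) F"
    by (rule L2_set_mult_ineq)
  also have "\<dots> \<le> norm \<xi> * norm \<eta>"
    by (intro mult_mono L L2_set_nonneg norm_ge_zero)
  finally show ?thesis .
qed

lemma cinner_abs_summable:
  "(\<lambda>x. cmod (ell2_apply \<xi> x * cnj (ell2_apply \<eta> x))) summable_on UNIV"
  by (rule nonneg_bounded_partial_sums_imp_summable_on[where C = "norm \<xi> * norm \<eta>"])
     (auto intro: eventually_finite_subsets_at_top_weakI cinner_finite_bound)

lemma cinner_summable: "(\<lambda>x. ell2_apply \<xi> x * cnj (ell2_apply \<eta> x)) summable_on UNIV"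
  by (rule abs_summable_summable[OF cinner_abs_summable])

lemma cmod_cinner_le: "cmod (cinner \<xi> \<eta>) \<le> norm \<xi> * norm \<eta>"
proof -
  have "cmod (cinner \<xi> \<eta>) \<le> (\<Sum>\<^sub>\<infinity>x. cmod (ell2_apply \<xi> x * cnj (ell2_apply \<eta> x)))"
    unfolding cinner.rep_eq by (rule norm_infsum_bound[OF cinner_abs_summable])
  also have "\<dots> \<le> norm \<xi> * norm \<eta>"
    by (rule infsum_le_finite_sums[OF cinner_abs_summable]) (rule cinner_finite_bound)
  finally show ?thesis .
qed

lemma cinner_simps:
  "cinner (\<xi> + \<xi>') \<eta> = cinner \<xi> \<eta> + cinner \<xi>' \<eta>"
  "cinner (scaleC c \<xi>) \<eta> = c * cinner \<xi> \<eta>"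
  "cinner (r *\<^sub>R \<xi>) \<eta> = r *\<^sub>R cinner \<xi> \<eta>"
  "cinner 0 \<eta> = 0"
proof -
  show s: "cinner (scaleC c \<xi>) \<eta> = c * cinner \<xi> \<eta>" for c
    by (simp add: cinner.rep_eq mult.assoc infsum_cmult_right')
  show "cinner (\<xi> + \<xi>') \<eta> = cinner \<xi> \<eta> + cinner \<xi>' \<eta>"
    by (simp add: cinner.rep_eq distrib_right infsum_add cinner_summable)
  show "cinner (r *\<^sub>R \<xi>) \<eta> = r *\<^sub>R cinner \<xi> \<eta>"
    using s[of "of_real r"] by (simp add: scaleC_simps scaleR_conv_of_real)
  show "cinner 0 \<eta> = 0" by (simp add: cinner.rep_eq)
qed

lemma cinner_commute: "cinner \<xi> \<eta> = cnj (cinner \<eta> \<xi>)"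
  unfolding cinner.rep_eq infsum_cnj[symmetric] by (simp add: mult.commute)

lemma cinner_simps_right:
  "cinner \<eta> (\<xi> + \<xi>') = cinner \<eta> \<xi> + cinner \<eta> \<xi>'"
  "cinner \<eta> (scaleC c \<xi>) = cnj c * cinner \<eta> \<xi>"
  "cinner \<eta> 0 = 0"
proof -
  show "cinner \<eta> (\<xi> + \<xi>') = cinner \<eta> \<xi> + cinner \<eta> \<xi>'"
    using cinner_simps(1)[of \<xi> \<xi>' \<eta>] by (simp add: cinner_commute[of \<eta>])
  show "cinner \<eta> (scaleC c \<xi>) = cnj c * cinner \<eta> \<xi>"
    using cinner_simps(2)[of c \<xi> \<eta>] by (simp add: cinner_commute[of \<eta>])
  show "cinner \<eta> 0 = 0"
    using cinner_simps(4)[of \<eta>] by (simp add: cinner_commute[of \<eta>])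
qed

lemma cinner_sum_right: "cinner \<eta> (\<Sum>i\<in>F. f i) = (\<Sum>i\<in>F. cinner \<eta> (f i))"
  by (induction F rule: infinite_finite_induct) (simp_all add: cinner_simps_right)

lemma cinner_ket_left: "cinner (ket x) \<eta> = cnj (ell2_apply \<eta> x)"
  by (simp add: cinner.rep_eq ell2_apply_ket) (subst infsum_single[where i = x], auto)

lemma cinner_ket_right: "cinner \<eta> (ket x) = ell2_apply \<eta> x"
  by (subst cinner_commute) (simp add: cinner_ket_left)

lemma bounded_linear_cinner: "bounded_linear (\<lambda>\<xi>. cinner \<xi> \<eta>)"
  by (rule bounded_linear_intro[where K = "norm \<eta>"]) (simp_all add: cinner_simps cmod_cinner_le)

text \<open>The coordinate of \<open>S \<xi>\<close> at x has to be
  \<open>cinner \<xi> (T (ket x))\<close>. That these numbers are square summable follows by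
  duality, from the boundedness of T.\<close>

lemma adjoint_exists:
  fixes T :: "'a op"
  assumes T: "complex_linear T"
  obtains S :: "'a op" where "\<And>\<xi> \<eta>. cinner (T \<xi>) \<eta> = cinner \<xi> (S \<eta>)"
proof -
  let ?g = "\<lambda>\<xi> x. cinner \<xi> (T (ket x))"
  have bound: "(\<Sum>x\<in>F. (cmod (?g \<xi> x))\<^sup>2) \<le> (norm T * norm \<xi>)\<^sup>2" if F: "finite F" for \<xi> F
  proof -
    let ?s = "\<Sum>x\<in>F. (cmod (?g \<xi> x))\<^sup>2"
    have s0: "?s \<ge> 0" by (simp add: sum_nonneg)
    \<comment> \<open>The test vector is the candidate itself cut off to F. Then
      \<open>cinner \<xi> (T \<zeta>)\<close> equals the sum \<open>?s\<close>, and Cauchy-Schwarz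
      bounds it by a multiple of \<open>sqrt ?s\<close>, which can be cancelled.\<close>
    have "\<exists>\<zeta>. ell2_apply \<zeta> = (\<lambda>x. if x \<in> F then ?g \<xi> x else 0) \<and> norm \<zeta> \<le> sqrt ?s"
    proof (rule ell2_exists[where f = "\<lambda>x. if x \<in> F then ?g \<xi> x else 0" and B = "sqrt ?s"])
      fix F' :: "'a set" assume F': "finite F'"
      have "(\<Sum>x\<in>F'. (cmod (if x \<in> F then ?g \<xi> x else 0))\<^sup>2) = (\<Sum>x\<in>F' \<inter> F. (cmod (?g \<xi> x))\<^sup>2)"
        using F' by (subst sum.inter_restrict) (auto intro: sum.cong)
      also have "\<dots> \<le> ?s" by (rule sum_mono2) (use F in auto)
      finally show "(\<Sum>x\<in>F'. (cmod (if x \<in> F then ?g \<xi> x else 0))\<^sup>2) \<le> (sqrt ?s)\<^sup>2"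
        using s0 by simp
    qed (use s0 in auto)
    then obtain \<zeta> where \<zeta>: "ell2_apply \<zeta> = (\<lambda>x. if x \<in> F then ?g \<xi> x else 0)"
      "norm \<zeta> \<le> sqrt ?s" by blast
    have "trunc F \<zeta> = \<zeta>" by (rule ell2_eqI) (simp add: ell2_apply_trunc F \<zeta>)
    then have "T \<zeta> = (\<Sum>x\<in>F. scaleC (ell2_apply \<zeta> x) (T (ket x)))"
      using complex_linear_trunc[OF T, of F \<zeta>] by simp
    then have "cinner \<xi> (T \<zeta>) = (\<Sum>x\<in>F. cnj (?g \<xi> x) * ?g \<xi> x)"
      by (simp add: cinner_sum_right cinner_simps_right \<zeta>)
    also have "\<dots> = of_real ?s"
      unfolding of_real_sum by (rule sum.cong) (simp_all only: complex_norm_square mult.commute)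
    finally have "cmod (cinner \<xi> (T \<zeta>)) = \<bar>?s\<bar>" by (simp only: norm_of_real)
    then have "?s = cmod (cinner \<xi> (T \<zeta>))" using s0 by linarith
    also have "\<dots> \<le> norm \<xi> * norm (T \<zeta>)" by (rule cmod_cinner_le)
    also have "\<dots> \<le> norm \<xi> * (norm T * sqrt ?s)"
      using \<zeta>(2) by (intro mult_left_mono order_trans[OF norm_blinfun]) auto
    finally have le: "sqrt ?s * sqrt ?s \<le> (norm T * norm \<xi>) * sqrt ?s" using s0 by (simp add: mult_ac)
    have "sqrt ?s \<le> norm T * norm \<xi>"
    proof (cases "?s = 0")
      case False
      then have "sqrt ?s > 0" using s0 by simp
      with le show ?thesis by (meson mult_right_le_imp_le)
    qed simp
    then have "(sqrt ?s)\<^sup>2 \<le> (norm T * norm \<xi>)\<^sup>2" using s0 by (intro power_mono) auto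
    then show ?thesis using s0 by simp
  qed
  obtain S :: "'a op" where S: "\<And>\<xi>. ell2_apply (S \<xi>) = ?g \<xi>"
    by (rule blinfun_ell2_exists[of ?g "norm T"]) (use bound in \<open>auto simp: cinner_simps\<close>)
  have "cinner (T \<xi>) \<eta> = cinner \<xi> (S \<eta>)" for \<xi> \<eta>
  proof (rule tendsto_unique[of "finite_subsets_at_top UNIV"])
    have cl: "bounded_linear (\<lambda>\<xi>. cinner (T \<xi>) \<eta>)" "bounded_linear (\<lambda>\<xi>. cinner \<xi> (S \<eta>))"
      using bounded_linear_compose[OF bounded_linear_cinner blinfun.bounded_linear_right]
        bounded_linear_cinner by auto
    show "((\<lambda>F. cinner (T (trunc F \<xi>)) \<eta>) \<longlongrightarrow> cinner (T \<xi>) \<eta>) (finite_subsets_at_top UNIV)"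
      by (rule bounded_linear.tendsto[OF cl(1) trunc_tendsto])
    have e: "cinner (T (trunc F \<xi>)) \<eta> = cinner (trunc F \<xi>) (S \<eta>)" for F
    proof -
      have 1: "cinner (T (ket x)) \<eta> = cinner (ket x) (S \<eta>)" for x
        by (simp add: cinner_ket_left S) (rule cinner_commute)
      have "cinner (\<Sum>i\<in>F. scaleC (ell2_apply \<xi> i) (h i)) \<zeta>
          = (\<Sum>i\<in>F. ell2_apply \<xi> i * cinner (h i) \<zeta>)" for h :: "'a \<Rightarrow> 'a ell2" and \<zeta>
        by (induction F rule: infinite_finite_induct) (simp_all add: cinner_simps)
      then show ?thesis unfolding complex_linear_trunc[OF T] unfolding trunc_def by (simp add: 1)
    qed
    show "((\<lambda>F. cinner (T (trunc F \<xi>)) \<eta>) \<longlongrightarrow> cinner \<xi> (S \<eta>)) (finite_subsets_at_top UNIV)"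
      unfolding e by (rule bounded_linear.tendsto[OF cl(2) trunc_tendsto])
  qed simp
  then show thesis by (rule that)
qed

text \<open>Existence comes from \<open>adjoint_exists\<close>, uniqueness from testing on basis
  vectors; together they resolve the definite description in \<open>op_adj\<close>.\<close>

lemma op_adj_eq:
  fixes T :: "'a op"
  assumes "complex_linear T"
  shows "cinner (T \<xi>) \<eta> = cinner \<xi> (op_adj T \<eta>)"
proof -
  obtain S :: "'a op" where S: "\<And>\<xi> \<eta>. cinner (T \<xi>) \<eta> = cinner \<xi> (S \<eta>)"
    using adjoint_exists[OF assms] by blast
  have "op_adj T = S" unfolding op_adj_def
  proof (rule the_equality)
    fix S' :: "'a op" assume S': "\<forall>\<xi> \<eta>. cinner (T \<xi>) \<eta> = cinner \<xi> (S' \<eta>)"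
    have "cnj (ell2_apply (S' \<eta>) x) = cnj (ell2_apply (S \<eta>) x)" for \<eta> x
      using S'[rule_format, of "ket x" \<eta>] S[of "ket x" \<eta>] by (simp add: cinner_ket_left)
    then show "S' = S" by (intro blinfun_eqI ell2_eqI) simp
  qed (use S in blast)
  with S show ?thesis by simp
qed

lemma coef_op_adj: "complex_linear T \<Longrightarrow> coef (op_adj T) y x = cnj (coef T x y)"
  using op_adj_eq[of T "ket y" "ket x"] by (simp add: coef_def cinner_ket_left cinner_ket_right)

lemma complex_linear_op_adj:
  assumes T: "complex_linear T"
  shows "complex_linear (op_adj T)"
  unfolding complex_linear_def
proof (intro allI ell2_eqI)
  fix c \<xi> x
  have "cnj (ell2_apply (op_adj T (scaleC c \<xi>)) x) = cnj (ell2_apply (scaleC c (op_adj T \<xi>)) x)"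
    using op_adj_eq[OF T, of "ket x" "scaleC c \<xi>"] op_adj_eq[OF T, of "ket x" \<xi>]
    by (simp add: cinner_ket_left cinner_simps_right)
  then show "ell2_apply (op_adj T (scaleC c \<xi>)) x = ell2_apply (scaleC c (op_adj T \<xi>)) x"
    by (simp only: complex_cnj_cancel_iff)
qed


subsection \<open>Amplifications\<close>

text \<open>An injective \<open>h\<close> identifies the square-summable functions supported on the
  image of \<open>Y \<times> Z\<close> with the Hilbert tensor product of those on Y and on Z. All
  other indices are treated by extension by 0.\<close>

locale product_coordinates =
  fixes Y :: "'a set" and Z :: "'z set" and h :: "'a \<times> 'z \<Rightarrow> 'b"
  assumes inj: "inj_on h (Y \<times> Z)"
begin

lemma h_eq_iff [simp]:
  "y \<in> Y \<Longrightarrow> y' \<in> Y \<Longrightarrow> z \<in> Z \<Longrightarrow> z' \<in> Z \<Longrightarrow> h (y, z) = h (y', z') \<longleftrightarrow> y = y' \<and> z = z'"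
  using inj by (auto simp: inj_on_def)

lemma slice_bound:
  assumes "finite B" "B \<subseteq> Z" "finite A"
  shows "(\<Sum>y\<in>A. \<Sum>z\<in>B. (cmod (if y \<in> Y then ell2_apply \<xi> (h (y, z)) else 0))\<^sup>2) \<le> (norm \<xi>)\<^sup>2"
proof -
  have "(\<Sum>y\<in>A. \<Sum>z\<in>B. (cmod (if y \<in> Y then ell2_apply \<xi> (h (y, z)) else 0))\<^sup>2)
     = (\<Sum>y\<in>A \<inter> Y. \<Sum>z\<in>B. (cmod (ell2_apply \<xi> (h (y, z))))\<^sup>2)"
    using assms by (intro sum.mono_neutral_cong_right) auto
  also have "\<dots> = (\<Sum>x\<in>(A \<inter> Y) \<times> B. (cmod (ell2_apply \<xi> (h x)))\<^sup>2)"
    using assms by (subst sum.cartesian_product) (simp add: case_prod_unfold)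
  also have "\<dots> = (\<Sum>w\<in>h ` ((A \<inter> Y) \<times> B). (cmod (ell2_apply \<xi> w))\<^sup>2)"
    using assms by (subst sum.reindex) (auto intro!: inj_on_subset[OF inj])
  also have "\<dots> \<le> (norm \<xi>)\<^sup>2"
    using assms by (intro sum_cmod_le_norm_ell2) auto
  finally show ?thesis .
qed

text \<open>In tensor notation this is the identity on Y tensored with the functional that reads off
  the coordinate z.\<close>

definition slice :: "'z \<Rightarrow> 'b ell2 \<Rightarrow>\<^sub>L 'a ell2" where
  "slice z = (SOME R :: 'b ell2 \<Rightarrow>\<^sub>L 'a ell2. \<forall>\<xi> y. ell2_apply (R \<xi>) y = (if y \<in> Y then ell2_apply \<xi> (h (y, z)) else 0))"

lemma slice_apply:
  assumes "z \<in> Z"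
  shows "ell2_apply (slice z \<xi>) y = (if y \<in> Y then ell2_apply \<xi> (h (y, z)) else 0)"
proof -
  obtain R :: "'b ell2 \<Rightarrow>\<^sub>L 'a ell2" where
    "\<And>\<xi>. ell2_apply (R \<xi>) = (\<lambda>y. if y \<in> Y then ell2_apply \<xi> (h (y, z)) else 0)"
    by (rule blinfun_ell2_exists[of "\<lambda>\<xi> y. if y \<in> Y then ell2_apply \<xi> (h (y, z)) else 0" 1])
       (use slice_bound[of "{z}"] assms in auto)
  then have "\<exists>R :: 'b ell2 \<Rightarrow>\<^sub>L 'a ell2. \<forall>\<xi> y.
      ell2_apply (R \<xi>) y = (if y \<in> Y then ell2_apply \<xi> (h (y, z)) else 0)"
    by metis
  from someI_ex[OF this] show ?thesis unfolding slice_def by blast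
qed

text \<open>Slices over different z use disjoint sets of coordinates of \<xi>, so their squared
  norms add up to at most that of \<xi>.\<close>

lemma sum_norm_slice:
  assumes B: "finite B" "B \<subseteq> Z"
  shows "(\<Sum>z\<in>B. (norm (slice z \<xi>))\<^sup>2) \<le> (norm \<xi>)\<^sup>2"
proof -
  let ?f = "\<lambda>z y. (cmod (ell2_apply (slice z \<xi>) y))\<^sup>2"
  have "((\<lambda>y. \<Sum>z\<in>B. ?f z y) has_sum (\<Sum>z\<in>B. infsum (?f z) UNIV)) UNIV"
    using B(1) by (induction B) (auto intro!: has_sum_add has_sum_infsum ell2_summable)
  then have "(\<Sum>z\<in>B. (norm (slice z \<xi>))\<^sup>2) = (\<Sum>\<^sub>\<infinity>y. \<Sum>z\<in>B. ?f z y)"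
    and s: "(\<lambda>y. \<Sum>z\<in>B. ?f z y) summable_on UNIV"
    by (simp_all add: norm_ell2_sq infsumI has_sum_imp_summable)
  then have eq: "(\<Sum>z\<in>B. (norm (slice z \<xi>))\<^sup>2) = (\<Sum>\<^sub>\<infinity>y. \<Sum>z\<in>B. ?f z y)" by simp
  show ?thesis unfolding eq
  proof (rule infsum_le_finite_sums[OF s])
    fix A :: "'a set" assume "finite A"
    from slice_bound[OF B this, of \<xi>]
    show "(\<Sum>y\<in>A. \<Sum>z\<in>B. ?f z y) \<le> (norm \<xi>)\<^sup>2"
      using B by (simp add: slice_apply subset_iff)
  qed
qed

text \<open>The operator \<open>T \<otimes> 1\<close> in the coordinates \<open>h\<close>.\<close>

definition amp :: "'a op \<Rightarrow> 'b op" where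
  "amp T = (SOME A :: 'b op. \<forall>\<xi> w. ell2_apply (A \<xi>) w = (if w \<in> h ` (Y \<times> Z)
     then let x = inv_into (Y \<times> Z) h w in ell2_apply (T (slice (snd x) \<xi>)) (fst x) else 0))"

lemma amp_exists:
  fixes T :: "'a op"
  obtains A :: "'b op" where "norm A \<le> norm T"
    "\<And>\<xi> w. ell2_apply (A \<xi>) w = (if w \<in> h ` (Y \<times> Z)
       then let x = inv_into (Y \<times> Z) h w in ell2_apply (T (slice (snd x) \<xi>)) (fst x) else 0)"
proof -
  let ?i = "inv_into (Y \<times> Z) h"
  let ?g = "\<lambda>\<xi> w. if w \<in> h ` (Y \<times> Z)
     then let x = ?i w in ell2_apply (T (slice (snd x) \<xi>)) (fst x) else 0"
  have bound: "(\<Sum>w\<in>F. (cmod (?g \<xi> w))\<^sup>2) \<le> (norm T * norm \<xi>)\<^sup>2" if F: "finite F" for \<xi> F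
  proof -
    \<comment> \<open>The finitely many indices are enclosed in a rectangle
      \<open>?A \<times> ?B\<close>; over it the sum splits into slices, on each of which T is
      applied separately.\<close>
    let ?D = "?i ` (F \<inter> h ` (Y \<times> Z))"
    let ?A = "fst ` ?D" and ?B = "snd ` ?D"
    have fin: "finite ?A" "finite ?B" using F by auto
    have inY: "x \<in> Y \<times> Z" if "x \<in> ?D" for x using that by (auto intro: inv_into_into simp del: mem_Sigma_iff)
    have BZ: "?B \<subseteq> Z"
    proof
      fix z assume "z \<in> ?B"
      then obtain x where "x \<in> ?D" "z = snd x" by blast
      with inY[of x] show "z \<in> Z" by (simp add: mem_Times_iff)
    qed
    have "(\<Sum>w\<in>F. (cmod (?g \<xi> w))\<^sup>2)
        = (\<Sum>w\<in>F \<inter> h ` (Y \<times> Z). (cmod (ell2_apply (T (slice (snd (?i w)) \<xi>)) (fst (?i w))))\<^sup>2)"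
      using F by (intro sum.mono_neutral_cong_right) (auto simp: Let_def)
    also have "\<dots> = (\<Sum>x\<in>?D. (cmod (ell2_apply (T (slice (snd x) \<xi>)) (fst x)))\<^sup>2)"
      by (subst sum.reindex) (auto intro: inj_on_subset[OF inj_on_inv_into[OF subset_refl]] simp: o_def)
    also have "\<dots> \<le> (\<Sum>x\<in>?A \<times> ?B. (cmod (ell2_apply (T (slice (snd x) \<xi>)) (fst x)))\<^sup>2)"
      using fin by (intro sum_mono2 finite_cartesian_product subset_fst_snd zero_le_power2)
    also have "\<dots> = (\<Sum>z\<in>?B. \<Sum>y\<in>?A. (cmod (ell2_apply (T (slice z \<xi>)) y))\<^sup>2)"
      by (subst sum.swap) (simp add: sum.cartesian_product case_prod_unfold)
    also have "\<dots> \<le> (\<Sum>z\<in>?B. (norm (T (slice z \<xi>)))\<^sup>2)"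
      using fin by (intro sum_mono sum_cmod_le_norm_ell2)
    also have "\<dots> \<le> (\<Sum>z\<in>?B. (norm T * norm (slice z \<xi>))\<^sup>2)"
      by (intro sum_mono power_mono norm_blinfun norm_ge_zero)
    also have "\<dots> = (norm T)\<^sup>2 * (\<Sum>z\<in>?B. (norm (slice z \<xi>))\<^sup>2)"
      by (simp add: power_mult_distrib sum_distrib_left)
    also have "\<dots> \<le> (norm T * norm \<xi>)\<^sup>2"
      unfolding power_mult_distrib by (intro mult_left_mono sum_norm_slice fin BZ) simp
    finally show ?thesis .
  qed
  obtain A :: "'b op" where "\<And>\<xi>. ell2_apply (A \<xi>) = ?g \<xi>" "norm A \<le> norm T"
    by (rule blinfun_ell2_exists[of ?g "norm T"])
       (use bound in \<open>auto simp: Let_def blinfun.add_right blinfun.scaleR_right\<close>)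
  then show thesis by (intro that) auto
qed

lemma amp_apply: "ell2_apply (amp T \<xi>) w = (if w \<in> h ` (Y \<times> Z)
     then let x = inv_into (Y \<times> Z) h w in ell2_apply (T (slice (snd x) \<xi>)) (fst x) else 0)"
proof -
  have "\<exists>A :: 'b op. \<forall>\<xi> w. ell2_apply (A \<xi>) w = (if w \<in> h ` (Y \<times> Z)
     then let x = inv_into (Y \<times> Z) h w in ell2_apply (T (slice (snd x) \<xi>)) (fst x) else 0)"
  proof -
    obtain A :: "'b op" where "\<And>\<xi> w. ell2_apply (A \<xi>) w = (if w \<in> h ` (Y \<times> Z)
       then let x = inv_into (Y \<times> Z) h w in ell2_apply (T (slice (snd x) \<xi>)) (fst x) else 0)"
      using amp_exists[of T] by metis
    then show ?thesis by blast
  qed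
  from someI_ex[OF this] show ?thesis unfolding amp_def by blast
qed

lemma amp_apply_h:
  "y \<in> Y \<Longrightarrow> z \<in> Z \<Longrightarrow> ell2_apply (amp T \<xi>) (h (y, z)) = ell2_apply (T (slice z \<xi>)) y"
  by (simp add: amp_apply inv_into_f_f[OF inj] Let_def)

lemma norm_amp_le: "norm (amp T) \<le> norm T"
proof -
  obtain A :: "'b op" where A: "norm A \<le> norm T"
    "\<And>\<xi> w. ell2_apply (A \<xi>) w = (if w \<in> h ` (Y \<times> Z)
       then let x = inv_into (Y \<times> Z) h w in ell2_apply (T (slice (snd x) \<xi>)) (fst x) else 0)"
    using amp_exists[of T] by metis
  have "amp T = A" by (intro blinfun_eqI ell2_eqI) (simp only: amp_apply A)
  with A show ?thesis by simp
qed

lemma amp_add: "amp (S + T) = amp S + amp T"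
  by (intro blinfun_eqI ell2_eqI) (simp add: amp_apply blinfun.add_left Let_def)

lemma amp_scaleR: "amp (r *\<^sub>R T) = r *\<^sub>R amp T"
  by (intro blinfun_eqI ell2_eqI) (simp add: amp_apply blinfun.scaleR_left Let_def)

lemma amp_op_scale: "amp (op_scale c T) = op_scale c (amp T)"
  by (intro blinfun_eqI ell2_eqI) (simp add: amp_apply Let_def)

lemma bounded_linear_amp: "bounded_linear amp"
  by (rule bounded_linear_intro[where K = 1]) (simp_all add: amp_add amp_scaleR norm_amp_le)

lemma complex_linear_amp: "complex_linear T \<Longrightarrow> complex_linear (amp T)"
proof -
  assume T: "complex_linear T"
  have "slice z (scaleC c \<xi>) = scaleC c (slice z \<xi>)" if "z \<in> Z" for z c \<xi>
    by (rule ell2_eqI) (simp add: slice_apply that)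
  moreover have "snd (inv_into (Y \<times> Z) h w) \<in> Z" if "w \<in> h ` (Y \<times> Z)" for w
    using inv_into_into[OF that] by (simp add: mem_Times_iff)
  ultimately show ?thesis using T
    by (auto intro!: ell2_eqI simp: complex_linear_def amp_apply Let_def)
qed

text \<open>\<open>amp\<close> sees only the block of T on Y. Vanishing outside this block is what
  makes \<open>amp\<close> multiplicative and injective.\<close>

definition supported :: "'a op \<Rightarrow> bool" where
  "supported T \<longleftrightarrow> complex_linear T \<and> (\<forall>x y. x \<notin> Y \<or> y \<notin> Y \<longrightarrow> coef T y x = 0)"

lemma supported_range:
  assumes "supported T" "y \<notin> Y"
  shows "ell2_apply (T \<xi>) y = 0"
proof -
  have "((\<lambda>x :: 'a. 0) has_sum ell2_apply (T \<xi>) y) UNIV"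
    using has_sum_coef[of T y \<xi>] assms unfolding supported_def by auto
  then show ?thesis using infsumI by fastforce
qed

lemma amp_compose:
  assumes "supported T"
  shows "amp (S o\<^sub>L T) = amp S o\<^sub>L amp T"
proof (intro blinfun_eqI ell2_eqI)
  fix \<xi> w
  have *: "slice z (amp T \<xi>) = T (slice z \<xi>)" if "z \<in> Z" for z
    by (rule ell2_eqI) (simp add: slice_apply that amp_apply_h supported_range[OF assms])
  have "snd (inv_into (Y \<times> Z) h w) \<in> Z" if "w \<in> h ` (Y \<times> Z)" for w
    using inv_into_into[OF that] by (simp add: mem_Times_iff)
  then show "ell2_apply (amp (S o\<^sub>L T) \<xi>) w = ell2_apply ((amp S o\<^sub>L amp T) \<xi>) w"
    by (simp add: amp_apply[where w = w] * Let_def)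
qed

lemma slice_ket:
  assumes "y \<in> Y" "z \<in> Z" "z' \<in> Z"
  shows "slice z' (ket (h (y, z))) = (if z' = z then ket y else 0)"
  by (rule ell2_eqI) (use assms in \<open>auto simp: slice_apply ell2_apply_ket\<close>)

lemma slice_ket_outside:
  assumes "w \<notin> h ` (Y \<times> Z)" "z' \<in> Z"
  shows "slice z' (ket w) = 0"
  by (rule ell2_eqI) (use assms in \<open>auto simp: slice_apply ell2_apply_ket\<close>)

lemma coef_amp:
  "y \<in> Y \<Longrightarrow> y' \<in> Y \<Longrightarrow> z \<in> Z \<Longrightarrow> z' \<in> Z \<Longrightarrow>
     coef (amp T) (h (y', z')) (h (y, z)) = (if z' = z then coef T y' y else 0)"
  by (simp add: coef_def amp_apply_h slice_ket)

lemma coef_amp_outside: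
  assumes "v \<notin> h ` (Y \<times> Z) \<or> w \<notin> h ` (Y \<times> Z)"
  shows "coef (amp T) w v = 0"
proof -
  have "snd (inv_into (Y \<times> Z) h w) \<in> Z" if "w \<in> h ` (Y \<times> Z)"
    using inv_into_into[OF that] by (simp add: mem_Times_iff)
  then show ?thesis using assms
    by (auto simp: coef_def amp_apply slice_ket_outside Let_def)
qed

lemma amp_op_adj:
  assumes T: "complex_linear T"
  shows "amp (op_adj T) = op_adj (amp T)"
proof (rule complex_linear_coef_eqI)
  fix v w
  show "coef (amp (op_adj T)) w v = coef (op_adj (amp T)) w v"
  proof (cases "v \<in> h ` (Y \<times> Z) \<and> w \<in> h ` (Y \<times> Z)")
    case True
    then obtain y z y' z' where "v = h (y, z)" "w = h (y', z')" "y \<in> Y" "z \<in> Z" "y' \<in> Y" "z' \<in> Z"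
      by auto
    then show ?thesis using T
      by (simp add: coef_op_adj complex_linear_amp coef_amp del: h_eq_iff)
  qed (use T in \<open>auto simp: coef_op_adj complex_linear_amp coef_amp_outside\<close>)
qed (simp_all add: T complex_linear_amp complex_linear_op_adj)

text \<open>Compression to the slice over a point of \<open>Z\<close> is a continuous left inverse of \<open>amp\<close>.\<close>

lemma amp_left_inverse:
  assumes z: "z \<in> Z"
  obtains \<psi> :: "'b op \<Rightarrow> 'a op" where "bounded_linear \<psi>" "\<And>T. supported T \<Longrightarrow> \<psi> (amp T) = T"
proof -
  let ?i = "inv_into (Y \<times> Z) h"
  let ?g = "\<lambda>\<xi> w. if w \<in> h ` (Y \<times> {z}) then ell2_apply \<xi> (fst (?i w)) else 0"
  have bound: "(\<Sum>w\<in>F. (cmod (?g \<xi> w))\<^sup>2) \<le> (1 * norm \<xi>)\<^sup>2" if F: "finite F" for \<xi> F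
  proof -
    have inj2: "inj_on (\<lambda>w. fst (?i w)) (F \<inter> h ` (Y \<times> {z}))"
    proof (rule inj_onI)
      fix w w' assume "w \<in> F \<inter> h ` (Y \<times> {z})" "w' \<in> F \<inter> h ` (Y \<times> {z})" "fst (?i w) = fst (?i w')"
      then show "w = w'" using z by (auto simp: inv_into_f_f[OF inj])
    qed
    have "(\<Sum>w\<in>F. (cmod (?g \<xi> w))\<^sup>2) = (\<Sum>w\<in>F \<inter> h ` (Y \<times> {z}). (cmod (ell2_apply \<xi> (fst (?i w))))\<^sup>2)"
      using F by (intro sum.mono_neutral_cong_right) auto
    also have "\<dots> = (\<Sum>y\<in>(\<lambda>w. fst (?i w)) ` (F \<inter> h ` (Y \<times> {z})). (cmod (ell2_apply \<xi> y))\<^sup>2)"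
      by (subst sum.reindex[OF inj2]) (simp add: o_def)
    also have "\<dots> \<le> (norm \<xi>)\<^sup>2"
      using F by (intro sum_cmod_le_norm_ell2) auto
    finally show ?thesis by simp
  qed
  obtain E :: "'a ell2 \<Rightarrow>\<^sub>L 'b ell2" where E: "\<And>\<xi>. ell2_apply (E \<xi>) = ?g \<xi>"
    by (rule blinfun_ell2_exists[of ?g 1]) (use bound in auto)
  let ?\<psi> = "\<lambda>S :: 'b op. (slice z o\<^sub>L S) o\<^sub>L E"
  have lin: "bounded_linear ?\<psi>"
    by (intro bounded_linear_compose[OF bounded_bilinear.bounded_linear_left[OF bounded_bilinear_blinfun_compose]]
        bounded_bilinear.bounded_linear_right[OF bounded_bilinear_blinfun_compose])
  have Ek: "E (ket x) = (if x \<in> Y then ket (h (x, z)) else 0)" for x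
    by (rule ell2_eqI) (use z in \<open>auto simp: E ell2_apply_ket inv_into_f_f[OF inj]\<close>)
  have cE: "complex_linear E"
    by (auto simp: complex_linear_def E intro!: ell2_eqI)
  have inverse: "?\<psi> (amp T) = T" if T: "supported T" for T
  proof (rule complex_linear_coef_eqI)
    show "complex_linear T" using T by (simp add: supported_def)
    then have "complex_linear (amp T)" by (rule complex_linear_amp)
    moreover have "complex_linear (slice z)"
      by (auto simp: complex_linear_def slice_apply z intro!: ell2_eqI)
    ultimately show "complex_linear (?\<psi> (amp T))"
      using cE by (simp add: complex_linear_def)
    show "coef (?\<psi> (amp T)) y x = coef T y x" for x y
      using T z by (auto simp: coef_def Ek supported_def slice_apply amp_apply_h slice_ket)
  qed
  show thesis by (rule that[OF lin inverse])
qed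

end

section \<open>Hecke algebras of groups with a family of local subgroups\<close>

text \<open>A Schur test: Cauchy-Schwarz in each row, which has at most R entries bounded by M, and
  the fact that each coordinate of \<xi> occurs in at most R rows give the operator bound
  \<open>real R * M\<close>.\<close>

lemma kernel_operator_exists:
  fixes k :: "'a \<Rightarrow> 'a \<Rightarrow> complex"
  assumes M: "\<And>y x. cmod (k y x) \<le> M"
    and rows: "\<And>y. finite {x. k y x \<noteq> 0} \<and> card {x. k y x \<noteq> 0} \<le> R"
    and cols: "\<And>x. finite {y. k y x \<noteq> 0} \<and> card {y. k y x \<noteq> 0} \<le> R"
  shows "\<exists>T :: 'a op. \<forall>\<xi> y. ell2_apply (T \<xi>) y = (\<Sum>x | k y x \<noteq> 0. k y x * ell2_apply \<xi> x)"
proof -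
  let ?N = "\<lambda>y. {x. k y x \<noteq> 0}"
  let ?g = "\<lambda>\<xi> y. \<Sum>x\<in>?N y. k y x * ell2_apply \<xi> x"
  have M0: "M \<ge> 0" using M[of undefined undefined] norm_ge_zero order_trans by blast
  have bound: "(\<Sum>y\<in>F. (cmod (?g \<xi> y))\<^sup>2) \<le> ((real R * M) * norm \<xi>)\<^sup>2" if F: "finite F" for \<xi> F
  proof -
    have "(cmod (?g \<xi> y))\<^sup>2 \<le> real R * M\<^sup>2 * (\<Sum>x\<in>?N y. (cmod (ell2_apply \<xi> x))\<^sup>2)" for y
    proof -
      have "(cmod (?g \<xi> y))\<^sup>2 \<le> (\<Sum>x\<in>?N y. cmod (k y x * ell2_apply \<xi> x))\<^sup>2"
        by (intro power_mono norm_sum norm_ge_zero)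
      also have "\<dots> \<le> (\<Sum>x\<in>?N y. (cmod (k y x * ell2_apply \<xi> x))\<^sup>2) * real (card (?N y))"
        by (rule sum_squared_le_sum_of_squares)
      also have "\<dots> \<le> (\<Sum>x\<in>?N y. (M * cmod (ell2_apply \<xi> x))\<^sup>2) * real R"
        using rows by (intro mult_mono sum_mono power_mono)
          (auto simp: norm_mult intro!: mult_right_mono M sum_nonneg)
      finally show ?thesis by (simp add: power_mult_distrib sum_distrib_left mult_ac)
    qed
    then have "(\<Sum>y\<in>F. (cmod (?g \<xi> y))\<^sup>2)
        \<le> (\<Sum>y\<in>F. real R * M\<^sup>2 * (\<Sum>x\<in>?N y. (cmod (ell2_apply \<xi> x))\<^sup>2))"
      by (rule sum_mono)
    also have "\<dots> = real R * M\<^sup>2 * (\<Sum>y\<in>F. \<Sum>x\<in>?N y. (cmod (ell2_apply \<xi> x))\<^sup>2)"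
      by (simp add: sum_distrib_left)
    also have "(\<Sum>y\<in>F. \<Sum>x\<in>?N y. (cmod (ell2_apply \<xi> x))\<^sup>2)
        = (\<Sum>y\<in>F. \<Sum>x\<in>(\<Union>y\<in>F. ?N y). if k y x \<noteq> 0 then (cmod (ell2_apply \<xi> x))\<^sup>2 else 0)"
      using F rows by (intro sum.cong refl sum.mono_neutral_cong_left) auto
    also have "\<dots> = (\<Sum>x\<in>(\<Union>y\<in>F. ?N y). \<Sum>y\<in>F. if k y x \<noteq> 0 then (cmod (ell2_apply \<xi> x))\<^sup>2 else 0)"
      by (rule sum.swap)
    also have "\<dots> \<le> (\<Sum>x\<in>(\<Union>y\<in>F. ?N y). real R * (cmod (ell2_apply \<xi> x))\<^sup>2)"
    proof (rule sum_mono)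
      fix x
      have "(\<Sum>y\<in>F. if k y x \<noteq> 0 then (cmod (ell2_apply \<xi> x))\<^sup>2 else 0)
          = real (card (F \<inter> {y. k y x \<noteq> 0})) * (cmod (ell2_apply \<xi> x))\<^sup>2"
        using F by (simp add: sum.If_cases)
      also have "card (F \<inter> {y. k y x \<noteq> 0}) \<le> R"
        using cols[of x] card_mono[of "{y. k y x \<noteq> 0}" "F \<inter> {y. k y x \<noteq> 0}"] by auto
      finally show "(\<Sum>y\<in>F. if k y x \<noteq> 0 then (cmod (ell2_apply \<xi> x))\<^sup>2 else 0)
          \<le> real R * (cmod (ell2_apply \<xi> x))\<^sup>2"
        by (simp add: mult_right_mono)
    qed
    also have "\<dots> \<le> real R * (norm \<xi>)\<^sup>2"
      unfolding sum_distrib_left[symmetric] using F rows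
      by (intro mult_left_mono sum_cmod_le_norm_ell2) auto
    finally have "(\<Sum>y\<in>F. (cmod (?g \<xi> y))\<^sup>2) \<le> real R * M\<^sup>2 * (real R * (norm \<xi>)\<^sup>2)"
      by (simp add: mult_left_mono)
    then show ?thesis by (simp add: power_mult_distrib power2_eq_square mult_ac)
  qed
  obtain T :: "'a op" where "\<And>\<xi>. ell2_apply (T \<xi>) = ?g \<xi>"
    by (rule blinfun_ell2_exists[of ?g "real R * M"])
       (use bound M0 in \<open>auto simp: distrib_left sum.distrib scaleR_sum_right\<close>)
  then show ?thesis by (intro exI[of _ T]) simp
qed

lemma finite_image_factor:
  assumes "finite (g ` A)" "\<And>x y. x \<in> A \<Longrightarrow> y \<in> A \<Longrightarrow> g x = g y \<Longrightarrow> f x = f y"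
  shows "finite (f ` A)"
proof -
  have "f x = f (SOME y. y \<in> A \<and> g y = g x)" if "x \<in> A" for x
    using assms(2) that by (metis (mono_tags, lifting) someI_ex)
  then have "f ` A = (\<lambda>t. f (SOME y. y \<in> A \<and> g y = t)) ` g ` A"
    unfolding image_image by (intro image_cong refl)
  then show ?thesis using assms(1) by simp
qed

lemma (in group) coset_eq_iff:
  assumes "subgroup L G" "x \<in> carrier G" "y \<in> carrier G"
  shows "L #> x = L #> y \<longleftrightarrow> x \<otimes> inv y \<in> L"
proof
  assume "L #> x = L #> y"
  then have "x \<in> L #> y" using rcos_self[OF assms(2,1)] by simp
  then obtain l where "l \<in> L" "x = l \<otimes> y" by (auto simp: r_coset_def)
  then show "x \<otimes> inv y \<in> L" using assms subgroup.mem_carrier by (fastforce simp: m_assoc)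
next
  assume "x \<otimes> inv y \<in> L"
  moreover have "x = (x \<otimes> inv y) \<otimes> y" using assms by (simp add: m_assoc)
  ultimately have "x \<in> L #> y" unfolding r_coset_def by blast
  from repr_independence[OF this assms(3,1)] show "L #> x = L #> y" by simp
qed

text \<open>To be applied with \<open>P\<close>, the set of primes, and the matrices in \<open>P\<close> that are integral at a prime
  together with their inverses.\<close>

locale local_family = group G for G (structure) +
  fixes I :: "'i set" and K :: "'i \<Rightarrow> 'a set"
  assumes subgroup_K: "i \<in> I \<Longrightarrow> subgroup (K i) G"
    and almost_all: "x \<in> carrier G \<Longrightarrow> finite {i \<in> I. x \<notin> K i}"
    and local_decomp: "i \<in> I \<Longrightarrow> x \<in> carrier G \<Longrightarrow>
      \<exists>z\<in>carrier G. (\<forall>j\<in>I - {i}. z \<in> K j) \<and> x \<otimes> inv z \<in> K i"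
    and local_finite: "i \<in> I \<Longrightarrow> x \<in> carrier G \<Longrightarrow> finite ((\<lambda>k. K i #> (x \<otimes> k)) ` K i)"
begin

section \<open>Local components and their gluing\<close>

definition H :: "'a set" where "H = {x \<in> carrier G. \<forall>i\<in>I. x \<in> K i}"

lemma K_closed:
  assumes "i \<in> I"
  shows K_carrier: "x \<in> K i \<Longrightarrow> x \<in> carrier G"
    and K_mult: "x \<in> K i \<Longrightarrow> y \<in> K i \<Longrightarrow> x \<otimes> y \<in> K i"
    and K_inv: "x \<in> K i \<Longrightarrow> inv x \<in> K i"
    and K_one: "\<one> \<in> K i"
  using subgroup.mem_carrier[OF subgroup_K[OF assms]] subgroup.m_closed[OF subgroup_K[OF assms]]
    subgroup.m_inv_closed[OF subgroup_K[OF assms]] subgroup.one_closed[OF subgroup_K[OF assms]]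
  by blast+

lemma subgroup_H: "subgroup H G"
proof (rule subgroupI)
  show "H \<noteq> {}" using K_one by (auto simp: H_def intro!: exI[of _ \<one>])
qed (use K_inv K_mult in \<open>simp_all add: H_def subset_iff\<close>)

lemma H_carrier: "x \<in> H \<Longrightarrow> x \<in> carrier G" by (simp add: H_def)

lemma H_closed:
  shows H_mult: "x \<in> H \<Longrightarrow> y \<in> H \<Longrightarrow> x \<otimes> y \<in> H"
    and H_inv: "x \<in> H \<Longrightarrow> inv x \<in> H"
    and H_one: "\<one> \<in> H"
  using subgroup.m_closed[OF subgroup_H] subgroup.m_inv_closed[OF subgroup_H]
    subgroup.one_closed[OF subgroup_H]
  by blast+

text \<open>The local component of x at i is the coset \<open>K i #> x\<close>; this relation is
  equality of such components. Left multiplication by \<open>K i\<close> does not change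
  them.\<close>

definition same :: "'i \<Rightarrow> 'a \<Rightarrow> 'a \<Rightarrow> bool" where
  "same i x y \<longleftrightarrow> x \<otimes> inv y \<in> K i"

lemma cancel1: "x \<in> carrier G \<Longrightarrow> y \<in> carrier G \<Longrightarrow> z \<in> carrier G \<Longrightarrow>
   (x \<otimes> inv y) \<otimes> (y \<otimes> z) = x \<otimes> z"
  by (simp add: m_assoc) (simp add: m_assoc[symmetric])

lemma cancel2: "x \<in> carrier G \<Longrightarrow> y \<in> carrier G \<Longrightarrow> inv x \<otimes> (x \<otimes> y) = y"
  by (simp add: m_assoc[symmetric])

lemma same_refl: "i \<in> I \<Longrightarrow> x \<in> carrier G \<Longrightarrow> same i x x"
  by (simp add: same_def K_one)

lemma same_sym: "i \<in> I \<Longrightarrow> x \<in> carrier G \<Longrightarrow> y \<in> carrier G \<Longrightarrow> same i x y \<Longrightarrow> same i y x"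
  using K_inv[of i "x \<otimes> inv y"] by (simp add: same_def inv_mult_group)

lemma same_trans:
  "i \<in> I \<Longrightarrow> x \<in> carrier G \<Longrightarrow> y \<in> carrier G \<Longrightarrow> z \<in> carrier G \<Longrightarrow>
    same i x y \<Longrightarrow> same i y z \<Longrightarrow> same i x z"
  using K_mult[of i "x \<otimes> inv y" "y \<otimes> inv z"] by (simp add: same_def cancel1)

lemma same_K: "i \<in> I \<Longrightarrow> x \<in> K i \<Longrightarrow> y \<in> K i \<Longrightarrow> same i x y"
  by (simp add: same_def K_mult K_inv)

lemma same_mult_K: "i \<in> I \<Longrightarrow> x \<in> K i \<Longrightarrow> y \<in> carrier G \<Longrightarrow> same i (x \<otimes> y) y"
  by (simp add: same_def m_assoc K_carrier)

lemma same_all_iff: "x \<in> carrier G \<Longrightarrow> y \<in> carrier G \<Longrightarrow> (\<forall>i\<in>I. same i x y) \<longleftrightarrow> x \<otimes> inv y \<in> H"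
  by (auto simp: H_def same_def)

text \<open>Places are added one at a time. To correct y at a new place i it is multiplied on the
  left by some z from \<open>local_decomp\<close> that agrees with
  \<open>x i \<otimes> inv y\<close> at i and lies in \<open>K j\<close> for all other j, so the
  components already arranged survive.\<close>

lemma glue:
  assumes "finite F" "F \<subseteq> I" "\<And>i. i \<in> F \<Longrightarrow> x i \<in> carrier G"
  shows "\<exists>y\<in>carrier G. (\<forall>i\<in>F. same i y (x i)) \<and> (\<forall>i\<in>I - F. y \<in> K i)"
  using assms
proof (induction F rule: finite_induct)
  case empty
  then show ?case by (intro bexI[of _ \<one>]) (simp_all add: K_one)
next
  case (insert i F)
  have "\<exists>y\<in>carrier G. (\<forall>i\<in>F. same i y (x i)) \<and> (\<forall>i\<in>I - F. y \<in> K i)"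
    by (rule insert.IH) (use insert.prems in auto)
  then obtain y where y: "y \<in> carrier G" "\<And>j. j \<in> F \<Longrightarrow> same j y (x j)" "\<And>j. j \<in> I - F \<Longrightarrow> y \<in> K j"
    by blast
  have i: "i \<in> I" "x i \<in> carrier G" using insert.prems by simp_all
  obtain z where z: "z \<in> carrier G" "\<And>j. j \<in> I - {i} \<Longrightarrow> z \<in> K j" "(x i \<otimes> inv y) \<otimes> inv z \<in> K i"
    using local_decomp[of i "x i \<otimes> inv y"] i y(1) by blast
  have zy: "z \<otimes> y \<in> carrier G" using y(1) z(1) by simp
  have "same i (x i) (z \<otimes> y)"
    using z(1,3) i y(1) by (simp add: same_def inv_mult_group m_assoc)
  then have 1: "same i (z \<otimes> y) (x i)" by (rule same_sym[OF i zy])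
  have 2: "same j (z \<otimes> y) (x j)" if j: "j \<in> F" for j
  proof (rule same_trans[of j "z \<otimes> y" y "x j"])
    have "j \<in> I - {i}" using j insert.hyps insert.prems by blast
    then show "j \<in> I" "same j (z \<otimes> y) y" using z(2) y(1) by (simp_all add: same_mult_K)
  qed (use j insert.prems(2) y(1,2) zy in simp_all)
  have 3: "z \<otimes> y \<in> K j" if "j \<in> I - insert i F" for j
    using that by (intro K_mult z(2) y(3)) simp_all
  from 1 2 3 zy show ?case by blast
qed

text \<open>Together with \<open>same_all_iff\<close> this describes the coset space of H as the
  restricted product of the local coset spaces.\<close>

lemma glue_family:
  assumes "\<And>i. i \<in> I \<Longrightarrow> x i \<in> carrier G" "finite {i \<in> I. x i \<notin> K i}"
  obtains y where "y \<in> carrier G" "\<And>i. i \<in> I \<Longrightarrow> same i y (x i)"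
proof -
  let ?F = "{i \<in> I. x i \<notin> K i}"
  have "\<exists>y\<in>carrier G. (\<forall>i\<in>?F. same i y (x i)) \<and> (\<forall>i\<in>I - ?F. y \<in> K i)"
    by (rule glue) (use assms in auto)
  then obtain y where "y \<in> carrier G" "\<And>i. i \<in> ?F \<Longrightarrow> same i y (x i)" "\<And>i. i \<in> I - ?F \<Longrightarrow> y \<in> K i"
    by auto
  then show thesis by (intro that[of y]) (auto intro: same_K)
qed

section \<open>Local double cosets and the classes they define\<close>

definition lequiv :: "'i \<Rightarrow> 'a \<Rightarrow> 'a \<Rightarrow> bool" where
  "lequiv i x y \<longleftrightarrow> (\<exists>k\<in>K i. \<exists>k'\<in>K i. y = k \<otimes> x \<otimes> k')"

lemma lequiv_refl: "i \<in> I \<Longrightarrow> x \<in> carrier G \<Longrightarrow> lequiv i x x"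
  unfolding lequiv_def by (intro bexI[of _ \<one>]) (simp_all add: K_one)

lemma lequiv_sym:
  assumes "i \<in> I" "x \<in> carrier G" "lequiv i x y"
  shows "lequiv i y x"
proof -
  obtain k k' where k: "k \<in> K i" "k' \<in> K i" "y = k \<otimes> x \<otimes> k'" using assms by (auto simp: lequiv_def)
  have "x = inv k \<otimes> y \<otimes> inv k'"
    using k assms by (simp add: K_carrier[OF assms(1)] m_assoc cancel2)
  then show ?thesis using k assms by (auto simp: lequiv_def intro: K_inv)
qed

lemma lequiv_trans:
  assumes "i \<in> I" "x \<in> carrier G" "lequiv i x y" "lequiv i y z"
  shows "lequiv i x z"
proof -
  obtain k k' where k: "k \<in> K i" "k' \<in> K i" "y = k \<otimes> x \<otimes> k'" using assms by (auto simp: lequiv_def)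
  obtain l l' where l: "l \<in> K i" "l' \<in> K i" "z = l \<otimes> y \<otimes> l'" using assms by (auto simp: lequiv_def)
  have "z = (l \<otimes> k) \<otimes> x \<otimes> (k' \<otimes> l')"
    using k l assms by (simp add: K_carrier[OF assms(1)] m_assoc)
  then show ?thesis using k l assms by (auto simp: lequiv_def intro: K_mult)
qed

lemma lequiv_K_left: "i \<in> I \<Longrightarrow> x \<in> carrier G \<Longrightarrow> k \<in> K i \<Longrightarrow> lequiv i x (k \<otimes> x)"
  unfolding lequiv_def by (rule bexI[of _ k], rule bexI[of _ \<one>]) (simp_all add: K_one K_carrier)

lemma lequiv_K_right: "i \<in> I \<Longrightarrow> x \<in> carrier G \<Longrightarrow> k \<in> K i \<Longrightarrow> lequiv i x (x \<otimes> k)"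
  unfolding lequiv_def by (rule bexI[of _ \<one>], rule bexI[of _ k]) (simp_all add: K_one K_carrier)

lemma lequiv_K_iff:
  assumes "i \<in> I" "x \<in> carrier G" "lequiv i x y"
  shows "x \<in> K i \<longleftrightarrow> y \<in> K i"
proof -
  have *: "y \<in> K i" if "x \<in> K i" "lequiv i x y" for x y
    using that assms(1) by (auto simp: lequiv_def intro: K_mult)
  from *[of x y] *[of y x] assms lequiv_sym[OF assms] show ?thesis by blast
qed

lemma lequiv_K: "i \<in> I \<Longrightarrow> x \<in> K i \<Longrightarrow> y \<in> K i \<Longrightarrow> lequiv i x y"
  unfolding lequiv_def
  by (rule bexI[of _ "y \<otimes> inv x"], rule bexI[of _ \<one>])
     (simp_all add: K_one K_mult K_inv K_carrier m_assoc)

lemma lequiv_same: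
  assumes i: "i \<in> I" and c: "c \<in> carrier G" "c' \<in> carrier G" "d \<in> carrier G" "d' \<in> carrier G"
    and "same i c c'" "same i d d'"
  shows "lequiv i (c \<otimes> inv d) (c' \<otimes> inv d')"
proof -
  have "c' \<otimes> inv d' = (c' \<otimes> inv c) \<otimes> (c \<otimes> inv d) \<otimes> (d \<otimes> inv d')"
    using c by (simp add: m_assoc cancel2)
  then show ?thesis using assms same_sym[OF i c(1,2)] unfolding lequiv_def same_def by blast
qed

text \<open>A class may contain several double cosets of H; by \<open>finite_cosets_cls\<close> it
  contains only finitely many.\<close>

definition cls :: "'a \<Rightarrow> 'a set" where
  "cls x = {y \<in> carrier G. \<forall>i\<in>I. lequiv i x y}"

lemma cls_refl: "x \<in> carrier G \<Longrightarrow> x \<in> cls x"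
  by (simp add: cls_def lequiv_refl)

lemma cls_sym: "x \<in> carrier G \<Longrightarrow> y \<in> cls x \<Longrightarrow> x \<in> cls y"
  by (auto simp: cls_def intro: lequiv_sym)

lemma cls_trans: "x \<in> carrier G \<Longrightarrow> y \<in> cls x \<Longrightarrow> z \<in> cls y \<Longrightarrow> z \<in> cls x"
  by (auto simp: cls_def intro: lequiv_trans)

lemma cls_eq: "x \<in> carrier G \<Longrightarrow> y \<in> cls x \<Longrightarrow> cls y = cls x"
  using cls_trans[of x y] cls_trans[of y x] cls_sym[of x y] by (auto simp: cls_def)

lemma cls_carrier: "y \<in> cls x \<Longrightarrow> y \<in> carrier G"
  by (simp add: cls_def)

lemma cls_H: "x \<in> carrier G \<Longrightarrow> h \<in> H \<Longrightarrow> k \<in> H \<Longrightarrow> h \<otimes> x \<otimes> k \<in> cls x"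
  unfolding cls_def lequiv_def H_def by auto

lemma cls_one: "cls \<one> = H"
proof -
  have "lequiv i \<one> x \<longleftrightarrow> x \<in> K i" if "i \<in> I" for i x
    using lequiv_K[OF that K_one[OF that]] lequiv_K_iff[OF that one_closed] K_one[OF that] by blast
  then show ?thesis by (auto simp: cls_def H_def)
qed

text \<open>A coset is determined by its local components. Where x lies in \<open>K i\<close> the
  component of y is trivial, and at the finitely many remaining places \<open>local_finite\<close>
  leaves finitely many values.\<close>

lemma finite_cosets_cls:
  assumes x: "x \<in> carrier G"
  shows "finite ((\<lambda>y. H #> y) ` cls x)"
proof (rule finite_image_factor)
  let ?F = "{i \<in> I. x \<notin> K i}"
  let ?g = "\<lambda>y. restrict (\<lambda>i. K i #> y) ?F"
  have "K i #> y \<in> (\<lambda>k. K i #> (x \<otimes> k)) ` K i" if y: "y \<in> cls x" and i: "i \<in> I" for y i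
  proof -
    obtain k k' where k: "k \<in> K i" "k' \<in> K i" "y = k \<otimes> x \<otimes> k'"
      using y i by (auto simp: cls_def lequiv_def)
    have "K i #> y = K i #> (x \<otimes> k')"
      using k x i same_mult_K[of i k "x \<otimes> k'"]
      by (subst coset_eq_iff[OF subgroup_K]) (auto simp: K_carrier same_def m_assoc)
    with k show ?thesis by blast
  qed
  then have "?g ` cls x \<subseteq> Pi\<^sub>E ?F (\<lambda>i. (\<lambda>k. K i #> (x \<otimes> k)) ` K i)"
    by (intro image_subsetI restrict_PiE_iff[THEN iffD2]) blast
  moreover have "finite (Pi\<^sub>E ?F (\<lambda>i. (\<lambda>k. K i #> (x \<otimes> k)) ` K i))"
    using almost_all[OF x] local_finite[OF _ x] by (intro finite_PiE) auto
  ultimately show "finite (?g ` cls x)" by (rule finite_subset)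
  fix y y' assume y: "y \<in> cls x" "y' \<in> cls x" and eq: "?g y = ?g y'"
  have "same i y y'" if i: "i \<in> I" for i
  proof (cases "x \<in> K i")
    case True
    then have "y \<in> K i" "y' \<in> K i" using y i lequiv_K_iff[OF i x] by (auto simp: cls_def)
    then show ?thesis using i by (rule same_K[rotated])
  next
    case False
    then have "K i #> y = K i #> y'" using fun_cong[OF eq, of i] i by simp
    then show ?thesis using coset_eq_iff[OF subgroup_K[OF i]] y by (simp add: same_def cls_carrier)
  qed
  then show "H #> y = H #> y'"
    using same_all_iff[of y y'] coset_eq_iff[OF subgroup_H, of y y'] y by (simp add: cls_carrier)
qed

subsection \<open>The regular representation\<close>

abbreviation "Y \<equiv> rcosets H"

text \<open>The same choice of representatives as in \<open>hecke_rep\<close>, so that its defining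
  formula can be rewritten with \<open>rep\<close>.\<close>

definition rep :: "'a set \<Rightarrow> 'a" where "rep C = (SOME x. x \<in> C)"

lemma rep_coset: "x \<in> carrier G \<Longrightarrow> \<exists>h\<in>H. rep (H #> x) = h \<otimes> x"
proof -
  assume x: "x \<in> carrier G"
  have "rep (H #> x) \<in> H #> x" unfolding rep_def
    by (rule someI[of _ x]) (rule rcos_self[OF x subgroup_H])
  then show ?thesis by (auto simp: r_coset_def)
qed

lemma coset_in_Y: "x \<in> carrier G \<Longrightarrow> H #> x \<in> Y"
  by (auto simp: RCOSETS_def)

lemma Y_cases:
  assumes "C \<in> Y"
  shows rep_carrier: "rep C \<in> carrier G" and coset_rep: "H #> rep C = C"
proof -
  obtain x where x: "x \<in> carrier G" "C = H #> x" using assms by (auto simp: RCOSETS_def)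
  obtain h where h: "h \<in> H" "rep C = h \<otimes> x" using rep_coset x by auto
  show "rep C \<in> carrier G" using h x by (simp add: H_carrier)
  show "H #> rep C = C" unfolding h(2) x(2)
    using h x by (subst coset_eq_iff[OF subgroup_H]) (auto simp: H_carrier m_assoc)
qed

lemma same_rep_coset: "i \<in> I \<Longrightarrow> x \<in> carrier G \<Longrightarrow> same i (rep (H #> x)) x"
  using rep_coset[of x] same_mult_K[of i _ x] by (auto simp: H_def)

lemma H_in_Y: "H \<in> Y"
  using coset_in_Y[of \<one>] by (simp add: coset_mult_one subgroup.subset[OF subgroup_H])

lemma rep_H: "rep H \<in> H"
  unfolding rep_def by (rule someI[of _ \<one>]) (rule H_one)

lemma Y_eqI:
  assumes "C \<in> Y" "D \<in> Y" "\<And>i. i \<in> I \<Longrightarrow> same i (rep C) (rep D)"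
  shows "C = D"
proof -
  have "H #> rep C = H #> rep D"
    using assms same_all_iff[of "rep C" "rep D"] by (subst coset_eq_iff[OF subgroup_H]) (auto simp: rep_carrier)
  then show ?thesis using assms by (simp add: coset_rep)
qed

definition support :: "('a \<Rightarrow> complex) \<Rightarrow> 'a set" where
  "support f = {x \<in> carrier G. f x \<noteq> 0}"

definition biinvariant :: "('a \<Rightarrow> complex) \<Rightarrow> bool" where
  "biinvariant f \<longleftrightarrow> (\<forall>x. x \<notin> carrier G \<longrightarrow> f x = 0) \<and>
     (\<forall>x\<in>carrier G. \<forall>h\<in>H. \<forall>k\<in>H. f (h \<otimes> x \<otimes> k) = f x)"

lemma double_coset: "x \<in> carrier G \<Longrightarrow> (H #> x) <#> H = {h \<otimes> x \<otimes> k | h k. h \<in> H \<and> k \<in> H}"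
  by (auto simp: r_coset_def set_mult_def)

lemma double_coset_cls: "x \<in> carrier G \<Longrightarrow> (H #> x) <#> H \<subseteq> cls x"
  using cls_H by (auto simp: double_coset)

text \<open>A double coset lies in one class and so consists of finitely many right cosets.
  Finiteness can therefore be counted in right cosets, which index the Hilbert space.\<close>

lemma hecke_algebra_iff:
  "f \<in> hecke_algebra G H \<longleftrightarrow> biinvariant f \<and> finite ((\<lambda>x. H #> x) ` support f)"
proof -
  let ?D = "{(H #> x) <#> H | x. x \<in> carrier G \<and> f x \<noteq> 0}"
  have D: "?D = (\<lambda>C. C <#> H) ` (\<lambda>x. H #> x) ` support f"
    by (auto simp: support_def)
  have "finite ((\<lambda>x. H #> x) ` support f)" if fin: "finite ?D"
  proof (rule finite_subset)
    show "(\<lambda>x. H #> x) ` support f \<subseteq> (\<Union>D\<in>?D. (\<lambda>x. H #> x) ` D)"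
    proof (rule image_subsetI)
      fix x assume x: "x \<in> support f"
      have "x \<in> (H #> x) <#> H"
        using x by (subst double_coset) (auto simp: support_def intro!: exI[of _ \<one>] H_one)
      then show "H #> x \<in> (\<Union>D\<in>?D. (\<lambda>x. H #> x) ` D)"
        using x by (auto simp: support_def)
    qed
    show "finite (\<Union>D\<in>?D. (\<lambda>x. H #> x) ` D)"
    proof (rule finite_UN_I[OF fin])
      fix D assume "D \<in> ?D"
      then obtain x where "x \<in> carrier G" "D = (H #> x) <#> H" by auto
      then show "finite ((\<lambda>x. H #> x) ` D)"
        using finite_subset[OF image_mono[OF double_coset_cls] finite_cosets_cls] by simp
    qed
  qed
  then have "finite ?D \<longleftrightarrow> finite ((\<lambda>x. H #> x) ` support f)" unfolding D by blast
  then show ?thesis by (simp add: hecke_algebra_def biinvariant_def)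
qed

lemma biinvariant_coset:
  assumes "biinvariant f" "x \<in> carrier G" "y \<in> carrier G" "H #> x = H #> y"
  shows "f x = f y"
proof -
  have h: "x \<otimes> inv y \<in> H" using assms coset_eq_iff[OF subgroup_H] by simp
  have "f (x \<otimes> inv y \<otimes> y \<otimes> \<one>) = f y" using assms(1,3) h H_one unfolding biinvariant_def by blast
  then show ?thesis using assms by (simp add: m_assoc)
qed

lemma hecke_finite_range:
  assumes "f \<in> hecke_algebra G H"
  shows "finite (range f)"
proof -
  have "finite (f ` support f)"
  proof (rule finite_image_factor[where g = "\<lambda>x. H #> x"])
    show "f x = f y" if "x \<in> support f" "y \<in> support f" "H #> x = H #> y" for x y
      using biinvariant_coset[of f x y] assms that by (simp add: hecke_algebra_iff support_def)
  qed (use assms in \<open>simp add: hecke_algebra_iff\<close>)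
  moreover have "range f \<subseteq> insert 0 (f ` support f)"
    using assms by (auto simp: hecke_algebra_iff biinvariant_def support_def)
  ultimately show ?thesis by (meson finite_insert finite_subset)
qed

text \<open>Inversion turns left factors from H into right ones, so the inverses of the support stay
  in finitely many classes. This bounds the rows of the convolution matrix, as the support itself
  bounds its columns.\<close>

lemma hecke_finite_inv:
  assumes f: "f \<in> hecke_algebra G H"
  shows "finite ((\<lambda>x. H #> inv x) ` support f)"
proof -
  let ?r = "\<lambda>C. rep C"
  have fin: "finite ((\<lambda>x. H #> x) ` support f)" using f by (simp add: hecke_algebra_iff)
  have "(\<lambda>x. H #> inv x) ` support f \<subseteq> (\<Union>C\<in>(\<lambda>x. H #> x) ` support f. (\<lambda>y. H #> y) ` cls (inv (rep C)))"
  proof (rule image_subsetI)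
    fix x assume x: "x \<in> support f"
    then have xG: "x \<in> carrier G" by (simp add: support_def)
    obtain h where h: "h \<in> H" "rep (H #> x) = h \<otimes> x" using rep_coset xG by blast
    have "inv x = \<one> \<otimes> inv (rep (H #> x)) \<otimes> h"
      using h xG by (simp add: inv_mult_group H_carrier m_assoc)
    also have "\<dots> \<in> cls (inv (rep (H #> x)))"
      using h xG by (intro cls_H H_one) (simp_all add: H_carrier)
    finally show "H #> inv x \<in> (\<Union>C\<in>(\<lambda>x. H #> x) ` support f. (\<lambda>y. H #> y) ` cls (inv (rep C)))"
      using x by blast
  qed
  moreover have "finite (\<Union>C\<in>(\<lambda>x. H #> x) ` support f. (\<lambda>y. H #> y) ` cls (inv (rep C)))"
    by (intro finite_UN_I[OF fin] finite_cosets_cls) (auto simp: support_def intro: rep_carrier coset_in_Y)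
  ultimately show ?thesis by (rule finite_subset)
qed

definition kernel :: "('a \<Rightarrow> complex) \<Rightarrow> 'a set \<Rightarrow> 'a set \<Rightarrow> complex" where
  "kernel f C D = (if C \<in> Y \<and> D \<in> Y then f (rep C \<otimes> inv (rep D)) else 0)"

text \<open>The nonzero entries of a column come from the cosets \<open>H #> u\<close>, those of a
  row from the cosets \<open>H #> inv u\<close>, with u in the support. The Schur test then yields
  an operator, and uniqueness resolves the definite description of \<open>hecke_rep\<close>.\<close>

lemma hecke_rep_properties:
  assumes f: "f \<in> hecke_algebra G H"
  shows complex_linear_hecke_rep: "complex_linear (hecke_rep G H f)"
    and coef_hecke_rep: "coef (hecke_rep G H f) C D = kernel f C D"
proof -
  let ?k = "kernel f" and ?N = "(\<lambda>x. H #> inv x) ` support f" and ?N' = "(\<lambda>x. H #> x) ` support f"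
  have fin: "finite ?N" "finite ?N'" using f hecke_finite_inv by (auto simp: hecke_algebra_iff)
  have rows: "{D. ?k C D \<noteq> 0} \<subseteq> (\<lambda>E. E #> rep C) ` ?N" for C
  proof
    fix D assume "D \<in> {D. ?k C D \<noteq> 0}"
    then have *: "C \<in> Y" "D \<in> Y" "f (rep C \<otimes> inv (rep D)) \<noteq> 0" by (auto simp: kernel_def split: if_splits)
    let ?u = "rep C \<otimes> inv (rep D)"
    have "?u \<in> support f" using * by (simp add: support_def rep_carrier)
    moreover have "(H #> inv ?u) #> rep C = D"
      using * by (simp add: rep_carrier coset_mult_assoc subgroup.subset[OF subgroup_H] inv_mult_group
          m_assoc coset_rep)
    ultimately show "D \<in> (\<lambda>E. E #> rep C) ` ?N" by blast
  qed
  have cols: "{C. ?k C D \<noteq> 0} \<subseteq> (\<lambda>E. E #> rep D) ` ?N'" for D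
  proof
    fix C assume "C \<in> {C. ?k C D \<noteq> 0}"
    then have *: "C \<in> Y" "D \<in> Y" "f (rep C \<otimes> inv (rep D)) \<noteq> 0" by (auto simp: kernel_def split: if_splits)
    let ?u = "rep C \<otimes> inv (rep D)"
    have "?u \<in> support f" using * by (simp add: support_def rep_carrier)
    moreover have "(H #> ?u) #> rep D = C"
      using * by (simp add: rep_carrier coset_mult_assoc subgroup.subset[OF subgroup_H] m_assoc coset_rep)
    ultimately show "C \<in> (\<lambda>E. E #> rep D) ` ?N'" by blast
  qed
  define R where "R = max (card ?N) (card ?N')"
  obtain M where M: "\<And>z. cmod (f z) \<le> M"
    using hecke_finite_range[OF f] finite_imp_bounded bounded_iff rangeI by metis
  have "\<exists>T :: 'a set op. \<forall>\<xi> C. ell2_apply (T \<xi>) C = (\<Sum>D | ?k C D \<noteq> 0. ?k C D * ell2_apply \<xi> D)"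
  proof (rule kernel_operator_exists[of ?k M R])
    show "cmod (?k C D) \<le> M" for C D
      using M[of "rep C \<otimes> inv (rep D)"] order_trans[OF norm_ge_zero M]
      by (auto simp: kernel_def)
    show "finite {D. ?k C D \<noteq> 0} \<and> card {D. ?k C D \<noteq> 0} \<le> R" for C
    proof -
      have "finite ((\<lambda>E. E #> rep C) ` ?N)" using fin by simp
      from finite_subset[OF rows this] card_mono[OF this rows] card_image_le[OF fin(1), of "\<lambda>E. E #> rep C"]
      show ?thesis by (simp add: R_def)
    qed
    show "finite {C. ?k C D \<noteq> 0} \<and> card {C. ?k C D \<noteq> 0} \<le> R" for D
    proof -
      have "finite ((\<lambda>E. E #> rep D) ` ?N')" using fin by simp
      from finite_subset[OF cols this] card_mono[OF this cols] card_image_le[OF fin(2), of "\<lambda>E. E #> rep D"]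
      show ?thesis by (simp add: R_def)
    qed
  qed
  then obtain T :: "'a set op"
    where T: "\<And>\<xi> C. ell2_apply (T \<xi>) C = (\<Sum>D | ?k C D \<noteq> 0. ?k C D * ell2_apply \<xi> D)" by blast
  have sum: "(\<Sum>\<^sub>\<infinity>D\<in>Y. f (rep C \<otimes> inv (rep D)) * ell2_apply \<xi> D)
      = (\<Sum>D | ?k C D \<noteq> 0. ?k C D * ell2_apply \<xi> D)" if "C \<in> Y" for \<xi> C
  proof -
    have fr: "finite {D. ?k C D \<noteq> 0}" using rows[of C] fin(1) by (meson finite_imageI finite_subset)
    have "(\<Sum>\<^sub>\<infinity>D\<in>Y. f (rep C \<otimes> inv (rep D)) * ell2_apply \<xi> D)
        = (\<Sum>\<^sub>\<infinity>D\<in>{D. ?k C D \<noteq> 0}. ?k C D * ell2_apply \<xi> D)"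
      by (rule infsum_cong_neutral) (use that in \<open>auto simp: kernel_def split: if_splits\<close>)
    then show ?thesis using fr by simp
  qed
  have "\<forall>\<xi> C. ell2_apply (T \<xi>) C = (if C \<in> Y
      then \<Sum>\<^sub>\<infinity>D\<in>Y. f ((SOME x. x \<in> C) \<otimes> inv (SOME y. y \<in> D)) * ell2_apply \<xi> D else 0)"
    unfolding rep_def[symmetric] by (simp add: T sum) (simp add: kernel_def)
  then have "hecke_rep G H f = T"
    unfolding hecke_rep_def by (intro the_equality) (auto intro!: blinfun_eqI ell2_eqI)
  moreover have "complex_linear T"
    by (auto simp: complex_linear_def T sum_distrib_left mult.left_commute intro!: ell2_eqI)
  moreover have "coef T C D = ?k C D"
    using finite_subset[OF rows] fin(1)
    by (auto simp: coef_def T ell2_apply_ket if_distrib[where f = "\<lambda>x. _ * x"] sum.delta' cong: if_cong)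
  ultimately show "complex_linear (hecke_rep G H f)" "coef (hecke_rep G H f) C D = ?k C D" by auto
qed

end

section \<open>Complex subspaces of operators\<close>

definition complex_subspace :: "'a op set \<Rightarrow> bool" where
  "complex_subspace V \<longleftrightarrow> 0 \<in> V \<and> (\<forall>S\<in>V. \<forall>T\<in>V. S + T \<in> V) \<and> (\<forall>c. \<forall>T\<in>V. op_scale c T \<in> V)"

lemma op_scale_simps:
  "op_scale c (S + T) = op_scale c S + op_scale c T"
  "op_scale c (0 :: 'a op) = 0"
  "op_scale (of_real r) S = r *\<^sub>R S"
  by (intro blinfun_eqI, simp add: blinfun.add_left blinfun.scaleR_left scaleC_simps)+

lemma complex_subspaceD:
  assumes "complex_subspace V"
  shows "0 \<in> V" "S \<in> V \<Longrightarrow> T \<in> V \<Longrightarrow> S + T \<in> V" "T \<in> V \<Longrightarrow> op_scale c T \<in> V"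
    and "subspace V"
  using assms by (auto simp: complex_subspace_def subspace_def op_scale_simps(3)[symmetric])

lemma complex_subspace_closure:
  assumes V: "complex_subspace V"
  shows "complex_subspace (closure V)"
  unfolding complex_subspace_def
proof (intro conjI ballI allI)
  show "0 \<in> closure V" using complex_subspaceD(1)[OF V] closure_subset[of V] by auto
  fix S T assume ST: "S \<in> closure V" "T \<in> closure V"
  obtain s t where st: "\<And>n. s n \<in> V" "s \<longlonglongrightarrow> S" "\<And>n. t n \<in> V" "t \<longlonglongrightarrow> T"
    using ST unfolding closure_sequential by blast
  have "(\<lambda>n. s n + t n) \<longlonglongrightarrow> S + T" by (intro tendsto_add st)
  then show "S + T \<in> closure V"
    using complex_subspaceD(2)[OF V st(1,3)] unfolding closure_sequential
    by (intro exI[of _ "\<lambda>n. s n + t n"] conjI allI)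
next
  fix c T assume T: "T \<in> closure V"
  obtain t where t: "\<And>n. t n \<in> V" "t \<longlonglongrightarrow> T"
    using T unfolding closure_sequential by blast
  have "(\<lambda>n. op_scale c (t n)) \<longlonglongrightarrow> op_scale c T"
    by (rule bounded_linear.tendsto[OF bounded_linear_op_scale t(2)])
  then show "op_scale c T \<in> closure V"
    using complex_subspaceD(3)[OF V t(1)] unfolding closure_sequential
    by (intro exI[of _ "\<lambda>n. op_scale c (t n)"] conjI allI)
qed

lemma complex_span_subset:
  assumes "complex_subspace V" "A \<subseteq> V"
  shows "complex_span A \<subseteq> V"
  unfolding complex_span_def using assms
  by (intro span_minimal) (auto dest: complex_subspaceD)

text \<open>Used to replace one factor inside a product by an arbitrary element of a closed span,
  once the claim is known for generators.\<close>

lemma complex_subspace_compose_vimage: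
  fixes S T :: "'a op"
  assumes "complex_subspace V" "complex_linear S"
  shows "complex_subspace {b. (S o\<^sub>L b) o\<^sub>L T \<in> V}"
proof -
  have "(S o\<^sub>L (a + b)) o\<^sub>L T = ((S o\<^sub>L a) o\<^sub>L T) + ((S o\<^sub>L b) o\<^sub>L T)" for a b :: "'a op"
    by (intro blinfun_eqI) (simp add: blinfun.add_left blinfun.add_right)
  moreover have "(S o\<^sub>L op_scale c a) o\<^sub>L T = op_scale c ((S o\<^sub>L a) o\<^sub>L T)" for c and a :: "'a op"
    using assms(2) by (intro blinfun_eqI) (simp add: complex_linear_def)
  ultimately show ?thesis
    using assms(1) by (auto simp: complex_subspace_def)
qed

lemma closed_compose_vimage:
  fixes S T :: "'a op"
  assumes "closed V"
  shows "closed {b. (S o\<^sub>L b) o\<^sub>L T \<in> V}"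
proof -
  have "continuous_on UNIV (\<lambda>b. (S o\<^sub>L b) o\<^sub>L T)" by (intro continuous_intros)
  from closed_vimage[OF assms this] show ?thesis by (simp add: vimage_def)
qed

lemma elementary_tensors_cong:
  "(\<And>i. i \<in> I \<Longrightarrow> A i = B i) \<Longrightarrow> elementary_tensors I X b A = elementary_tensors I X b B"
  unfolding elementary_tensors_def by (intro Collect_cong ex_cong1) (auto 4 3)

section \<open>The algebra of locally invariant Hecke functions and its local subalgebras\<close>

context local_family
begin

text \<open>For the group P this becomes \<open>P_at p\<close>.\<close>

definition At :: "'i \<Rightarrow> 'a set" where
  "At i = {x \<in> carrier G. \<forall>j\<in>I - {i}. x \<in> K j}"

definition locally_invariant :: "('a \<Rightarrow> complex) set" where
  "locally_invariant = {f \<in> hecke_algebra G H. \<forall>x\<in>carrier G. \<forall>y\<in>cls x. f y = f x}"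

definition e :: "'a \<Rightarrow> 'a \<Rightarrow> complex" where
  "e x y = (if y \<in> cls x then 1 else 0)"

abbreviation E :: "'a \<Rightarrow> 'a set op" where "E x \<equiv> hecke_rep G H (e x)"

text \<open>Defined without reference to symmetries; \<open>fixed_points_CrP\<close> and
  \<open>fixed_points_Afr\<close> later identify \<open>A\<close> and \<open>Aloc p\<close> with the
  fixed point algebras.\<close>

definition A :: "'a set op set" where
  "A = closure (hecke_rep G H ` locally_invariant)"

definition Aloc :: "'i \<Rightarrow> 'a set op set" where
  "Aloc i = closure (hecke_rep G H ` {f \<in> locally_invariant. support f \<subseteq> At i})"

lemma locally_invariant_hecke: "f \<in> locally_invariant \<Longrightarrow> f \<in> hecke_algebra G H"
  by (simp add: locally_invariant_def)

lemma locally_invariant_cls: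
  "f \<in> locally_invariant \<Longrightarrow> x \<in> carrier G \<Longrightarrow> y \<in> cls x \<Longrightarrow> f y = f x"
  by (simp add: locally_invariant_def)

lemma support_e: "support (e x) = cls x"
  by (auto simp: support_def e_def cls_carrier)

lemma e_locally_invariant: "x \<in> carrier G \<Longrightarrow> e x \<in> locally_invariant"
proof -
  assume x: "x \<in> carrier G"
  have inv: "z \<in> cls x \<longleftrightarrow> y \<in> cls x" if "y \<in> carrier G" "z \<in> cls y" for y z
    using cls_trans[of x y z] cls_trans[of x z y] cls_sym[of y z] x that by (auto simp: cls_carrier)
  have "biinvariant (e x)"
    unfolding biinvariant_def using inv[OF _ cls_H] by (auto simp: e_def cls_carrier)
  then show ?thesis
    using inv finite_cosets_cls[OF x]
    by (auto simp: locally_invariant_def hecke_algebra_iff support_e) (auto simp: e_def)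
qed

lemmas e_hecke = locally_invariant_hecke[OF e_locally_invariant]

lemma hecke_algebra_zero: "(\<lambda>x. 0) \<in> hecke_algebra G H"
  by (simp add: hecke_algebra_iff biinvariant_def support_def)

lemma hecke_algebra_add:
  assumes "f \<in> hecke_algebra G H" "g \<in> hecke_algebra G H"
  shows "(\<lambda>x. f x + g x) \<in> hecke_algebra G H"
proof -
  have "(\<lambda>x. H #> x) ` support (\<lambda>x. f x + g x) \<subseteq> (\<lambda>x. H #> x) ` support f \<union> (\<lambda>x. H #> x) ` support g"
    by (auto simp: support_def)
  then show ?thesis
    using assms by (auto simp: hecke_algebra_iff biinvariant_def intro: finite_subset)
qed

lemma hecke_algebra_scale:
  assumes "f \<in> hecke_algebra G H"
  shows "(\<lambda>x. c * f x) \<in> hecke_algebra G H"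
proof -
  have "(\<lambda>x. H #> x) ` support (\<lambda>x. c * f x) \<subseteq> (\<lambda>x. H #> x) ` support f"
    by (auto simp: support_def)
  then show ?thesis
    using assms by (auto simp: hecke_algebra_iff biinvariant_def intro: finite_subset)
qed

lemma hecke_rep_linear:
  assumes "f \<in> hecke_algebra G H"
  shows hecke_rep_add: "g \<in> hecke_algebra G H \<Longrightarrow>
      hecke_rep G H (\<lambda>x. f x + g x) = hecke_rep G H f + hecke_rep G H g"
    and hecke_rep_scale: "hecke_rep G H (\<lambda>x. c * f x) = op_scale c (hecke_rep G H f)"
    and hecke_rep_zero: "hecke_rep G H (\<lambda>x. 0) = 0"
  by (rule complex_linear_coef_eqI;
      simp add: assms complex_linear_hecke_rep hecke_algebra_add hecke_algebra_scale hecke_algebra_zero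
        complex_linear_simps coef_hecke_rep kernel_def)+

lemma complex_subspace_hecke_rep:
  assumes S: "S \<subseteq> hecke_algebra G H" "(\<lambda>x. 0) \<in> S" "\<And>f g. f \<in> S \<Longrightarrow> g \<in> S \<Longrightarrow> (\<lambda>x. f x + g x) \<in> S"
    "\<And>f c. f \<in> S \<Longrightarrow> (\<lambda>x. c * f x) \<in> S"
  shows "complex_subspace (hecke_rep G H ` S)"
  unfolding complex_subspace_def
proof (safe)
  show "0 \<in> hecke_rep G H ` S"
    by (rule image_eqI[OF _ S(2)]) (simp add: hecke_rep_zero[OF hecke_algebra_zero])
next
  fix f g assume "f \<in> S" "g \<in> S"
  then show "hecke_rep G H f + hecke_rep G H g \<in> hecke_rep G H ` S"
    using S(1) by (intro image_eqI[where x = "\<lambda>x. f x + g x"] hecke_rep_add[symmetric] S(3)) auto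
next
  fix c f assume "f \<in> S"
  then show "op_scale c (hecke_rep G H f) \<in> hecke_rep G H ` S"
    using S(1) by (intro image_eqI[where x = "\<lambda>x. c * f x"] hecke_rep_scale[symmetric] S(4)) auto
qed

lemma complex_subspace_A: "complex_subspace A"
  unfolding A_def
  by (intro complex_subspace_closure complex_subspace_hecke_rep)
     (auto simp: locally_invariant_def intro: hecke_algebra_zero hecke_algebra_add hecke_algebra_scale)

text \<open>The support consists of finitely many right cosets and the class of an element depends
  only on its coset, so only finitely many classes occur; R contains one representative of
  each.\<close>

lemma locally_invariant_decomp:
  assumes f: "f \<in> locally_invariant"
  obtains R where "finite R" "R \<subseteq> support f" "hecke_rep G H f = (\<Sum>x\<in>R. op_scale (f x) (E x))"
proof -
  have fH: "f \<in> hecke_algebra G H" using f by (rule locally_invariant_hecke)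
  let ?C = "cls ` support f"
  have finC: "finite ?C"
  proof (rule finite_image_factor[where g = "\<lambda>x. H #> x"])
    show "finite ((\<lambda>x. H #> x) ` support f)" using fH by (simp add: hecke_algebra_iff)
    fix x y assume xy: "x \<in> support f" "y \<in> support f" "H #> x = H #> y"
    then have xyG: "x \<in> carrier G" "y \<in> carrier G" by (auto simp: support_def)
    then have h: "x \<otimes> inv y \<in> H" using xy coset_eq_iff[OF subgroup_H] by simp
    have "x \<otimes> inv y \<otimes> y \<otimes> \<one> \<in> cls y" by (rule cls_H[OF xyG(2) h H_one])
    then have "x \<in> cls y" using xyG by (simp add: m_assoc)
    then show "cls x = cls y" by (rule cls_eq[OF xyG(2)])
  qed
  have "\<forall>c\<in>?C. \<exists>x. x \<in> support f \<and> cls x = c" by blast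
  from bchoice[OF this] obtain r where r: "\<And>c. c \<in> ?C \<Longrightarrow> r c \<in> support f \<and> cls (r c) = c"
    by blast
  let ?R = "r ` ?C"
  have inj: "inj_on cls ?R" using r by (auto simp: inj_on_def)
  have cov: "\<exists>x\<in>?R. y \<in> cls x" if "y \<in> support f" for y
    using r[of "cls y"] that cls_refl[of y] by (auto simp: support_def)
  have R: "?R \<subseteq> support f" using r by auto
  have RG: "x \<in> carrier G" if "x \<in> ?R" for x using R that by (auto simp: support_def)
  have point: "f y = (\<Sum>x\<in>?R. f x * e x y)" if y: "y \<in> carrier G" for y
  proof (cases "y \<in> support f")
    case True
    then obtain x where x: "x \<in> ?R" "y \<in> cls x" using cov by blast
    have "e x' y = (if x' = x then 1 else 0)" if "x' \<in> ?R" for x'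
    proof (cases "y \<in> cls x'")
      case True
      then have "cls x' = cls x" using cls_eq[OF RG[OF that] True] cls_eq[OF RG[OF x(1)] x(2)] by simp
      then have "x' = x" using inj that x(1) by (auto simp: inj_on_def)
      with True show ?thesis by (simp add: e_def)
    qed (use x in \<open>auto simp: e_def\<close>)
    then have "(\<Sum>x'\<in>?R. f x' * e x' y) = (\<Sum>x'\<in>?R. if x' = x then f x else 0)"
      by (intro sum.cong) auto
    also have "\<dots> = f x" using finC x by (subst sum.delta) auto
    also have "\<dots> = f y" using locally_invariant_cls[OF f RG[OF x(1)] x(2)] by simp
    finally show ?thesis by simp
  next
    case False
    have "y \<notin> cls x" if "x \<in> ?R" for x
      using locally_invariant_cls[OF f RG[OF that], of y] R that False y by (auto simp: support_def)
    then show ?thesis using False y by (simp add: e_def support_def)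
  qed
  have "hecke_rep G H f = (\<Sum>x\<in>?R. op_scale (f x) (E x))"
  proof (rule complex_linear_coef_eqI)
    show "complex_linear (\<Sum>x\<in>?R. op_scale (f x) (E x))"
      by (intro complex_linear_sum complex_linear_simps complex_linear_hecke_rep e_hecke RG)
    show "coef (hecke_rep G H f) D C = coef (\<Sum>x\<in>?R. op_scale (f x) (E x)) D C" for C D
      using point[of "rep D \<otimes> inv (rep C)"]
      by (cases "D \<in> Y \<and> C \<in> Y") (auto simp: coef_hecke_rep fH e_hecke RG kernel_def rep_carrier)
  qed (rule complex_linear_hecke_rep[OF fH])
  with finC R show thesis by (intro that[of ?R]) auto
qed

text \<open>The induction principle for the completed algebra: closed complex linear conditions need
  to be checked on the operators \<open>E x\<close> only. \<open>Aloc_subset\<close> is the local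
  version.\<close>

lemma A_subset:
  assumes V: "closed V" "complex_subspace V" and E: "\<And>x. x \<in> carrier G \<Longrightarrow> E x \<in> V"
  shows "A \<subseteq> V"
  unfolding A_def
proof (rule closure_minimal[OF _ V(1)], rule image_subsetI)
  fix f assume "f \<in> locally_invariant"
  then obtain R where R: "finite R" "R \<subseteq> support f" "hecke_rep G H f = (\<Sum>x\<in>R. op_scale (f x) (E x))"
    by (rule locally_invariant_decomp)
  show "hecke_rep G H f \<in> V" unfolding R(3)
    using R(2) E complex_subspaceD[OF V(2)] by (intro subspace_sum) (auto simp: support_def)
qed

lemma Aloc_subset:
  assumes V: "closed V" "complex_subspace V" and E: "\<And>x. x \<in> At i \<Longrightarrow> E x \<in> V"
  shows "Aloc i \<subseteq> V"
  unfolding Aloc_def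
proof (rule closure_minimal[OF _ V(1)], rule image_subsetI)
  fix f assume f: "f \<in> {f \<in> locally_invariant. support f \<subseteq> At i}"
  then have "f \<in> locally_invariant" by simp
  then obtain R where R: "finite R" "R \<subseteq> support f" "hecke_rep G H f = (\<Sum>x\<in>R. op_scale (f x) (E x))"
    by (rule locally_invariant_decomp)
  show "hecke_rep G H f \<in> V" unfolding R(3)
    using R(2) f E complex_subspaceD[OF V(2)] by (intro subspace_sum) auto
qed

lemma At_carrier: "x \<in> At i \<Longrightarrow> x \<in> carrier G"
  by (simp add: At_def)

lemma E_in_Aloc:
  assumes "x \<in> At i"
  shows "E x \<in> Aloc i"
proof -
  have "cls x \<subseteq> At i"
    using lequiv_K_iff[OF _ At_carrier[OF assms]] assms unfolding cls_def At_def by blast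
  then have "e x \<in> {f \<in> locally_invariant. support f \<subseteq> At i}"
    using assms e_locally_invariant[of x] by (simp add: support_e At_carrier)
  then have "E x \<in> hecke_rep G H ` {f \<in> locally_invariant. support f \<subseteq> At i}" by (rule imageI)
  then show ?thesis unfolding Aloc_def by (rule closure_subset[THEN subsetD])
qed

lemma E_in_A: "x \<in> carrier G \<Longrightarrow> E x \<in> A"
  unfolding A_def by (intro closure_subset[THEN subsetD] imageI e_locally_invariant)

lemma closed_A: "closed A" by (simp add: A_def)

lemma Aloc_subset_A: "Aloc i \<subseteq> A"
  by (rule Aloc_subset[OF closed_A complex_subspace_A]) (rule E_in_A[OF At_carrier])

lemma complex_linear_A: "T \<in> A \<Longrightarrow> complex_linear T"
proof -
  have "A \<subseteq> {T. complex_linear T}"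
    by (rule A_subset[OF closed_complex_linear])
       (auto simp: complex_subspace_def complex_linear_simps intro: complex_linear_hecke_rep e_hecke)
  then show "T \<in> A \<Longrightarrow> complex_linear T" by blast
qed

lemma coef_A_outside:
  assumes "T \<in> A" "C \<notin> Y \<or> D \<notin> Y"
  shows "coef T C D = 0"
proof -
  have "A \<subseteq> {T. coef T C D = 0}"
  proof (rule A_subset)
    show "closed {T. coef T C D = 0}"
      by (intro closed_Collect_eq continuous_on_const linear_continuous_on bounded_linear_coef)
  qed (use assms(2) in \<open>auto simp: complex_subspace_def coef_hecke_rep e_hecke kernel_def\<close>)
  then show ?thesis using assms(1) by blast
qed

text \<open>An intermediate coset W between C and D contributes only if it agrees with C wherever y
  is integral and with D wherever u is integral. This fixes all local components of W, so one coset
  at most contributes and the product of two indicators is again an indicator, with coefficient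
  1.\<close>

lemma E_mult:
  assumes y: "y \<in> carrier G" and u: "u \<in> carrier G" and yu: "\<And>i. i \<in> I \<Longrightarrow> y \<in> K i \<or> u \<in> K i"
  shows "E y o\<^sub>L E u = E (y \<otimes> u)"
proof (rule complex_linear_coef_eqI)
  have yuG: "y \<otimes> u \<in> carrier G" using y u by simp
  show lin: "complex_linear (E y o\<^sub>L E u)" "complex_linear (E (y \<otimes> u))"
    by (intro complex_linear_compose complex_linear_hecke_rep e_hecke y u yuG)+
  fix D C
  show "coef (E y o\<^sub>L E u) C D = coef (E (y \<otimes> u)) C D"
  proof (cases "C \<in> Y \<and> D \<in> Y")
    case False
    then have "coef (E y o\<^sub>L E u) C D = coef (E y) C undefined * coef (E u) undefined D"
      by (intro coef_compose_single complex_linear_hecke_rep e_hecke y)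
         (auto simp: coef_hecke_rep e_hecke kernel_def y u)
    also have "\<dots> = coef (E (y \<otimes> u)) C D"
      using False by (auto simp: coef_hecke_rep e_hecke kernel_def y u)
    finally show ?thesis .
  next
    case True
    let ?c = "rep C" and ?d = "rep D"
    have c: "?c \<in> carrier G" "?d \<in> carrier G" using True by (auto intro: rep_carrier)
    \<comment> \<open>The only possible intermediate coset. Where both y and u are integral,
      \<open>?c\<close> is taken; the factor u then tests whether C and D agree there.\<close>
    obtain g where g: "g \<in> carrier G" "\<And>i. i \<in> I \<Longrightarrow> same i g (if y \<in> K i then ?c else ?d)"
    proof (rule glue_family[of "\<lambda>i. if y \<in> K i then ?c else ?d"])
      have "{i \<in> I. (if y \<in> K i then ?c else ?d) \<notin> K i} \<subseteq> {i \<in> I. ?c \<notin> K i} \<union> {i \<in> I. ?d \<notin> K i}"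
        by auto
      then show "finite {i \<in> I. (if y \<in> K i then ?c else ?d) \<notin> K i}"
        by (rule finite_subset) (use almost_all c in auto)
    qed (use c in auto)
    let ?Z = "H #> g"
    have Z: "?Z \<in> Y" using g(1) by (rule coset_in_Y)
    let ?z = "rep ?Z"
    have zG: "?z \<in> carrier G" using Z by (rule rep_carrier)
    have zi: "same i ?z (if y \<in> K i then ?c else ?d)" if i: "i \<in> I" for i
      using same_trans[OF i zG g(1) _ same_rep_coset[OF i g(1)] g(2)[OF i]] c by (cases "y \<in> K i") auto
    have single: "coef (E y) C W * coef (E u) W D = 0" if W: "W \<noteq> ?Z" for W
    proof (rule ccontr)
      assume *: "coef (E y) C W * coef (E u) W D \<noteq> 0"
      then have WY: "W \<in> Y" and 1: "?c \<otimes> inv (rep W) \<in> cls y" and 2: "rep W \<otimes> inv ?d \<in> cls u"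
        by (auto simp: coef_hecke_rep e_hecke y u kernel_def e_def split: if_splits)
      have wG: "rep W \<in> carrier G" using WY by (rule rep_carrier)
      have "same i (rep W) ?z" if i: "i \<in> I" for i
      proof (cases "y \<in> K i")
        case True
        have "lequiv i y (?c \<otimes> inv (rep W))" using 1 i by (simp add: cls_def)
        then have "same i ?c (rep W)" using lequiv_K_iff[OF i y] True by (simp add: same_def)
        with zi[OF i] True have "same i ?z (rep W)" using same_trans[OF i zG c(1) wG] by simp
        then show ?thesis by (rule same_sym[OF i zG wG])
      next
        case False
        have "lequiv i u (rep W \<otimes> inv ?d)" using 2 i by (simp add: cls_def)
        then have "same i (rep W) ?d" using lequiv_K_iff[OF i u] False yu[OF i] by (simp add: same_def)
        moreover have "same i ?d ?z" using zi[OF i] False same_sym[OF i zG c(2)] by simp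
        ultimately show ?thesis using same_trans[OF i wG c(2) zG] by blast
      qed
      then have "W = ?Z" by (rule Y_eqI[OF WY Z])
      with W show False by simp
    qed
    \<comment> \<open>At each place one of the two conditions holds automatically by the choice of
      \<open>?z\<close>, and the other one is the condition for
      \<open>y \<otimes> u\<close>.\<close>
    have key: "lequiv i y (?c \<otimes> inv ?z) \<and> lequiv i u (?z \<otimes> inv ?d) \<longleftrightarrow> lequiv i (y \<otimes> u) (?c \<otimes> inv ?d)"
      if i: "i \<in> I" for i
    proof (cases "y \<in> K i")
      case True
      then have z: "same i ?z ?c" using zi[OF i] by simp
      then have z': "same i ?c ?z" by (rule same_sym[OF i zG c(1)])
      then have "lequiv i y (?c \<otimes> inv ?z)" using True by (auto simp: same_def intro: lequiv_K[OF i])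
      moreover have "lequiv i (?z \<otimes> inv ?d) (?c \<otimes> inv ?d)"
        by (rule lequiv_same[OF i zG c(1) c(2) c(2) z same_refl[OF i c(2)]])
      moreover have "lequiv i u (y \<otimes> u)" by (rule lequiv_K_left[OF i u True])
      ultimately show ?thesis
        using lequiv_trans[OF i] lequiv_sym[OF i] u y c zG by (meson m_closed inv_closed)
    next
      case False
      then have z: "same i ?z ?d" using zi[OF i] by simp
      have uK: "u \<in> K i" using False yu[OF i] by simp
      have "lequiv i u (?z \<otimes> inv ?d)" using uK z by (auto simp: same_def intro: lequiv_K[OF i])
      moreover have "lequiv i (?c \<otimes> inv ?z) (?c \<otimes> inv ?d)"
        by (rule lequiv_same[OF i c(1) c(1) zG c(2) same_refl[OF i c(1)] z])
      moreover have "lequiv i y (y \<otimes> u)" by (rule lequiv_K_right[OF i y uK])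
      ultimately show ?thesis
        using lequiv_trans[OF i] lequiv_sym[OF i] u y c zG by (meson m_closed inv_closed)
    qed
    have "coef (E y o\<^sub>L E u) C D = coef (E y) C ?Z * coef (E u) ?Z D"
      by (rule coef_compose_single[OF complex_linear_hecke_rep[OF e_hecke[OF y]] single])
    also have "\<dots> = e y (?c \<otimes> inv ?z) * e u (?z \<otimes> inv ?d)"
      using True Z by (simp add: coef_hecke_rep e_hecke y u kernel_def)
    also have "\<dots> = e (y \<otimes> u) (?c \<otimes> inv ?d)"
      using key c zG by (auto simp: e_def cls_def)
    also have "\<dots> = coef (E (y \<otimes> u)) C D"
      using True by (simp add: coef_hecke_rep e_hecke y u kernel_def)
    finally show ?thesis .
  qed
qed

text \<open>At each place one factor lies in \<open>K i\<close>, so both products are locally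
  equivalent to the other factor.\<close>

lemma cls_mult_commute:
  assumes y: "y \<in> carrier G" and u: "u \<in> carrier G" and yu: "\<And>i. i \<in> I \<Longrightarrow> y \<in> K i \<or> u \<in> K i"
  shows "cls (y \<otimes> u) = cls (u \<otimes> y)"
proof (rule cls_eq)
  have "lequiv i (u \<otimes> y) (y \<otimes> u)" if i: "i \<in> I" for i
  proof (cases "y \<in> K i")
    case True
    from lequiv_K_left[OF i u True] lequiv_K_right[OF i u True] show ?thesis
      using lequiv_trans[OF i] lequiv_sym[OF i] u y by (meson m_closed)
  next
    case False
    then have uK: "u \<in> K i" using yu[OF i] by simp
    from lequiv_K_left[OF i y uK] lequiv_K_right[OF i y uK] show ?thesis
      using lequiv_trans[OF i] lequiv_sym[OF i] u y by (meson m_closed)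
  qed
  then show "y \<otimes> u \<in> cls (u \<otimes> y)" using y u by (simp add: cls_def)
qed (use y u in simp)

lemma E_cong: "cls x = cls y \<Longrightarrow> E x = E y"
  by (rule arg_cong[where f = "hecke_rep G H"]) (simp add: e_def fun_eq_iff)

lemma E_commute:
  assumes "y \<in> At p" "u \<in> At q" "p \<noteq> q"
  shows "E y o\<^sub>L E u = E u o\<^sub>L E y"
proof -
  have yu: "y \<in> K i \<or> u \<in> K i" if "i \<in> I" for i
    using assms that by (auto simp: At_def)
  have "E y o\<^sub>L E u = E (y \<otimes> u)" by (rule E_mult[OF At_carrier At_carrier yu]) (use assms in auto)
  also have "\<dots> = E (u \<otimes> y)"
    by (rule E_cong[OF cls_mult_commute[OF At_carrier At_carrier yu]]) (use assms in auto)
  also have "\<dots> = E u o\<^sub>L E y"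
    by (rule E_mult[symmetric, OF At_carrier At_carrier]) (use assms yu in auto)
  finally show ?thesis .
qed

text \<open>Commuting with a fixed complex linear operator is a closed complex linear condition. It
  is extended from generators in S for fixed \<open>E u\<close>, and after that in T for fixed
  S.\<close>

lemma Aloc_commute:
  assumes "S \<in> Aloc p" "T \<in> Aloc q" "p \<noteq> q"
  shows "S o\<^sub>L T = T o\<^sub>L S"
proof -
  have sub: "complex_subspace {a. a o\<^sub>L b = b o\<^sub>L a}" if "complex_linear b" for b :: "'a set op"
  proof -
    have "(S + T) o\<^sub>L b = (S o\<^sub>L b) + (T o\<^sub>L b)" "b o\<^sub>L (S + T) = (b o\<^sub>L S) + (b o\<^sub>L T)"
      "op_scale c S o\<^sub>L b = op_scale c (S o\<^sub>L b)" "b o\<^sub>L op_scale c S = op_scale c (b o\<^sub>L S)"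
      for S T c
      using that by (intro blinfun_eqI; simp add: blinfun.add_left blinfun.add_right complex_linear_def)+
    moreover have "0 o\<^sub>L b = 0" "b o\<^sub>L 0 = 0" by (intro blinfun_eqI; simp)+
    ultimately show ?thesis by (simp add: complex_subspace_def)
  qed
  have cl: "closed {a. a o\<^sub>L b = b o\<^sub>L a}" for b :: "'a set op"
    by (intro closed_Collect_eq continuous_intros)
  have 1: "S o\<^sub>L E u = E u o\<^sub>L S" if u: "u \<in> At q" for u
  proof -
    have "Aloc p \<subseteq> {a. a o\<^sub>L E u = E u o\<^sub>L a}"
      by (rule Aloc_subset[OF cl sub])
         (auto intro: complex_linear_hecke_rep e_hecke At_carrier[OF u] E_commute[OF _ u assms(3)])
    then show ?thesis using assms(1) by blast
  qed
  have "Aloc q \<subseteq> {a. a o\<^sub>L S = S o\<^sub>L a}"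
    by (rule Aloc_subset[OF cl sub])
       (use assms(1) Aloc_subset_A complex_linear_A 1 in auto)
  then show ?thesis using assms(2) by auto
qed

subsection \<open>The tensor product decomposition\<close>

abbreviation samec :: "'i \<Rightarrow> 'a set \<Rightarrow> 'a set \<Rightarrow> bool" where
  "samec i C D \<equiv> same i (rep C) (rep D)"

lemma samec_refl: "i \<in> I \<Longrightarrow> C \<in> Y \<Longrightarrow> samec i C C"
  by (rule same_refl[OF _ rep_carrier])

lemma samec_sym: "i \<in> I \<Longrightarrow> C \<in> Y \<Longrightarrow> D \<in> Y \<Longrightarrow> samec i C D \<Longrightarrow> samec i D C"
  by (rule same_sym[OF _ rep_carrier rep_carrier])

lemma samec_trans:
  "i \<in> I \<Longrightarrow> C \<in> Y \<Longrightarrow> D \<in> Y \<Longrightarrow> B \<in> Y \<Longrightarrow> samec i C D \<Longrightarrow> samec i D B \<Longrightarrow> samec i C B"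
  by (rule same_trans[OF _ rep_carrier rep_carrier rep_carrier])

lemma samec_H_iff: "i \<in> I \<Longrightarrow> C \<in> Y \<Longrightarrow> samec i C H \<longleftrightarrow> rep C \<in> K i"
proof -
  assume i: "i \<in> I" and C: "C \<in> Y"
  have h: "rep H \<in> K i" using rep_H i by (simp add: H_def)
  show ?thesis
  proof
    assume "samec i C H"
    then have "rep C \<otimes> inv (rep H) \<otimes> rep H \<in> K i" using h i by (simp add: same_def K_mult)
    then show "rep C \<in> K i" using C rep_carrier[OF H_in_Y] by (simp add: m_assoc rep_carrier)
  qed (use same_K[OF i _ h] in simp)
qed

lemma glue_cosets:
  assumes "\<And>i. i \<in> I \<Longrightarrow> C i \<in> Y" "finite {i \<in> I. \<not> samec i (C i) H}"
  obtains D where "D \<in> Y" "\<And>i. i \<in> I \<Longrightarrow> samec i D (C i)"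
proof -
  obtain y where y: "y \<in> carrier G" "\<And>i. i \<in> I \<Longrightarrow> same i y (rep (C i))"
  proof (rule glue_family[of "\<lambda>i. rep (C i)"])
    have "{i \<in> I. rep (C i) \<notin> K i} = {i \<in> I. \<not> samec i (C i) H}"
      using assms(1) samec_H_iff by auto
    then show "finite {i \<in> I. rep (C i) \<notin> K i}" using assms(2) by simp
  qed (use assms(1) rep_carrier in auto)
  show thesis
  proof (rule that[of "H #> y"])
    show "samec i (H #> y) (C i)" if "i \<in> I" for i
      using same_trans[OF that rep_carrier[OF coset_in_Y] y(1) rep_carrier same_rep_coset[OF that y(1)] y(2)[OF that]]
        assms(1)[OF that] y(1) by simp
  qed (rule coset_in_Y[OF y(1)])
qed

lemma finite_not_H: "C \<in> Y \<Longrightarrow> finite {i \<in> I. \<not> samec i C H}"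
proof -
  assume C: "C \<in> Y"
  have "{i \<in> I. \<not> samec i C H} = {i \<in> I. rep C \<notin> K i}" using samec_H_iff[OF _ C] by blast
  then show ?thesis using almost_all[OF rep_carrier[OF C]] by simp
qed

text \<open>The coset with the local component of \<open>C\<close> at \<open>i\<close> and those of \<open>D\<close> elsewhere.\<close>

definition repl :: "'i \<Rightarrow> 'a set \<Rightarrow> 'a set \<Rightarrow> 'a set" where
  "repl i C D = (SOME B. B \<in> Y \<and> samec i B C \<and> (\<forall>j\<in>I - {i}. samec j B D))"

lemma repl:
  assumes "i \<in> I" "C \<in> Y" "D \<in> Y"
  shows repl_Y: "repl i C D \<in> Y" and repl_at: "samec i (repl i C D) C"
    and repl_off: "j \<in> I \<Longrightarrow> j \<noteq> i \<Longrightarrow> samec j (repl i C D) D"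
proof -
  obtain B where B: "B \<in> Y" "\<And>j. j \<in> I \<Longrightarrow> samec j B (if j = i then C else D)"
  proof (rule glue_cosets[of "\<lambda>j. if j = i then C else D"])
    have "{j \<in> I. \<not> samec j (if j = i then C else D) H} \<subseteq> {j \<in> I. \<not> samec j C H} \<union> {j \<in> I. \<not> samec j D H}"
      by auto
    then show "finite {j \<in> I. \<not> samec j (if j = i then C else D) H}"
      by (rule finite_subset) (use assms finite_not_H in simp)
  qed (use assms in auto)
  have "samec j B D" if "j \<in> I - {i}" for j
    using B(2)[of j] that by simp
  then have "B \<in> Y \<and> samec i B C \<and> (\<forall>j\<in>I - {i}. samec j B D)"
    using B(1) B(2)[OF assms(1)] by simp
  then have *: "repl i C D \<in> Y \<and> samec i (repl i C D) C \<and> (\<forall>j\<in>I - {i}. samec j (repl i C D) D)"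
    unfolding repl_def by (rule someI)
  then show "repl i C D \<in> Y" "samec i (repl i C D) C"
    "j \<in> I \<Longrightarrow> j \<noteq> i \<Longrightarrow> samec j (repl i C D) D" by auto
qed

lemma repl_unique:
  assumes "i \<in> I" "C \<in> Y" "D \<in> Y" "B \<in> Y" "samec i B C" "\<And>j. j \<in> I \<Longrightarrow> j \<noteq> i \<Longrightarrow> samec j B D"
  shows "repl i C D = B"
proof (rule Y_eqI[OF repl_Y[OF assms(1-3)] assms(4)])
  fix j assume j: "j \<in> I"
  show "samec j (repl i C D) B"
  proof (cases "j = i")
    case True
    show ?thesis unfolding True
      by (rule samec_trans[OF assms(1) repl_Y assms(2) assms(4) repl_at samec_sym]) (use assms in auto)
  next
    case False
    show ?thesis
      by (rule samec_trans[OF j repl_Y assms(3) assms(4) repl_off samec_sym]) (use assms j False in auto)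
  qed
qed

definition RF :: "('i \<Rightarrow> 'a set) set" where
  "RF = restricted_families I (\<lambda>_. Y) (\<lambda>_. H)"

text \<open>A family \<open>w\<close> of cosets has local components \<open>w i\<close> at \<open>j\<close> for all \<open>i\<close> and \<open>j\<close>.  The components
  with \<open>i = j\<close> are collected in one coset \<open>C\<close>, the others in \<open>z \<in> Z\<close>, and \<open>hh\<close> reassembles \<open>w\<close>.\<close>

definition Z :: "('i \<Rightarrow> 'a set) set" where
  "Z = {z \<in> RF. \<forall>i\<in>I. samec i (z i) H}"

definition hh :: "'a set \<times> ('i \<Rightarrow> 'a set) \<Rightarrow> 'i \<Rightarrow> 'a set" where
  "hh = (\<lambda>(C, z). \<lambda>i\<in>I. repl i C (z i))"

lemma RF_iff: "w \<in> RF \<longleftrightarrow> w \<in> I \<rightarrow>\<^sub>E Y \<and> finite {i \<in> I. w i \<noteq> H}"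
  by (auto simp: RF_def restricted_families_def)

lemma RF_Y: "w \<in> RF \<Longrightarrow> i \<in> I \<Longrightarrow> w i \<in> Y"
  by (auto simp: RF_iff)

lemma RF_eqI:
  assumes "w \<in> RF" "v \<in> RF" "\<And>i j. i \<in> I \<Longrightarrow> j \<in> I \<Longrightarrow> samec j (w i) (v i)"
  shows "w = v"
proof
  fix i
  show "w i = v i"
  proof (cases "i \<in> I")
    case True
    then show ?thesis by (intro Y_eqI RF_Y assms)
  next
    case False
    then show ?thesis using assms(1,2) PiE_arb unfolding RF_iff by metis
  qed
qed

lemma RF_ext: "w \<in> RF \<Longrightarrow> v \<in> RF \<Longrightarrow> (\<And>i. i \<in> I \<Longrightarrow> w i = v i) \<Longrightarrow> w = v"
  unfolding RF_iff by (blast intro: PiE_ext)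

lemma Z_RF: "z \<in> Z \<Longrightarrow> z \<in> RF" by (simp add: Z_def)

lemma hh:
  assumes "C \<in> Y" "z \<in> Z"
  shows hh_RF: "hh (C, z) \<in> RF"
    and hh_at: "i \<in> I \<Longrightarrow> samec i (hh (C, z) i) C"
    and hh_off: "i \<in> I \<Longrightarrow> j \<in> I \<Longrightarrow> j \<noteq> i \<Longrightarrow> samec j (hh (C, z) i) (z i)"
proof -
  have zY: "z i \<in> Y" if "i \<in> I" for i using RF_Y[OF Z_RF[OF assms(2)] that] .
  have "hh (C, z) i = H" if i: "i \<in> I" "samec i C H" "z i = H" for i
  proof -
    have "repl i C H = H"
      using i assms(1) H_in_Y by (intro repl_unique samec_sym[of _ C] samec_refl)
    then show ?thesis using i by (simp add: hh_def)
  qed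
  then have "{i \<in> I. hh (C, z) i \<noteq> H} \<subseteq> {i \<in> I. \<not> samec i C H} \<union> {i \<in> I. z i \<noteq> H}" by auto
  moreover have "finite ({i \<in> I. \<not> samec i C H} \<union> {i \<in> I. z i \<noteq> H})"
    using finite_not_H[OF assms(1)] assms(2) by (simp add: Z_def RF_iff)
  ultimately have "finite {i \<in> I. hh (C, z) i \<noteq> H}" by (rule finite_subset)
  then show "hh (C, z) \<in> RF"
    using assms(1) zY by (simp add: RF_iff) (simp add: hh_def repl_Y)
  show "i \<in> I \<Longrightarrow> samec i (hh (C, z) i) C"
    using assms(1) zY by (simp add: hh_def repl_at)
  show "i \<in> I \<Longrightarrow> j \<in> I \<Longrightarrow> j \<noteq> i \<Longrightarrow> samec j (hh (C, z) i) (z i)"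
    using assms(1) zY by (simp add: hh_def repl_off)
qed

text \<open>The coordinate z is recorded by the off-diagonal components of the family. Its equality
  can thus be tested on the families alone, whatever C and C' are.\<close>

lemma hh_z_eq_iff:
  assumes C: "C \<in> Y" "C' \<in> Y" and z: "z \<in> Z" "z' \<in> Z"
  shows "z = z' \<longleftrightarrow> (\<forall>i\<in>I. \<forall>j\<in>I - {i}. samec j (hh (C, z) i) (hh (C', z') i))"
proof -
  have zY: "z i \<in> Y" "z' i \<in> Y" if "i \<in> I" for i using RF_Y[OF Z_RF[OF z(1)] that] RF_Y[OF Z_RF[OF z(2)] that] .
  have hY: "hh (C, z) i \<in> Y" "hh (C', z') i \<in> Y" if "i \<in> I" for i
    using RF_Y[OF hh_RF that] C z by auto
  show ?thesis
  proof (intro iffI ballI)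
    fix i j assume eq: "z = z'" and i: "i \<in> I" and j: "j \<in> I - {i}"
    have "samec j (hh (C, z) i) (z i)" "samec j (hh (C', z') i) (z i)"
      using hh_off[OF C(1) z(1) i, of j] hh_off[OF C(2) z(2) i, of j] j eq by auto
    then show "samec j (hh (C, z) i) (hh (C', z') i)"
      using samec_trans[of j _ "z i"] samec_sym[of j "hh (C', z') i" "z i"] zY[OF i] hY[OF i] j by blast
  next
    assume *: "\<forall>i\<in>I. \<forall>j\<in>I - {i}. samec j (hh (C, z) i) (hh (C', z') i)"
    show "z = z'"
    proof (rule RF_eqI[OF Z_RF[OF z(1)] Z_RF[OF z(2)]])
      fix i j assume i: "i \<in> I" and j: "j \<in> I"
      show "samec j (z i) (z' i)"
      proof (cases "j = i")
        case True
        have "samec i (z i) H" "samec i (z' i) H" using z i by (auto simp: Z_def)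
        then show ?thesis using True samec_trans[of i "z i" H "z' i"] samec_sym[of i "z' i" H] zY[OF i] i H_in_Y by blast
      next
        case False
        have 1: "samec j (z i) (hh (C, z) i)"
          using hh_off[OF C(1) z(1) i j False] samec_sym[OF j] hY[OF i] zY[OF i] by blast
        have 2: "samec j (hh (C, z) i) (hh (C', z') i)" using * i j False by blast
        have 3: "samec j (hh (C', z') i) (z' i)" using hh_off[OF C(2) z(2) i j False] .
        show ?thesis
          using samec_trans[OF j zY(1)[OF i] hY(1)[OF i] hY(2)[OF i] 1 2]
            samec_trans[OF j zY(1)[OF i] hY(2)[OF i] zY(2)[OF i] _ 3] by blast
      qed
    qed
  qed
qed

lemma hh_inj: "inj_on hh (Y \<times> Z)"
proof (rule inj_onI, clarify)
  fix C z C' z' assume C: "C \<in> Y" "C' \<in> Y" and z: "z \<in> Z" "z' \<in> Z" and eq: "hh (C, z) = hh (C', z')"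
  have "z = z'" unfolding hh_z_eq_iff[OF C z] eq
    using samec_refl RF_Y[OF hh_RF[OF C(2) z(2)]] by blast
  moreover have "C = C'"
  proof (rule Y_eqI[OF C])
    fix i assume i: "i \<in> I"
    have "hh (C', z') i \<in> Y" using RF_Y[OF hh_RF[OF C(2) z(2)] i] .
    then show "samec i C C'"
      using hh_at[OF C(1) z(1) i] hh_at[OF C(2) z(2) i] eq samec_sym[OF i] samec_trans[OF i] C by metis
  qed
  ultimately show "C = C' \<and> z = z'" by simp
qed

text \<open>For surjectivity the diagonal components of w are glued to C, which is possible because
  \<open>w i = H\<close> for almost all i; z arises from w by making the diagonal components
  trivial.\<close>

lemma hh_image: "hh ` (Y \<times> Z) = RF"
proof (intro equalityI subsetI)
  fix w assume w: "w \<in> RF"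
  obtain C where C: "C \<in> Y" "\<And>i. i \<in> I \<Longrightarrow> samec i C (w i)"
  proof (rule glue_cosets[of w])
    have "{i \<in> I. \<not> samec i (w i) H} \<subseteq> {i \<in> I. w i \<noteq> H}" using samec_refl[OF _ H_in_Y] by auto
    then show "finite {i \<in> I. \<not> samec i (w i) H}" by (rule finite_subset) (use w in \<open>simp add: RF_iff\<close>)
  qed (use RF_Y[OF w] in auto)
  define z where "z = (\<lambda>i\<in>I. repl i H (w i))"
  have zi: "z i = repl i H (w i)" if "i \<in> I" for i using that by (simp add: z_def)
  have "repl i H H = H" if "i \<in> I" for i by (intro repl_unique samec_refl H_in_Y that)
  then have "{i \<in> I. z i \<noteq> H} \<subseteq> {i \<in> I. w i \<noteq> H}" by (auto simp: zi)
  then have "finite {i \<in> I. z i \<noteq> H}" by (rule finite_subset) (use w in \<open>simp add: RF_iff\<close>)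
  then have z: "z \<in> Z"
    using RF_Y[OF w] H_in_Y by (simp add: Z_def RF_iff zi repl_at) (simp add: z_def repl_Y)
  have "hh (C, z) = w"
  proof (rule RF_eqI[OF hh_RF[OF C(1) z] w])
    fix i j assume i: "i \<in> I" and j: "j \<in> I"
    note Ys = RF_Y[OF hh_RF[OF C(1) z] i] RF_Y[OF w i] RF_Y[OF Z_RF[OF z] i]
    show "samec j (hh (C, z) i) (w i)"
    proof (cases "j = i")
      case True
      then show ?thesis
        using samec_trans[OF i Ys(1) C(1) Ys(2) hh_at[OF C(1) z i] C(2)[OF i]] by simp
    next
      case False
      have "samec j (z i) (w i)" unfolding zi[OF i] by (rule repl_off[OF i H_in_Y Ys(2) j False])
      then show ?thesis
        by (rule samec_trans[OF j Ys(1) Ys(3) Ys(2) hh_off[OF C(1) z i j False]])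
    qed
  qed
  then show "w \<in> hh ` (Y \<times> Z)" using C(1) z by blast
qed (auto intro: hh_RF)

sublocale tensor: product_coordinates Y Z hh
  by unfold_locales (rule hh_inj)

lemma supported_A: "T \<in> A \<Longrightarrow> tensor.supported T"
  using complex_linear_A coef_A_outside by (auto simp: tensor.supported_def)

lemma constant_in_Z: "(\<lambda>i\<in>I. H) \<in> Z"
proof -
  have "{i \<in> I. (\<lambda>i\<in>I. H) i \<noteq> H} = {}" by auto
  then have "finite {i \<in> I. (\<lambda>i\<in>I. H) i \<noteq> H}" by (simp only: finite.emptyI)
  then show ?thesis using H_in_Y samec_refl by (auto simp: Z_def RF_iff)
qed

text \<open>The amplification acts through the coset C of diagonal components. An element coming
  from \<open>At p\<close> changes only the component of C at p, and in the family this component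
  belongs to \<open>w p\<close> alone; so only the coordinate p is affected, and there the action is
  that of \<open>a\<close>.\<close>

lemma coef_amp_local:
  assumes p: "p \<in> I" and a: "a \<in> Aloc p" and w: "w \<in> RF" and v: "v \<in> RF"
  shows "coef (tensor.amp a) w v = (if \<forall>i\<in>I - {p}. w i = v i then coef a (w p) (v p) else 0)"
proof -
  let ?P = "\<forall>i\<in>I - {p}. w i = v i"
  have "Aloc p \<subseteq> {a. coef (tensor.amp a) w v = (if ?P then coef a (w p) (v p) else 0)}"
    unfolding Aloc_def
  proof (rule closure_minimal)
    have lin: "bounded_linear (\<lambda>a. coef (tensor.amp a) w v)"
      by (rule bounded_linear_compose[OF bounded_linear_coef tensor.bounded_linear_amp])
    show "closed {a. coef (tensor.amp a) w v = (if ?P then coef a (w p) (v p) else 0)}"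
    proof (cases ?P)
      case True
      show ?thesis unfolding if_P[OF True]
        by (intro closed_Collect_eq linear_continuous_on bounded_linear_coef lin)
    next
      case False
      show ?thesis unfolding if_not_P[OF False]
        by (intro closed_Collect_eq continuous_on_const linear_continuous_on lin)
    qed
    show "hecke_rep G H ` {f \<in> locally_invariant. support f \<subseteq> At p}
      \<subseteq> {a. coef (tensor.amp a) w v = (if ?P then coef a (w p) (v p) else 0)}"
    proof (rule image_subsetI)
      fix f assume "f \<in> {f \<in> locally_invariant. support f \<subseteq> At p}"
      then have f: "f \<in> locally_invariant" and supp: "support f \<subseteq> At p" by auto
      note fH = locally_invariant_hecke[OF f]
      obtain C z where C: "C \<in> Y" "z \<in> Z" and wC: "w = hh (C, z)" using w hh_image by blast
      obtain C' z' where C': "C' \<in> Y" "z' \<in> Z" and vC: "v = hh (C', z')" using v hh_image by blast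
      have wY: "w i \<in> Y" "v i \<in> Y" if "i \<in> I" for i using RF_Y w v that by auto
      let ?c = "rep C \<otimes> inv (rep C')" and ?d = "rep (w p) \<otimes> inv (rep (v p))"
      have cd: "?c \<in> carrier G" "?d \<in> carrier G" using C(1) C'(1) wY[OF p] by (auto simp: rep_carrier)
      have L: "coef (tensor.amp (hecke_rep G H f)) w v = (if z = z' then f ?c else 0)"
        unfolding wC vC using C C' by (simp add: tensor.coef_amp coef_hecke_rep fH kernel_def)
      have R: "coef (hecke_rep G H f) (w p) (v p) = f ?d"
        using wY[OF p] by (simp add: coef_hecke_rep fH kernel_def)
      have supp_same: "samec j B D" if "f (rep B \<otimes> inv (rep D)) \<noteq> 0" "j \<in> I" "j \<noteq> p" "B \<in> Y" "D \<in> Y" for j B D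
      proof -
        have "rep B \<otimes> inv (rep D) \<in> support f" using that by (simp add: support_def rep_carrier)
        then show ?thesis using supp that by (auto simp: At_def same_def)
      qed
      have zz: "z = z' \<longleftrightarrow> (\<forall>i\<in>I. \<forall>j\<in>I - {i}. samec j (w i) (v i))"
        unfolding wC vC by (rule hh_z_eq_iff[OF C(1) C'(1) C(2) C'(2)])
      have wat: "samec i (w i) C" "samec i (v i) C'" if "i \<in> I" for i
        using hh_at C C' that by (auto simp: wC vC)
      have "(if z = z' then f ?c else 0) = (if ?P then f ?d else 0)"
      proof (cases ?P)
        case P: True
        show ?thesis
        proof (cases "\<forall>j\<in>I - {p}. samec j (w p) (v p)")
          case True
          have "samec j (w i) (v i)" if i: "i \<in> I" and j: "j \<in> I - {i}" for i j
          proof (cases "i = p")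
            case False
            then have "w i = v i" using P i by blast
            then show ?thesis using samec_refl[of j "v i"] wY(2)[OF i] j by simp
          qed (use True j in blast)
          then have "z = z'" unfolding zz by blast
          \<comment> \<open>At p the components of C and C' are those of \<open>w p\<close> and
            \<open>v p\<close>. At any other j both quotients are integral: \<open>?c\<close>
            because \<open>w j = v j\<close>, and \<open>?d\<close> by the case assumption.\<close>
          moreover have "?c \<in> cls ?d"
          proof -
            have "lequiv j ?d ?c" if j: "j \<in> I" for j
            proof (cases "j = p")
              case True
              then show ?thesis
                using wat[OF p] p wY[OF p] C C' by (intro lequiv_same rep_carrier) auto
            next
              case False
              then have wv: "w j = v j" using P j by blast
              have "samec j C (w j)" using wat(1)[OF j] samec_sym[OF j] wY[OF j] C(1) by blast
              then have "samec j C C'" using samec_trans[OF j C(1) _ C'(1)] wY[OF j] wat(2)[OF j] wv by metis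
              then show ?thesis using True False j by (intro lequiv_K) (auto simp: same_def)
            qed
            then show ?thesis using cd by (simp add: cls_def)
          qed
          ultimately show ?thesis using P locally_invariant_cls[OF f cd(2)] by simp
        next
          case False
          then have "z \<noteq> z'" unfolding zz using p by blast
          moreover have "f ?d = 0" using False supp_same wY[OF p] by blast
          ultimately show ?thesis by simp
        qed
      next
        case False
        then obtain i where i: "i \<in> I" "i \<noteq> p" "w i \<noteq> v i" by blast
        \<comment> \<open>Otherwise C and C' would agree at the place i as well, and together with
          \<open>z = z'\<close> all components of \<open>w i\<close> and \<open>v i\<close> would
          agree, against the choice of i.\<close>
        have "f ?c = 0" if z: "z = z'"
        proof (rule ccontr)
          assume "f ?c \<noteq> 0"
          then have s: "samec i C C'" using supp_same i C C' by blast
          have "w i = v i"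
          proof (rule Y_eqI)
            fix j assume j: "j \<in> I"
            show "samec j (w i) (v i)"
            proof (cases "j = i")
              case True
              have "samec i (w i) C'"
                using samec_trans[OF i(1) wY(1)[OF i(1)] C(1) C'(1) wat(1)[OF i(1)] s] .
              then show ?thesis unfolding True
                using samec_trans[OF i(1) wY(1)[OF i(1)] C'(1) wY(2)[OF i(1)]]
                  samec_sym[OF i(1) wY(2)[OF i(1)] C'(1) wat(2)[OF i(1)]] by blast
            qed (use z zz i j in blast)
          qed (use wY i in auto)
          with i show False by simp
        qed
        then show ?thesis unfolding if_not_P[OF False] by (cases "z = z'") simp_all
      qed
      then show "hecke_rep G H f \<in> {a. coef (tensor.amp a) w v = (if ?P then coef a (w p) (v p) else 0)}"
        by (simp add: L R)
    qed
  qed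
  then show ?thesis using a by blast
qed

text \<open>The product ends in a prescribed operator, because the unit of the algebra is not the
  identity but \<open>E \<one>\<close>, the projection onto the functions on Y. The same device
  allows an \<open>E u\<close> at the end.\<close>

definition opprod :: "('i \<Rightarrow> 'a set op) \<Rightarrow> 'i list \<Rightarrow> 'a set op \<Rightarrow> 'a set op" where
  "opprod a ps T = foldr (\<lambda>p X. a p o\<^sub>L X) ps T"

lemma opprod_simps [simp]:
  "opprod a [] T = T"
  "opprod a (p # ps) T = a p o\<^sub>L opprod a ps T"
  "opprod a (ps @ [p]) T = opprod a ps (a p o\<^sub>L T)"
  by (simp_all add: opprod_def)

lemma supported_compose:
  assumes "tensor.supported S" "tensor.supported T"
  shows "tensor.supported (S o\<^sub>L T)"
  unfolding tensor.supported_def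
proof (intro conjI allI impI)
  show "complex_linear (S o\<^sub>L T)"
    using assms by (intro complex_linear_compose) (auto simp: tensor.supported_def)
  fix x y assume xy: "x \<notin> Y \<or> y \<notin> Y"
  show "coef (S o\<^sub>L T) y x = 0"
  proof (cases "y \<in> Y")
    case True
    then have "T (ket x) = 0"
      using assms(2) xy by (intro ell2_eqI) (auto simp: tensor.supported_def coef_def)
    then show ?thesis by (simp add: coef_def)
  next
    case False
    then show ?thesis using tensor.supported_range[OF assms(1) False] by (simp add: coef_def)
  qed
qed

lemma supported_opprod:
  assumes "\<And>p. p \<in> set ps \<Longrightarrow> a p \<in> Aloc p" "tensor.supported T"
  shows "tensor.supported (opprod a ps T)"
  using assms
proof (induction ps)
  case (Cons p ps)
  have "tensor.supported (a p)"
    using Cons.prems(1)[of p] by (intro supported_A subsetD[OF Aloc_subset_A]) simp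
  with Cons show ?case by (simp add: supported_compose)
qed simp

lemma E_one: "coef (E \<one>) C D = (if C \<in> Y \<and> C = D then 1 else 0)"
proof -
  have "rep C \<otimes> inv (rep D) \<in> H \<longleftrightarrow> C = D" if "C \<in> Y" "D \<in> Y" for C D
    using that coset_eq_iff[OF subgroup_H, of "rep C" "rep D"] by (simp add: rep_carrier coset_rep)
  then show ?thesis by (auto simp: coef_hecke_rep e_hecke kernel_def e_def cls_one)
qed

text \<open>In the product of the factor at p with the remaining ones the only intermediate family
  is \<open>w(p := v p)\<close>: the factor at p can change nothing but the coordinate p, and the
  others cannot change this coordinate.\<close>

lemma coef_amp_opprod:
  assumes "distinct ps" "set ps \<subseteq> I" "\<And>p. p \<in> set ps \<Longrightarrow> a p \<in> Aloc p"
  shows "coef (tensor.amp (opprod a ps (E \<one>))) w v =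
    (if v \<in> RF \<and> w \<in> RF \<and> (\<forall>i\<in>I - set ps. v i = w i) then \<Prod>i\<in>set ps. coef (a i) (w i) (v i) else 0)"
proof (cases "v \<in> RF \<and> w \<in> RF")
  case False
  then show ?thesis using tensor.coef_amp_outside by (auto simp: hh_image)
next
  case True
  from assms True show ?thesis
  proof (induction ps arbitrary: w)
    case Nil
    then obtain C z C' z' where C: "C \<in> Y" "z \<in> Z" "w = hh (C, z)" "C' \<in> Y" "z' \<in> Z" "v = hh (C', z')"
      using hh_image by blast
    have "(\<forall>i\<in>I. v i = w i) \<longleftrightarrow> v = w"
      using Nil.prems(4) RF_ext[of v w] by blast
    also have "\<dots> \<longleftrightarrow> C = C' \<and> z = z'" using C by auto
    finally show ?case using C Nil.prems(4) by (simp add: tensor.coef_amp E_one)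
  next
    case (Cons p ps)
    let ?R = "opprod a ps (E \<one>)"
    have p: "p \<in> I" "p \<notin> set ps" and ap: "a p \<in> Aloc p" using Cons.prems by auto
    have w: "w \<in> RF" and v: "v \<in> RF" using Cons.prems by auto
    have IH: "coef (tensor.amp ?R) u v =
        (if \<forall>i\<in>I - set ps. v i = u i then \<Prod>i\<in>set ps. coef (a i) (u i) (v i) else 0)" if "u \<in> RF" for u
      using Cons.IH[of u] Cons.prems that by simp
    have supR: "tensor.supported ?R"
      using Cons.prems by (intro supported_opprod supported_A E_in_A) auto
    let ?u = "w(p := v p)"
    have "{i \<in> I. ?u i \<noteq> H} \<subseteq> insert p {i \<in> I. w i \<noteq> H}" by auto
    then have "finite {i \<in> I. ?u i \<noteq> H}" by (rule finite_subset) (use w in \<open>simp add: RF_iff\<close>)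
    moreover have "?u \<in> I \<rightarrow>\<^sub>E Y"
    proof -
      have "w \<in> I \<rightarrow>\<^sub>E Y" using w by (simp add: RF_iff)
      from PiE_fun_upd[of "v p" "\<lambda>_. Y" p w I, OF RF_Y[OF v p(1)] this] show ?thesis by (simp only: insert_absorb[OF p(1)])
    qed
    ultimately have uRF: "?u \<in> RF" by (simp only: RF_iff)
    have 1: "coef (tensor.amp (a p)) w u * coef (tensor.amp ?R) u v = 0" if u: "u \<noteq> ?u" for u
    proof (rule ccontr)
      assume *: "coef (tensor.amp (a p)) w u * coef (tensor.amp ?R) u v \<noteq> 0"
      have uR: "u \<in> RF"
      proof (rule ccontr)
        assume "u \<notin> RF"
        then have "coef (tensor.amp (a p)) w u = 0"
          by (intro tensor.coef_amp_outside) (simp add: hh_image)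
        with * show False by simp
      qed
      have "\<forall>i\<in>I - {p}. w i = u i"
      proof (rule ccontr)
        assume "\<not> (\<forall>i\<in>I - {p}. w i = u i)"
        then have "coef (tensor.amp (a p)) w u = 0"
          unfolding coef_amp_local[OF p(1) ap w uR] by (rule if_not_P)
        with * show False by simp
      qed
      moreover have "\<forall>i\<in>I - set ps. v i = u i"
      proof (rule ccontr)
        assume "\<not> (\<forall>i\<in>I - set ps. v i = u i)"
        then have "coef (tensor.amp ?R) u v = 0" unfolding IH[OF uR] by (rule if_not_P)
        with * show False by simp
      qed
      then have "v p = u p" using p by blast
      ultimately have "u = ?u" by (intro RF_ext[OF uR uRF]) simp
      with u show False by simp
    qed
    have "coef (tensor.amp (opprod a (p # ps) (E \<one>))) w v = coef (tensor.amp (a p) o\<^sub>L tensor.amp ?R) w v"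
      by (simp add: tensor.amp_compose[OF supR])
    also have "\<dots> = coef (tensor.amp (a p)) w ?u * coef (tensor.amp ?R) ?u v"
      by (rule coef_compose_single[OF tensor.complex_linear_amp 1])
         (use ap Aloc_subset_A complex_linear_A in blast)
    also have "coef (tensor.amp (a p)) w ?u = coef (a p) (w p) (v p)"
      by (simp add: coef_amp_local[OF p(1) ap w uRF])
    also have "coef (tensor.amp ?R) ?u v =
        (if \<forall>i\<in>I - set ps. v i = ?u i then \<Prod>i\<in>set ps. coef (a i) (?u i) (v i) else 0)"
      by (rule IH[OF uRF])
    also have "(\<forall>i\<in>I - set ps. v i = ?u i) \<longleftrightarrow> (\<forall>i\<in>I - set (p # ps). v i = w i)" by auto
    also have "(\<Prod>i\<in>set ps. coef (a i) (?u i) (v i)) = (\<Prod>i\<in>set ps. coef (a i) (w i) (v i))"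
      using p by (intro prod.cong) auto
    finally show ?case using w v p by simp
  qed
qed

lemma opprod_compose: "opprod a ps S o\<^sub>L T = opprod a ps (S o\<^sub>L T)"
proof (induction ps)
  case (Cons p ps)
  have "(a p o\<^sub>L X) o\<^sub>L T = a p o\<^sub>L (X o\<^sub>L T)" for X by (rule blinfun_eqI) simp
  with Cons show ?case by simp
qed simp

text \<open>The last local factor may be replaced by some \<open>E y\<close>, which
  \<open>E_mult\<close> absorbs into the end operator:
  \<open>E y o\<^sub>L E u = E (y \<otimes> u)\<close>. The element \<open>y \<otimes> u\<close> is
  still integral at the places of the remaining factors, so the induction continues.\<close>

lemma opprod_in_A:
  assumes "distinct ps" "set ps \<subseteq> I" "\<And>p. p \<in> set ps \<Longrightarrow> a p \<in> Aloc p"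
    and "u \<in> carrier G" "\<And>p. p \<in> set ps \<Longrightarrow> u \<in> K p"
  shows "opprod a ps (E u) \<in> A"
  using assms
proof (induction ps arbitrary: u rule: rev_induct)
  case Nil
  then show ?case by (simp add: E_in_A)
next
  case (snoc p ps)
  have p: "p \<in> I" "p \<notin> set ps" using snoc.prems by auto
  let ?X = "opprod a ps id_blinfun"
  have id: "complex_linear (id_blinfun :: 'a set op)" by (simp add: complex_linear_def)
  have "complex_linear (a q)" if "q \<in> set ps" for q
    using snoc.prems(3)[of q] that Aloc_subset_A complex_linear_A by auto
  then have "complex_linear ?X"
    by (induction ps) (auto intro: complex_linear_compose id)
  then have V: "complex_subspace {b. (?X o\<^sub>L b) o\<^sub>L E u \<in> A}"
    by (rule complex_subspace_compose_vimage[OF complex_subspace_A])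
  have X: "(?X o\<^sub>L b) o\<^sub>L E u = opprod a ps (b o\<^sub>L E u)" for b
  proof -
    have "id_blinfun o\<^sub>L b = b" by (intro blinfun_eqI) simp
    then show ?thesis by (simp add: opprod_compose)
  qed
  have "Aloc p \<subseteq> {b. (?X o\<^sub>L b) o\<^sub>L E u \<in> A}"
  proof (rule Aloc_subset[OF closed_compose_vimage[OF closed_A] V])
    fix y assume y: "y \<in> At p"
    have "E y o\<^sub>L E u = E (y \<otimes> u)"
      by (rule E_mult) (use y snoc.prems in \<open>auto simp: At_def\<close>)
    moreover have "opprod a ps (E (y \<otimes> u)) \<in> A"
    proof (rule snoc.IH)
      fix q assume q: "q \<in> set ps"
      then have "y \<in> K q" using y p snoc.prems(2) by (auto simp: At_def)
      then show "y \<otimes> u \<in> K q" using q snoc.prems(2,5) by (intro K_mult) auto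
    qed (use snoc.prems y in \<open>auto simp: At_def\<close>)
    ultimately show "E y \<in> {b. (?X o\<^sub>L b) o\<^sub>L E u \<in> A}" by (simp add: X)
  qed
  then have "(?X o\<^sub>L a p) o\<^sub>L E u \<in> A" using snoc.prems(3)[of p] by auto
  then show ?case by (simp add: X)
qed

text \<open>Induction on the number of places where x is not integral. With z from
  \<open>local_decomp\<close> at one such place p, the quotient \<open>x \<otimes> inv z\<close> is
  integral at p and, elsewhere, exactly where x is.\<close>

lemma E_factorization:
  assumes "x \<in> carrier G"
  shows "\<exists>ps a. distinct ps \<and> set ps = {i \<in> I. x \<notin> K i} \<and> (\<forall>p\<in>set ps. a p \<in> Aloc p) \<and>
    E x = opprod a ps (E \<one>)"
  using assms
proof (induction "card {i \<in> I. x \<notin> K i}" arbitrary: x)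
  case 0
  then have "{i \<in> I. x \<notin> K i} = {}" using almost_all by simp
  then have "x \<in> cls \<one>" using 0 by (auto simp: cls_one H_def)
  then have "E x = E \<one>" by (intro E_cong cls_eq) simp_all
  with \<open>{i \<in> I. x \<notin> K i} = {}\<close> show ?case
    by (intro exI[of _ "[]"] exI[of _ "\<lambda>_. 0"]) simp
next
  case (Suc n)
  let ?B = "\<lambda>x. {i \<in> I. x \<notin> K i}"
  have fin: "finite (?B x)" using almost_all Suc.prems by simp
  have "?B x \<noteq> {}" using Suc.hyps(2) by force
  then obtain p where p: "p \<in> I" "x \<notin> K p" by auto
  obtain z where z: "z \<in> carrier G" "\<forall>j\<in>I - {p}. z \<in> K j" "x \<otimes> inv z \<in> K p"
    using local_decomp[OF p(1) Suc.prems] by blast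
  let ?k = "x \<otimes> inv z"
  have kG: "?k \<in> carrier G" using Suc.prems z by simp
  have xk: "x = ?k \<otimes> z" using Suc.prems z by (simp add: m_assoc)
  have iff: "?k \<in> K j \<longleftrightarrow> x \<in> K j" if j: "j \<in> I - {p}" for j
  proof
    assume "?k \<in> K j"
    then have "?k \<otimes> z \<in> K j" using j z K_mult[of j ?k z] by simp
    then show "x \<in> K j" by (simp flip: xk)
  next
    assume "x \<in> K j"
    then show "?k \<in> K j" using j z K_mult[of j x "inv z"] K_inv[of j z] by simp
  qed
  have Bk: "?B ?k = ?B x - {p}" using iff z(3) p by auto
  then have "card (?B ?k) = n" using Suc.hyps(2) p fin by simp
  from Suc.hyps(1)[OF this[symmetric] kG] obtain ps a where
    ps: "distinct ps" "set ps = ?B ?k" "\<forall>q\<in>set ps. a q \<in> Aloc q" "E ?k = opprod a ps (E \<one>)" by blast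
  have pps: "p \<notin> set ps" using ps(2) Bk by simp
  have kz: "?k \<in> K i \<or> z \<in> K i" if "i \<in> I" for i using z that by auto
  have "E x = E (?k \<otimes> z)" using xk by simp
  \<comment> \<open>\<open>E z\<close> is the factor at p and is to head the list, so the two
    factors are exchanged.\<close>
  also have "\<dots> = E (z \<otimes> ?k)" by (rule E_cong[OF cls_mult_commute[OF kG z(1) kz]])
  also have "\<dots> = E z o\<^sub>L E ?k" by (rule E_mult[symmetric, OF z(1) kG]) (use kz in blast)
  also have "\<dots> = opprod (a(p := E z)) (p # ps) (E \<one>)"
  proof -
    have "opprod (a(p := E z)) ps T = opprod a ps T" for T
      using pps by (induction ps) auto
    then show ?thesis by (simp add: ps(4))
  qed
  finally have "E x = opprod (a(p := E z)) (p # ps) (E \<one>)" .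
  moreover have "E z \<in> Aloc p" using z by (intro E_in_Aloc) (simp add: At_def)
  ultimately show ?case using ps pps Bk p
    by (intro exI[of _ "p # ps"] exI[of _ "a(p := E z)"]) auto
qed

text \<open>The image of \<open>A\<close> under amplification is closed because of the continuous
  left inverse, and it contains the elementary tensors, which are amplified products of local
  elements. Conversely every \<open>E x\<close> is such a product, so the elementary tensors span a
  dense part of the image.\<close>

theorem tensor_decomposition:
  "star_isomorphic A (spatial_tensor I (\<lambda>_. Y) (\<lambda>_. H) Aloc)"
proof -
  let ?el = "elementary_tensors I (\<lambda>_. Y) (\<lambda>_. H) Aloc"
  let ?V = "tensor.amp ` A"
  obtain \<psi> :: "('i \<Rightarrow> 'a set) op \<Rightarrow> 'a set op" where \<psi>: "bounded_linear \<psi>"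
    "\<And>T. tensor.supported T \<Longrightarrow> \<psi> (tensor.amp T) = T"
    by (rule tensor.amp_left_inverse[OF constant_in_Z]) blast
  have \<psi>A: "\<psi> (tensor.amp T) = T" if "T \<in> A" for T using \<psi>(2)[OF supported_A[OF that]] .
  have closedV: "closed ?V"
  proof -
    have "?V = {S. \<psi> S \<in> A \<and> tensor.amp (\<psi> S) = S}"
      using \<psi>A by (auto simp: image_iff) metis
    moreover have "closed (\<psi> -` A)"
      by (rule closed_vimage[OF closed_A linear_continuous_on[OF \<psi>(1)]])
    moreover have "closed {S. tensor.amp (\<psi> S) = S}"
      by (intro closed_Collect_eq linear_continuous_on continuous_on_id
          bounded_linear_compose[OF tensor.bounded_linear_amp \<psi>(1)])
    ultimately show ?thesis by (simp add: vimage_def Collect_conj_eq closed_Int)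
  qed
  have subV: "complex_subspace ?V"
    unfolding complex_subspace_def
  proof safe
    show "0 \<in> ?V"
      using complex_subspaceD(1)[OF complex_subspace_A] linear_0[OF bounded_linear.linear[OF tensor.bounded_linear_amp]]
      by (metis imageI)
  qed (auto simp: tensor.amp_add[symmetric] tensor.amp_op_scale[symmetric]
      intro!: imageI complex_subspaceD[OF complex_subspace_A])
  have el: "T \<in> ?el" if "T = tensor.amp (opprod a ps (E \<one>))" "distinct ps" "set ps \<subseteq> I"
    "\<forall>p\<in>set ps. a p \<in> Aloc p" for T a ps
  proof -
    have "opprod a ps (E \<one>) \<in> A" using that by (intro opprod_in_A) (auto simp: K_one)
    then have "complex_linear T" unfolding that(1) by (intro tensor.complex_linear_amp complex_linear_A)
    then show ?thesis
      unfolding elementary_tensors_def RF_def[symmetric]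
      using that coef_amp_opprod[of ps a] unfolding complex_linear_def
      by (auto intro!: exI[of _ "set ps"] exI[of _ a])
  qed
  have "?el \<subseteq> ?V"
  proof
    fix T assume "T \<in> ?el"
    then obtain F a where F: "finite F" "F \<subseteq> I" "\<forall>i\<in>F. a i \<in> Aloc i" and lin: "complex_linear T"
      and T: "\<And>x y. coef T y x = (if x \<in> RF \<and> y \<in> RF \<and> (\<forall>i\<in>I - F. x i = y i)
         then \<Prod>i\<in>F. coef (a i) (y i) (x i) else 0)"
      unfolding elementary_tensors_def RF_def[symmetric] complex_linear_def by blast
    obtain ps where ps: "set ps = F" "distinct ps" using finite_distinct_list[OF F(1)] by blast
    have A: "opprod a ps (E \<one>) \<in> A" using F ps by (intro opprod_in_A) (auto simp: K_one)
    have "T = tensor.amp (opprod a ps (E \<one>))"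
    proof (rule complex_linear_coef_eqI[OF lin])
      show "complex_linear (tensor.amp (opprod a ps (E \<one>)))"
        by (intro tensor.complex_linear_amp complex_linear_A A)
      show "coef T y x = coef (tensor.amp (opprod a ps (E \<one>))) y x" for x y
        using F ps by (subst coef_amp_opprod) (auto simp: T)
    qed
    with A show "T \<in> ?V" by blast
  qed
  then have "spatial_tensor I (\<lambda>_. Y) (\<lambda>_. H) Aloc \<subseteq> ?V"
    unfolding spatial_tensor_def by (intro closure_minimal closedV complex_span_subset subV)
  moreover have "?V \<subseteq> spatial_tensor I (\<lambda>_. Y) (\<lambda>_. H) Aloc"
  proof -
    have basis: "op_scale c (tensor.amp (E x)) \<in> complex_span ?el" if x: "x \<in> carrier G" for c x
    proof -
      obtain ps a where "distinct ps" "set ps = {i \<in> I. x \<notin> K i}" "\<forall>p\<in>set ps. a p \<in> Aloc p"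
        "E x = opprod a ps (E \<one>)"
        using E_factorization[OF x] by blast
      then have "tensor.amp (E x) \<in> ?el" by (intro el[of _ a ps]) auto
      then show ?thesis unfolding complex_span_def by (intro span_base) auto
    qed
    have "tensor.amp (hecke_rep G H f) \<in> complex_span ?el" if f: "f \<in> locally_invariant" for f
    proof -
      obtain R where R: "finite R" "R \<subseteq> support f" "hecke_rep G H f = (\<Sum>x\<in>R. op_scale (f x) (E x))"
        using f by (rule locally_invariant_decomp)
      have "tensor.amp (hecke_rep G H f) = (\<Sum>x\<in>R. op_scale (f x) (tensor.amp (E x)))"
        unfolding R(3) linear_sum[OF bounded_linear.linear[OF tensor.bounded_linear_amp]]
        by (simp add: tensor.amp_op_scale)
      also have "\<dots> \<in> complex_span ?el"
        unfolding complex_span_def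
        by (rule span_sum) (use basis R(2) in \<open>auto simp: complex_span_def support_def\<close>)
      finally show ?thesis .
    qed
    then have "tensor.amp ` hecke_rep G H ` locally_invariant \<subseteq> complex_span ?el" by auto
    then have "tensor.amp ` closure (hecke_rep G H ` locally_invariant) \<subseteq> closure (complex_span ?el)"
      by (intro image_closure_subset linear_continuous_on tensor.bounded_linear_amp closed_closure)
         (use closure_subset in blast)
    then show ?thesis by (simp add: A_def spatial_tensor_def)
  qed
  ultimately have V: "?V = spatial_tensor I (\<lambda>_. Y) (\<lambda>_. H) Aloc" by (rule equalityI[rotated])
  have "inj_on tensor.amp A" using inj_on_inverseI[of A \<psi>] \<psi>A by blast
  then have "bij_betw tensor.amp A (spatial_tensor I (\<lambda>_. Y) (\<lambda>_. H) Aloc)"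
    unfolding V[symmetric] by (rule inj_on_imp_bij_betw)
  then show ?thesis
    unfolding star_isomorphic_def
    by (intro exI[of _ tensor.amp])
       (simp add: tensor.amp_add tensor.amp_compose supported_A tensor.amp_op_scale tensor.amp_op_adj complex_linear_A)
qed

end

subsection \<open>Averaging over symmetries\<close>

text \<open>The maps in \<open>T\<close> are only determined, and only multiplicative, up to \<open>H\<close>: they stand for the
  symmetries of a completion of \<open>G\<close>, expressed by representatives in \<open>G\<close>.\<close>

locale local_symmetries = local_family +
  fixes T :: "('a \<Rightarrow> 'a) set"
  assumes t_cls: "t \<in> T \<Longrightarrow> x \<in> carrier G \<Longrightarrow> t x \<in> cls x"
    and t_quot: "t \<in> T \<Longrightarrow> x \<in> carrier G \<Longrightarrow> y \<in> carrier G \<Longrightarrow>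
      \<exists>h\<in>H. \<exists>k\<in>H. t x \<otimes> inv (t y) = h \<otimes> t (x \<otimes> inv y) \<otimes> k"
    and t_trans: "x \<in> carrier G \<Longrightarrow> y \<in> cls x \<Longrightarrow> \<exists>t\<in>T. \<exists>h\<in>H. \<exists>k\<in>H. y = h \<otimes> t x \<otimes> k"
    and t_comp: "t \<in> T \<Longrightarrow> t' \<in> T \<Longrightarrow>
      \<exists>t''\<in>T. \<forall>x\<in>carrier G. \<exists>h\<in>H. \<exists>k\<in>H. t'' x = h \<otimes> t (t' x) \<otimes> k"
    and t_inv: "t \<in> T \<Longrightarrow> \<exists>t'\<in>T. \<forall>x\<in>carrier G. t (t' x) \<in> H #> x \<and> t' (t x) \<in> H #> x"
begin

lemma t_carrier: "t \<in> T \<Longrightarrow> x \<in> carrier G \<Longrightarrow> t x \<in> carrier G"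
  by (rule cls_carrier[OF t_cls])

lemma t_H:
  assumes "t \<in> T" "h \<in> H"
  shows "t h \<in> H"
proof -
  have "cls h = H" using cls_eq[OF one_closed, of h] assms(2) by (simp add: cls_one)
  then show ?thesis using t_cls[OF assms(1) H_carrier[OF assms(2)]] by simp
qed

lemma biinvariantD: "biinvariant f \<Longrightarrow> x \<in> carrier G \<Longrightarrow> h \<in> H \<Longrightarrow> k \<in> H \<Longrightarrow> f (h \<otimes> x \<otimes> k) = f x"
  by (simp add: biinvariant_def)

lemma biinvariant_left: "biinvariant f \<Longrightarrow> x \<in> carrier G \<Longrightarrow> h \<in> H \<Longrightarrow> f (h \<otimes> x) = f x"
  using biinvariantD[of f x h \<one>] by (simp add: H_one H_carrier)

text \<open>By \<open>t_quot\<close> the quotient of \<open>t (h \<otimes> x)\<close> and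
  \<open>t x\<close> is \<open>t h\<close> up to factors from H, and \<open>t h\<close> itself lies
  in H.\<close>

lemma t_left_coset:
  assumes t: "t \<in> T" and h: "h \<in> H" and x: "x \<in> carrier G"
  shows "\<exists>h'\<in>H. t (h \<otimes> x) = h' \<otimes> t x"
proof -
  have hx: "h \<otimes> x \<in> carrier G" using h x by (simp add: H_carrier)
  obtain a b where ab: "a \<in> H" "b \<in> H" "t (h \<otimes> x) \<otimes> inv (t x) = a \<otimes> t (h \<otimes> x \<otimes> inv x) \<otimes> b"
    using t_quot[OF t hx x] by blast
  have "h \<otimes> x \<otimes> inv x = h" using h x by (simp add: m_assoc H_carrier)
  then have "t (h \<otimes> x) \<otimes> inv (t x) \<in> H" using ab t_H[OF t h] by (simp add: H_mult)
  moreover have "t (h \<otimes> x) = (t (h \<otimes> x) \<otimes> inv (t x)) \<otimes> t x"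
    using t_carrier[OF t hx] t_carrier[OF t x] by (simp add: m_assoc)
  ultimately show ?thesis by blast
qed

lemma f_quot:
  assumes f: "biinvariant f" and t: "t \<in> T" and x: "x \<in> carrier G" and y: "y \<in> carrier G"
  shows "f (t x \<otimes> inv (t y)) = f (t (x \<otimes> inv y))"
proof -
  obtain h k where hk: "h \<in> H" "k \<in> H" "t x \<otimes> inv (t y) = h \<otimes> t (x \<otimes> inv y) \<otimes> k"
    using t_quot[OF t x y] by blast
  show ?thesis unfolding hk(3)
    by (rule biinvariantD[OF f t_carrier[OF t] hk(1,2)]) (use x y in simp)
qed

lemma f_t_biinvariant:
  assumes f: "biinvariant f" and t: "t \<in> T" and x: "x \<in> carrier G" and hk: "h \<in> H" "k \<in> H"
  shows "f (t (h \<otimes> x \<otimes> k)) = f (t x)"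
proof -
  have kG: "k \<in> carrier G" using hk(2) by (rule H_carrier)
  have xk: "x \<otimes> k \<in> carrier G" using x kG by simp
  have "h \<otimes> x \<otimes> k = h \<otimes> (x \<otimes> k)" using x kG H_carrier[OF hk(1)] by (simp add: m_assoc)
  then obtain h' where h': "h' \<in> H" "t (h \<otimes> x \<otimes> k) = h' \<otimes> t (x \<otimes> k)"
    using t_left_coset[OF t hk(1) xk] by auto
  \<comment> \<open>\<open>t_quot\<close> speaks of quotients only, so the right factor k is written
    as an inverse.\<close>
  then have "f (t (h \<otimes> x \<otimes> k)) = f (t (x \<otimes> inv (inv k)))"
    using biinvariant_left[OF f t_carrier[OF t xk]] kG by simp
  also have "\<dots> = f (t x \<otimes> inv (t (inv k)))"
    by (rule f_quot[OF f t x, symmetric]) (use kG in simp)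
  also have "\<dots> = f (\<one> \<otimes> t x \<otimes> inv (t (inv k)))" using t_carrier[OF t x] by simp
  also have "\<dots> = f (t x)"
    by (rule biinvariantD[OF f t_carrier[OF t x] H_one H_inv[OF t_H[OF t H_inv[OF hk(2)]]]])
  finally show ?thesis .
qed

section \<open>The action on Hecke functions and on operators\<close>

definition act :: "('a \<Rightarrow> 'a) \<Rightarrow> ('a \<Rightarrow> complex) \<Rightarrow> 'a \<Rightarrow> complex" where
  "act t f x = (if x \<in> carrier G then f (t x) else 0)"

text \<open>A finite set of cosets containing the supports of all transforms of f at once; it exists
  because the maps in T preserve classes.\<close>

definition cosets_near :: "('a \<Rightarrow> complex) \<Rightarrow> 'a set set" where
  "cosets_near f = (\<Union>C\<in>(\<lambda>x. H #> x) ` support f. (\<lambda>y. H #> y) ` cls (rep C))"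

lemma finite_cosets_near:
  assumes "f \<in> hecke_algebra G H"
  shows "finite (cosets_near f)"
  unfolding cosets_near_def
proof (rule finite_UN_I)
  show "finite ((\<lambda>x. H #> x) ` support f)" using assms by (simp add: hecke_algebra_iff)
  fix C assume "C \<in> (\<lambda>x. H #> x) ` support f"
  then have "C \<in> Y" by (auto simp: support_def intro: coset_in_Y)
  then show "finite ((\<lambda>y. H #> y) ` cls (rep C))" by (intro finite_cosets_cls rep_carrier)
qed

lemma support_act_near:
  assumes t: "t \<in> T" and x: "x \<in> support (act t f)"
  shows "H #> x \<in> cosets_near f"
proof -
  have xG: "x \<in> carrier G" and tx: "t x \<in> support f"
    using x t_carrier[OF t] by (auto simp: support_def act_def split: if_splits)
  have txG: "t x \<in> carrier G" using t xG by (rule t_carrier)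
  obtain h where h: "h \<in> H" "rep (H #> t x) = h \<otimes> t x" using rep_coset[OF txG] by blast
  have "h \<otimes> t x \<otimes> \<one> \<in> cls (t x)" by (rule cls_H[OF txG h(1) H_one])
  then have "rep (H #> t x) \<in> cls (t x)" using h txG by (simp add: H_carrier)
  then have "cls (rep (H #> t x)) = cls x"
    using cls_eq[OF txG] cls_eq[OF xG t_cls[OF t xG]] by simp
  then have "x \<in> cls (rep (H #> t x))" using cls_refl[OF xG] by simp
  then show ?thesis using tx unfolding cosets_near_def by blast
qed

lemma act_hecke:
  assumes t: "t \<in> T" and f: "f \<in> hecke_algebra G H"
  shows "act t f \<in> hecke_algebra G H"
proof -
  have fb: "biinvariant f" using f by (simp add: hecke_algebra_iff)
  have "biinvariant (act t f)"
    using f_t_biinvariant[OF fb t] by (simp add: biinvariant_def act_def H_carrier)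
  moreover have "(\<lambda>x. H #> x) ` support (act t f) \<subseteq> cosets_near f"
    using support_act_near[OF t] by blast
  then have "finite ((\<lambda>x. H #> x) ` support (act t f))"
    by (rule finite_subset[OF _ finite_cosets_near[OF f]])
  ultimately show ?thesis by (simp add: hecke_algebra_iff)
qed

definition perm :: "('a \<Rightarrow> 'a) \<Rightarrow> 'a set \<Rightarrow> 'a set" where
  "perm t C = H #> t (rep C)"

lemma perm_Y: "t \<in> T \<Longrightarrow> C \<in> Y \<Longrightarrow> perm t C \<in> Y"
  unfolding perm_def by (rule coset_in_Y[OF t_carrier[OF _ rep_carrier]])

lemma perm_coset:
  assumes t: "t \<in> T" and x: "x \<in> carrier G"
  shows "perm t (H #> x) = H #> t x"
proof -
  obtain h where h: "h \<in> H" "rep (H #> x) = h \<otimes> x" using rep_coset[OF x] by blast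
  obtain h' where h': "h' \<in> H" "t (h \<otimes> x) = h' \<otimes> t x" using t_left_coset[OF t h(1) x] by blast
  have "h' \<otimes> t x \<otimes> inv (t x) \<in> H" using h' t_carrier[OF t x] by (simp add: m_assoc H_carrier)
  then show ?thesis unfolding perm_def h(2) h'(2)
    using h' t_carrier[OF t x] by (subst coset_eq_iff[OF subgroup_H]) (auto simp: H_carrier)
qed

lemma perm_inverse:
  assumes t: "t \<in> T"
  obtains t' where "t' \<in> T" "\<And>C. C \<in> Y \<Longrightarrow> perm t (perm t' C) = C" "\<And>C. C \<in> Y \<Longrightarrow> perm t' (perm t C) = C"
proof -
  obtain t' where t': "t' \<in> T" "\<And>x. x \<in> carrier G \<Longrightarrow> t (t' x) \<in> H #> x" "\<And>x. x \<in> carrier G \<Longrightarrow> t' (t x) \<in> H #> x"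
    using t_inv[OF t] by blast
  have "perm t (perm t' C) = C \<and> perm t' (perm t C) = C" if C: "C \<in> Y" for C
  proof -
    have c: "rep C \<in> carrier G" using C by (rule rep_carrier)
    have "perm t (perm t' C) = H #> t (t' (rep C))"
      unfolding perm_def[of t' C] by (rule perm_coset[OF t t_carrier[OF t'(1) c]])
    moreover have "H #> t (t' (rep C)) = H #> rep C"
      by (rule repr_independence[OF t'(2)[OF c] c subgroup_H, symmetric])
    moreover have "perm t' (perm t C) = H #> t' (t (rep C))"
      unfolding perm_def[of t C] by (rule perm_coset[OF t'(1) t_carrier[OF t c]])
    moreover have "H #> t' (t (rep C)) = H #> rep C"
      by (rule repr_independence[OF t'(3)[OF c] c subgroup_H, symmetric])
    ultimately show ?thesis using coset_rep[OF C] by simp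
  qed
  with t'(1) that show thesis by blast
qed

lemma kernel_act:
  assumes f: "biinvariant f" and t: "t \<in> T" and C: "C \<in> Y" and D: "D \<in> Y"
  shows "kernel (act t f) C D = kernel f (perm t C) (perm t D)"
proof -
  have cd: "rep C \<in> carrier G" "rep D \<in> carrier G" using C D by (auto intro: rep_carrier)
  have tcd: "t (rep C) \<in> carrier G" "t (rep D) \<in> carrier G" using t_carrier[OF t] cd by auto
  obtain h where h: "h \<in> H" "rep (perm t C) = h \<otimes> t (rep C)"
    using rep_coset[OF tcd(1)] unfolding perm_def by blast
  obtain k where k: "k \<in> H" "rep (perm t D) = k \<otimes> t (rep D)"
    using rep_coset[OF tcd(2)] unfolding perm_def by blast
  have "rep (perm t C) \<otimes> inv (rep (perm t D)) = h \<otimes> (t (rep C) \<otimes> inv (t (rep D))) \<otimes> inv k"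
    using h k tcd by (simp add: H_carrier m_assoc inv_mult_group)
  then have "f (rep (perm t C) \<otimes> inv (rep (perm t D))) = f (t (rep C) \<otimes> inv (t (rep D)))"
    using biinvariantD[OF f _ h(1) H_inv[OF k(1)]] tcd by simp
  then show ?thesis
    using C D cd perm_Y[OF t] f_quot[OF f t cd] by (simp add: kernel_def act_def)
qed

lemma permutation_operator:
  fixes \<pi> :: "'a set \<Rightarrow> 'a set"
  assumes "inj_on \<pi> Y"
  obtains V :: "'a set op" where "norm V \<le> 1"
    "\<And>\<xi> C. ell2_apply (V \<xi>) C = (if C \<in> Y then ell2_apply \<xi> (\<pi> C) else 0)"
proof -
  let ?g = "\<lambda>\<xi> C. if C \<in> Y then ell2_apply \<xi> (\<pi> C) else 0"
  have bound: "(\<Sum>C\<in>F. (cmod (?g \<xi> C))\<^sup>2) \<le> (1 * norm \<xi>)\<^sup>2" if F: "finite F" for \<xi> :: "'a set ell2" and F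
  proof -
    have "(\<Sum>C\<in>F. (cmod (?g \<xi> C))\<^sup>2) = (\<Sum>C\<in>F \<inter> Y. (cmod (ell2_apply \<xi> (\<pi> C)))\<^sup>2)"
      using F by (intro sum.mono_neutral_cong_right) auto
    also have "\<dots> = (\<Sum>D\<in>\<pi> ` (F \<inter> Y). (cmod (ell2_apply \<xi> D))\<^sup>2)"
      by (subst sum.reindex) (auto intro: inj_on_subset[OF assms])
    also have "\<dots> \<le> (norm \<xi>)\<^sup>2" using F by (intro sum_cmod_le_norm_ell2) auto
    finally show ?thesis by simp
  qed
  obtain V :: "'a set op" where V: "\<And>\<xi>. ell2_apply (V \<xi>) = ?g \<xi>" "norm V \<le> 1"
    by (rule blinfun_ell2_exists[of ?g 1]) (use bound in auto)
  show thesis by (rule that[OF V(2)]) (simp add: V(1))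
qed

text \<open>The maps in T permute the cosets, and transforming a Hecke function conjugates its
  matrix by this permutation. Hence the action is induced by a linear map on all operators that does
  not increase norms.\<close>

lemma conjugation_exists:
  assumes t: "t \<in> T"
  obtains \<Phi> :: "'a set op \<Rightarrow> 'a set op" where "bounded_linear \<Phi>" "\<And>S. norm (\<Phi> S) \<le> norm S"
    "\<And>f. f \<in> hecke_algebra G H \<Longrightarrow> \<Phi> (hecke_rep G H f) = hecke_rep G H (act t f)"
proof -
  obtain t' where t': "t' \<in> T" "\<And>C. C \<in> Y \<Longrightarrow> perm t (perm t' C) = C" "\<And>C. C \<in> Y \<Longrightarrow> perm t' (perm t C) = C"
    using perm_inverse[OF t] by blast
  have inj: "inj_on (perm t) Y" "inj_on (perm t') Y"
    using t' inj_on_inverseI[of Y "perm t'" "perm t"] inj_on_inverseI[of Y "perm t" "perm t'"] by blast+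
  obtain V :: "'a set op" where V: "norm V \<le> 1"
    "\<And>\<xi> C. ell2_apply (V \<xi>) C = (if C \<in> Y then ell2_apply \<xi> (perm t C) else 0)"
    using permutation_operator[OF inj(1)] by blast
  obtain W :: "'a set op" where W: "norm W \<le> 1"
    "\<And>\<xi> C. ell2_apply (W \<xi>) C = (if C \<in> Y then ell2_apply \<xi> (perm t' C) else 0)"
    using permutation_operator[OF inj(2)] by blast
  let ?\<Phi> = "\<lambda>S. (V o\<^sub>L S) o\<^sub>L W"
  have lin: "bounded_linear ?\<Phi>"
    by (intro bounded_linear_compose[OF bounded_bilinear.bounded_linear_left[OF bounded_bilinear_blinfun_compose]]
        bounded_bilinear.bounded_linear_right[OF bounded_bilinear_blinfun_compose])
  have norm: "norm (?\<Phi> S) \<le> norm S" for S :: "'a set op"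
  proof -
    have "norm (?\<Phi> S) \<le> norm (V o\<^sub>L S) * norm W" by (rule norm_blinfun_compose)
    also have "\<dots> \<le> norm (V o\<^sub>L S) * 1" by (intro mult_left_mono W norm_ge_zero)
    also have "\<dots> \<le> norm V * norm S" using norm_blinfun_compose[of V S] by simp
    also have "\<dots> \<le> 1 * norm S" by (intro mult_right_mono V norm_ge_zero)
    finally show ?thesis by simp
  qed
  have Wk: "W (ket D) = (if D \<in> Y then ket (perm t D) else 0)" for D
  proof (rule ell2_eqI)
    fix C
    have "perm t' C = D \<longleftrightarrow> D \<in> Y \<and> C = perm t D" if "C \<in> Y"
      using that t'(2)[OF that] t'(3)[of D] perm_Y[OF t'(1) that] by auto
    then show "ell2_apply (W (ket D)) C = ell2_apply (if D \<in> Y then ket (perm t D) else 0) C"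
      using perm_Y[OF t, of D] by (cases "C \<in> Y") (auto simp: W ell2_apply_ket)
  qed
  have cV: "complex_linear V" and cW: "complex_linear W"
    unfolding complex_linear_def by (intro allI ell2_eqI; simp add: V W)+
  have act: "?\<Phi> (hecke_rep G H f) = hecke_rep G H (act t f)" if f: "f \<in> hecke_algebra G H" for f
  proof (rule complex_linear_coef_eqI)
    show "complex_linear (?\<Phi> (hecke_rep G H f))" "complex_linear (hecke_rep G H (act t f))"
      by (intro complex_linear_compose cV cW complex_linear_hecke_rep f act_hecke[OF t f])+
    fix D C
    have fb: "biinvariant f" using f by (simp add: hecke_algebra_iff)
    have "coef (?\<Phi> (hecke_rep G H f)) C D =
        (if C \<in> Y \<and> D \<in> Y then coef (hecke_rep G H f) (perm t C) (perm t D) else 0)"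
      by (simp add: coef_def V Wk)
    also have "\<dots> = (if C \<in> Y \<and> D \<in> Y then kernel (act t f) C D else 0)"
      using kernel_act[OF fb t] by (simp add: coef_hecke_rep[OF f])
    also have "\<dots> = coef (hecke_rep G H (act t f)) C D"
      by (simp add: coef_hecke_rep[OF act_hecke[OF t f]] kernel_def)
    finally show "coef (?\<Phi> (hecke_rep G H f)) C D = coef (hecke_rep G H (act t f)) C D" .
  qed
  show thesis by (rule that[OF lin norm act])
qed

text \<open>The definition of \<open>alpha\<close> with \<open>act t\<close> in place of the adelic
  formula; \<open>alpha_eq\<close> matches the two.\<close>

definition ext :: "('a \<Rightarrow> 'a) \<Rightarrow> 'a set op \<Rightarrow> 'a set op" where
  "ext t = (THE \<Phi>. \<Phi> \<in> extensional (reduced_hecke_algebra G H) \<and>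
     continuous_on (reduced_hecke_algebra G H) \<Phi> \<and>
     (\<forall>f\<in>hecke_algebra G H. \<Phi> (hecke_rep G H f) = hecke_rep G H (act t f)))"

text \<open>Conjugation is a continuous extension, and the density of the Hecke operators makes it
  the only one; this resolves the definite description in \<open>ext\<close>.\<close>

lemma ext_conjugation:
  assumes t: "t \<in> T"
  obtains \<Phi> :: "'a set op \<Rightarrow> 'a set op" where "bounded_linear \<Phi>" "\<And>S. norm (\<Phi> S) \<le> norm S"
    "\<And>f. f \<in> hecke_algebra G H \<Longrightarrow> \<Phi> (hecke_rep G H f) = hecke_rep G H (act t f)"
    "\<And>S. S \<in> reduced_hecke_algebra G H \<Longrightarrow> ext t S = \<Phi> S"
proof -
  obtain \<Phi> :: "'a set op \<Rightarrow> 'a set op" where \<Phi>: "bounded_linear \<Phi>" "\<And>S. norm (\<Phi> S) \<le> norm S"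
    "\<And>f. f \<in> hecke_algebra G H \<Longrightarrow> \<Phi> (hecke_rep G H f) = hecke_rep G H (act t f)"
    using conjugation_exists[OF t] by blast
  let ?R = "reduced_hecke_algebra G H" and ?h = "hecke_rep G H ` hecke_algebra G H"
  have R: "?R = closure ?h" by (simp add: reduced_hecke_algebra_def)
  have hR: "hecke_rep G H f \<in> ?R" if "f \<in> hecke_algebra G H" for f
    unfolding R by (intro closure_subset[THEN subsetD] imageI that)
  have "ext t = restrict \<Phi> ?R" unfolding ext_def
  proof (rule the_equality)
    have "continuous_on ?R \<Phi>" by (rule linear_continuous_on[OF \<Phi>(1)])
    then have "continuous_on ?R (restrict \<Phi> ?R)"
      by (rule continuous_on_eq) simp
    then show "restrict \<Phi> ?R \<in> extensional ?R \<and> continuous_on ?R (restrict \<Phi> ?R) \<and>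
        (\<forall>f\<in>hecke_algebra G H. restrict \<Phi> ?R (hecke_rep G H f) = hecke_rep G H (act t f))"
      using \<Phi>(3) hR by simp
  next
    fix \<Psi> :: "'a set op \<Rightarrow> 'a set op"
    assume \<Psi>: "\<Psi> \<in> extensional ?R \<and> continuous_on ?R \<Psi> \<and>
        (\<forall>f\<in>hecke_algebra G H. \<Psi> (hecke_rep G H f) = hecke_rep G H (act t f))"
    show "\<Psi> = restrict \<Phi> ?R"
    proof (rule extensionalityI[of _ ?R])
      fix x assume x: "x \<in> ?R"
      have cont: "continuous_on (closure ?h) (\<lambda>x. \<Psi> x - \<Phi> x)"
        using \<Psi> linear_continuous_on[OF \<Phi>(1)] unfolding R by (intro continuous_on_diff) blast+
      have 0: "\<Psi> y - \<Phi> y = 0" if "y \<in> ?h" for y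
        using that \<Psi> \<Phi>(3) by auto
      have "\<Psi> x - \<Phi> x = 0"
        by (rule continuous_constant_on_closure[OF cont 0 x[unfolded R]])
      then show "\<Psi> x = restrict \<Phi> ?R x" using x by simp
    qed (use \<Psi> in simp_all)
  qed
  then show thesis by (intro that[OF \<Phi>]) simp_all
qed

text \<open>The mean is taken over the orbit of f and not over T: the orbit is finite even when T is
  infinite.\<close>

definition average :: "('a \<Rightarrow> complex) \<Rightarrow> 'a \<Rightarrow> complex" where
  "average f x = (\<Sum>g\<in>(\<lambda>t. act t f) ` T. g x) / of_nat (card ((\<lambda>t. act t f) ` T))"

lemma T_nonempty: "T \<noteq> {}"
  using t_trans[OF one_closed cls_refl[OF one_closed]] by blast

text \<open>A transform of f is determined by its values on the finitely many cosets near f, and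
  these values are 0 or lie in the finite range of f.\<close>

lemma finite_orbit:
  assumes f: "f \<in> hecke_algebra G H"
  shows "finite ((\<lambda>t. act t f) ` T)"
proof (rule finite_imageD)
  let ?\<rho> = "\<lambda>g. restrict (\<lambda>C. g (rep C)) (cosets_near f)"
  have "?\<rho> ` (\<lambda>t. act t f) ` T \<subseteq> cosets_near f \<rightarrow>\<^sub>E insert 0 (range f)"
    by (auto simp: act_def)
  moreover have "finite (cosets_near f \<rightarrow>\<^sub>E insert 0 (range f))"
    using finite_cosets_near[OF f] hecke_finite_range[OF f] by (intro finite_PiE) simp_all
  ultimately show "finite (?\<rho> ` (\<lambda>t. act t f) ` T)" by (rule finite_subset)
  show "inj_on ?\<rho> ((\<lambda>t. act t f) ` T)"
  proof (rule inj_onI)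
    fix g g' assume g: "g \<in> (\<lambda>t. act t f) ` T" "g' \<in> (\<lambda>t. act t f) ` T" and eq: "?\<rho> g = ?\<rho> g'"
    have val: "g x = (if x \<in> carrier G \<and> H #> x \<in> cosets_near f then ?\<rho> g (H #> x) else 0)"
      if g: "g \<in> (\<lambda>t. act t f) ` T" for g x
    proof -
      obtain t where t: "t \<in> T" "g = act t f" using g by blast
      have gb: "biinvariant g" using act_hecke[OF t(1) f] t(2) by (simp add: hecke_algebra_iff)
      show ?thesis
      proof (cases "x \<in> carrier G \<and> H #> x \<in> cosets_near f")
        case True
        then have "H #> x \<in> Y" by (intro coset_in_Y) simp
        then have "g x = g (rep (H #> x))"
          using True by (intro biinvariant_coset[OF gb]) (simp_all add: coset_rep rep_carrier)
        with True show ?thesis by simp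
      next
        case False
        have "x \<notin> support g" using False support_act_near[OF t(1), of x f] t(2) by (auto simp: support_def)
        then have "g x = 0" using gb by (auto simp: support_def biinvariant_def)
        then show ?thesis unfolding if_not_P[OF False] .
      qed
    qed
    show "g = g'"
    proof (rule HOL.ext)
      fix x
      show "g x = g' x"
        by (rule trans[OF val[OF g(1)] trans[OF _ val[OF g(2), symmetric]]]) (simp only: eq)
    qed
  qed
qed

text \<open>Composition keeps the orbit stable, \<open>t_inv\<close> makes the map injective, and an
  injective self-map of a finite set is bijective.\<close>

lemma act_orbit:
  assumes f: "f \<in> hecke_algebra G H" and t: "t \<in> T"
  shows "bij_betw (act t) ((\<lambda>s. act s f) ` T) ((\<lambda>s. act s f) ` T)"
proof -
  let ?O = "(\<lambda>s. act s f) ` T"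
  have fb: "biinvariant f" using f by (simp add: hecke_algebra_iff)
  have sub: "act t ` ?O \<subseteq> ?O"
  proof (clarify)
    fix s assume s: "s \<in> T"
    obtain r where r: "r \<in> T" "\<And>x. x \<in> carrier G \<Longrightarrow> \<exists>h\<in>H. \<exists>k\<in>H. r x = h \<otimes> s (t x) \<otimes> k"
      using t_comp[OF s t] by blast
    have "act t (act s f) x = act r f x" for x
    proof (cases "x \<in> carrier G")
      case True
      obtain h k where hk: "h \<in> H" "k \<in> H" "r x = h \<otimes> s (t x) \<otimes> k" using r(2)[OF True] by blast
      have "s (t x) \<in> carrier G" by (rule t_carrier[OF s t_carrier[OF t True]])
      then have "f (r x) = f (s (t x))" unfolding hk(3) by (intro biinvariantD[OF fb] hk)
      then show ?thesis using True t_carrier[OF t True] by (simp add: act_def)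
    qed (simp add: act_def)
    then have "act t (act s f) = act r f" by (rule HOL.ext)
    then show "act t (act s f) \<in> ?O" using r(1) by (rule image_eqI)
  qed
  have inj: "inj_on (act t) ?O"
  proof (rule inj_onI)
    fix g g' assume g: "g \<in> ?O" "g' \<in> ?O" and eq: "act t g = act t g'"
    have gb: "biinvariant g" "biinvariant g'"
      using g act_hecke[OF _ f] by (auto simp: hecke_algebra_iff)
    obtain t' where t': "t' \<in> T" "\<And>x. x \<in> carrier G \<Longrightarrow> t (t' x) \<in> H #> x" using t_inv[OF t] by blast
    show "g = g'"
    proof (rule HOL.ext)
      fix x
      show "g x = g' x"
      proof (cases "x \<in> carrier G")
        case True
        have t'x: "t' x \<in> carrier G" using t'(1) True by (rule t_carrier)
        obtain h where h: "h \<in> H" "t (t' x) = h \<otimes> x" using t'(2)[OF True] by (auto simp: r_coset_def)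
        have "g x = g (t (t' x))" "g' x = g' (t (t' x))"
          unfolding h(2) using biinvariant_left[OF gb(1) True h(1)] biinvariant_left[OF gb(2) True h(1)] by auto
        then show ?thesis using fun_cong[OF eq, of "t' x"] t'x by (simp add: act_def)
      qed (use gb in \<open>simp add: biinvariant_def\<close>)
    qed
  qed
  show ?thesis
    using inj endo_inj_surj[OF finite_orbit[OF f] sub inj] by (simp add: bij_betw_def)
qed

lemma sum_hecke:
  assumes "finite F" "\<And>g. g \<in> F \<Longrightarrow> g \<in> hecke_algebra G H"
  shows "(\<lambda>x. \<Sum>g\<in>F. g x) \<in> hecke_algebra G H"
  using assms
proof (induction F rule: finite_induct)
  case (insert g F)
  then have "(\<lambda>x. g x + (\<Sum>g\<in>F. g x)) \<in> hecke_algebra G H"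
    by (intro hecke_algebra_add) simp_all
  with insert.hyps show ?case by simp
qed (simp add: hecke_algebra_zero)

lemma average_hecke:
  assumes f: "f \<in> hecke_algebra G H"
  shows "average f \<in> hecke_algebra G H"
proof -
  have "(\<lambda>x. \<Sum>g\<in>(\<lambda>t. act t f) ` T. g x) \<in> hecke_algebra G H"
    by (rule sum_hecke[OF finite_orbit[OF f]]) (auto intro: act_hecke f)
  from hecke_algebra_scale[OF this, of "1 / of_nat (card ((\<lambda>t. act t f) ` T))"]
  show ?thesis by (simp add: average_def[abs_def])
qed

text \<open>Up to H a class is one orbit of T, by \<open>t_trans\<close>, and moving the argument by
  t only permutes the summands of the mean.\<close>

lemma average_locally_invariant:
  assumes f: "f \<in> hecke_algebra G H"
  shows "average f \<in> locally_invariant"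
  unfolding locally_invariant_def
proof (intro CollectI conjI ballI)
  show h: "average f \<in> hecke_algebra G H" by (rule average_hecke[OF f])
  then have ab: "biinvariant (average f)" by (simp add: hecke_algebra_iff)
  fix x y assume x: "x \<in> carrier G" and y: "y \<in> cls x"
  let ?O = "(\<lambda>s. act s f) ` T"
  obtain t h k where t: "t \<in> T" "h \<in> H" "k \<in> H" "y = h \<otimes> t x \<otimes> k" using t_trans[OF x y] by blast
  have 1: "average f y = average f (t x)"
    unfolding t(4) by (rule biinvariantD[OF ab t_carrier[OF t(1) x] t(2,3)])
  have "(\<Sum>g\<in>?O. g (t x)) = (\<Sum>g\<in>?O. act t g x)"
    using x by (simp add: act_def)
  then have "average f (t x) = average f x"
    using sum.reindex_bij_betw[OF act_orbit[OF f t(1)], of "\<lambda>g. g x"] by (simp add: average_def)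
  with 1 show "average f y = average f x" by simp
qed

lemma support_average:
  assumes B: "\<And>x y. x \<in> B \<Longrightarrow> y \<in> cls x \<Longrightarrow> y \<in> B" and supp: "support f \<subseteq> B"
  shows "support (average f) \<subseteq> B"
proof
  fix x assume "x \<in> support (average f)"
  then have xG: "x \<in> carrier G" and "(\<Sum>g\<in>(\<lambda>t. act t f) ` T. g x) \<noteq> 0"
    by (auto simp: support_def average_def)
  then obtain g where "g \<in> (\<lambda>t. act t f) ` T" "g x \<noteq> 0" by (blast elim: sum.not_neutral_contains_not_neutral)
  then obtain t where t: "t \<in> T" "act t f x \<noteq> 0" by blast
  then have "t x \<in> support f" using xG t_carrier[OF t(1) xG] by (simp add: support_def act_def)
  then show "x \<in> B" using B[of "t x" x] supp cls_sym[OF xG t_cls[OF t(1) xG]] by blast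
qed

text \<open>For the nontrivial inclusion let f approximate a fixed S. The action fixes S and does
  not increase norms, so all transforms of f, and hence their mean, are at least as close to S as f
  is.\<close>

lemma fixed_algebra:
  assumes B: "\<And>x y. x \<in> B \<Longrightarrow> y \<in> cls x \<Longrightarrow> y \<in> B"
  shows "{S \<in> closure (hecke_rep G H ` {f \<in> hecke_algebra G H. support f \<subseteq> B}). \<forall>t\<in>T. ext t S = S}
    = closure (hecke_rep G H ` {f \<in> locally_invariant. support f \<subseteq> B})" (is "?L = closure (_ ` ?F)")
proof (intro equalityI subsetI)
  let ?R = "reduced_hecke_algebra G H"
  have SR: "closure (hecke_rep G H ` {f \<in> hecke_algebra G H. support f \<subseteq> B}) \<subseteq> ?R"
    unfolding reduced_hecke_algebra_def by (intro closure_mono) auto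
  show "S \<in> ?L" if S: "S \<in> closure (hecke_rep G H ` ?F)" for S
  proof -
    have "closure (hecke_rep G H ` ?F) \<subseteq> closure (hecke_rep G H ` {f \<in> hecke_algebra G H. support f \<subseteq> B})"
      by (intro closure_mono) (auto simp: locally_invariant_def)
    with S have S': "S \<in> closure (hecke_rep G H ` {f \<in> hecke_algebra G H. support f \<subseteq> B})" by blast
    have "ext t S = S" if t: "t \<in> T" for t
    proof -
      obtain \<Phi> :: "'a set op \<Rightarrow> 'a set op" where \<Phi>: "bounded_linear \<Phi>" "\<And>S. norm (\<Phi> S) \<le> norm S"
        "\<And>f. f \<in> hecke_algebra G H \<Longrightarrow> \<Phi> (hecke_rep G H f) = hecke_rep G H (act t f)"
        "\<And>S. S \<in> ?R \<Longrightarrow> ext t S = \<Phi> S"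
        using ext_conjugation[OF t] by blast
      have "closure (hecke_rep G H ` ?F) \<subseteq> {S. \<Phi> S = S}"
      proof (rule closure_minimal)
        show "closed {S. \<Phi> S = S}"
          by (intro closed_Collect_eq linear_continuous_on[OF \<Phi>(1)] continuous_on_id)
        show "hecke_rep G H ` ?F \<subseteq> {S. \<Phi> S = S}"
        proof (rule image_subsetI)
          fix f assume "f \<in> ?F"
          then have f: "f \<in> locally_invariant" by simp
          note fH = locally_invariant_hecke[OF f]
          have "act t f x = f x" for x
          proof (cases "x \<in> carrier G")
            case True
            then show ?thesis using locally_invariant_cls[OF f True t_cls[OF t True]] by (simp add: act_def)
          qed (use fH in \<open>simp add: act_def hecke_algebra_iff biinvariant_def\<close>)
          then have "act t f = f" by (rule HOL.ext)
          then show "hecke_rep G H f \<in> {S. \<Phi> S = S}" using \<Phi>(3)[OF fH] by simp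
        qed
      qed
      then have "\<Phi> S = S" using S by blast
      then show ?thesis using \<Phi>(4)[OF subsetD[OF SR S']] by simp
    qed
    with S' show ?thesis by blast
  qed
  fix S assume "S \<in> ?L"
  then have S: "S \<in> closure (hecke_rep G H ` {f \<in> hecke_algebra G H. support f \<subseteq> B})"
    and fixed: "\<And>t. t \<in> T \<Longrightarrow> ext t S = S" by auto
  show "S \<in> closure (hecke_rep G H ` ?F)"
    unfolding closure_approachable
  proof (intro allI impI)
    fix e :: real assume e: "e > 0"
    obtain f where f: "f \<in> hecke_algebra G H" "support f \<subseteq> B" and d: "dist (hecke_rep G H f) S < e"
      using S e unfolding closure_approachable by blast
    let ?O = "(\<lambda>t. act t f) ` T" and ?n = "card ((\<lambda>t. act t f) ` T)"
    have n: "?n > 0" using finite_orbit[OF f(1)] T_nonempty by (simp add: card_gt_0_iff)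
    have close: "norm (hecke_rep G H g - S) \<le> norm (hecke_rep G H f - S)" if "g \<in> ?O" for g
    proof -
      obtain t where t: "t \<in> T" "g = act t f" using \<open>g \<in> ?O\<close> by blast
      obtain \<Phi> :: "'a set op \<Rightarrow> 'a set op" where \<Phi>: "bounded_linear \<Phi>" "\<And>S. norm (\<Phi> S) \<le> norm S"
        "\<And>f. f \<in> hecke_algebra G H \<Longrightarrow> \<Phi> (hecke_rep G H f) = hecke_rep G H (act t f)"
        "\<And>S. S \<in> ?R \<Longrightarrow> ext t S = \<Phi> S"
        using ext_conjugation[OF t(1)] by blast
      have "\<Phi> S = S" using \<Phi>(4)[OF subsetD[OF SR S]] fixed[OF t(1)] by simp
      then have "hecke_rep G H g - S = \<Phi> (hecke_rep G H f - S)"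
        using \<Phi>(3)[OF f(1)] t(2) by (simp add: linear_diff[OF bounded_linear.linear[OF \<Phi>(1)]])
      then show ?thesis using \<Phi>(2) by simp
    qed
    have rep: "hecke_rep G H (average f) = (1 / real ?n) *\<^sub>R (\<Sum>g\<in>?O. hecke_rep G H g)"
    proof (rule complex_linear_coef_eqI)
      have OH: "g \<in> hecke_algebra G H" if "g \<in> ?O" for g using that act_hecke[OF _ f(1)] by blast
      show "complex_linear (hecke_rep G H (average f))"
        by (rule complex_linear_hecke_rep[OF average_hecke[OF f(1)]])
      show "complex_linear ((1 / real ?n) *\<^sub>R (\<Sum>g\<in>?O. hecke_rep G H g))"
        by (intro complex_linear_simps(3) complex_linear_sum complex_linear_hecke_rep OH)
      fix D C
      have "coef ((1 / real ?n) *\<^sub>R (\<Sum>g\<in>?O. hecke_rep G H g)) C D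
          = (1 / real ?n) *\<^sub>R (\<Sum>g\<in>?O. kernel g C D)"
        unfolding coef_simps coef_sum by (simp only: coef_hecke_rep[OF OH] cong: sum.cong)
      also have "\<dots> = kernel (average f) C D"
        by (cases "C \<in> Y \<and> D \<in> Y") (auto simp: kernel_def average_def scaleR_conv_of_real)
      finally show "coef (hecke_rep G H (average f)) C D
          = coef ((1 / real ?n) *\<^sub>R (\<Sum>g\<in>?O. hecke_rep G H g)) C D"
        by (simp only: coef_hecke_rep[OF average_hecke[OF f(1)]])
    qed
    have "S = (1 / real ?n) *\<^sub>R (\<Sum>g\<in>?O. S)"
      using n by (simp only: sum_constant_scaleR scaleR_scaleR) simp
    then have "hecke_rep G H (average f) - S = (1 / real ?n) *\<^sub>R (\<Sum>g\<in>?O. (hecke_rep G H g - S))"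
      unfolding rep sum_subtractf scaleR_right_diff_distrib by simp
    then have "norm (hecke_rep G H (average f) - S) = (1 / real ?n) * norm (\<Sum>g\<in>?O. (hecke_rep G H g - S))"
      by simp
    also have "\<dots> \<le> (1 / real ?n) * (\<Sum>g\<in>?O. norm (hecke_rep G H g - S))"
      by (intro mult_left_mono norm_sum) simp
    also have "\<dots> \<le> (1 / real ?n) * (real ?n * norm (hecke_rep G H f - S))"
      by (intro mult_left_mono sum_bounded_above close) simp_all
    also have "\<dots> = norm (hecke_rep G H f - S)" using n by simp
    finally have "dist (hecke_rep G H (average f)) S < e" using d by (simp add: dist_norm)
    moreover have "average f \<in> ?F"
      using average_locally_invariant[OF f(1)] support_average[of B f] B f(2) by blast
    ultimately show "\<exists>y\<in>hecke_rep G H ` ?F. dist y S < e" by blast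
  qed
qed

end

section \<open>Symmetries of a completion\<close>

text \<open>B plays the role of a completion of G and B0 that of a compact open subgroup.
  \<open>B_decomp\<close> and \<open>B0_approx\<close> are the consequences of density in use: each
  coset of B0 has a representative from G, and right multiplication by B0 can be traded for one by
  H. The last two assumptions say that the orbits of \<Theta> on double cosets are the
  classes.\<close>

locale adelic_completion = local_family G I K + B: group B
  for G :: "('a, 'g) monoid_scheme" (structure) and I :: "'i set" and K :: "'i \<Rightarrow> 'a set"
    and B :: "('b, 'h) monoid_scheme" +
  fixes B0 :: "'b set" and \<iota> :: "'a \<Rightarrow> 'b" and \<Theta> :: "('b \<Rightarrow> 'b) set"
  assumes subgroup_B0: "subgroup B0 B"
    and \<iota>_hom: "\<iota> \<in> hom G B"
    and B_decomp: "X \<in> carrier B \<Longrightarrow> \<exists>y\<in>carrier G. \<exists>k\<in>B0. X = k \<otimes>\<^bsub>B\<^esub> \<iota> y"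
    and \<iota>_B0: "x \<in> carrier G \<Longrightarrow> \<iota> x \<in> B0 \<longleftrightarrow> x \<in> H"
    and B0_approx: "x \<in> carrier G \<Longrightarrow> k \<in> B0 \<Longrightarrow>
      \<exists>h\<in>H. \<exists>l\<in>B0. \<iota> x \<otimes>\<^bsub>B\<^esub> k = l \<otimes>\<^bsub>B\<^esub> \<iota> (x \<otimes> h)"
    and \<Theta>_hom: "\<theta> \<in> \<Theta> \<Longrightarrow> \<theta> \<in> hom B B"
    and \<Theta>_B0: "\<theta> \<in> \<Theta> \<Longrightarrow> k \<in> B0 \<Longrightarrow> \<theta> k \<in> B0"
    and \<Theta>_comp: "\<theta> \<in> \<Theta> \<Longrightarrow> \<theta>' \<in> \<Theta> \<Longrightarrow> \<exists>\<theta>''\<in>\<Theta>. \<forall>X\<in>carrier B. \<theta>'' X = \<theta> (\<theta>' X)"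
    and \<Theta>_inv: "\<theta> \<in> \<Theta> \<Longrightarrow> \<exists>\<theta>'\<in>\<Theta>. \<forall>X\<in>carrier B. \<theta> (\<theta>' X) = X \<and> \<theta>' (\<theta> X) = X"
    and \<Theta>_cls: "\<theta> \<in> \<Theta> \<Longrightarrow> x \<in> carrier G \<Longrightarrow> y \<in> carrier G \<Longrightarrow> k \<in> B0 \<Longrightarrow>
      \<theta> (\<iota> x) = k \<otimes>\<^bsub>B\<^esub> \<iota> y \<Longrightarrow> y \<in> cls x"
    and cls_\<Theta>: "x \<in> carrier G \<Longrightarrow> y \<in> cls x \<Longrightarrow>
      \<exists>\<theta>\<in>\<Theta>. \<exists>k\<in>B0. \<exists>l\<in>B0. \<theta> (\<iota> x) = k \<otimes>\<^bsub>B\<^esub> \<iota> y \<otimes>\<^bsub>B\<^esub> l"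
begin

lemma B0_closed:
  shows B0_carrier: "k \<in> B0 \<Longrightarrow> k \<in> carrier B"
    and B0_mult: "k \<in> B0 \<Longrightarrow> l \<in> B0 \<Longrightarrow> k \<otimes>\<^bsub>B\<^esub> l \<in> B0"
    and B0_inv: "k \<in> B0 \<Longrightarrow> inv\<^bsub>B\<^esub> k \<in> B0"
    and B0_one: "\<one>\<^bsub>B\<^esub> \<in> B0"
  using subgroup.mem_carrier[OF subgroup_B0] subgroup.m_closed[OF subgroup_B0]
    subgroup.m_inv_closed[OF subgroup_B0] subgroup.one_closed[OF subgroup_B0]
  by blast+

lemma \<iota>_carrier: "x \<in> carrier G \<Longrightarrow> \<iota> x \<in> carrier B"
  using \<iota>_hom by (auto simp: hom_def)

lemma \<iota>_mult: "x \<in> carrier G \<Longrightarrow> y \<in> carrier G \<Longrightarrow> \<iota> (x \<otimes> y) = \<iota> x \<otimes>\<^bsub>B\<^esub> \<iota> y"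
  using \<iota>_hom by (auto simp: hom_def)

interpretation \<iota>: group_hom G B \<iota>
  by unfold_locales (rule \<iota>_hom)

lemma \<iota>_inv: "x \<in> carrier G \<Longrightarrow> \<iota> (inv x) = inv\<^bsub>B\<^esub> (\<iota> x)"
  by (rule \<iota>.hom_inv)

lemma \<iota>_coset:
  assumes y: "y \<in> carrier G" "z \<in> carrier G" and k: "k \<in> B0" "l \<in> B0"
    and eq: "k \<otimes>\<^bsub>B\<^esub> \<iota> y = l \<otimes>\<^bsub>B\<^esub> \<iota> z"
  shows "y \<otimes> inv z \<in> H"
proof -
  have c: "k \<in> carrier B" "l \<in> carrier B" "\<iota> y \<in> carrier B" "\<iota> z \<in> carrier B"
    using k y by (simp_all add: B0_carrier \<iota>_carrier)
  have "\<iota> (y \<otimes> inv z) = inv\<^bsub>B\<^esub> k \<otimes>\<^bsub>B\<^esub> (k \<otimes>\<^bsub>B\<^esub> \<iota> y) \<otimes>\<^bsub>B\<^esub> inv\<^bsub>B\<^esub> (\<iota> z)"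
    using c y by (simp add: \<iota>_mult \<iota>_inv B.m_assoc[symmetric])
  also have "\<dots> = inv\<^bsub>B\<^esub> k \<otimes>\<^bsub>B\<^esub> l"
    unfolding eq using c by (simp add: B.m_assoc)
  finally have "\<iota> (y \<otimes> inv z) \<in> B0" using k by (simp add: B0_mult B0_inv)
  moreover have "y \<otimes> inv z \<in> carrier G" using y by simp
  ultimately show ?thesis using \<iota>_B0 by blast
qed

text \<open>\<open>B0_approx\<close> trades the right factor l for one in H; what remains on the
  left lies both in B0 and in the image of G, hence comes from H.\<close>

lemma \<iota>_double_coset:
  assumes u: "u \<in> carrier G" and v: "v \<in> carrier G" and k: "k \<in> B0" and l: "l \<in> B0"
    and eq: "\<iota> v = k \<otimes>\<^bsub>B\<^esub> \<iota> u \<otimes>\<^bsub>B\<^esub> l"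
  shows "\<exists>h\<in>H. \<exists>h'\<in>H. v = h \<otimes> u \<otimes> h'"
proof -
  obtain h' l' where h': "h' \<in> H" "l' \<in> B0" "\<iota> u \<otimes>\<^bsub>B\<^esub> l = l' \<otimes>\<^bsub>B\<^esub> \<iota> (u \<otimes> h')"
    using B0_approx[OF u l] by blast
  have uh: "u \<otimes> h' \<in> carrier G" using u h' by (simp add: H_carrier)
  have "\<one>\<^bsub>B\<^esub> \<otimes>\<^bsub>B\<^esub> \<iota> v = (k \<otimes>\<^bsub>B\<^esub> l') \<otimes>\<^bsub>B\<^esub> \<iota> (u \<otimes> h')"
    unfolding eq using h' k l u uh
    by (simp add: B.m_assoc B0_carrier \<iota>_carrier)
  then have "v \<otimes> inv (u \<otimes> h') \<in> H"
    by (rule \<iota>_coset[OF v uh B0_one B0_mult[OF k h'(2)]])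
  moreover have "v = (v \<otimes> inv (u \<otimes> h')) \<otimes> u \<otimes> h'"
    using v u uh h' by (simp add: m_assoc H_carrier)
  ultimately show ?thesis using h'(1) by blast
qed

text \<open>An automorphism of B need not preserve G, so the image of x is replaced by an element of
  G in the same B0-coset. It is determined up to a left factor from H.\<close>

definition tr :: "('b \<Rightarrow> 'b) \<Rightarrow> 'a \<Rightarrow> 'a" where
  "tr \<theta> x = (SOME y. y \<in> carrier G \<and> (\<exists>k\<in>B0. \<theta> (\<iota> x) = k \<otimes>\<^bsub>B\<^esub> \<iota> y))"

lemma \<theta>_carrier: "\<theta> \<in> \<Theta> \<Longrightarrow> X \<in> carrier B \<Longrightarrow> \<theta> X \<in> carrier B"
  using \<Theta>_hom[of \<theta>] by (auto simp: hom_def)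

lemma \<theta>_mult: "\<theta> \<in> \<Theta> \<Longrightarrow> X \<in> carrier B \<Longrightarrow> X' \<in> carrier B \<Longrightarrow>
    \<theta> (X \<otimes>\<^bsub>B\<^esub> X') = \<theta> X \<otimes>\<^bsub>B\<^esub> \<theta> X'"
  using \<Theta>_hom[of \<theta>] by (auto simp: hom_def)

lemma \<theta>_inv: "\<theta> \<in> \<Theta> \<Longrightarrow> X \<in> carrier B \<Longrightarrow> \<theta> (inv\<^bsub>B\<^esub> X) = inv\<^bsub>B\<^esub> (\<theta> X)"
  using group_hom.hom_inv[OF group_hom.intro[OF B.group_axioms B.group_axioms group_hom_axioms.intro[OF \<Theta>_hom]]]
  by blast

lemma tr:
  assumes "\<theta> \<in> \<Theta>" "x \<in> carrier G"
  obtains k where "tr \<theta> x \<in> carrier G" "k \<in> B0" "\<theta> (\<iota> x) = k \<otimes>\<^bsub>B\<^esub> \<iota> (tr \<theta> x)"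
proof -
  have "\<exists>y. y \<in> carrier G \<and> (\<exists>k\<in>B0. \<theta> (\<iota> x) = k \<otimes>\<^bsub>B\<^esub> \<iota> y)"
    using B_decomp[OF \<theta>_carrier[OF assms(1) \<iota>_carrier[OF assms(2)]]] by blast
  from someI_ex[OF this] show thesis unfolding tr_def[symmetric] using that by blast
qed

lemma tr_unique:
  assumes \<theta>: "\<theta> \<in> \<Theta>" and x: "x \<in> carrier G" and y: "y \<in> carrier G" and k: "k \<in> B0"
    and eq: "\<theta> (\<iota> x) = k \<otimes>\<^bsub>B\<^esub> \<iota> y"
  shows "tr \<theta> x \<otimes> inv y \<in> H" "\<exists>h\<in>H. tr \<theta> x = h \<otimes> y"
proof -
  obtain l where l: "tr \<theta> x \<in> carrier G" "l \<in> B0" "\<theta> (\<iota> x) = l \<otimes>\<^bsub>B\<^esub> \<iota> (tr \<theta> x)"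
    by (rule tr[OF \<theta> x])
  show 1: "tr \<theta> x \<otimes> inv y \<in> H"
    by (rule \<iota>_coset[OF l(1) y l(2) k]) (use l(3) eq in simp)
  have "tr \<theta> x = (tr \<theta> x \<otimes> inv y) \<otimes> y" using l(1) y by (simp add: m_assoc)
  with 1 show "\<exists>h\<in>H. tr \<theta> x = h \<otimes> y" by blast
qed

text \<open>Each use of \<open>tr\<close> costs a left factor in B0. These factors are collected on
  the left, or for quotients on both sides, and \<open>tr_unique\<close> or
  \<open>\<iota>_double_coset\<close> turns them into factors from H.\<close>

sublocale symmetries: local_symmetries G I K "tr ` \<Theta>"
proof (unfold_locales; (elim imageE)?; hypsubst?)
  fix \<theta> x assume \<theta>: "\<theta> \<in> \<Theta>" and x: "x \<in> carrier G"
  obtain k where k: "tr \<theta> x \<in> carrier G" "k \<in> B0" "\<theta> (\<iota> x) = k \<otimes>\<^bsub>B\<^esub> \<iota> (tr \<theta> x)"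
    by (rule tr[OF \<theta> x])
  show "tr \<theta> x \<in> cls x" by (rule \<Theta>_cls[OF \<theta> x k])
  fix y assume y: "y \<in> carrier G"
  obtain l where l: "tr \<theta> y \<in> carrier G" "l \<in> B0" "\<theta> (\<iota> y) = l \<otimes>\<^bsub>B\<^esub> \<iota> (tr \<theta> y)"
    by (rule tr[OF \<theta> y])
  let ?u = "tr \<theta> (x \<otimes> inv y)" and ?v = "tr \<theta> x \<otimes> inv (tr \<theta> y)"
  have xy: "x \<otimes> inv y \<in> carrier G" using x y by simp
  obtain m where m: "?u \<in> carrier G" "m \<in> B0" "\<theta> (\<iota> (x \<otimes> inv y)) = m \<otimes>\<^bsub>B\<^esub> \<iota> ?u"
    by (rule tr[OF \<theta> xy])
  have v: "?v \<in> carrier G" using k l by simp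
  have c: "k \<in> carrier B" "l \<in> carrier B" "m \<in> carrier B" "\<iota> ?u \<in> carrier B"
    "\<iota> (tr \<theta> x) \<in> carrier B" "\<iota> (tr \<theta> y) \<in> carrier B" "\<iota> x \<in> carrier B" "\<iota> y \<in> carrier B"
    using k l m x y by (simp_all add: B0_carrier \<iota>_carrier)
  have "m \<otimes>\<^bsub>B\<^esub> \<iota> ?u = \<theta> (\<iota> x) \<otimes>\<^bsub>B\<^esub> inv\<^bsub>B\<^esub> (\<theta> (\<iota> y))"
    unfolding m(3)[symmetric] using x y c by (simp add: \<iota>_mult \<iota>_inv \<theta>_mult[OF \<theta>] \<theta>_inv[OF \<theta>])
  also have "\<dots> = k \<otimes>\<^bsub>B\<^esub> \<iota> ?v \<otimes>\<^bsub>B\<^esub> inv\<^bsub>B\<^esub> l"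
    unfolding k(3) l(3) using c k(1) l(1) by (simp add: \<iota>_mult \<iota>_inv B.inv_mult_group B.m_assoc)
  finally have e: "m \<otimes>\<^bsub>B\<^esub> \<iota> ?u = k \<otimes>\<^bsub>B\<^esub> \<iota> ?v \<otimes>\<^bsub>B\<^esub> inv\<^bsub>B\<^esub> l" .
  have "\<iota> ?v = inv\<^bsub>B\<^esub> k \<otimes>\<^bsub>B\<^esub> (k \<otimes>\<^bsub>B\<^esub> \<iota> ?v \<otimes>\<^bsub>B\<^esub> inv\<^bsub>B\<^esub> l) \<otimes>\<^bsub>B\<^esub> l"
    using c \<iota>_carrier[OF v] by (simp add: B.m_assoc) (simp add: B.m_assoc[symmetric])
  also have "\<dots> = (inv\<^bsub>B\<^esub> k \<otimes>\<^bsub>B\<^esub> m) \<otimes>\<^bsub>B\<^esub> \<iota> ?u \<otimes>\<^bsub>B\<^esub> l"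
    unfolding e[symmetric] using c by (simp add: B.m_assoc)
  finally show "\<exists>h\<in>H. \<exists>k\<in>H. ?v = h \<otimes> ?u \<otimes> k"
    by (rule \<iota>_double_coset[OF m(1) v B0_mult[OF B0_inv[OF k(2)] m(2)] l(2)])
next
  fix x y assume x: "x \<in> carrier G" and y: "y \<in> cls x"
  have yG: "y \<in> carrier G" using y by (rule cls_carrier)
  obtain \<theta> k l where \<theta>: "\<theta> \<in> \<Theta>" and k: "k \<in> B0" and l: "l \<in> B0"
    and eq: "\<theta> (\<iota> x) = k \<otimes>\<^bsub>B\<^esub> \<iota> y \<otimes>\<^bsub>B\<^esub> l"
    using cls_\<Theta>[OF x y] by blast
  obtain m where m: "tr \<theta> x \<in> carrier G" "m \<in> B0" "\<theta> (\<iota> x) = m \<otimes>\<^bsub>B\<^esub> \<iota> (tr \<theta> x)"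
    by (rule tr[OF \<theta> x])
  have c: "k \<in> carrier B" "l \<in> carrier B" "m \<in> carrier B" "\<iota> y \<in> carrier B" "\<iota> (tr \<theta> x) \<in> carrier B"
    using k l m yG by (simp_all add: B0_carrier \<iota>_carrier)
  have "\<iota> y = inv\<^bsub>B\<^esub> k \<otimes>\<^bsub>B\<^esub> (k \<otimes>\<^bsub>B\<^esub> \<iota> y \<otimes>\<^bsub>B\<^esub> l) \<otimes>\<^bsub>B\<^esub> inv\<^bsub>B\<^esub> l"
    using c by (simp add: B.m_assoc) (simp add: B.m_assoc[symmetric])
  also have "\<dots> = (inv\<^bsub>B\<^esub> k \<otimes>\<^bsub>B\<^esub> m) \<otimes>\<^bsub>B\<^esub> \<iota> (tr \<theta> x) \<otimes>\<^bsub>B\<^esub> inv\<^bsub>B\<^esub> l"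
    unfolding eq[symmetric] m(3) using c by (simp add: B.m_assoc)
  finally have "\<exists>h\<in>H. \<exists>h'\<in>H. y = h \<otimes> tr \<theta> x \<otimes> h'"
    by (rule \<iota>_double_coset[OF m(1) yG B0_mult[OF B0_inv[OF k] m(2)] B0_inv[OF l]])
  then show "\<exists>t\<in>tr ` \<Theta>. \<exists>h\<in>H. \<exists>k\<in>H. y = h \<otimes> t x \<otimes> k" using \<theta> by blast
next
  fix \<theta> \<theta>' assume \<theta>: "\<theta> \<in> \<Theta>" and \<theta>': "\<theta>' \<in> \<Theta>"
  obtain \<theta>'' where \<theta>'': "\<theta>'' \<in> \<Theta>" "\<And>X. X \<in> carrier B \<Longrightarrow> \<theta>'' X = \<theta> (\<theta>' X)"
    using \<Theta>_comp[OF \<theta> \<theta>'] by blast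
  have "\<exists>h\<in>H. \<exists>k\<in>H. tr \<theta>'' x = h \<otimes> tr \<theta> (tr \<theta>' x) \<otimes> k" if x: "x \<in> carrier G" for x
  proof -
    obtain k where k: "tr \<theta>' x \<in> carrier G" "k \<in> B0" "\<theta>' (\<iota> x) = k \<otimes>\<^bsub>B\<^esub> \<iota> (tr \<theta>' x)"
      by (rule tr[OF \<theta>' x])
    obtain l where l: "tr \<theta> (tr \<theta>' x) \<in> carrier G" "l \<in> B0"
      "\<theta> (\<iota> (tr \<theta>' x)) = l \<otimes>\<^bsub>B\<^esub> \<iota> (tr \<theta> (tr \<theta>' x))"
      by (rule tr[OF \<theta> k(1)])
    have "\<theta>'' (\<iota> x) = (\<theta> k \<otimes>\<^bsub>B\<^esub> l) \<otimes>\<^bsub>B\<^esub> \<iota> (tr \<theta> (tr \<theta>' x))"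
      using \<theta>''(2)[OF \<iota>_carrier[OF x]] k l \<Theta>_B0[OF \<theta> k(2)]
      by (simp add: \<theta>_mult[OF \<theta>] B0_carrier \<iota>_carrier B.m_assoc)
    from tr_unique(2)[OF \<theta>''(1) x l(1) B0_mult[OF \<Theta>_B0[OF \<theta> k(2)] l(2)] this]
    obtain h where h: "h \<in> H" "tr \<theta>'' x = h \<otimes> tr \<theta> (tr \<theta>' x)" by blast
    then show ?thesis using l(1) by (intro bexI[of _ h] bexI[of _ \<one>]) (simp_all add: H_one H_carrier)
  qed
  then show "\<exists>t''\<in>tr ` \<Theta>. \<forall>x\<in>carrier G. \<exists>h\<in>H. \<exists>k\<in>H. t'' x = h \<otimes> tr \<theta> (tr \<theta>' x) \<otimes> k"
    using \<theta>''(1) by blast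
next
  fix \<theta> assume \<theta>: "\<theta> \<in> \<Theta>"
  obtain \<theta>' where \<theta>': "\<theta>' \<in> \<Theta>" "\<And>X. X \<in> carrier B \<Longrightarrow> \<theta> (\<theta>' X) = X" "\<And>X. X \<in> carrier B \<Longrightarrow> \<theta>' (\<theta> X) = X"
    using \<Theta>_inv[OF \<theta>] by blast
  have *: "tr \<sigma> (tr \<tau> x) \<in> H #> x"
    if x: "x \<in> carrier G" and \<sigma>: "\<sigma> \<in> \<Theta>" and \<tau>: "\<tau> \<in> \<Theta>" and inv: "\<And>X. X \<in> carrier B \<Longrightarrow> \<sigma> (\<tau> X) = X" for \<sigma> \<tau> x
  proof -
    obtain k where k: "tr \<tau> x \<in> carrier G" "k \<in> B0" "\<tau> (\<iota> x) = k \<otimes>\<^bsub>B\<^esub> \<iota> (tr \<tau> x)"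
      by (rule tr[OF \<tau> x])
    have sk: "\<sigma> k \<in> B0" by (rule \<Theta>_B0[OF \<sigma> k(2)])
    have "\<iota> x = \<sigma> k \<otimes>\<^bsub>B\<^esub> \<sigma> (\<iota> (tr \<tau> x))"
      using inv[OF \<iota>_carrier[OF x]] k by (simp add: \<theta>_mult[OF \<sigma>] B0_carrier \<iota>_carrier)
    then have "\<sigma> (\<iota> (tr \<tau> x)) = inv\<^bsub>B\<^esub> (\<sigma> k) \<otimes>\<^bsub>B\<^esub> \<iota> x"
      using sk \<theta>_carrier[OF \<sigma> \<iota>_carrier[OF k(1)]] by (simp add: B0_carrier B.m_assoc[symmetric])
    from tr_unique(2)[OF \<sigma> k(1) x B0_inv[OF sk] this] show ?thesis by (auto simp: r_coset_def)
  qed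
  show "\<exists>t'\<in>tr ` \<Theta>. \<forall>x\<in>carrier G. tr \<theta> (t' x) \<in> H #> x \<and> t' (tr \<theta> x) \<in> H #> x"
    using *[OF _ \<theta> \<theta>'(1) \<theta>'(2)] *[OF _ \<theta>'(1) \<theta> \<theta>'(3)] \<theta>'(1) by blast
qed

text \<open>The value on the coset of \<open>\<iota> x\<close> is forced to be \<open>f x\<close>.
  It is well defined by \<open>\<iota>_coset\<close>, invariant on the right by
  \<open>B0_approx\<close>, and unique because by \<open>B_decomp\<close> these cosets exhaust
  B.\<close>

lemma extension:
  assumes f: "f \<in> hecke_algebra G H"
  obtains F where "(THE F. F \<in> hecke_algebra B B0 \<and> (\<forall>x\<in>carrier G. F (\<iota> x) = f x)) = F"
    "\<And>x k. x \<in> carrier G \<Longrightarrow> k \<in> B0 \<Longrightarrow> F (k \<otimes>\<^bsub>B\<^esub> \<iota> x) = f x"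
proof -
  have fb: "biinvariant f" using f by (simp add: hecke_algebra_iff)
  define s where "s X = (SOME y. y \<in> carrier G \<and> (\<exists>k\<in>B0. X = k \<otimes>\<^bsub>B\<^esub> \<iota> y))" for X
  define F where "F X = (if X \<in> carrier B then f (s X) else 0)" for X
  have s: "s X \<in> carrier G \<and> (\<exists>k\<in>B0. X = k \<otimes>\<^bsub>B\<^esub> \<iota> (s X))" if "X \<in> carrier B" for X
    unfolding s_def by (rule someI_ex) (use B_decomp[OF that] in blast)
  have F: "F (k \<otimes>\<^bsub>B\<^esub> \<iota> x) = f x" if x: "x \<in> carrier G" and k: "k \<in> B0" for x k
  proof -
    let ?X = "k \<otimes>\<^bsub>B\<^esub> \<iota> x"
    have X: "?X \<in> carrier B" using x k by (simp add: B0_carrier \<iota>_carrier)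
    obtain l where l: "s ?X \<in> carrier G" "l \<in> B0" "?X = l \<otimes>\<^bsub>B\<^esub> \<iota> (s ?X)" using s[OF X] by blast
    have h: "x \<otimes> inv (s ?X) \<in> H" by (rule \<iota>_coset[OF x l(1) k l(2) l(3)])
    have "f x = f (s ?X)"
      using h coset_eq_iff[OF subgroup_H x l(1)] by (intro biinvariant_coset[OF fb x l(1)]) simp
    then show ?thesis using X by (simp add: F_def)
  qed
  have F\<iota>: "F (\<iota> x) = f x" if "x \<in> carrier G" for x
    using F[OF that B0_one] that by (simp add: \<iota>_carrier)
  have FH: "F \<in> hecke_algebra B B0"
    unfolding hecke_algebra_def
  proof (intro CollectI conjI allI ballI impI)
    show "F X = 0" if "X \<notin> carrier B" for X using that by (simp add: F_def)
    fix X h k assume X: "X \<in> carrier B" and h: "h \<in> B0" and k: "k \<in> B0"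
    obtain y l where y: "y \<in> carrier G" "l \<in> B0" "X = l \<otimes>\<^bsub>B\<^esub> \<iota> y" using B_decomp[OF X] by blast
    obtain h' l' where h': "h' \<in> H" "l' \<in> B0" "\<iota> y \<otimes>\<^bsub>B\<^esub> k = l' \<otimes>\<^bsub>B\<^esub> \<iota> (y \<otimes> h')"
      using B0_approx[OF y(1) k] by blast
    have yh: "y \<otimes> h' \<in> carrier G" using y h' by (simp add: H_carrier)
    have "h \<otimes>\<^bsub>B\<^esub> X \<otimes>\<^bsub>B\<^esub> k = (h \<otimes>\<^bsub>B\<^esub> l) \<otimes>\<^bsub>B\<^esub> (\<iota> y \<otimes>\<^bsub>B\<^esub> k)"
      using h k y by (simp add: B.m_assoc B0_carrier \<iota>_carrier)
    also have "\<dots> = (h \<otimes>\<^bsub>B\<^esub> l \<otimes>\<^bsub>B\<^esub> l') \<otimes>\<^bsub>B\<^esub> \<iota> (y \<otimes> h')"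
      unfolding h'(3) using h y(2) h'(2) yh by (simp add: B.m_assoc B0_carrier \<iota>_carrier)
    finally have "F (h \<otimes>\<^bsub>B\<^esub> X \<otimes>\<^bsub>B\<^esub> k) = f (y \<otimes> h')"
      using F[OF yh] h y(2) h'(2) by (simp add: B0_mult)
    also have "\<dots> = f (\<one> \<otimes> y \<otimes> h')" using y by simp
    also have "\<dots> = f y" by (rule symmetries.biinvariantD[OF fb y(1) H_one h'(1)])
    also have "\<dots> = F X" using F[OF y(1,2)] y(3) by simp
    finally show "F (h \<otimes>\<^bsub>B\<^esub> X \<otimes>\<^bsub>B\<^esub> k) = F X" .
  next
    have "{(B0 #>\<^bsub>B\<^esub> X) <#>\<^bsub>B\<^esub> B0 | X. X \<in> carrier B \<and> F X \<noteq> 0}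
        \<subseteq> (\<lambda>C. (B0 #>\<^bsub>B\<^esub> \<iota> (rep C)) <#>\<^bsub>B\<^esub> B0) ` (\<lambda>x. H #> x) ` support f"
    proof
      fix D assume "D \<in> {(B0 #>\<^bsub>B\<^esub> X) <#>\<^bsub>B\<^esub> B0 | X. X \<in> carrier B \<and> F X \<noteq> 0}"
      then obtain X where X: "X \<in> carrier B" "F X \<noteq> 0" and D: "D = (B0 #>\<^bsub>B\<^esub> X) <#>\<^bsub>B\<^esub> B0" by blast
      obtain y l where y: "y \<in> carrier G" "l \<in> B0" "X = l \<otimes>\<^bsub>B\<^esub> \<iota> y" using B_decomp[OF X(1)] by blast
      have "y \<in> support f" using F[OF y(1,2)] y X(2) by (simp add: support_def)
      moreover have "B0 #>\<^bsub>B\<^esub> X = B0 #>\<^bsub>B\<^esub> \<iota> (rep (H #> y))"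
      proof -
        obtain h where h: "h \<in> H" "rep (H #> y) = h \<otimes> y" using rep_coset[OF y(1)] by blast
        have hB: "\<iota> h \<in> B0" using h(1) \<iota>_B0 H_carrier by blast
        have "\<iota> (rep (H #> y)) = (\<iota> h \<otimes>\<^bsub>B\<^esub> inv\<^bsub>B\<^esub> l) \<otimes>\<^bsub>B\<^esub> X"
          unfolding h(2) y(3) using h(1) y hB
          by (simp add: \<iota>_mult H_carrier B.m_assoc B0_carrier \<iota>_carrier)
             (simp add: B.m_assoc[symmetric] B0_carrier \<iota>_carrier)
        then have "\<iota> (rep (H #> y)) \<in> B0 #>\<^bsub>B\<^esub> X"
          using B0_mult[OF hB B0_inv[OF y(2)]] unfolding r_coset_def by blast
        then show ?thesis by (rule B.repr_independence[OF _ X(1) subgroup_B0])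
      qed
      ultimately show "D \<in> (\<lambda>C. (B0 #>\<^bsub>B\<^esub> \<iota> (rep C)) <#>\<^bsub>B\<^esub> B0) ` (\<lambda>x. H #> x) ` support f"
        unfolding D by simp
    qed
    then show "finite {(B0 #>\<^bsub>B\<^esub> X) <#>\<^bsub>B\<^esub> B0 | X. X \<in> carrier B \<and> F X \<noteq> 0}"
      by (rule finite_subset) (use f in \<open>simp add: hecke_algebra_iff\<close>)
  qed
  have "(THE F. F \<in> hecke_algebra B B0 \<and> (\<forall>x\<in>carrier G. F (\<iota> x) = f x)) = F"
  proof (rule the_equality)
    show "F \<in> hecke_algebra B B0 \<and> (\<forall>x\<in>carrier G. F (\<iota> x) = f x)" using FH F\<iota> by blast
    fix F' assume F': "F' \<in> hecke_algebra B B0 \<and> (\<forall>x\<in>carrier G. F' (\<iota> x) = f x)"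
    show "F' = F"
    proof
      fix X
      show "F' X = F X"
      proof (cases "X \<in> carrier B")
        case True
        obtain y l where y: "y \<in> carrier G" "l \<in> B0" "X = l \<otimes>\<^bsub>B\<^esub> \<iota> y" using B_decomp[OF True] by blast
        have "F' (l \<otimes>\<^bsub>B\<^esub> \<iota> y \<otimes>\<^bsub>B\<^esub> \<one>\<^bsub>B\<^esub>) = F' (\<iota> y)"
          using F' \<iota>_carrier[OF y(1)] y(2) B0_one by (simp add: hecke_algebra_def)
        then have "F' X = F' (\<iota> y)" using True y(3) by simp
        then show ?thesis using F' y F[OF y(1,2)] by simp
      qed (use F' in \<open>simp add: F_def hecke_algebra_def\<close>)
    qed
  qed
  with F that show thesis by blast
qed

lemma extension_\<theta>:
  assumes f: "f \<in> hecke_algebra G H" and \<theta>: "\<theta> \<in> \<Theta>" and x: "x \<in> carrier G"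
  shows "(THE F. F \<in> hecke_algebra B B0 \<and> (\<forall>x\<in>carrier G. F (\<iota> x) = f x)) (\<theta> (\<iota> x)) = symmetries.act (tr \<theta>) f x"
proof -
  obtain F where F: "(THE F. F \<in> hecke_algebra B B0 \<and> (\<forall>x\<in>carrier G. F (\<iota> x) = f x)) = F"
    "\<And>x k. x \<in> carrier G \<Longrightarrow> k \<in> B0 \<Longrightarrow> F (k \<otimes>\<^bsub>B\<^esub> \<iota> x) = f x"
    using extension[OF f] by blast
  obtain k where k: "tr \<theta> x \<in> carrier G" "k \<in> B0" "\<theta> (\<iota> x) = k \<otimes>\<^bsub>B\<^esub> \<iota> (tr \<theta> x)"
    by (rule tr[OF \<theta> x])
  show ?thesis unfolding F(1) k(3) using F(2)[OF k(1,2)] x by (simp add: symmetries.act_def)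
qed

end

section \<open>Integrality of rational numbers at a prime\<close>

text \<open>The localisation of the integers at p, that is, the rational numbers that are p-adic
  integers.\<close>

definition Zloc :: "nat \<Rightarrow> rat set" where
  "Zloc p = {x. padic_abs p x \<le> 1}"

definition is_subring :: "'a::comm_ring_1 set \<Rightarrow> bool" where
  "is_subring R \<longleftrightarrow> 0 \<in> R \<and> 1 \<in> R \<and> (\<forall>x\<in>R. \<forall>y\<in>R. x + y \<in> R \<and> x * y \<in> R) \<and> (\<forall>x\<in>R. - x \<in> R)"

lemma is_subringD:
  assumes "is_subring R"
  shows "0 \<in> R" "1 \<in> R" "x \<in> R \<Longrightarrow> y \<in> R \<Longrightarrow> x + y \<in> R" "x \<in> R \<Longrightarrow> y \<in> R \<Longrightarrow> x * y \<in> R"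
    "x \<in> R \<Longrightarrow> - x \<in> R" "x \<in> R \<Longrightarrow> y \<in> R \<Longrightarrow> x - y \<in> R"
  using assms by (auto simp: is_subring_def) (metis add_uminus_conv_diff)

lemma is_subring_Zloc: "prime p \<Longrightarrow> is_subring (Zloc p)"
proof -
  assume p: "prime p"
  have "padic_abs p (x + y) \<le> 1" if "padic_abs p x \<le> 1" "padic_abs p y \<le> 1" for x y
    using padic_abs_add[OF p, of x y] that by simp
  then show ?thesis by (simp add: is_subring_def Zloc_def padic_abs_mult[OF p] mult_le_one)
qed

lemma is_subring_Ints: "is_subring (\<int> :: rat set)"
  by (simp add: is_subring_def)

lemma padic_abs_of_int_le: "prime p \<Longrightarrow> padic_abs p (of_int a) \<le> 1"
proof (cases "a = 0")
  case False
  assume p: "prime p"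
  have "padic_abs p (of_int a / of_int 1) = real p powi (- int (multiplicity (int p) a))"
    using padic_abs_frac[OF p False, of 1] by simp
  also have "\<dots> \<le> real p powi 0"
    using prime_ge_1_nat[OF p] by (intro power_int_increasing) auto
  finally show ?thesis by simp
qed simp

lemma Ints_Zloc: "prime p \<Longrightarrow> x \<in> \<int> \<Longrightarrow> x \<in> Zloc p"
  by (auto elim!: Ints_cases simp: Zloc_def padic_abs_of_int_le)

lemma padic_abs_power: "prime p \<Longrightarrow> padic_abs p (x ^ n) = padic_abs p x ^ n"
  by (induction n) (simp_all add: padic_abs_mult)

lemma padic_abs_prime: "prime p \<Longrightarrow> padic_abs p (of_nat p) = 1 / real p"
proof -
  assume p: "prime p"
  have "prime_elem (int p)" using p by simp
  then have "multiplicity (int p) (int p) = 1"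
    using p by (intro multiplicity_self) (auto simp: prime_elem_def)
  then show ?thesis
    using padic_abs_frac[OF p, of "int p" 1] p by (simp add: power_int_minus divide_inverse)
qed

lemma padic_abs_eq_0_iff: "prime p \<Longrightarrow> padic_abs p x = 0 \<longleftrightarrow> x = 0"
  by (auto simp: padic_abs_def)

lemma padic_abs_inverse: "prime p \<Longrightarrow> padic_abs p (inverse x) = inverse (padic_abs p x)"
proof (cases "x = 0")
  case False
  assume p: "prime p"
  have "padic_abs p x * padic_abs p (inverse x) = 1"
    using False by (simp flip: padic_abs_mult[OF p])
  then show ?thesis by (metis inverse_unique)
qed simp

lemma padic_abs_divide: "prime p \<Longrightarrow> padic_abs p (x / y) = padic_abs p x / padic_abs p y"
  by (simp add: divide_inverse padic_abs_mult padic_abs_inverse)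

lemma padic_abs_coprime_int:
  assumes p: "prime p" and a: "\<not> int p dvd a"
  shows "padic_abs p (of_int a) = 1"
proof -
  have "a \<noteq> 0" using a by auto
  then show ?thesis using padic_abs_frac[OF p, of a 1] not_dvd_imp_multiplicity_0[OF a] by simp
qed

text \<open>A prime divisor of the reduced denominator does not divide the numerator, which makes
  the absolute value at that prime exceed 1.\<close>

lemma rat_in_Ints_iff: "x \<in> \<int> \<longleftrightarrow> (\<forall>p. prime p \<longrightarrow> x \<in> Zloc p)"
proof
  assume *: "\<forall>p. prime p \<longrightarrow> x \<in> Zloc p"
  obtain a b where q: "quotient_of x = (a, b)" by force
  have b: "b > 0" using quotient_of_denom_pos[OF q] .
  have cop: "coprime a b" using quotient_of_coprime[OF q] .
  have x: "x = of_int a / of_int b" using quotient_of_div[OF q] .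
  have "b = 1"
  proof (rule ccontr)
    assume "b \<noteq> 1"
    then have "nat b \<noteq> 1" using b by simp
    then obtain p where p: "prime p" "p dvd nat b" using prime_factor_nat by blast
    then have pb: "int p dvd b" using b by (simp add: int_dvd_int_iff[symmetric])
    have "\<not> is_unit (int p)" using p(1) not_prime_unit prime_nat_int_transfer by blast
    then have pa: "\<not> int p dvd a" using cop pb coprime_common_divisor by blast
    obtain c where c: "b = int p * c" using pb by (elim dvdE)
    have "padic_abs p (of_int b) = (1 / real p) * padic_abs p (of_int c)"
      using padic_abs_mult[OF p(1), of "of_nat p" "of_int c"] padic_abs_prime[OF p(1)] by (simp add: c)
    also have "\<dots> \<le> (1 / real p) * 1" by (intro mult_left_mono padic_abs_of_int_le p) simp
    also have "\<dots> < 1" using prime_gt_1_nat[OF p(1)] by simp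
    finally have lt: "padic_abs p (of_int b) < 1" .
    have "padic_abs p (of_int b) \<noteq> 0" using padic_abs_eq_0_iff[OF p(1)] b by simp
    then have "padic_abs p (of_int b) > 0" using padic_abs_nonneg[of p "of_int b"] by linarith
    then have "padic_abs p x > 1"
      using lt by (simp add: x padic_abs_divide[OF p(1)] padic_abs_coprime_int[OF p(1) pa])
    then show False using * p(1) by (auto simp: Zloc_def)
  qed
  then show "x \<in> \<int>" using x by simp
qed (simp add: Ints_Zloc)

text \<open>If x is integral away from p, a high power of p makes it integral everywhere, hence an
  integer.\<close>

lemma Z_inv_iff:
  assumes p: "prime p"
  shows "x \<in> Z_inv p \<longleftrightarrow> (\<forall>q. prime q \<and> q \<noteq> p \<longrightarrow> x \<in> Zloc q)"
proof
  assume "x \<in> Z_inv p"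
  then obtain a k where x: "x = of_int a / of_nat p ^ k" by (auto simp: Z_inv_def)
  show "\<forall>q. prime q \<and> q \<noteq> p \<longrightarrow> x \<in> Zloc q"
  proof (intro allI impI)
    fix q assume q: "prime q \<and> q \<noteq> p"
    then have "\<not> q dvd p" using p primes_dvd_imp_eq by blast
    then have "padic_abs q (of_int (int p)) = 1" using q by (intro padic_abs_coprime_int) auto
    then show "x \<in> Zloc q"
      using q padic_abs_of_int_le[of q a] by (simp add: x Zloc_def padic_abs_divide padic_abs_power)
  qed
next
  assume *: "\<forall>q. prime q \<and> q \<noteq> p \<longrightarrow> x \<in> Zloc q"
  obtain k where k: "padic_abs p x \<le> real p ^ k"
    using real_arch_pow[of "real p" "padic_abs p x"] prime_gt_1_nat[OF p] by (auto intro: less_imp_le)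
  let ?y = "x * of_nat p ^ k"
  have "?y \<in> \<int>"
    unfolding rat_in_Ints_iff
  proof (intro allI impI)
    fix q :: nat assume q: "prime q"
    show "?y \<in> Zloc q"
    proof (cases "q = p")
      case True
      then show ?thesis using k prime_gt_0_nat[OF p]
        by (simp add: Zloc_def padic_abs_mult[OF p] padic_abs_power[OF p] padic_abs_prime[OF p]
            power_divide field_simps)
    next
      case False
      have "of_nat p ^ k \<in> \<int>" by simp
      then have "of_nat p ^ k \<in> Zloc q" using Ints_Zloc q by blast
      then show ?thesis using * q False is_subringD(4)[OF is_subring_Zloc] by blast
    qed
  qed
  then obtain a where "?y = of_int a" by (elim Ints_cases)
  then have "x = of_int a / of_nat p ^ k" using prime_gt_0_nat[OF p] by (simp add: field_simps)
  then show "x \<in> Z_inv p" by (auto simp: Z_inv_def)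
qed

text \<open>Let x = a / (p^k c) with c prime to p, and let u be an inverse of c modulo p^(k+n).
  Replacing 1/c by u changes x by p^n times a p-integral number and leaves only powers of p in the
  denominator.\<close>

lemma padic_approx:
  assumes p: "prime p"
  obtains z where "z \<in> Z_inv p" "(x - z) / of_nat p ^ n \<in> Zloc p"
proof -
  obtain a b where q: "quotient_of x = (a, b)" by force
  have b: "b > 0" using quotient_of_denom_pos[OF q] .
  have x: "x = of_int a / of_int b" using quotient_of_div[OF q] .
  have "\<not> is_unit (int p)" using p not_prime_unit prime_nat_int_transfer by blast
  then obtain c where c: "b = int p ^ multiplicity (int p) b * c" "\<not> int p dvd c"
    using multiplicity_decompose'[of b "int p"] b by auto
  let ?k = "multiplicity (int p) b"
  have "prime (int p)" using p by simp
  then have "coprime (int p ^ (?k + n)) c"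
    using c(2) by (intro coprime_power_left_iff[THEN iffD2] disjI1 prime_imp_coprime)
  then have "gcd c (int p ^ (?k + n)) = 1" by (simp add: coprime_iff_gcd_eq_1 gcd.commute)
  then obtain u v where uv: "u * c + v * int p ^ (?k + n) = 1" using bezout_int[of c "int p ^ (?k + n)"] by metis
  let ?z = "of_int (a * u) / of_nat p ^ ?k :: rat"
  have pk: "(of_nat p :: rat) \<noteq> 0" and c0: "(of_int c :: rat) \<noteq> 0" using p c(2) by auto
  have xb: "x = of_int a / (of_nat p ^ ?k * of_int c)" unfolding x by (subst c(1)) simp
  have uv': "(of_int u * of_int c + of_int v * of_nat p ^ (?k + n) :: rat) = 1"
    using arg_cong[OF uv, of "of_int :: int \<Rightarrow> rat"] by simp
  have "x - ?z = of_int a * (1 - of_int u * of_int c) / (of_nat p ^ ?k * of_int c)"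
    using pk c0 by (simp add: xb field_simps)
  also have "1 - of_int u * of_int c = (of_int v * of_nat p ^ (?k + n) :: rat)" using uv' by (simp add: algebra_simps)
  finally have "(x - ?z) / of_nat p ^ n = of_int (a * v) / of_int c"
    using pk c0 by (simp add: power_add field_simps)
  then have "padic_abs p ((x - ?z) / of_nat p ^ n) \<le> 1"
    using padic_abs_of_int_le[OF p, of "a * v"] padic_abs_coprime_int[OF p c(2)] by (simp add: padic_abs_divide[OF p])
  moreover have "?z \<in> Z_inv p" unfolding Z_inv_def by blast
  ultimately show thesis using that by (simp add: Zloc_def)
qed

lemma finite_not_Zloc: "finite {p. prime p \<and> c \<notin> Zloc p}"
  using finite_not_padic_int_const[of c] by (simp add: padic_int_seq_def Zloc_def)

section \<open>Two by two and block matrices\<close>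

definition mk2 :: "'a \<Rightarrow> 'a \<Rightarrow> 'a \<Rightarrow> 'a \<Rightarrow> 'a^2^2" where
  "mk2 a b c d = (\<chi> i j. if i = 1 then if j = 1 then a else b else if j = 1 then c else d)"

lemma mk2_nth [simp]:
  "mk2 a b c d $ 1 $ 1 = a" "mk2 a b c d $ 1 $ 2 = b" "mk2 a b c d $ 2 $ 1 = c" "mk2 a b c d $ 2 $ 2 = d"
  by (simp_all add: mk2_def)

lemma mat2_eq_iff: "(A :: 'a^2^2) = B \<longleftrightarrow>
   A $ 1 $ 1 = B $ 1 $ 1 \<and> A $ 1 $ 2 = B $ 1 $ 2 \<and> A $ 2 $ 1 = B $ 2 $ 1 \<and> A $ 2 $ 2 = B $ 2 $ 2"
  by (auto simp: vec_eq_iff forall_2)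

lemma mult2_nth: "((A :: 'a::comm_ring_1^2^2) ** B) $ i $ j = A $ i $ 1 * B $ 1 $ j + A $ i $ 2 * B $ 2 $ j"
  by (simp add: matrix_matrix_mult_def sum_2)

lemma mat1_nth: "(mat 1 :: 'a::comm_ring_1^2^2) $ i $ j = (if i = j then 1 else 0)"
  by (simp add: mat_def)

lemma mat1_2 [simp]:
  "(mat 1 :: 'a::comm_ring_1^2^2) $ 1 $ 1 = 1" "(mat 1 :: 'a::comm_ring_1^2^2) $ 1 $ 2 = 0"
  "(mat 1 :: 'a::comm_ring_1^2^2) $ 2 $ 1 = 0" "(mat 1 :: 'a::comm_ring_1^2^2) $ 2 $ 2 = 1"
  by (simp_all add: mat1_nth)

lemma Mat2_iff: "m \<in> Mat2 R \<longleftrightarrow> m $ 1 $ 1 \<in> R \<and> m $ 1 $ 2 \<in> R \<and> m $ 2 $ 1 \<in> R \<and> m $ 2 $ 2 \<in> R"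
  by (auto simp: Mat2_def forall_2)

lemma Mat2_closed:
  assumes "is_subring R"
  shows Mat2_mult: "m \<in> Mat2 R \<Longrightarrow> n \<in> Mat2 R \<Longrightarrow> m ** n \<in> Mat2 R"
    and Mat2_add: "m \<in> Mat2 R \<Longrightarrow> n \<in> Mat2 R \<Longrightarrow> m + n \<in> Mat2 R"
    and Mat2_diff: "m \<in> Mat2 R \<Longrightarrow> n \<in> Mat2 R \<Longrightarrow> m - n \<in> Mat2 R"
    and Mat2_uminus: "m \<in> Mat2 R \<Longrightarrow> - m \<in> Mat2 R"
    and Mat2_one: "mat 1 \<in> Mat2 R"
    and Mat2_det: "m \<in> Mat2 R \<Longrightarrow> det m \<in> R"
  using is_subringD[OF assms] by (auto simp: Mat2_iff mult2_nth det_2)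

text \<open>The inverse of \<open>g\<close> when \<open>u\<close> is the inverse of \<open>det g\<close>.\<close>

definition inv2 :: "'a::comm_ring_1 \<Rightarrow> 'a^2^2 \<Rightarrow> 'a^2^2" where
  "inv2 u g = mk2 (u * g $ 2 $ 2) (- (u * g $ 1 $ 2)) (- (u * g $ 2 $ 1)) (u * g $ 1 $ 1)"

lemma inv2:
  fixes g :: "'a::comm_ring_1^2^2"
  assumes "det g * u = 1"
  shows "g ** inv2 u g = mat 1" "inv2 u g ** g = mat 1"
proof -
  have d: "u * (g $ 1 $ 1 * g $ 2 $ 2) - u * (g $ 1 $ 2 * g $ 2 $ 1) = 1"
    using assms by (simp add: det_2 algebra_simps)
  then show "g ** inv2 u g = mat 1" "inv2 u g ** g = mat 1"
    by (simp_all add: mat2_eq_iff mult2_nth inv2_def algebra_simps)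
qed

lemma inv2_Mat2: "is_subring R \<Longrightarrow> u \<in> R \<Longrightarrow> g \<in> Mat2 R \<Longrightarrow> inv2 u g \<in> Mat2 R"
  using is_subringD[of R] by (auto simp: Mat2_iff inv2_def)

lemma GL2_iff:
  assumes R: "is_subring R"
  shows "g \<in> GL2 R \<longleftrightarrow> g \<in> Mat2 R \<and> (\<exists>u\<in>R. det g * u = 1)"
proof
  assume "g \<in> GL2 R"
  then obtain h where h: "g \<in> Mat2 R" "h \<in> Mat2 R" "g ** h = mat 1" by (auto simp: GL2_def)
  have "det g * det h = 1" using h(3) by (metis det_I det_mul)
  then show "g \<in> Mat2 R \<and> (\<exists>u\<in>R. det g * u = 1)" using h Mat2_det[OF R] by blast
next
  assume "g \<in> Mat2 R \<and> (\<exists>u\<in>R. det g * u = 1)"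
  then obtain u where u: "g \<in> Mat2 R" "u \<in> R" "det g * u = 1" by blast
  show "g \<in> GL2 R" unfolding GL2_def
    using u(1) inv2[OF u(3)] inv2_Mat2[OF R u(2,1)] by blast
qed

lemma UNIV_subring [simp]: "is_subring UNIV" by (simp add: is_subring_def)

lemma Mat2_UNIV [simp]: "Mat2 UNIV = UNIV" by (simp add: Mat2_def)

lemma matrix_inverse_unique:
  fixes g h k :: "'a::comm_ring_1^'n^'n"
  assumes "h ** g = mat 1" "g ** k = mat 1"
  shows "h = k"
  by (metis assms matrix_mul_assoc matrix_mul_lid matrix_mul_rid)

lemma block_mat_eq_iff: "block_mat m g = block_mat m' g' \<longleftrightarrow> m = m' \<and> g = g'"
proof
  assume eq: "block_mat m g = block_mat m' g'"
  have "block_mat m g $ Inl a $ Inr b = m $ a $ b" "block_mat m g $ Inr a $ Inr b = g $ a $ b" for m g :: "'a^2^2" and a b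
    by (simp_all add: block_mat_def)
  with eq show "m = m' \<and> g = g'" by (metis vec_eq_iff)
qed simp

lemma block_mat_mult: "block_mat m g ** block_mat m' g' = block_mat (m' + m ** g') (g ** g')"
proof -
  have S: "(\<Sum>k\<in>UNIV. f k) = (\<Sum>k\<in>UNIV. f (Inl k)) + (\<Sum>k\<in>UNIV. f (Inr k))" for f :: "2 + 2 \<Rightarrow> 'a"
    by (subst UNIV_Plus_UNIV[symmetric]) (subst sum.Plus, simp_all)
  have "(block_mat m g ** block_mat m' g') $ i $ j = block_mat (m' + m ** g') (g ** g') $ i $ j" for i j
    unfolding matrix_matrix_mult_def
    by (cases i; cases j) (simp_all add: S block_mat_def mat1_nth matrix_matrix_mult_def if_distrib[where f = "\<lambda>x. x * _"] sum.delta cong: if_cong)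
  then show ?thesis by (simp add: vec_eq_iff)
qed

lemma block_mat_one: "block_mat 0 (mat 1) = mat 1"
  by (auto simp: vec_eq_iff block_mat_def mat_def split: sum.splits)

lemma matrix_mul_zero [simp]: "(A :: 'a::comm_ring_1^'n^'m) ** (0 :: 'a^'k^'n) = 0" "(0 :: 'a^'n^'m) ** (B :: 'a^'k^'n) = 0"
  by (simp_all add: matrix_matrix_mult_def vec_eq_iff)

lemma matrix_diff_right: "(A - B :: 'a::comm_ring_1^'n^'m) ** (C :: 'a^'k^'n) = A ** C - B ** C"
  by (simp add: matrix_matrix_mult_def vec_eq_iff left_diff_distrib sum_subtractf)

lemma matrix_diff_left: "(C :: 'a::comm_ring_1^'n^'m) ** (A - B :: 'a^'k^'n) = C ** A - C ** B"
  by (simp add: matrix_matrix_mult_def vec_eq_iff right_diff_distrib sum_subtractf)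

lemma matrix_minus_left: "(- A :: 'a::comm_ring_1^'n^'m) ** (C :: 'a^'k^'n) = - (A ** C)"
  by (simp add: matrix_matrix_mult_def vec_eq_iff sum_negf)

section \<open>The group of rational block matrices and its local subgroups\<close>

lemma matrix_group_simps [simp]:
  "carrier (matrix_group S) = S" "x \<otimes>\<^bsub>matrix_group S\<^esub> y = x ** y" "\<one>\<^bsub>matrix_group S\<^esub> = mat 1"
  by (simp_all add: matrix_group_def)

lemma block_mat_in_block_set [simp]: "block_mat m g \<in> block_set M S \<longleftrightarrow> m \<in> M \<and> g \<in> S"
  by (auto simp: block_set_def block_mat_eq_iff)

lemma block_setE:
  assumes "x \<in> block_set M S"
  obtains m g where "x = block_mat m g" "m \<in> M" "g \<in> S"
  using assms by (auto simp: block_set_def)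

lemma block_mat_inverse:
  assumes "h ** g = mat 1"
  shows "block_mat (- (m ** h)) h ** block_mat m g = mat 1"
proof -
  have "m ** h ** g = m" using assms by (simp add: matrix_mul_assoc[symmetric])
  then show ?thesis using assms by (simp add: block_mat_mult matrix_minus_left block_mat_one)
qed

lemma block_group:
  assumes one: "mat 1 \<in> S" and mult: "\<And>g h. g \<in> S \<Longrightarrow> h \<in> S \<Longrightarrow> g ** h \<in> S"
    and inv: "\<And>g. g \<in> S \<Longrightarrow> \<exists>h\<in>S. h ** g = mat 1"
  shows "group (matrix_group (block_set UNIV S))"
proof (rule groupI)
  show "\<one>\<^bsub>matrix_group (block_set UNIV S)\<^esub> \<in> carrier (matrix_group (block_set UNIV S))"
    using one by (simp flip: block_mat_one)
next
  fix x assume "x \<in> carrier (matrix_group (block_set UNIV S))"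
  then obtain m g where x: "x = block_mat m g" "g \<in> S" by (auto elim: block_setE)
  obtain h where h: "h \<in> S" "h ** g = mat 1" using inv[OF x(2)] by blast
  then show "\<exists>y\<in>carrier (matrix_group (block_set UNIV S)).
      y \<otimes>\<^bsub>matrix_group (block_set UNIV S)\<^esub> x = \<one>\<^bsub>matrix_group (block_set UNIV S)\<^esub>"
    using x block_mat_inverse[OF h(2), of m] by (intro bexI[of _ "block_mat (- (m ** h)) h"]) simp_all
qed (auto elim!: block_setE simp: block_mat_mult mult matrix_mul_assoc)

definition rinv :: "rat^2^2 \<Rightarrow> rat^2^2" where
  "rinv g = inv2 (1 / det g) g"

lemma rinv:
  assumes "det g \<noteq> 0"
  shows rinv_right: "g ** rinv g = mat 1" and rinv_left: "rinv g ** g = mat 1"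
    and det_rinv: "det (rinv g) = 1 / det g"
proof -
  show 1: "g ** rinv g = mat 1" "rinv g ** g = mat 1"
    unfolding rinv_def using assms by (auto intro!: inv2)
  have "det g * det (rinv g) = 1" using 1(1) by (metis det_I det_mul)
  then show "det (rinv g) = 1 / det g" using assms by (simp add: field_simps)
qed

lemma GL2Q_pos_iff: "g \<in> GL2Q_pos \<longleftrightarrow> det g > 0"
proof -
  have "\<exists>u. det g * u = 1" if "det g > 0" using that by (intro exI[of _ "1 / det g"]) simp
  then show ?thesis by (auto simp: GL2Q_pos_def GL2_iff)
qed

lemma P_carrier_iff [simp]: "block_mat m g \<in> carrier P_grp \<longleftrightarrow> det g > 0"
  by (simp add: P_grp_def GL2Q_pos_iff)

lemma P_carrierE:
  assumes "x \<in> carrier P_grp"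
  obtains m g where "x = block_mat m g" "det g > 0"
  using assms by (auto simp: P_grp_def GL2Q_pos_iff elim: block_setE)

lemma P_mult: "x \<otimes>\<^bsub>P_grp\<^esub> y = x ** y" and P_one: "\<one>\<^bsub>P_grp\<^esub> = mat 1"
  by (simp_all add: P_grp_def)

lemma group_P: "group P_grp"
  unfolding P_grp_def
proof (rule block_group)
  show "\<exists>h\<in>GL2Q_pos. h ** g = mat 1" if "g \<in> GL2Q_pos" for g
    using that rinv[of g] by (intro bexI[of _ "rinv g"]) (simp_all add: GL2Q_pos_iff)
qed (simp_all add: GL2Q_pos_iff det_mul)

interpretation P: group P_grp by (rule group_P)

lemma P_inv:
  assumes "det g > 0"
  shows "inv\<^bsub>P_grp\<^esub> (block_mat m g) = block_mat (- (m ** rinv g)) (rinv g)"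
  using assms rinv[of g]
  by (intro P.inv_equality) (simp_all add: P_mult P_one block_mat_inverse)

lemma P_quot:
  assumes "det h > 0"
  shows "block_mat m g \<otimes>\<^bsub>P_grp\<^esub> inv\<^bsub>P_grp\<^esub> (block_mat n h) = block_mat ((m - n) ** rinv h) (g ** rinv h)"
  by (simp add: P_inv[OF assms] P_mult block_mat_mult matrix_diff_right)

definition Kp :: "nat \<Rightarrow> (rat^(2+2)^(2+2)) set" where
  "Kp p = block_set (Mat2 (Zloc p)) (GL2 (Zloc p) \<inter> GL2Q_pos)"

lemma GL2_Zloc_iff:
  assumes p: "prime p"
  shows "g \<in> GL2 (Zloc p) \<longleftrightarrow> g \<in> Mat2 (Zloc p) \<and> padic_abs p (det g) = 1"
proof
  assume "g \<in> GL2 (Zloc p)"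
  then obtain u where g: "g \<in> Mat2 (Zloc p)" and u: "u \<in> Zloc p" "det g * u = 1"
    using GL2_iff[OF is_subring_Zloc[OF p]] by blast
  have d: "padic_abs p (det g) \<le> 1" "padic_abs p u \<le> 1"
    using Mat2_det[OF is_subring_Zloc[OF p] g] u by (auto simp: Zloc_def)
  have "padic_abs p (det g) * padic_abs p u = 1" using u(2) by (simp flip: padic_abs_mult[OF p])
  then have "padic_abs p (det g) \<ge> 1"
    using d mult_left_le[OF d(2) padic_abs_nonneg[of p "det g"]] by simp
  with d g show "g \<in> Mat2 (Zloc p) \<and> padic_abs p (det g) = 1" by simp
next
  assume g: "g \<in> Mat2 (Zloc p) \<and> padic_abs p (det g) = 1"
  then have "det g \<noteq> 0" by auto
  then have "det g * (1 / det g) = 1" by simp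
  moreover have "1 / det g \<in> Zloc p" using g by (simp add: Zloc_def padic_abs_divide[OF p])
  ultimately show "g \<in> GL2 (Zloc p)" using g GL2_iff[OF is_subring_Zloc[OF p]] by blast
qed

lemma Kp_iff:
  "prime p \<Longrightarrow> block_mat m g \<in> Kp p \<longleftrightarrow>
    m \<in> Mat2 (Zloc p) \<and> g \<in> Mat2 (Zloc p) \<and> det g > 0 \<and> padic_abs p (det g) = 1"
  by (auto simp: Kp_def GL2_Zloc_iff GL2Q_pos_iff)

lemma rinv_Zloc:
  assumes p: "prime p" and g: "g \<in> Mat2 (Zloc p)" "padic_abs p (det g) = 1"
  shows "rinv g \<in> Mat2 (Zloc p)"
  unfolding rinv_def
  by (rule inv2_Mat2[OF is_subring_Zloc[OF p] _ g(1)]) (use g in \<open>simp add: Zloc_def padic_abs_divide[OF p]\<close>)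

lemma subgroup_Kp:
  assumes p: "prime p"
  shows "subgroup (Kp p) P_grp"
proof (rule P.subgroupI)
  note R = is_subring_Zloc[OF p]
  show "Kp p \<subseteq> carrier P_grp" by (auto simp: Kp_def P_grp_def elim!: block_setE)
  have "mat 1 \<in> Kp p"
    using Mat2_one[OF R] is_subringD(1)[OF R]
    by (simp add: Kp_iff[OF p] Mat2_iff det_I del: mat1_2 flip: block_mat_one)
  then show "Kp p \<noteq> {}" by blast
  fix x assume "x \<in> Kp p"
  then obtain m g where x: "x = block_mat m g" "m \<in> Mat2 (Zloc p)" "g \<in> Mat2 (Zloc p)" "det g > 0"
    "padic_abs p (det g) = 1"
    using Kp_iff[OF p] by (metis Kp_def block_setE)
  show "inv\<^bsub>P_grp\<^esub> x \<in> Kp p"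
    using x rinv_Zloc[OF p x(3,5)] det_rinv[of g]
    by (simp add: P_inv Kp_iff[OF p] Mat2_uminus[OF R] Mat2_mult[OF R] padic_abs_divide[OF p])
  fix y assume "y \<in> Kp p"
  then obtain n h where y: "y = block_mat n h" "n \<in> Mat2 (Zloc p)" "h \<in> Mat2 (Zloc p)" "det h > 0"
    "padic_abs p (det h) = 1"
    using Kp_iff[OF p] by (metis Kp_def block_setE)
  show "x \<otimes>\<^bsub>P_grp\<^esub> y \<in> Kp p"
    using x y by (simp add: P_mult block_mat_mult Kp_iff[OF p] Mat2_add[OF R] Mat2_mult[OF R] det_mul
        padic_abs_mult[OF p])
qed

lemma finite_not_Kp:
  assumes x: "x \<in> carrier P_grp"
  shows "finite {p \<in> {p. prime p}. x \<notin> Kp p}"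
proof -
  obtain m g where mg: "x = block_mat m g" "det g > 0" using x by (rule P_carrierE)
  let ?D = "{m$1$1, m$1$2, m$2$1, m$2$2, g$1$1, g$1$2, g$2$1, g$2$2, 1 / det g}"
  have "{p \<in> {p. prime p}. x \<notin> Kp p} \<subseteq> (\<Union>c\<in>?D. {p. prime p \<and> c \<notin> Zloc p})"
  proof
    fix p assume "p \<in> {p \<in> {p. prime p}. x \<notin> Kp p}"
    then have p: "prime p" and nx: "x \<notin> Kp p" by auto
    show "p \<in> (\<Union>c\<in>?D. {p. prime p \<and> c \<notin> Zloc p})"
    proof (rule ccontr)
      assume "p \<notin> (\<Union>c\<in>?D. {p. prime p \<and> c \<notin> Zloc p})"
      then have D: "m \<in> Mat2 (Zloc p)" "g \<in> Mat2 (Zloc p)" "1 / det g \<in> Zloc p"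
        using p by (auto simp: Mat2_iff)
      have "g \<in> GL2 (Zloc p)"
        using D mg(2) GL2_iff[OF is_subring_Zloc[OF p]] by (auto intro!: bexI[of _ "1 / det g"])
      then have "x \<in> Kp p" using D mg by (simp add: Kp_def GL2Q_pos_iff)
      with nx show False by simp
    qed
  qed
  then show ?thesis by (rule finite_subset) (use finite_not_Zloc in auto)
qed

section \<open>Decomposition of rational matrices at a prime\<close>

lemma padic_abs_power_int: "prime p \<Longrightarrow> padic_abs p (of_nat p powi i) = real p powi (- i)"
  by (cases i rule: int_cases4)
     (simp_all add: power_int_minus padic_abs_inverse padic_abs_power padic_abs_prime power_one_over
       inverse_eq_divide padic_abs_divide)

lemma padic_valuation:
  assumes p: "prime p" and x: "x \<noteq> 0"
  obtains i where "padic_abs p (x / of_nat p powi i) = 1"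
proof -
  obtain i where "padic_abs p x = real p powi i" using x by (auto simp: padic_abs_def)
  then have "padic_abs p (x / of_nat p powi (- i)) = 1"
    using prime_gt_0_nat[OF p] by (simp add: padic_abs_divide[OF p] padic_abs_power_int[OF p])
  then show thesis by (rule that)
qed

lemma Z_inv_power_int: "prime p \<Longrightarrow> of_nat p powi i \<in> Z_inv p"
proof (cases i rule: int_cases4)
  case (nonneg n)
  then show ?thesis unfolding Z_inv_def
    by (intro CollectI exI[of _ "int p ^ n"] exI[of _ 0]) simp
next
  case (neg n)
  then show ?thesis unfolding Z_inv_def
    by (intro CollectI exI[of _ 1] exI[of _ n]) (simp add: power_int_minus inverse_eq_divide)
qed

text \<open>For negative n the approximation is made to precision \<open>nat n\<close>; the power of
  p left over has the nonnegative exponent \<open>int (nat n) - n\<close>.\<close>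

lemma padic_approx_int:
  assumes p: "prime p"
  obtains z where "z \<in> Z_inv p" "(x - z) / of_nat p powi n \<in> Zloc p"
proof -
  obtain z where z: "z \<in> Z_inv p" "(x - z) / of_nat p ^ nat n \<in> Zloc p"
    by (rule padic_approx[OF p])
  have "of_nat p powi (int (nat n) - n) \<in> Zloc p"
    using prime_ge_1_nat[OF p] power_int_decreasing[of "n - int (nat n)" 0 "real p"]
      power_int_increasing[of "n - int (nat n)" 0 "real p"]
    by (simp add: Zloc_def padic_abs_power_int[OF p])
  then have "(x - z) / of_nat p ^ nat n * of_nat p powi (int (nat n) - n) \<in> Zloc p"
    using is_subringD(4)[OF is_subring_Zloc[OF p]] z(2) by blast
  also have "(x - z) / of_nat p ^ nat n * of_nat p powi (int (nat n) - n) = (x - z) / of_nat p powi n"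
  proof -
    have p0: "(of_nat p :: rat) \<noteq> 0" using p by auto
    have "of_nat p powi (int (nat n) - n) = of_nat p powi int (nat n) / (of_nat p powi n :: rat)"
      by (rule power_int_diff) (use p0 in simp)
    then show ?thesis using p0 by (simp only: power_int_of_nat) simp
  qed
  finally show thesis using z(1) that by blast
qed

text \<open>A p-adic Iwasawa decomposition: the conclusions say that the matrix with rows (a, b) and
  (c, d), divided on the right by the triangular matrix with rows (p^i, t) and (0, p^j), is integral
  with unit determinant. The entry a serves as pivot because of its larger absolute value.\<close>

lemma row_reduction:
  fixes a b c d :: rat
  assumes p: "prime p" and le: "padic_abs p c \<le> padic_abs p a" and D: "a * d - b * c \<noteq> 0"
  obtains i j t where "t \<in> Z_inv p" "a / of_nat p powi i \<in> Zloc p" "c / of_nat p powi i \<in> Zloc p"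
    "(b - a / of_nat p powi i * t) / of_nat p powi j \<in> Zloc p"
    "(d - c / of_nat p powi i * t) / of_nat p powi j \<in> Zloc p"
    "padic_abs p ((a * d - b * c) / (of_nat p powi i * of_nat p powi j)) = 1"
proof -
  note R = is_subringD[OF is_subring_Zloc[OF p]]
  have a: "a \<noteq> 0"
  proof
    assume "a = 0"
    moreover then have "c = 0" using le padic_abs_eq_0_iff[OF p, of c] padic_abs_nonneg[of p c] by simp
    ultimately show False using D by simp
  qed
  let ?D = "a * d - b * c"
  \<comment> \<open>p^i matches the pivot and p^j matches \<open>?D / a\<close>, which makes the
    determinant of the quotient a unit; t then approximates \<open>b / ?u\<close> to precision
    p^j.\<close>
  obtain i where i: "padic_abs p (a / of_nat p powi i) = 1" by (rule padic_valuation[OF p a])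
  have Da: "?D / a \<noteq> 0" using D a by simp
  obtain j where j: "padic_abs p (?D / a / of_nat p powi j) = 1" by (rule padic_valuation[OF p Da])
  define I J where "I = (of_nat p powi i :: rat)" and "J = (of_nat p powi j :: rat)"
  note i = i[folded I_def] and j = j[folded J_def]
  let ?u = "a / I" and ?I = I and ?J = J
  have nz: "?I \<noteq> 0" "?J \<noteq> 0" "?u \<noteq> 0" using p a by (auto simp: I_def J_def)
  obtain t where t: "t \<in> Z_inv p" "(b / ?u - t) / ?J \<in> Zloc p"
    unfolding J_def by (rule padic_approx_int[OF p])
  have u: "?u \<in> Zloc p" using i by (simp add: Zloc_def)
  have ca: "c / a \<in> Zloc p"
  proof -
    have "padic_abs p a > 0"
      using a padic_abs_eq_0_iff[OF p, of a] padic_abs_nonneg[of p a] by linarith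
    then show ?thesis using le by (simp add: Zloc_def padic_abs_divide[OF p])
  qed
  have cI: "c / ?I = (c / a) * ?u" using a by simp
  have b': "(b - ?u * t) / ?J = ?u * ((b / ?u - t) / ?J)" using nz by (simp add: field_simps)
  have bZ: "(b - ?u * t) / ?J \<in> Zloc p" unfolding b' by (rule R(4)[OF u t(2)])
  \<comment> \<open>The lower right entry is expressed by the determinant and the upper right entry,
    both already controlled.\<close>
  have d': "(d - c / ?I * t) / ?J = ?D / a / ?J + (c / a) * ((b - ?u * t) / ?J)"
    using nz a by (simp add: field_simps)
  have "?D / a / ?J \<in> Zloc p" using j by (simp add: Zloc_def)
  then have dZ: "(d - c / ?I * t) / ?J \<in> Zloc p" unfolding d' by (intro R(3) R(4)[OF ca bZ])
  have "?D / (?I * ?J) = ?u * (?D / a / ?J)" using a by simp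
  then have DIJ: "padic_abs p (?D / (?I * ?J)) = 1" using i j by (simp only: padic_abs_mult[OF p])
  have "c / ?I \<in> Zloc p" unfolding cI by (rule R(4)[OF ca u])
  from that[OF t(1) u[unfolded I_def] this[unfolded I_def] bZ[unfolded I_def J_def]
      dZ[unfolded I_def J_def] DIJ[unfolded I_def J_def]]
  show thesis .
qed

lemma GL2_decomp:
  assumes p: "prime p" and g: "det g > 0"
  obtains h where "h \<in> Mat2 (Z_inv p)" "det h > 0" "rinv h \<in> Mat2 (Z_inv p)"
    "g ** rinv h \<in> Mat2 (Zloc p)" "padic_abs p (det (g ** rinv h)) = 1"
proof -
  have "\<exists>i j t. t \<in> Z_inv p \<and> g$1$1 / of_nat p powi i \<in> Zloc p \<and> g$2$1 / of_nat p powi i \<in> Zloc p \<and>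
    (g$1$2 - g$1$1 / of_nat p powi i * t) / of_nat p powi j \<in> Zloc p \<and>
    (g$2$2 - g$2$1 / of_nat p powi i * t) / of_nat p powi j \<in> Zloc p \<and>
    padic_abs p (det g / (of_nat p powi i * of_nat p powi j)) = 1"
  proof (cases "padic_abs p (g$2$1) \<le> padic_abs p (g$1$1)")
    case True
    have D: "g$1$1 * g$2$2 - g$1$2 * g$2$1 \<noteq> 0" using g by (simp add: det_2)
    show ?thesis by (rule row_reduction[OF p True D]) (auto simp: det_2)
  next
    case False
    \<comment> \<open>Here the pivot is in the lower row. Exchanging the rows changes only the sign
      of the determinant.\<close>
    have D: "g$2$1 * g$1$2 - g$2$2 * g$1$1 \<noteq> 0" using g by (simp add: det_2 mult.commute)
    have e: "g$2$1 * g$1$2 - g$2$2 * g$1$1 = - det g" by (simp add: det_2)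
    show ?thesis
      by (rule row_reduction[OF p _ D]) (use False in \<open>auto simp: e\<close>)
  qed
  then obtain i j t where *: "t \<in> Z_inv p" "g$1$1 / of_nat p powi i \<in> Zloc p" "g$2$1 / of_nat p powi i \<in> Zloc p"
    "(g$1$2 - g$1$1 / of_nat p powi i * t) / of_nat p powi j \<in> Zloc p"
    "(g$2$2 - g$2$1 / of_nat p powi i * t) / of_nat p powi j \<in> Zloc p"
    "padic_abs p (det g / (of_nat p powi i * of_nat p powi j)) = 1" by blast
  define I J where IJ_def: "I = (of_nat p powi i :: rat)" "J = (of_nat p powi j :: rat)"
  note * = *[folded IJ_def]
  let ?I = I and ?J = J
  have nz: "?I > 0" "?J > 0" using prime_gt_0_nat[OF p] by (auto simp: IJ_def zero_less_power_int)
  let ?h = "mk2 ?I t 0 ?J"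
  have deth: "det ?h = ?I * ?J" by (simp add: det_2)
  have Zc: "x * y \<in> Z_inv p" "- x \<in> Z_inv p" "0 \<in> Z_inv p" if "x \<in> Z_inv p" "y \<in> Z_inv p" for x y
    using that is_subringD[OF is_subring_Zloc] by (auto simp: Z_inv_iff[OF p])
  have rh: "rinv ?h = mk2 (1 / ?I) (- (t / (?I * ?J))) 0 (1 / ?J)"
    using nz by (simp add: rinv_def inv2_def deth mat2_eq_iff)
  have inv: "1 / ?I = of_nat p powi (- i)" "1 / ?J = of_nat p powi (- j)"
    by (simp_all add: power_int_minus inverse_eq_divide IJ_def)
  have IJ: "1 / ?I \<in> Z_inv p" "1 / ?J \<in> Z_inv p" "?I \<in> Z_inv p" "?J \<in> Z_inv p"
    unfolding inv unfolding IJ_def by (intro Z_inv_power_int p)+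
  have 1: "?h \<in> Mat2 (Z_inv p)" using *(1) IJ Zc by (simp add: Mat2_iff)
  have "t * (1 / ?I) * (1 / ?J) \<in> Z_inv p" by (intro Zc *(1) IJ)
  then have 2: "rinv ?h \<in> Mat2 (Z_inv p)" using IJ Zc unfolding rh by (simp add: Mat2_iff)
  have 3: "g ** rinv ?h \<in> Mat2 (Zloc p)"
  proof -
    have e: "x * - (t / (?I * ?J)) + y * (1 / ?J) = (y - x / ?I * t) / ?J" for x y
      using nz by (simp add: field_simps)
    show ?thesis using *(2-5) unfolding rh Mat2_iff mult2_nth mk2_nth e by simp
  qed
  have "det ?h \<noteq> 0" using nz by (simp add: deth)
  then have "det (g ** rinv ?h) = det g / (?I * ?J)" by (simp add: det_mul det_rinv) (simp add: deth)
  with 1 2 3 *(6) nz show thesis by (intro that[of ?h]) (simp_all add: deth)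
qed

definition smul2 :: "'a::comm_ring_1 \<Rightarrow> 'a^2^2 \<Rightarrow> 'a^2^2" where
  "smul2 c A = (\<chi> i j. c * A $ i $ j)"

lemma smul2_nth [simp]: "smul2 c A $ i $ j = c * A $ i $ j"
  by (simp add: smul2_def)

lemma smul2_simps:
  "smul2 c (smul2 d A) = smul2 (c * d) A" "smul2 1 A = A"
  "smul2 c A ** B = smul2 c (A ** B)" "A ** smul2 c B = smul2 c (A ** B)"
  "smul2 c (A + B) = smul2 c A + smul2 c B" "smul2 c (A - B) = smul2 c A - smul2 c B"
  by (simp_all add: mat2_eq_iff mult2_nth algebra_simps)

text \<open>If \<open>q\<close> clears the denominators of \<open>(m, g)\<close> and its inverse, elements of the compact subgroup
  that are congruent modulo \<open>q\<^sup>2\<close> give the same coset after multiplication by \<open>(m, g)\<close> on the left.\<close>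

lemma conj_integral:
  fixes m g gi r s r' s' si R0 S0 :: "'a::comm_ring_1^2^2"
  assumes R: "is_subring R" and q: "q \<in> R"
    and x: "smul2 q m \<in> Mat2 R" "smul2 q g \<in> Mat2 R" "smul2 q gi \<in> Mat2 R"
    and inv: "g ** gi = mat 1" "s' ** si = mat 1" "si \<in> Mat2 R"
    and RS: "r - r' = smul2 (q * q) R0" "s - s' = smul2 (q * q) S0" "R0 \<in> Mat2 R" "S0 \<in> Mat2 R"
  shows "((r + m ** s) - (r' + m ** s')) ** (si ** gi) \<in> Mat2 R" "(g ** s) ** (si ** gi) \<in> Mat2 R"
proof -
  have pull: "smul2 q A + smul2 q B = smul2 q (A + B)" for A B :: "'a^2^2" by (simp add: smul2_simps)
  have "((r + m ** s) - (r' + m ** s')) ** (si ** gi) = ((r - r') + m ** (s - s')) ** si ** gi"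
    by (simp add: matrix_mul_assoc matrix_diff_left algebra_simps)
  also have "\<dots> = (smul2 q R0 + smul2 q m ** S0) ** si ** smul2 q gi"
    unfolding RS(1,2) smul2_simps(1)[symmetric] by (simp only: smul2_simps(3,4) pull)
  finally have e1: "((r + m ** s) - (r' + m ** s')) ** (si ** gi)
      = (smul2 q R0 + smul2 q m ** S0) ** si ** smul2 q gi" .
  have "smul2 q R0 \<in> Mat2 R" using RS(3) is_subringD(4)[OF R q] unfolding Mat2_iff smul2_nth by blast
  then show "((r + m ** s) - (r' + m ** s')) ** (si ** gi) \<in> Mat2 R"
    unfolding e1 by (intro Mat2_mult[OF R] Mat2_add[OF R] x RS inv)
  have "(g ** s) ** (si ** gi) = g ** (s' ** si) ** gi + (g ** (s - s')) ** si ** gi"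
    by (simp add: matrix_diff_left matrix_diff_right matrix_mul_assoc)
  also have "\<dots> = mat 1 + smul2 q g ** S0 ** si ** smul2 q gi"
    unfolding RS(2) smul2_simps(1)[symmetric] inv(2) by (simp only: smul2_simps(3,4) matrix_mul_rid inv(1))
  finally show "(g ** s) ** (si ** gi) \<in> Mat2 R"
    by (auto intro!: Mat2_mult[OF R] Mat2_add[OF R] Mat2_one[OF R] x RS inv)
qed

lemma Zloc_bounded:
  assumes p: "prime p"
  shows "\<exists>N. \<forall>n\<ge>N. of_nat p ^ n * x \<in> Zloc p"
proof -
  obtain N where N: "padic_abs p x \<le> real p ^ N"
    using real_arch_pow[of "real p" "padic_abs p x"] prime_gt_1_nat[OF p] by (auto intro: less_imp_le)
  have "of_nat p ^ n * x \<in> Zloc p" if "n \<ge> N" for n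
  proof -
    have "padic_abs p x \<le> real p ^ n"
      using N power_increasing[OF that, of "real p"] prime_ge_1_nat[OF p] by simp
    then show ?thesis using prime_gt_0_nat[OF p]
      by (simp add: Zloc_def padic_abs_mult[OF p] padic_abs_power[OF p] padic_abs_prime[OF p]
          power_divide field_simps)
  qed
  then show ?thesis by blast
qed

lemma Mat2_bounded:
  assumes p: "prime p"
  shows "\<exists>N. \<forall>n\<ge>N. smul2 (of_nat p ^ n) A \<in> Mat2 (Zloc p)"
proof -
  obtain N11 where 11: "\<forall>n\<ge>N11. of_nat p ^ n * A $ 1 $ 1 \<in> Zloc p" using Zloc_bounded[OF p] by blast
  obtain N12 where 12: "\<forall>n\<ge>N12. of_nat p ^ n * A $ 1 $ 2 \<in> Zloc p" using Zloc_bounded[OF p] by blast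
  obtain N21 where 21: "\<forall>n\<ge>N21. of_nat p ^ n * A $ 2 $ 1 \<in> Zloc p" using Zloc_bounded[OF p] by blast
  obtain N22 where 22: "\<forall>n\<ge>N22. of_nat p ^ n * A $ 2 $ 2 \<in> Zloc p" using Zloc_bounded[OF p] by blast
  have "smul2 (of_nat p ^ n) A \<in> Mat2 (Zloc p)" if "n \<ge> N11 + N12 + N21 + N22" for n
    using that 11 12 21 22 by (simp add: Mat2_iff)
  then show ?thesis by blast
qed

lemma Mat2_approx:
  assumes p: "prime p"
  obtains n where "n \<in> Mat2 (Z_inv p)" "smul2 (1 / of_nat p ^ N) (m - n) \<in> Mat2 (Zloc p)"
proof -
  have "\<exists>z. z \<in> Z_inv p \<and> (x - z) / of_nat p ^ N \<in> Zloc p" for x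
    by (rule padic_approx[OF p]) blast
  then obtain z where z: "\<And>x. z x \<in> Z_inv p" "\<And>x. (x - z x) / of_nat p ^ N \<in> Zloc p" by metis
  show thesis
    by (rule that[of "mk2 (z (m$1$1)) (z (m$1$2)) (z (m$2$1)) (z (m$2$2))"])
       (use z in \<open>simp_all add: Mat2_iff\<close>)
qed

lemma P_at_iff:
  assumes p: "prime p" and g: "det g > 0"
  shows "block_mat m g \<in> P_at p \<longleftrightarrow> (\<forall>q\<in>{q. prime q} - {p}. block_mat m g \<in> Kp q)"
proof
  have sub: "is_subring (Z_inv p)"
    using is_subring_Zloc by (simp add: is_subring_def Z_inv_iff[OF p])
  have M: "A \<in> Mat2 (Z_inv p) \<longleftrightarrow> (\<forall>q\<in>{q. prime q} - {p}. A \<in> Mat2 (Zloc q))" for A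
    by (auto simp: Mat2_iff Z_inv_iff[OF p])
  show "\<forall>q\<in>{q. prime q} - {p}. block_mat m g \<in> Kp q" if "block_mat m g \<in> P_at p"
  proof
    fix q assume q: "q \<in> {q. prime q} - {p}"
    have mg: "m \<in> Mat2 (Z_inv p)" and "g \<in> GL2 (Z_inv p)"
      using \<open>block_mat m g \<in> P_at p\<close> by (auto simp: P_at_def)
    then obtain u where u: "u \<in> Z_inv p" "det g * u = 1" and g': "g \<in> Mat2 (Z_inv p)"
      using GL2_iff[OF sub] by blast
    have "u \<in> Zloc q" using u q Z_inv_iff[OF p] by blast
    moreover have "g \<in> Mat2 (Zloc q)" using g' q unfolding M by blast
    ultimately have "g \<in> GL2 (Zloc q)" using GL2_iff[OF is_subring_Zloc, of q g] u q by blast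
    then show "block_mat m g \<in> Kp q" using mg M q g by (simp add: Kp_def GL2Q_pos_iff)
  qed
  assume *: "\<forall>q\<in>{q. prime q} - {p}. block_mat m g \<in> Kp q"
  then have mg: "m \<in> Mat2 (Z_inv p)" "g \<in> Mat2 (Z_inv p)" unfolding M by (auto simp: Kp_iff)
  have "1 / det g \<in> Z_inv p"
    unfolding Z_inv_iff[OF p] using * by (auto simp: Kp_iff Zloc_def padic_abs_divide)
  then have "g \<in> GL2 (Z_inv p)" using GL2_iff[OF sub] mg g by (auto intro!: bexI[of _ "1 / det g"])
  then show "block_mat m g \<in> P_at p" using mg g by (simp add: P_at_def GL2Q_pos_iff)
qed

text \<open>The linear block h comes from \<open>GL2_decomp\<close>. The block n approximates m so
  closely that the denominators p^N of the inverse of h are absorbed.\<close>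

lemma P_local_decomp:
  assumes p: "prime p" and x: "x \<in> carrier P_grp"
  shows "\<exists>z\<in>carrier P_grp. (\<forall>j\<in>{p. prime p} - {p}. z \<in> Kp j) \<and> x \<otimes>\<^bsub>P_grp\<^esub> inv\<^bsub>P_grp\<^esub> z \<in> Kp p"
proof -
  obtain m g where mg: "x = block_mat m g" "det g > 0" using x by (rule P_carrierE)
  obtain h where h: "h \<in> Mat2 (Z_inv p)" "det h > 0" "rinv h \<in> Mat2 (Z_inv p)"
    "g ** rinv h \<in> Mat2 (Zloc p)" "padic_abs p (det (g ** rinv h)) = 1"
    by (rule GL2_decomp[OF p mg(2)])
  obtain N where N: "smul2 (of_nat p ^ N) (rinv h) \<in> Mat2 (Zloc p)" using Mat2_bounded[OF p] by blast
  obtain n where n: "n \<in> Mat2 (Z_inv p)" "smul2 (1 / of_nat p ^ N) (m - n) \<in> Mat2 (Zloc p)"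
    by (rule Mat2_approx[OF p])
  have pN: "of_nat p ^ N * (1 / of_nat p ^ N :: rat) = 1" using p by auto
  have e: "(m - n) ** rinv h = smul2 (1 / of_nat p ^ N) (m - n) ** smul2 (of_nat p ^ N) (rinv h)"
    by (simp only: smul2_simps(1-4) pN)
  have 1: "(m - n) ** rinv h \<in> Mat2 (Zloc p)"
    unfolding e by (rule Mat2_mult[OF is_subring_Zloc[OF p] n(2) N])
  have "det h * det (rinv h) = 1" using det_rinv[of h] h(2) by simp
  then have "h \<in> GL2 (Z_inv p)" using h rinv[of h] by (auto simp: GL2_def)
  then have "block_mat n h \<in> P_at p" using n h by (simp add: P_at_def GL2Q_pos_iff)
  then have 2: "\<forall>q\<in>{q. prime q} - {p}. block_mat n h \<in> Kp q" using P_at_iff[OF p h(2)] by blast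
  have "det (g ** rinv h) > 0" using mg(2) h(2) by (simp add: det_mul det_rinv)
  then have 3: "x \<otimes>\<^bsub>P_grp\<^esub> inv\<^bsub>P_grp\<^esub> (block_mat n h) \<in> Kp p"
    using 1 h by (simp add: mg(1) P_quot[OF h(2)] Kp_iff[OF p])
  show ?thesis using 2 3 h(2) by (intro bexI[of _ "block_mat n h"]) simp_all
qed

text \<open>An approximation of a p-integral x by an element of Z[1/p] is itself p-integral, hence
  an integer, which is then reduced modulo p^N.\<close>

lemma Zloc_residue:
  assumes p: "prime p"
  obtains res :: "rat \<Rightarrow> int" where "\<And>x. x \<in> Zloc p \<Longrightarrow> res x \<in> {0..<int p ^ N}"
    "\<And>x. x \<in> Zloc p \<Longrightarrow> (x - of_int (res x)) / of_nat p ^ N \<in> Zloc p"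
proof -
  note R = is_subringD[OF is_subring_Zloc[OF p]]
  have pN: "(of_nat p ^ N :: rat) \<noteq> 0" using p by auto
  have pZ: "of_nat p ^ N \<in> Zloc p" by (rule Ints_Zloc[OF p]) simp
  have "\<exists>a. a \<in> {0..<int p ^ N} \<and> (x - of_int a) / of_nat p ^ N \<in> Zloc p" if x: "x \<in> Zloc p" for x
  proof -
    obtain z where z: "z \<in> Z_inv p" "(x - z) / of_nat p ^ N \<in> Zloc p" by (rule padic_approx[OF p])
    have "x - (x - z) / of_nat p ^ N * of_nat p ^ N \<in> Zloc p" by (intro R(6)[OF x] R(4)[OF z(2) pZ])
    moreover have "(x - z) / of_nat p ^ N * of_nat p ^ N = x - z"
      using pN by (metis nonzero_divide_eq_eq)
    ultimately have "z \<in> Zloc p" by simp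
    then have "z \<in> \<int>" using z(1) unfolding rat_in_Ints_iff Z_inv_iff[OF p] by blast
    then obtain a where a: "z = of_int a" by (elim Ints_cases)
    let ?a = "a mod int p ^ N"
    have "of_int a = (of_int ?a + of_int (a div int p ^ N) * of_nat p ^ N :: rat)"
      using arg_cong[OF mod_div_mult_eq[of a "int p ^ N"], of "of_int :: int \<Rightarrow> rat"] by simp
    then have "(x - of_int ?a) / of_nat p ^ N = (x - z) / of_nat p ^ N + of_int (a div int p ^ N)"
      using pN by (simp add: a field_simps)
    also have "\<dots> \<in> Zloc p" by (intro R(3) z(2) Ints_Zloc[OF p]) simp
    finally have "(x - of_int ?a) / of_nat p ^ N \<in> Zloc p" .
    moreover have "?a \<in> {0..<int p ^ N}" using prime_gt_0_nat[OF p] by simp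
    ultimately show ?thesis by blast
  qed
  then have "\<forall>x\<in>Zloc p. \<exists>a. a \<in> {0..<int p ^ N} \<and> (x - of_int a) / of_nat p ^ N \<in> Zloc p" by blast
  from bchoice[OF this] that show thesis by blast
qed

text \<open>By \<open>conj_integral\<close> the coset of x k depends only on the entries of k modulo
  the square of a common denominator p^M of m, g and the inverse of g; there are finitely many such
  residues.\<close>

lemma P_local_finite:
  assumes p: "prime p" and x: "x \<in> carrier P_grp"
  shows "finite ((\<lambda>k. Kp p #>\<^bsub>P_grp\<^esub> (x \<otimes>\<^bsub>P_grp\<^esub> k)) ` Kp p)"
proof -
  note R = is_subring_Zloc[OF p]
  note R' = is_subringD[OF R]
  obtain m g where mg: "x = block_mat m g" "det g > 0" using x by (rule P_carrierE)
  obtain Nm Ng Nr where "\<forall>n\<ge>Nm. smul2 (of_nat p ^ n) m \<in> Mat2 (Zloc p)"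
    "\<forall>n\<ge>Ng. smul2 (of_nat p ^ n) g \<in> Mat2 (Zloc p)" "\<forall>n\<ge>Nr. smul2 (of_nat p ^ n) (rinv g) \<in> Mat2 (Zloc p)"
    using Mat2_bounded[OF p] by meson
  then obtain M where M: "smul2 (of_nat p ^ M) m \<in> Mat2 (Zloc p)" "smul2 (of_nat p ^ M) g \<in> Mat2 (Zloc p)"
    "smul2 (of_nat p ^ M) (rinv g) \<in> Mat2 (Zloc p)"
    by (meson max.cobounded1 max.cobounded2 order_trans)
  let ?q = "of_nat p ^ M :: rat"
  have q: "?q \<noteq> 0" "?q \<in> Zloc p" using p by (auto intro: Ints_Zloc)
  obtain res :: "rat \<Rightarrow> int" where res: "\<And>x. x \<in> Zloc p \<Longrightarrow> res x \<in> {0..<int p ^ (M + M)}"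
    "\<And>x. x \<in> Zloc p \<Longrightarrow> (x - of_int (res x)) / of_nat p ^ (M + M) \<in> Zloc p"
    by (rule Zloc_residue[OF p, where N = "M + M"]) blast
  have res_eq: "(1 / (?q * ?q)) * (a - b) \<in> Zloc p" if "a \<in> Zloc p" "b \<in> Zloc p" "res a = res b" for a b
  proof -
    have "(1 / (?q * ?q)) * (a - b) = (a - of_int (res a)) / of_nat p ^ (M + M) - (b - of_int (res b)) / of_nat p ^ (M + M)"
      using that(3) q by (simp add: power_add field_simps)
    then show ?thesis using R'(6)[OF res(2)[OF that(1)] res(2)[OF that(2)]] by simp
  qed
  let ?e = "\<lambda>a b A. res (A $ a $ b)"
  let ?key4 = "\<lambda>A :: rat^2^2. (res (A$1$1), res (A$1$2), res (A$2$1), res (A$2$2))"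
  let ?r = "\<lambda>x :: rat^(2+2)^(2+2). (THE m. \<exists>g. x = block_mat m g)"
  let ?s = "\<lambda>x :: rat^(2+2)^(2+2). (THE g. \<exists>m. x = block_mat m g)"
  have rs: "?r (block_mat m g) = m" "?s (block_mat m g) = g" for m g :: "rat^2^2"
    by (auto simp: block_mat_eq_iff)
  show ?thesis
  proof (rule finite_image_factor[where g = "\<lambda>x. (?key4 (?r x), ?key4 (?s x))"])
    let ?S = "{0..<int p ^ (M + M)}"
    have "(\<lambda>x. (?key4 (?r x), ?key4 (?s x))) ` Kp p \<subseteq> (?S \<times> ?S \<times> ?S \<times> ?S) \<times> (?S \<times> ?S \<times> ?S \<times> ?S)"
    proof (rule image_subsetI)
      fix x assume x: "x \<in> Kp p"
      then obtain r s where rsx: "x = block_mat r s" by (auto simp: Kp_def elim: block_setE)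
      have "r \<in> Mat2 (Zloc p)" "s \<in> Mat2 (Zloc p)" using x by (auto simp: rsx Kp_iff[OF p])
      then show "(?key4 (?r x), ?key4 (?s x)) \<in> (?S \<times> ?S \<times> ?S \<times> ?S) \<times> (?S \<times> ?S \<times> ?S \<times> ?S)"
        unfolding rsx rs mem_Times_iff fst_conv snd_conv Mat2_iff by (intro conjI res(1)) blast+
    qed
    then show "finite ((\<lambda>x. (?key4 (?r x), ?key4 (?s x))) ` Kp p)"
      by (rule finite_subset) (intro finite_SigmaI finite_atLeastLessThan_int)
    fix k k' assume k: "k \<in> Kp p" "k' \<in> Kp p" and eq: "(?key4 (?r k), ?key4 (?s k)) = (?key4 (?r k'), ?key4 (?s k'))"
    obtain r s where rs1: "k = block_mat r s" using k by (auto simp: Kp_def elim: block_setE)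
    obtain r' s' where rs2: "k' = block_mat r' s'" using k by (auto simp: Kp_def elim: block_setE)
    have i: "r \<in> Mat2 (Zloc p)" "s \<in> Mat2 (Zloc p)" "r' \<in> Mat2 (Zloc p)" "s' \<in> Mat2 (Zloc p)"
      and d: "det s > 0" "det s' > 0" "padic_abs p (det s) = 1" "padic_abs p (det s') = 1"
      using k by (auto simp: rs1 rs2 Kp_iff[OF p])
    define R0 S0 where "R0 = smul2 (1 / (?q * ?q)) (r - r')" and "S0 = smul2 (1 / (?q * ?q)) (s - s')"
    let ?R = R0 and ?S = S0
    have RS: "?R \<in> Mat2 (Zloc p)" "?S \<in> Mat2 (Zloc p)"
      using i eq unfolding rs1 rs2 rs R0_def S0_def by (auto simp only: Mat2_iff smul2_nth vector_minus_component prod.inject intro!: res_eq)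
    have qq: "?q * ?q * (1 / (?q * ?q)) = 1" using q by simp
    have gs: "det (g ** s') > 0" using mg d by (simp add: det_mul)
    have ri: "rinv s' \<in> Mat2 (Zloc p)" by (rule rinv_Zloc[OF p i(4) d(4)])
    have "(rinv s' ** rinv g) ** (g ** s') = rinv s' ** (rinv g ** g) ** s'" by (simp only: matrix_mul_assoc)
    also have "\<dots> = mat 1" using rinv_left[of g] rinv_left[of s'] mg d by simp
    finally have rgs: "rinv s' ** rinv g = rinv (g ** s')"
      by (rule matrix_inverse_unique) (use rinv_right[of "g ** s'"] gs in simp)
    have g0: "g ** rinv g = mat 1" and s0: "s' ** rinv s' = mat 1" using rinv_right mg d by simp_all
    have RS'': "r - r' = smul2 (?q * ?q) ?R" "s - s' = smul2 (?q * ?q) ?S"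
      unfolding R0_def S0_def smul2_simps(1) qq smul2_simps(2) by (rule refl)+
    note 12 = conj_integral[OF R q(2) M g0 s0 ri RS'' RS, unfolded rgs]
    note 1 = 12(1) and 2 = 12(2)
    have "det ((g ** s) ** rinv (g ** s')) = det s / det s'"
    proof -
      have "det (rinv (g ** s')) = 1 / (det g * det s')"
      proof -
        have "det (g ** s') \<noteq> 0" using gs by simp
        from det_rinv[OF this] show ?thesis by (simp only: det_mul)
      qed
      then show ?thesis using mg(2) d by (simp add: det_mul)
    qed
    then have 3: "det ((g ** s) ** rinv (g ** s')) > 0" "padic_abs p (det ((g ** s) ** rinv (g ** s'))) = 1"
      using d by (simp_all add: padic_abs_divide[OF p])
    have "(x \<otimes>\<^bsub>P_grp\<^esub> k) \<otimes>\<^bsub>P_grp\<^esub> inv\<^bsub>P_grp\<^esub> (x \<otimes>\<^bsub>P_grp\<^esub> k') \<in> Kp p"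
      using 1 2 3 by (simp add: mg(1) rs1 rs2 P_mult block_mat_mult P_quot[OF gs, unfolded P_mult] Kp_iff[OF p])
    then show "Kp p #>\<^bsub>P_grp\<^esub> (x \<otimes>\<^bsub>P_grp\<^esub> k) = Kp p #>\<^bsub>P_grp\<^esub> (x \<otimes>\<^bsub>P_grp\<^esub> k')"
      using d gs mg by (subst P.coset_eq_iff[OF subgroup_Kp[OF p]]) (simp_all add: mg(1) rs1 rs2 P_mult block_mat_mult det_mul)
  qed
qed

interpretation P: local_family P_grp "{p. prime p}" Kp
proof (intro local_family.intro local_family_axioms.intro group_P)
  show "subgroup (Kp p) P_grp" if "p \<in> {p. prime p}" for p using that by (simp add: subgroup_Kp)
  show "finite {p \<in> {p. prime p}. x \<notin> Kp p}" if "x \<in> carrier P_grp" for x using that by (rule finite_not_Kp)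
  show "\<exists>z\<in>carrier P_grp. (\<forall>q\<in>{p. prime p} - {p}. z \<in> Kp q) \<and> x \<otimes>\<^bsub>P_grp\<^esub> inv\<^bsub>P_grp\<^esub> z \<in> Kp p"
    if "p \<in> {p. prime p}" "x \<in> carrier P_grp" for p x
    using that by (intro P_local_decomp) simp_all
  show "finite ((\<lambda>k. Kp p #>\<^bsub>P_grp\<^esub> (x \<otimes>\<^bsub>P_grp\<^esub> k)) ` Kp p)"
    if "p \<in> {p. prime p}" "x \<in> carrier P_grp" for p x
    using that by (intro P_local_finite) simp_all
qed

text \<open>Both d and 1/d are integers, and positivity excludes -1. This is how positive
  determinants that are units at all primes become equal to 1 in \<open>P0\<close> and
  \<open>Pbar0\<close>.\<close>

lemma rat_unit_eq_1:
  assumes "d > 0" "\<And>p. prime p \<Longrightarrow> padic_abs p d = 1"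
  shows "d = 1"
proof -
  have "d \<in> \<int>" unfolding rat_in_Ints_iff using assms(2) by (simp add: Zloc_def)
  moreover have "1 / d \<in> \<int>" unfolding rat_in_Ints_iff using assms(2) by (simp add: Zloc_def padic_abs_divide)
  ultimately obtain a b :: int where ab: "d = of_int a" "1 / d = of_int b" by (elim Ints_cases)
  have "(of_int (a * b) :: rat) = 1" using ab assms(1) by (simp flip: ab)
  then have "a * b = 1" by (simp only: of_int_eq_1_iff)
  moreover have "a > 0" using ab assms(1) by simp
  ultimately have "a = 1" by (simp add: pos_zmult_eq_1_iff)
  with ab show ?thesis by simp
qed

lemma P_H: "P.H = P0"
proof (intro equalityI subsetI)
  fix x assume x: "x \<in> P.H"
  then obtain m g where mg: "x = block_mat m g" "det g > 0"
    unfolding P.H_def by (auto elim: P_carrierE)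
  have K: "\<And>p. prime p \<Longrightarrow> block_mat m g \<in> Kp p" using x mg by (auto simp: P.H_def)
  then have "m \<in> Mat2 \<int>" "g \<in> Mat2 \<int>" by (auto simp: Mat2_iff rat_in_Ints_iff Kp_iff)
  moreover have "det g = 1" using K by (intro rat_unit_eq_1 mg) (auto simp: Kp_iff)
  ultimately show "x \<in> P0" by (simp add: mg P0_def SL2_def)
next
  fix x assume "x \<in> P0"
  then obtain m g where mg: "x = block_mat m g" "m \<in> Mat2 \<int>" "g \<in> Mat2 \<int>" "det g = 1"
    by (auto simp: P0_def SL2_def elim: block_setE)
  then have "block_mat m g \<in> Kp p" if "prime p" for p
    using that Ints_Zloc by (auto simp: Kp_iff Mat2_iff)
  with mg show "x \<in> P.H" by (simp add: P.H_def)
qed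

lemma P_At:
  assumes p: "prime p"
  shows "P.At p = P_at p"
proof (intro equalityI subsetI)
  fix x assume x: "x \<in> P.At p"
  then obtain m g where "x = block_mat m g" "det g > 0" unfolding P.At_def by (auto elim: P_carrierE)
  with x show "x \<in> P_at p" using P_at_iff[OF p, of g m] by (auto simp: P.At_def)
next
  fix x assume x: "x \<in> P_at p"
  then obtain m g where "x = block_mat m g" "det g > 0"
    by (auto simp: P_at_def GL2Q_pos_iff elim: block_setE)
  with x show "x \<in> P.At p" using P_at_iff[OF p, of g m] by (auto simp: P.At_def)
qed

section \<open>Adeles and their local integrality\<close>

definition Rad :: "nat \<Rightarrow> adele set" where
  "Rad p = {a. adele_integral_at p a}"

lemma is_subring_Rad:
  assumes p: "prime p"
  shows "is_subring (Rad p)"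
proof -
  have "adele_integral_at p 0" "adele_integral_at p 1"
    by (transfer, simp add: padic_int_seq_def)+
  moreover have "adele_integral_at p a \<Longrightarrow> adele_integral_at p b \<Longrightarrow> adele_integral_at p (a + b)" for a b
    using p by transfer (simp add: padic_int_seq_add)
  moreover have "adele_integral_at p a \<Longrightarrow> adele_integral_at p b \<Longrightarrow> adele_integral_at p (a * b)" for a b
    using p by transfer (simp add: padic_int_seq_mult)
  moreover have "adele_integral_at p a \<Longrightarrow> adele_integral_at p (- a)" for a
    by transfer (simp add: padic_int_seq_minus)
  ultimately show ?thesis by (simp add: is_subring_def Rad_def)
qed

lemma adele_of_rat_hom [simp]:
  "adele_of_rat 0 = 0" "adele_of_rat 1 = 1"
  "adele_of_rat (x + y) = adele_of_rat x + adele_of_rat y"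
  "adele_of_rat (x * y) = adele_of_rat x * adele_of_rat y"
  "adele_of_rat (- x) = - adele_of_rat x"
  by (transfer, simp add: adele_rel_refl preadele_const)+

lemma adele_of_rat_diff [simp]: "adele_of_rat (x - y) = adele_of_rat x - adele_of_rat y"
  using adele_of_rat_hom(3)[of x "- y"] by simp

lemma adele_of_rat_Rad_iff: "prime p \<Longrightarrow> adele_of_rat x \<in> Rad p \<longleftrightarrow> x \<in> Zloc p"
  unfolding Rad_def Zloc_def mem_Collect_eq by transfer (simp add: padic_int_seq_def)

lemma adele_of_rat_eq_iff [simp]: "adele_of_rat x = adele_of_rat y \<longleftrightarrow> x = y"
proof
  assume "adele_of_rat x = adele_of_rat y"
  then have "padic_null 2 (\<lambda>n. x - y)"
    by transfer (use two_is_prime_nat in \<open>auto simp: adele_rel_def\<close>)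
  then have "padic_abs 2 (x - y) = 0" by (simp add: padic_null_def LIMSEQ_const_iff)
  then show "x = y" using padic_abs_eq_0_iff[OF two_is_prime_nat] by simp
qed simp

lemma padic_abs_le_iff:
  assumes p: "prime p"
  shows "x / of_nat p ^ N \<in> Zloc p \<longleftrightarrow> padic_abs p x \<le> 1 / real p ^ N"
  using prime_gt_0_nat[OF p]
  by (simp add: Zloc_def padic_abs_divide[OF p] padic_abs_power[OF p] padic_abs_prime[OF p] power_divide field_simps)

text \<open>A term, far enough out, of the Cauchy sequence that represents the component of a at p
  serves as x.\<close>

lemma adele_approx:
  assumes p: "prime p"
  shows "\<exists>x. adele_of_rat (1 / of_nat p ^ N) * (a - adele_of_rat x) \<in> Rad p"
proof -
  have "\<exists>x. adele_integral_at p (adele_of_rat (1 / of_nat p ^ N) * (a + - adele_of_rat x))"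
  proof (transfer fixing: p N)
    fix a assume a: "adele_rel a a"
    then have c: "padic_cauchy p (a p)" using p by (simp add: adele_rel_def preadele_def)
    have "1 / real p ^ N > 0" using prime_gt_0_nat[OF p] by simp
    then obtain M where M: "\<And>m n. m \<ge> M \<Longrightarrow> n \<ge> M \<Longrightarrow> padic_abs p (a p m - a p n) < 1 / real p ^ N"
      using c unfolding padic_cauchy_def by blast
    have "padic_int_seq p (\<lambda>n. 1 / of_nat p ^ N * (a p n + - a p M))"
      unfolding padic_int_seq_def eventually_sequentially
    proof (intro exI[of _ M] allI impI)
      fix n assume "n \<ge> M"
      then have "padic_abs p (a p n - a p M) \<le> 1 / real p ^ N" using M[of n M] by simp
      then show "padic_abs p (1 / of_nat p ^ N * (a p n + - a p M)) \<le> 1"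
        using padic_abs_le_iff[OF p, of "a p n - a p M" N] by (simp add: Zloc_def)
    qed
    then show "\<exists>x. prime p \<longrightarrow> padic_int_seq p (\<lambda>n. 1 / of_nat p ^ N * (a p n + - x))" by blast
  qed
  then show ?thesis by (simp add: Rad_def)
qed

lemma finite_not_Rad: "finite {p. prime p \<and> a \<notin> Rad p}"
proof -
  have "finite {p. \<not> adele_integral_at p a}"
  proof transfer
    fix a assume "adele_rel a a"
    then have "finite {p. prime p \<and> \<not> padic_int_seq p (a p)}" by (simp add: adele_rel_def preadele_def)
    then show "finite {p. \<not> (prime p \<longrightarrow> padic_int_seq p (a p))}" by simp
  qed
  moreover have "{p. prime p \<and> a \<notin> Rad p} \<subseteq> {p. \<not> adele_integral_at p a}" by (simp add: Rad_def subset_iff)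
  ultimately show ?thesis by (rule finite_subset[rotated])
qed

text \<open>At p the adele differs from a rational number by something integral, so the bound for
  rational numbers suffices.\<close>

lemma adele_bounded:
  assumes p: "prime p"
  shows "\<exists>N. \<forall>n\<ge>N. adele_of_rat (of_nat p ^ n) * a \<in> Rad p"
proof -
  note R = is_subringD[OF is_subring_Rad[OF p]]
  obtain x where x: "a - adele_of_rat x \<in> Rad p" using adele_approx[OF p, of 0 a] by auto
  obtain N where N: "\<forall>n\<ge>N. of_nat p ^ n * x \<in> Zloc p" using Zloc_bounded[OF p] by blast
  have "adele_of_rat (of_nat p ^ n) * a \<in> Rad p" if "n \<ge> N" for n
  proof -
    have "adele_of_rat (of_nat p ^ n) \<in> Rad p"
      using Ints_Zloc[OF p, of "of_nat p ^ n"] by (simp add: adele_of_rat_Rad_iff[OF p])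
    moreover have "adele_of_rat (of_nat p ^ n * x) \<in> Rad p" using N that by (simp only: adele_of_rat_Rad_iff[OF p])
    ultimately have "adele_of_rat (of_nat p ^ n) * (a - adele_of_rat x) + adele_of_rat (of_nat p ^ n * x) \<in> Rad p"
      using x R by blast
    then show ?thesis by (simp add: algebra_simps)
  qed
  then show ?thesis by blast
qed

lemma zhat_eq: "zhat = (\<Inter>p\<in>{p. prime p}. Rad p)"
  by (auto simp: zhat_def Rad_def)

lemma zhat_iff: "a \<in> zhat \<longleftrightarrow> (\<forall>p. prime p \<longrightarrow> a \<in> Rad p)"
  by (auto simp: zhat_eq)

lemma is_subring_zhat: "is_subring zhat"
  using is_subringD[OF is_subring_Rad] by (simp add: is_subring_def zhat_iff)

lemma adele_of_rat_zhat_iff: "adele_of_rat x \<in> zhat \<longleftrightarrow> x \<in> \<int>"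
  by (simp add: zhat_iff rat_in_Ints_iff adele_of_rat_Rad_iff)

text \<open>The adele with the rational components \<open>f p\<close>.\<close>

definition adele_family :: "(nat \<Rightarrow> rat) \<Rightarrow> adele" where
  "adele_family f = abs_adele (\<lambda>p n. f p)"

definition almost_integral :: "(nat \<Rightarrow> rat) \<Rightarrow> bool" where
  "almost_integral f \<longleftrightarrow> finite {p. prime p \<and> f p \<notin> Zloc p}"

lemma preadele_family: "almost_integral f \<Longrightarrow> preadele (\<lambda>p n. f p)"
  by (simp add: almost_integral_def preadele_def padic_int_seq_def Zloc_def)

lemma adele_family_add:
  assumes "almost_integral f" "almost_integral g"
  shows "adele_family f + adele_family g = adele_family (\<lambda>p. f p + g p)"
  unfolding adele_family_def
  by (rule plus_adele.abs_eq) (use assms in \<open>simp_all add: adele_rel_refl preadele_family\<close>)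

lemma adele_family_mult:
  assumes "almost_integral f" "almost_integral g"
  shows "adele_family f * adele_family g = adele_family (\<lambda>p. f p * g p)"
  unfolding adele_family_def
  by (rule times_adele.abs_eq) (use assms in \<open>simp_all add: adele_rel_refl preadele_family\<close>)

lemma adele_family_const: "adele_family (\<lambda>p. x) = adele_of_rat x"
  by (simp add: adele_family_def adele_of_rat.abs_eq)

lemma adele_family_zhat:
  assumes "\<And>p. prime p \<Longrightarrow> f p \<in> Zloc p"
  shows "almost_integral f" "adele_family f \<in> zhat"
proof -
  have "{p. prime p \<and> f p \<notin> Zloc p} = {}" using assms by blast
  then show f: "almost_integral f" by (simp only: almost_integral_def finite.emptyI)
  have "adele_integral_at p (adele_family f) \<longleftrightarrow> (prime p \<longrightarrow> padic_int_seq p (\<lambda>n. f p))" for p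
    unfolding adele_family_def
    by (rule adele_integral_at.abs_eq) (rule adele_rel_refl[OF preadele_family[OF f]])
  then show "adele_family f \<in> zhat" using assms by (simp add: zhat_def padic_int_seq_def Zloc_def)
qed

lemma adele_family_cong:
  assumes "almost_integral f" "\<And>p. prime p \<Longrightarrow> f p = g p"
  shows "adele_family f = adele_family g"
proof -
  have "{p. prime p \<and> f p \<notin> Zloc p} = {p. prime p \<and> g p \<notin> Zloc p}" using assms(2) by auto
  then have g: "almost_integral g" using assms(1) by (simp add: almost_integral_def)
  have "adele_rel (\<lambda>p n. f p) (\<lambda>p n. g p)"
    unfolding adele_rel_def using preadele_family assms(1) g assms(2) by (simp add: padic_null_def)
  then show ?thesis unfolding adele_family_def by (rule Quotient_rel_abs[OF Quotient_adele])
qed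

lemma almost_integral_const: "almost_integral (\<lambda>p. x)"
  by (simp add: almost_integral_def finite_not_Zloc)

lemma almost_integral_closed:
  assumes "almost_integral f" "almost_integral g"
  shows "almost_integral (\<lambda>p. f p + g p)" "almost_integral (\<lambda>p. f p * g p)"
  using assms is_subringD[OF is_subring_Zloc] unfolding almost_integral_def
  by (auto intro!: finite_subset[of _ "{p. prime p \<and> f p \<notin> Zloc p} \<union> {p. prime p \<and> g p \<notin> Zloc p}"])

section \<open>The adelic group\<close>

definition embm :: "rat^2^2 \<Rightarrow> adele^2^2" where
  "embm m = (\<chi> i j. adele_of_rat (m $ i $ j))"

lemma embm_nth [simp]: "embm m $ i $ j = adele_of_rat (m $ i $ j)"
  by (simp add: embm_def)

lemma embm_simps:
  "embm (m ** n) = embm m ** embm n" "embm (m + n) = embm m + embm n" "embm (m - n) = embm m - embm n"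
  "embm (mat 1) = mat 1" "embm 0 = 0" "embm (- m) = - embm m" "det (embm m) = adele_of_rat (det m)"
  "embm (smul2 c m) = smul2 (adele_of_rat c) (embm m)"
  by (simp_all add: mat2_eq_iff mult2_nth det_2)

lemma embm_Rad_iff: "prime p \<Longrightarrow> embm m \<in> Mat2 (Rad p) \<longleftrightarrow> m \<in> Mat2 (Zloc p)"
  by (simp add: Mat2_iff adele_of_rat_Rad_iff)

lemma P_embed_block: "P_embed (block_mat m g) = block_mat (embm m) (embm g)"
  by (auto simp: vec_eq_iff P_embed_def block_mat_def mat1_nth split: sum.splits)

lemma GL2Af_pos_iff: "g \<in> GL2Af_pos \<longleftrightarrow> (\<exists>q>0. det g = adele_of_rat q)"
proof -
  have "\<exists>u. adele_of_rat q * u = 1" if "q > 0" for q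
    using that by (intro exI[of _ "adele_of_rat (1 / q)"]) (simp flip: adele_of_rat_hom(4))
  then show ?thesis by (auto simp: GL2Af_pos_def GL2_iff)
qed

lemma Pbar_carrier_iff [simp]: "block_mat m g \<in> carrier Pbar_grp \<longleftrightarrow> (\<exists>q>0. det g = adele_of_rat q)"
  by (simp add: Pbar_grp_def GL2Af_pos_iff)

lemma Pbar_carrierE:
  assumes "x \<in> carrier Pbar_grp"
  obtains m g q where "x = block_mat m g" "q > 0" "det g = adele_of_rat q"
  using assms by (auto simp: Pbar_grp_def GL2Af_pos_iff elim!: block_setE)

lemma Pbar_mult: "x \<otimes>\<^bsub>Pbar_grp\<^esub> y = x ** y" and Pbar_one: "\<one>\<^bsub>Pbar_grp\<^esub> = mat 1"
  by (simp_all add: Pbar_grp_def)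

definition ainv :: "rat \<Rightarrow> adele^2^2 \<Rightarrow> adele^2^2" where
  "ainv q g = inv2 (adele_of_rat (1 / q)) g"

lemma ainv:
  assumes "det g = adele_of_rat q" "q \<noteq> 0"
  shows ainv_right: "g ** ainv q g = mat 1" and ainv_left: "ainv q g ** g = mat 1"
    and det_ainv: "det (ainv q g) = adele_of_rat (1 / q)"
proof -
  have d: "det g * adele_of_rat (1 / q) = 1"
    using assms by (simp flip: adele_of_rat_hom(4))
  show 1: "g ** ainv q g = mat 1" "ainv q g ** g = mat 1"
    unfolding ainv_def by (intro inv2 d)+
  have "det g * det (ainv q g) = 1" using 1(1) by (metis det_I det_mul)
  then have "adele_of_rat (1 / q) * (det g * det (ainv q g)) = adele_of_rat (1 / q)" by simp
  then show "det (ainv q g) = adele_of_rat (1 / q)" using d by (simp add: mult.assoc[symmetric] mult.commute)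
qed

lemma group_Pbar: "group Pbar_grp"
  unfolding Pbar_grp_def
proof (rule block_group)
  show "mat 1 \<in> GL2Af_pos" by (auto simp: GL2Af_pos_iff intro!: exI[of _ 1])
  show "g ** h \<in> GL2Af_pos" if gh: "g \<in> GL2Af_pos" "h \<in> GL2Af_pos" for g h
  proof -
    obtain q r where "q > 0" "det g = adele_of_rat q" "r > 0" "det h = adele_of_rat r"
      using gh by (auto simp: GL2Af_pos_iff)
    then show ?thesis unfolding GL2Af_pos_iff by (intro exI[of _ "q * r"]) (simp add: det_mul)
  qed
  show "\<exists>h\<in>GL2Af_pos. h ** g = mat 1" if g: "g \<in> GL2Af_pos" for g
  proof -
    obtain q where q: "q > 0" "det g = adele_of_rat q" using g by (auto simp: GL2Af_pos_iff)
    then show ?thesis using ainv[of g q]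
      by (intro bexI[of _ "ainv q g"]) (auto simp: GL2Af_pos_iff intro!: exI[of _ "1 / q"])
  qed
qed

interpretation Pbar: group Pbar_grp by (rule group_Pbar)

lemma Pbar_inv:
  assumes "det g = adele_of_rat q" "q > 0" "h ** g = mat 1"
  shows "inv\<^bsub>Pbar_grp\<^esub> (block_mat m g) = block_mat (- (m ** h)) h"
proof (rule Pbar.inv_equality)
  have "h = ainv q g"
    by (rule matrix_inverse_unique[OF assms(3)]) (use ainv_right[of g q] assms in simp)
  then show "block_mat (- (m ** h)) h \<in> carrier Pbar_grp"
    using det_ainv[of g q] assms by (auto intro!: exI[of _ "1 / q"])
qed (use assms in \<open>auto simp: Pbar_mult Pbar_one block_mat_inverse\<close>)

lemma Pbar_quot:
  assumes "det h = adele_of_rat q" "q > 0" "k ** h = mat 1"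
  shows "block_mat m g \<otimes>\<^bsub>Pbar_grp\<^esub> inv\<^bsub>Pbar_grp\<^esub> (block_mat n h) = block_mat ((m - n) ** k) (g ** k)"
  by (simp add: Pbar_inv[OF assms] Pbar_mult block_mat_mult matrix_diff_right)

lemma P_embed_hom: "P_embed \<in> hom P_grp Pbar_grp"
proof (rule homI)
  fix x assume "x \<in> carrier P_grp"
  then obtain m g where x: "x = block_mat m g" "det g > 0" by (rule P_carrierE)
  then show "P_embed x \<in> carrier Pbar_grp" by (auto simp: P_embed_block embm_simps)
  fix y assume "y \<in> carrier P_grp"
  then obtain n h where y: "y = block_mat n h" "det h > 0" by (rule P_carrierE)
  show "P_embed (x \<otimes>\<^bsub>P_grp\<^esub> y) = P_embed x \<otimes>\<^bsub>Pbar_grp\<^esub> P_embed y"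
    by (simp add: x y P_mult Pbar_mult block_mat_mult P_embed_block embm_simps)
qed

text \<open>The elements of the adelic group whose component at p is integral together with its
  inverse. Since determinants there are rational, the unit condition can be put on the rational
  number q.\<close>

definition Khat :: "nat \<Rightarrow> (adele^(2+2)^(2+2)) set" where
  "Khat p = block_set (Mat2 (Rad p)) {g \<in> Mat2 (Rad p). \<exists>q>0. det g = adele_of_rat q \<and> padic_abs p q = 1}"

lemma Khat_iff:
  "block_mat m g \<in> Khat p \<longleftrightarrow> m \<in> Mat2 (Rad p) \<and> g \<in> Mat2 (Rad p) \<and>
     (\<exists>q>0. det g = adele_of_rat q \<and> padic_abs p q = 1)"
  by (simp add: Khat_def)

lemma KhatE:
  assumes "x \<in> Khat p"
  obtains m g q where "x = block_mat m g" "m \<in> Mat2 (Rad p)" "g \<in> Mat2 (Rad p)"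
    "q > 0" "det g = adele_of_rat q" "padic_abs p q = 1"
  using assms by (auto simp: Khat_def elim!: block_setE)

lemma ainv_Rad:
  assumes p: "prime p" and g: "g \<in> Mat2 (Rad p)" and q: "padic_abs p q = 1"
  shows "ainv q g \<in> Mat2 (Rad p)"
  unfolding ainv_def
  by (rule inv2_Mat2[OF is_subring_Rad[OF p] _ g])
     (use q in \<open>simp add: adele_of_rat_Rad_iff[OF p] Zloc_def padic_abs_divide[OF p]\<close>)

lemma subgroup_Khat:
  assumes p: "prime p"
  shows "subgroup (Khat p) Pbar_grp"
proof (rule Pbar.subgroupI)
  note R = is_subring_Rad[OF p]
  show "Khat p \<subseteq> carrier Pbar_grp" by (auto simp: Khat_def elim!: block_setE)
  have "block_mat 0 (mat 1) \<in> Khat p"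
    using Mat2_one[OF R] is_subringD(1)[OF R] by (auto simp: Khat_iff Mat2_iff intro!: exI[of _ 1])
  then show "Khat p \<noteq> {}" by blast
  fix x assume "x \<in> Khat p"
  then obtain m g q where x: "x = block_mat m g" "m \<in> Mat2 (Rad p)" "g \<in> Mat2 (Rad p)"
    "q > 0" "det g = adele_of_rat q" "padic_abs p q = 1" by (rule KhatE)
  have l: "ainv q g ** g = mat 1" using ainv_left[OF x(5)] x(4) by simp
  have i: "ainv q g \<in> Mat2 (Rad p)" by (rule ainv_Rad[OF p x(3,6)])
  show "inv\<^bsub>Pbar_grp\<^esub> x \<in> Khat p"
    unfolding x(1) Pbar_inv[OF x(5,4) l] Khat_iff
    using i x det_ainv[OF x(5)] Mat2_uminus[OF R Mat2_mult[OF R x(2) i]]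
    by (auto simp: padic_abs_divide[OF p] intro!: exI[of _ "1 / q"])
  fix y assume "y \<in> Khat p"
  then obtain n h r where y: "y = block_mat n h" "n \<in> Mat2 (Rad p)" "h \<in> Mat2 (Rad p)"
    "r > 0" "det h = adele_of_rat r" "padic_abs p r = 1" by (rule KhatE)
  show "x \<otimes>\<^bsub>Pbar_grp\<^esub> y \<in> Khat p"
    unfolding x(1) y(1) Pbar_mult block_mat_mult Khat_iff
    using Mat2_add[OF R y(2) Mat2_mult[OF R x(2) y(3)]] Mat2_mult[OF R x(3) y(3)] x y
    by (auto simp: det_mul padic_abs_mult[OF p] intro!: exI[of _ "q * r"])
qed

lemma P_embed_Khat:
  assumes p: "prime p" and x: "x \<in> carrier P_grp"
  shows "P_embed x \<in> Khat p \<longleftrightarrow> x \<in> Kp p"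
proof -
  obtain m g where "x = block_mat m g" "det g > 0" using x by (rule P_carrierE)
  then show ?thesis
    by (auto simp: P_embed_block Khat_iff Kp_iff[OF p] embm_Rad_iff[OF p] embm_simps)
qed

lemma Pbar0_iff_SL2: "block_mat m g \<in> Pbar0 \<longleftrightarrow> m \<in> Mat2 zhat \<and> g \<in> Mat2 zhat \<and> det g = 1"
  by (auto simp: Pbar0_def SL2_def)

lemma Mat2_zhat_iff: "m \<in> Mat2 zhat \<longleftrightarrow> (\<forall>p. prime p \<longrightarrow> m \<in> Mat2 (Rad p))"
  by (auto simp: Mat2_iff zhat_iff)

lemma Pbar0_iff: "x \<in> Pbar0 \<longleftrightarrow> x \<in> carrier Pbar_grp \<and> (\<forall>p. prime p \<longrightarrow> x \<in> Khat p)"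
proof
  assume "x \<in> Pbar0"
  then obtain m g where x: "x = block_mat m g" "m \<in> Mat2 zhat" "g \<in> Mat2 zhat" "det g = 1"
    by (auto simp: Pbar0_def SL2_def elim!: block_setE)
  then have d: "det g = adele_of_rat 1" by simp
  show "x \<in> carrier Pbar_grp \<and> (\<forall>p. prime p \<longrightarrow> x \<in> Khat p)"
    using x(2,3) d unfolding x(1) Khat_iff Pbar_carrier_iff Mat2_zhat_iff
    by (intro conjI allI impI exI[of _ 1]) simp_all
next
  assume *: "x \<in> carrier Pbar_grp \<and> (\<forall>p. prime p \<longrightarrow> x \<in> Khat p)"
  then obtain m g q where x: "x = block_mat m g" "q > 0" "det g = adele_of_rat q"
    by (auto elim: Pbar_carrierE)
  have "padic_abs p q = 1" if "prime p" for p
    using * that x by (auto simp: Khat_iff)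
  then have "q = 1" using x(2) by (intro rat_unit_eq_1)
  then show "x \<in> Pbar0" using * x by (auto simp: Pbar0_iff_SL2 Mat2_zhat_iff Khat_iff)
qed

lemma subgroup_Pbar0: "subgroup Pbar0 Pbar_grp"
proof -
  have "subgroup (\<Inter>p\<in>{p. prime p}. Khat p) Pbar_grp"
    using two_is_prime_nat by (intro Pbar.subgroups_Inter) (auto intro: subgroup_Khat)
  moreover have "(\<Inter>p\<in>{p. prime p}. Khat p) = Pbar0"
    using subgroup.mem_carrier[OF subgroup_Khat[OF two_is_prime_nat]] two_is_prime_nat
    by (auto simp: Pbar0_iff)
  ultimately show ?thesis by simp
qed

lemma P_embed_Pbar0: "x \<in> carrier P_grp \<Longrightarrow> P_embed x \<in> Pbar0 \<longleftrightarrow> x \<in> P0"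
  using hom_in_carrier[OF P_embed_hom]
  by (auto simp: Pbar0_iff P_embed_Khat P_H[symmetric] P.H_def)

section \<open>Strong approximation\<close>

lemma Mat2_adele_approx:
  assumes p: "prime p"
  shows "\<exists>m. smul2 (adele_of_rat (1 / of_nat p ^ N)) (M - embm m) \<in> Mat2 (Rad p)"
proof -
  obtain f where f: "\<And>a. adele_of_rat (1 / of_nat p ^ N) * (a - adele_of_rat (f a)) \<in> Rad p"
    using adele_approx[OF p] by metis
  then show ?thesis
    by (intro exI[of _ "mk2 (f (M$1$1)) (f (M$1$2)) (f (M$2$1)) (f (M$2$2))"]) (simp add: Mat2_iff)
qed

lemma Mat2_adele_bounded:
  assumes p: "prime p"
  shows "\<exists>N. \<forall>n\<ge>N. smul2 (adele_of_rat (of_nat p ^ n)) A \<in> Mat2 (Rad p)"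
proof -
  obtain N11 where 11: "\<forall>n\<ge>N11. adele_of_rat (of_nat p ^ n) * A $ 1 $ 1 \<in> Rad p" using adele_bounded[OF p] by blast
  obtain N12 where 12: "\<forall>n\<ge>N12. adele_of_rat (of_nat p ^ n) * A $ 1 $ 2 \<in> Rad p" using adele_bounded[OF p] by blast
  obtain N21 where 21: "\<forall>n\<ge>N21. adele_of_rat (of_nat p ^ n) * A $ 2 $ 1 \<in> Rad p" using adele_bounded[OF p] by blast
  obtain N22 where 22: "\<forall>n\<ge>N22. adele_of_rat (of_nat p ^ n) * A $ 2 $ 2 \<in> Rad p" using adele_bounded[OF p] by blast
  have "smul2 (adele_of_rat (of_nat p ^ n)) A \<in> Mat2 (Rad p)" if "n \<ge> N11 + N12 + N21 + N22" for n
    using that 11 12 21 22 by (simp add: Mat2_iff)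
  then show ?thesis by blast
qed

lemma padic_abs_near_1:
  assumes p: "prime p" and x: "(1 - x) / of_nat p \<in> Zloc p"
  shows "padic_abs p x = 1"
proof -
  have "padic_abs p (1 - x) \<le> 1 / real p" using padic_abs_le_iff[OF p, of "1 - x" 1] x by simp
  also have "\<dots> < 1" using prime_gt_1_nat[OF p] by simp
  finally have lt: "padic_abs p (1 - x) < 1" .
  have "padic_abs p x \<le> 1" using padic_abs_diff[OF p, of 1 "1 - x"] lt by simp
  moreover have "1 \<le> max (padic_abs p (1 - x)) (padic_abs p x)" using padic_abs_add[OF p, of "1 - x" x] by simp
  ultimately show ?thesis using lt by (simp add: max_def split: if_splits)
qed

lemma det_one_minus:
  fixes F :: "'a::comm_ring_1^2^2"
  assumes R: "is_subring R" and c: "c \<in> R" and F: "F \<in> Mat2 R"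
  obtains f where "f \<in> R" "det (mat 1 - smul2 c F) = 1 - c * f"
proof (rule that)
  show "det (mat 1 - smul2 c F) = 1 - c * (F$1$1 + F$2$2 - c * det F)"
    by (simp add: det_2 algebra_simps)
  show "F$1$1 + F$2$2 - c * det F \<in> R"
    using F by (intro is_subringD(3,4,6)[OF R] c Mat2_det[OF R]) (simp_all add: Mat2_iff)
qed

text \<open>The determinant of 1 - p F is 1 modulo p, and for a rational determinant x this
  congruence descends to x.\<close>

lemma near_one_det:
  assumes p: "prime p" and F: "F \<in> Mat2 (Rad p)"
    and d: "det (mat 1 - smul2 (adele_of_rat (of_nat p)) F) = adele_of_rat x"
  shows "padic_abs p x = 1"
proof -
  have pR: "adele_of_rat (of_nat p) \<in> Rad p"
    using Ints_Zloc[OF p, of "of_nat p"] by (simp add: adele_of_rat_Rad_iff[OF p])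
  obtain f where f: "f \<in> Rad p" "det (mat 1 - smul2 (adele_of_rat (of_nat p)) F) = 1 - adele_of_rat (of_nat p) * f"
    by (rule det_one_minus[OF is_subring_Rad[OF p] pR F])
  have "adele_of_rat ((1 - x) / of_nat p) = adele_of_rat (1 / of_nat p) * (1 - adele_of_rat x)"
    by (simp flip: adele_of_rat_hom(4) adele_of_rat_hom(2) adele_of_rat_diff)
  also have "1 - adele_of_rat x = adele_of_rat (of_nat p) * f" unfolding d[symmetric] f(2) by simp
  also have "adele_of_rat (1 / of_nat p) * (adele_of_rat (of_nat p) * f) = adele_of_rat (1 / of_nat p * of_nat p) * f"
    by (simp only: adele_of_rat_hom(4) mult.assoc)
  also have "\<dots> = f" using p by simp
  finally have "(1 - x) / of_nat p \<in> Zloc p" using f(1) adele_of_rat_Rad_iff[OF p] by metis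
  then show ?thesis by (rule padic_abs_near_1[OF p])
qed

text \<open>Rational blocks m and g approximate X at p so well that
  \<open>embm g ** \<Gamma>i\<close> is 1 minus p times an integral matrix. Its determinant is then
  a unit at p, so its inverse is integral as well.\<close>

lemma Pbar_local_decomp:
  assumes p: "prime p" and X: "X \<in> carrier Pbar_grp"
  shows "\<exists>y\<in>carrier P_grp. X \<otimes>\<^bsub>Pbar_grp\<^esub> inv\<^bsub>Pbar_grp\<^esub> (P_embed y) \<in> Khat p"
proof -
  note R = is_subring_Rad[OF p]
  obtain M \<Gamma> q where X': "X = block_mat M \<Gamma>" and q: "q > 0" "det \<Gamma> = adele_of_rat q"
    using X by (rule Pbar_carrierE)
  define \<Gamma>i where "\<Gamma>i = ainv q \<Gamma>"
  have \<Gamma>i: "\<Gamma> ** \<Gamma>i = mat 1" "\<Gamma>i ** \<Gamma> = mat 1" "det \<Gamma>i = adele_of_rat (1 / q)"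
    using ainv[OF q(2)] q(1) by (auto simp: \<Gamma>i_def)
  \<comment> \<open>N clears the denominators of \<open>\<Gamma>i\<close>; approximating to order
    \<open>Suc N\<close> leaves one factor p to spare, which forces the unit determinant.\<close>
  obtain N where N: "smul2 (adele_of_rat (of_nat p ^ N)) \<Gamma>i \<in> Mat2 (Rad p)"
    using Mat2_adele_bounded[OF p] by blast
  obtain g where g: "smul2 (adele_of_rat (1 / of_nat p ^ (Suc N))) (\<Gamma> - embm g) \<in> Mat2 (Rad p)"
    using Mat2_adele_approx[OF p] by blast
  obtain m where m: "smul2 (adele_of_rat (1 / of_nat p ^ (Suc N))) (M - embm m) \<in> Mat2 (Rad p)"
    using Mat2_adele_approx[OF p] by blast
  define \<pi> c where "\<pi> = adele_of_rat (of_nat p)" and "c = adele_of_rat (of_nat p ^ N)"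
  have p0: "(of_nat p :: rat) \<noteq> 0" using p by auto
  have "\<pi> * (c * adele_of_rat (1 / of_nat p ^ Suc N)) = adele_of_rat (of_nat p * (of_nat p ^ N * (1 / of_nat p ^ Suc N)))"
    unfolding \<pi>_def c_def by (simp only: adele_of_rat_hom(4))
  also have "of_nat p * (of_nat p ^ N * (1 / of_nat p ^ Suc N)) = (1 :: rat)" using p0 by simp
  finally have \<pi>c: "\<pi> * (c * adele_of_rat (1 / of_nat p ^ Suc N)) = 1" by simp
  have small: "\<exists>F\<in>Mat2 (Rad p). D ** \<Gamma>i = smul2 \<pi> F"
    if D: "smul2 (adele_of_rat (1 / of_nat p ^ (Suc N))) D \<in> Mat2 (Rad p)" for D
  proof -
    let ?F = "smul2 (adele_of_rat (1 / of_nat p ^ (Suc N))) D ** smul2 c \<Gamma>i"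
    have "?F \<in> Mat2 (Rad p)" unfolding c_def by (intro Mat2_mult[OF R] D N)
    moreover have "smul2 \<pi> ?F = smul2 (\<pi> * (c * adele_of_rat (1 / of_nat p ^ Suc N))) (D ** \<Gamma>i)"
      by (simp only: smul2_simps(1,3,4) mult_ac)
    then have "D ** \<Gamma>i = smul2 \<pi> ?F" unfolding \<pi>c by (simp only: smul2_simps(2))
    ultimately show ?thesis by blast
  qed
  obtain F where F: "F \<in> Mat2 (Rad p)" "(\<Gamma> - embm g) ** \<Gamma>i = smul2 \<pi> F" using small[OF g] by blast
  obtain F' where F': "F' \<in> Mat2 (Rad p)" "(M - embm m) ** \<Gamma>i = smul2 \<pi> F'" using small[OF m] by blast
  have \<pi>R: "\<pi> \<in> Rad p"
    using Ints_Zloc[OF p, of "of_nat p"] by (simp add: \<pi>_def adele_of_rat_Rad_iff[OF p])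
  have smR: "smul2 \<pi> F \<in> Mat2 (Rad p)" if "F \<in> Mat2 (Rad p)" for F
    using that is_subringD(4)[OF R \<pi>R] unfolding Mat2_iff smul2_nth by blast
  have W: "embm g ** \<Gamma>i = mat 1 - smul2 \<pi> F"
    unfolding F(2)[symmetric] by (simp add: matrix_diff_right \<Gamma>i)
  have "det (mat 1 - smul2 \<pi> F) = adele_of_rat (det g / q)"
    unfolding W[symmetric] det_mul embm_simps \<Gamma>i(3) adele_of_rat_hom(4)[symmetric] by simp
  then have dg: "padic_abs p (det g / q) = 1" unfolding \<pi>_def by (rule near_one_det[OF p F(1)])
  \<comment> \<open>Approximation at p does not see the sign of the determinant of g. The diagonal
    matrix with entries 1 and -1, which is integral, corrects it.\<close>
  define \<sigma> :: "rat^2^2" where "\<sigma> = (if det g > 0 then mat 1 else mk2 1 0 0 (- 1))"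
  have \<sigma>: "\<sigma> \<in> Mat2 (Zloc p)" "det \<sigma> = (if det g > 0 then 1 else - 1)"
    using is_subringD[OF is_subring_Zloc[OF p]] by (auto simp: \<sigma>_def Mat2_iff det_2)
  define g' where "g' = \<sigma> ** g"
  have "det g \<noteq> 0" using dg by auto
  then have g': "det g' > 0" "padic_abs p (det g' / q) = 1"
    using dg by (auto simp: g'_def det_mul \<sigma>(2))
  have W': "embm g' ** \<Gamma>i \<in> Mat2 (Rad p)"
    unfolding g'_def embm_simps matrix_mul_assoc[symmetric] W
    by (intro Mat2_mult[OF R] Mat2_diff[OF R] Mat2_one[OF R] smR F) (simp add: embm_Rad_iff[OF p] \<sigma>)
  have dW': "det (embm g' ** \<Gamma>i) = adele_of_rat (det g' / q)"
    unfolding det_mul embm_simps \<Gamma>i(3) adele_of_rat_hom(4)[symmetric] by simp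
  let ?k = "embm (rinv g')"
  have kg: "embm g' ** ?k = mat 1" "?k ** embm g' = mat 1"
    using rinv[of g'] g'(1) by (simp_all flip: embm_simps(1) add: embm_simps(4))
  have "ainv (det g' / q) (embm g' ** \<Gamma>i) = \<Gamma> ** ?k"
  proof (rule matrix_inverse_unique)
    show "ainv (det g' / q) (embm g' ** \<Gamma>i) ** (embm g' ** \<Gamma>i) = mat 1"
      using ainv_left[OF dW'] g' q by simp
    have "(embm g' ** \<Gamma>i) ** (\<Gamma> ** ?k) = embm g' ** (\<Gamma>i ** \<Gamma>) ** ?k" by (simp only: matrix_mul_assoc)
    then show "(embm g' ** \<Gamma>i) ** (\<Gamma> ** ?k) = mat 1" by (simp add: \<Gamma>i kg)
  qed
  then have \<Gamma>k: "\<Gamma> ** ?k \<in> Mat2 (Rad p)" using ainv_Rad[OF p W' g'(2)] by simp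
  have "(M - embm m) ** ?k = ((M - embm m) ** \<Gamma>i) ** (\<Gamma> ** ?k)"
  proof -
    have "((M - embm m) ** \<Gamma>i) ** (\<Gamma> ** ?k) = (M - embm m) ** (\<Gamma>i ** \<Gamma>) ** ?k" by (simp only: matrix_mul_assoc)
    then show ?thesis by (simp add: \<Gamma>i)
  qed
  then have Mk: "(M - embm m) ** ?k \<in> Mat2 (Rad p)"
    unfolding F'(2) using Mat2_mult[OF R smR[OF F'(1)] \<Gamma>k] by simp
  have dk: "det (\<Gamma> ** ?k) = adele_of_rat (q / det g')"
    using det_rinv[of g'] g'(1) q(2) by (simp add: det_mul embm_simps flip: adele_of_rat_hom(4))
  have "padic_abs p (q / det g') = 1"
    using g' q(1) by (simp add: padic_abs_divide[OF p] divide_eq_1_iff)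
  then have "block_mat ((M - embm m) ** ?k) (\<Gamma> ** ?k) \<in> Khat p"
    unfolding Khat_iff using Mk \<Gamma>k dk q(1) g'(1) by (intro conjI exI[of _ "q / det g'"]) simp_all
  moreover have "X \<otimes>\<^bsub>Pbar_grp\<^esub> inv\<^bsub>Pbar_grp\<^esub> (P_embed (block_mat m g')) = block_mat ((M - embm m) ** ?k) (\<Gamma> ** ?k)"
    unfolding X' P_embed_block by (rule Pbar_quot[OF embm_simps(7) g'(1) kg(2)])
  ultimately show ?thesis using g'(1) by (intro bexI[of _ "block_mat m g'"]) simp_all
qed

lemma finite_not_Khat:
  assumes X: "X \<in> carrier Pbar_grp"
  shows "finite {p. prime p \<and> X \<notin> Khat p}"
proof -
  obtain m g q where mg: "X = block_mat m g" "q > 0" "det g = adele_of_rat q" using X by (rule Pbar_carrierE)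
  let ?D = "{m$1$1, m$1$2, m$2$1, m$2$2, g$1$1, g$1$2, g$2$1, g$2$2, adele_of_rat q, adele_of_rat (1 / q)}"
  have "{p. prime p \<and> X \<notin> Khat p} \<subseteq> (\<Union>c\<in>?D. {p. prime p \<and> c \<notin> Rad p})"
  proof
    fix p assume "p \<in> {p. prime p \<and> X \<notin> Khat p}"
    then have p: "prime p" and nx: "X \<notin> Khat p" by auto
    show "p \<in> (\<Union>c\<in>?D. {p. prime p \<and> c \<notin> Rad p})"
    proof (rule ccontr)
      assume "p \<notin> (\<Union>c\<in>?D. {p. prime p \<and> c \<notin> Rad p})"
      then have D: "m \<in> Mat2 (Rad p)" "g \<in> Mat2 (Rad p)" "adele_of_rat q \<in> Rad p" "adele_of_rat (1 / q) \<in> Rad p"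
        using p by (auto simp: Mat2_iff)
      have le: "padic_abs p q \<le> 1" "1 / padic_abs p q \<le> 1"
        using D(3,4) by (simp_all add: adele_of_rat_Rad_iff[OF p] Zloc_def padic_abs_divide[OF p])
      moreover have "padic_abs p q > 0"
        using mg(2) padic_abs_eq_0_iff[OF p, of q] padic_abs_nonneg[of p q] by linarith
      ultimately have "padic_abs p q = 1" by (simp add: divide_le_eq)
      then have "X \<in> Khat p" unfolding mg(1) Khat_iff using D(1,2) mg by blast
      with nx show False by simp
    qed
  qed
  then show ?thesis by (rule finite_subset) (intro finite_UN_I finite.intros finite_not_Rad)
qed

interpretation \<iota>: group_hom P_grp Pbar_grp P_embed
  by unfold_locales (rule P_embed_hom)

text \<open>A class number one statement: the adelic group is the product of \<open>Pbar0\<close>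
  and P. The representatives found at the single primes are glued to one element of P.\<close>

lemma Pbar_decomp:
  assumes X: "X \<in> carrier Pbar_grp"
  shows "\<exists>y\<in>carrier P_grp. \<exists>k\<in>Pbar0. X = k \<otimes>\<^bsub>Pbar_grp\<^esub> P_embed y"
proof -
  \<comment> \<open>Insisting on the unit element wherever X is integral keeps all but finitely many
    representatives in \<open>Kp p\<close>, as gluing demands.\<close>
  have "\<forall>p\<in>{p. prime p}. \<exists>y. y \<in> carrier P_grp \<and> X \<otimes>\<^bsub>Pbar_grp\<^esub> inv\<^bsub>Pbar_grp\<^esub> (P_embed y) \<in> Khat p \<and>
      (X \<in> Khat p \<longrightarrow> y = \<one>\<^bsub>P_grp\<^esub>)"
  proof
    fix p :: nat assume "p \<in> {p. prime p}"
    then have p: "prime p" by simp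
    show "\<exists>y. y \<in> carrier P_grp \<and> X \<otimes>\<^bsub>Pbar_grp\<^esub> inv\<^bsub>Pbar_grp\<^esub> (P_embed y) \<in> Khat p \<and> (X \<in> Khat p \<longrightarrow> y = \<one>\<^bsub>P_grp\<^esub>)"
    proof (cases "X \<in> Khat p")
      case True
      then show ?thesis using X by (intro exI[of _ "\<one>\<^bsub>P_grp\<^esub>"]) simp
    qed (use Pbar_local_decomp[OF p X] in blast)
  qed
  from bchoice[OF this] obtain y where y: "\<And>p. prime p \<Longrightarrow> y p \<in> carrier P_grp"
    "\<And>p. prime p \<Longrightarrow> X \<otimes>\<^bsub>Pbar_grp\<^esub> inv\<^bsub>Pbar_grp\<^esub> (P_embed (y p)) \<in> Khat p"
    "\<And>p. prime p \<Longrightarrow> X \<in> Khat p \<Longrightarrow> y p = \<one>\<^bsub>P_grp\<^esub>" by auto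
  have "finite {p \<in> {p. prime p}. y p \<notin> Kp p}"
  proof (rule finite_subset[OF _ finite_not_Khat[OF X]], rule subsetI)
    fix p assume "p \<in> {p \<in> {p. prime p}. y p \<notin> Kp p}"
    then show "p \<in> {p. prime p \<and> X \<notin> Khat p}"
      using y(3)[of p] subgroup.one_closed[OF subgroup_Kp[of p]] by auto
  qed
  then obtain z where z: "z \<in> carrier P_grp" "\<And>p. p \<in> {p. prime p} \<Longrightarrow> P.same p z (y p)"
    using P.glue_family[of y] y(1) by auto
  let ?k = "X \<otimes>\<^bsub>Pbar_grp\<^esub> inv\<^bsub>Pbar_grp\<^esub> (P_embed z)"
  have zc: "P_embed z \<in> carrier Pbar_grp" using z(1) by simp
  have "?k \<in> Khat p" if p: "prime p" for p
  proof -
    have yc: "y p \<in> carrier P_grp" "P_embed (y p) \<in> carrier Pbar_grp" using y(1)[OF p] by simp_all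
    have "y p \<otimes>\<^bsub>P_grp\<^esub> inv\<^bsub>P_grp\<^esub> z \<in> Kp p"
      using P.same_sym[OF _ z(1) yc(1) z(2)] p by (simp add: P.same_def)
    then have "P_embed (y p \<otimes>\<^bsub>P_grp\<^esub> inv\<^bsub>P_grp\<^esub> z) \<in> Khat p"
      by (rule iffD2[OF P_embed_Khat[OF p P.m_closed[OF yc(1) P.inv_closed[OF z(1)]]]])
    then have "(X \<otimes>\<^bsub>Pbar_grp\<^esub> inv\<^bsub>Pbar_grp\<^esub> (P_embed (y p))) \<otimes>\<^bsub>Pbar_grp\<^esub> P_embed (y p \<otimes>\<^bsub>P_grp\<^esub> inv\<^bsub>P_grp\<^esub> z) \<in> Khat p"
      by (rule subgroup.m_closed[OF subgroup_Khat[OF p] y(2)[OF p]])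
    also have "(X \<otimes>\<^bsub>Pbar_grp\<^esub> inv\<^bsub>Pbar_grp\<^esub> (P_embed (y p))) \<otimes>\<^bsub>Pbar_grp\<^esub> P_embed (y p \<otimes>\<^bsub>P_grp\<^esub> inv\<^bsub>P_grp\<^esub> z) = ?k"
      using X yc z(1) zc by (simp add: Pbar.m_assoc) (simp add: Pbar.m_assoc[symmetric])
    finally show ?thesis .
  qed
  then have "?k \<in> Pbar0" using X zc by (simp add: Pbar0_iff)
  moreover have "X = ?k \<otimes>\<^bsub>Pbar_grp\<^esub> P_embed z" using X zc by (simp add: Pbar.m_assoc)
  ultimately show ?thesis using z(1) by blast
qed

text \<open>\<open>Pbar_decomp\<close>, applied to the translation by k/N, writes k/N as m + a g
  with a and g integral. Multiplied by N this compares k with the rational matrix N m, which is then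
  integral too.\<close>

lemma zhat_approx:
  assumes k: "k \<in> Mat2 zhat" and N: "N > 0"
  obtains c S where "c \<in> Mat2 \<int>" "S \<in> Mat2 zhat" "k - embm c = smul2 (adele_of_rat (of_nat N)) S"
proof -
  note Z = is_subring_zhat
  have N0: "(of_nat N :: rat) \<noteq> 0" using N by simp
  have nn: "adele_of_rat (of_nat N) * adele_of_rat (1 / of_nat N) = 1"
    using N0 by (simp flip: adele_of_rat_hom(4))
  let ?X = "block_mat (smul2 (adele_of_rat (1 / of_nat N)) k) (mat 1)"
  have X: "?X \<in> carrier Pbar_grp" by (auto intro!: exI[of _ 1])
  obtain y l where y: "y \<in> carrier P_grp" "l \<in> Pbar0" "?X = l ** P_embed y"
    using Pbar_decomp[OF X] by (auto simp: Pbar_mult)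
  obtain m g where mg: "y = block_mat m g" "det g > 0" using y(1) by (rule P_carrierE)
  obtain a b where ab: "l = block_mat a b" "a \<in> Mat2 zhat" "b \<in> Mat2 zhat" "det b = 1"
    using y(2) by (auto simp: Pbar0_def SL2_def elim!: block_setE)
  have e: "smul2 (adele_of_rat (1 / of_nat N)) k = embm m + a ** embm g" "b ** embm g = mat 1"
    using y(3) by (simp_all add: mg(1) ab(1) P_embed_block block_mat_mult block_mat_eq_iff)
  have "inv2 1 b = embm g"
    by (rule matrix_inverse_unique[OF inv2(2) e(2)]) (use ab(4) in simp)
  then have gZ: "embm g \<in> Mat2 zhat" using inv2_Mat2[OF Z is_subringD(2)[OF Z] ab(3)] by simp
  let ?S = "a ** embm g"
  have S: "?S \<in> Mat2 zhat" by (rule Mat2_mult[OF Z ab(2) gZ])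
  have "k = smul2 (adele_of_rat (of_nat N)) (smul2 (adele_of_rat (1 / of_nat N)) k)"
    by (simp only: smul2_simps(1,2) nn)
  also have "\<dots> = embm (smul2 (of_nat N) m) + smul2 (adele_of_rat (of_nat N)) ?S"
    unfolding e(1) by (simp add: smul2_simps embm_simps)
  finally have ke: "k - embm (smul2 (of_nat N) m) = smul2 (adele_of_rat (of_nat N)) ?S" by simp
  have NZ: "adele_of_rat (of_nat N) \<in> zhat" by (simp add: adele_of_rat_zhat_iff)
  have "smul2 (adele_of_rat (of_nat N)) ?S \<in> Mat2 zhat"
    using S is_subringD(4)[OF Z NZ] unfolding Mat2_iff smul2_nth by blast
  then have "k - (k - embm (smul2 (of_nat N) m)) \<in> Mat2 zhat" unfolding ke by (rule Mat2_diff[OF Z k])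
  then have "embm (smul2 (of_nat N) m) \<in> Mat2 zhat" by simp
  then have "smul2 (of_nat N) m \<in> Mat2 \<int>" unfolding Mat2_iff embm_nth adele_of_rat_zhat_iff .
  then show thesis using S ke by (rule that)
qed

text \<open>Reduction from SL2(Z) to SL2(Z/N) is surjective: the lower row is made coprime within
  its residue classes, and a Bezout relation for it supplies corrections of the upper row by
  multiples of N.\<close>

lemma SL2_lift:
  fixes a b c e N :: int
  assumes N: "N > 0" and d: "N dvd a * e - b * c - 1"
  obtains a' b' c' e' where "N dvd a - a'" "N dvd b - b'" "N dvd c - c'" "N dvd e - e'" "a' * e' - b' * c' = 1"
proof -
  \<comment> \<open>The entry 0 is replaced by N, in the same residue class, so that c' has only
    finitely many prime divisors.\<close>
  define c' where "c' = (if c = 0 then N else c)"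
  have c': "c' \<noteq> 0" "N dvd c - c'" using N by (auto simp: c'_def)
  have d': "N dvd a * e - b * c' - 1"
  proof -
    have *: "a * e - b * c' - 1 = (a * e - b * c - 1) + b * (c - c')" by (simp add: algebra_simps)
    show ?thesis unfolding * by (intro dvd_add d dvd_mult c'(2))
  qed
  \<comment> \<open>A prime divisor of c' that divides e divides neither N, by the determinant
    congruence, nor t; one that does not divide e divides t. In both cases it does not divide e + t
    N.\<close>
  define t where "t = \<Prod>{p \<in> prime_factors c'. \<not> p dvd e}"
  define e' where "e' = e + t * N"
  have "coprime c' e'"
  proof (rule ccontr)
    assume "\<not> coprime c' e'"
    then have "\<not> is_unit (gcd c' e')" by (simp add: coprime_iff_gcd_eq_1)
    then obtain p where p: "prime p" "p dvd gcd c' e'"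
      using prime_divisor_exists[of "gcd c' e'"] c' by auto
    then have pc: "p dvd c'" and pe': "p dvd e'" by auto
    show False
    proof (cases "p dvd e")
      case True
      then have "p dvd t * N" using pe' by (simp add: e'_def dvd_add_right_iff)
      moreover have "\<not> p dvd t"
      proof
        assume "p dvd t"
        then obtain q where q: "q \<in> prime_factors c'" "\<not> q dvd e" "p dvd q"
          using prime_dvd_prod_iff[of "{p \<in> prime_factors c'. \<not> p dvd e}" p "\<lambda>x. x"] p(1) by (auto simp: t_def)
        then have "p = q" using primes_dvd_imp_eq[OF p(1), of q] by (auto simp: in_prime_factors_iff)
        with q True show False by simp
      qed
      ultimately have "p dvd N" using p(1) prime_dvd_mult_iff by blast
      then have "p dvd a * e - b * c' - 1" using d' dvd_trans by blast
      moreover have "p dvd a * e - b * c'" using True pc by simp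
      ultimately have "p dvd (a * e - b * c') - (a * e - b * c' - 1)" by (rule dvd_diff[rotated])
      then have "p dvd 1" by simp
      then show False using p(1) not_prime_unit by blast
    next
      case False
      then have "p \<in> {p \<in> prime_factors c'. \<not> p dvd e}" using p(1) pc c'(1) by (simp add: in_prime_factors_iff)
      then have "p dvd t" unfolding t_def by (intro dvd_prodI[where f = "\<lambda>x. x", simplified]) simp_all
      then have "p dvd e" using pe' by (simp add: e'_def dvd_add_left_iff)
      with False show False by simp
    qed
  qed
  then have "gcd e' c' = 1" by (simp add: coprime_iff_gcd_eq_1 gcd.commute)
  then obtain u v where uv: "u * e' + v * c' = 1" using bezout_int[of e' c'] by metis
  have *: "a * e' - b * c' - 1 = (a * e - b * c' - 1) + a * t * N" by (simp add: e'_def algebra_simps)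
  have "N dvd a * e' - b * c' - 1" unfolding * by (intro dvd_add d' dvd_triv_right)
  then obtain m where m: "a * e' - b * c' - 1 = N * m" by (elim dvdE)
  \<comment> \<open>N m is the error of the determinant; the Bezout relation distributes it over the
    upper row.\<close>
  let ?a = "a - m * u * N" and ?b = "b + m * v * N"
  have "?a * e' - ?b * c' = (a * e' - b * c') - m * N * (u * e' + v * c')" by (simp add: algebra_simps)
  also have "\<dots> = 1" unfolding uv using m by (simp add: mult.commute)
  finally have "?a * e' - ?b * c' = 1" .
  moreover have "N dvd a - ?a" "N dvd b - ?b" "N dvd e - e'" by (simp_all add: e'_def)
  ultimately show thesis using c'(2) that by blast
qed

lemma Mat2_denominator:
  fixes m :: "rat^2^2"
  obtains N where "N > 0" "smul2 (of_nat N) m \<in> Mat2 \<int>"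
proof -
  have den: "\<exists>N>0. of_nat N * x \<in> \<int>" for x :: rat
  proof -
    obtain a b where q: "quotient_of x = (a, b)" by force
    have "of_nat (nat b) * x = of_int a"
      using quotient_of_denom_pos[OF q] quotient_of_div[OF q] by simp
    then show ?thesis using quotient_of_denom_pos[OF q] by (intro exI[of _ "nat b"]) simp
  qed
  obtain N11 N12 N21 N22 where N: "N11 > 0" "of_nat N11 * m$1$1 \<in> \<int>" "N12 > 0" "of_nat N12 * m$1$2 \<in> \<int>"
    "N21 > 0" "of_nat N21 * m$2$1 \<in> \<int>" "N22 > 0" "of_nat N22 * m$2$2 \<in> \<int>"
    using den by meson
  let ?N = "N11 * N12 * N21 * N22"
  have mult: "of_nat (k * n) * x \<in> \<int>" if "of_nat n * x \<in> \<int>" for k n and x :: rat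
    using Ints_mult[OF Ints_of_nat that, of k] by (simp add: mult.assoc)
  have "of_nat ?N * m$1$1 \<in> \<int>" "of_nat ?N * m$1$2 \<in> \<int>" "of_nat ?N * m$2$1 \<in> \<int>" "of_nat ?N * m$2$2 \<in> \<int>"
    using mult[OF N(2), of "N12 * N21 * N22"] mult[OF N(4), of "N11 * N21 * N22"]
      mult[OF N(6), of "N11 * N12 * N22"] mult[OF N(8), of "N11 * N12 * N21"] by (simp_all only: mult_ac)
  then have "smul2 (of_nat ?N) m \<in> Mat2 \<int>" unfolding Mat2_iff smul2_nth by blast
  then show thesis using N by (intro that[of ?N]) simp_all
qed

lemma smul2_Ints_mult:
  assumes "smul2 (of_nat n) m \<in> Mat2 \<int>"
  shows "smul2 (of_nat (k * n)) m \<in> Mat2 (\<int> :: rat set)"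
proof -
  have "smul2 (of_nat (k * n)) m $ i $ j = of_nat k * (smul2 (of_nat n) m $ i $ j)" for i j by simp
  moreover have "of_nat k * (smul2 (of_nat n) m $ i $ j) \<in> \<int>" for i j
    using assms unfolding Mat2_def by (intro Ints_mult Ints_of_nat) blast
  ultimately show ?thesis unfolding Mat2_def by (simp only: mem_Collect_eq) blast
qed

lemma embm_zhat_iff: "embm m \<in> Mat2 zhat \<longleftrightarrow> m \<in> Mat2 \<int>"
  by (simp add: Mat2_iff adele_of_rat_zhat_iff)

text \<open>Strong approximation for SL2: an entrywise approximation c of b has determinant 1 modulo
  N because det b = 1, and \<open>SL2_lift\<close> moves it to determinant exactly 1 within its
  residue class.\<close>

lemma SL2_zhat_approx:
  assumes b: "b \<in> Mat2 zhat" "det b = 1" and N: "N > 0"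
  obtains d S where "d \<in> Mat2 \<int>" "det d = 1" "S \<in> Mat2 zhat" "b - embm d = smul2 (adele_of_rat (of_nat N)) S"
proof -
  note Z = is_subring_zhat
  let ?n = "adele_of_rat (of_nat N)"
  obtain c S where c: "c \<in> Mat2 \<int>" and S: "S \<in> Mat2 zhat" and bc: "b - embm c = smul2 ?n S"
    by (rule zhat_approx[OF b(1) N])
  have nZ: "?n \<in> zhat" by (simp add: adele_of_rat_zhat_iff)
  have cZ: "embm c \<in> Mat2 zhat" using c by (simp add: embm_zhat_iff)
  have N0: "(of_nat N :: rat) \<noteq> 0" using N by simp
  \<comment> \<open>Expanding the determinant of c + N S gives det b = det c + N f.\<close>
  let ?f = "embm c$1$1 * S$2$2 + S$1$1 * embm c$2$2 - embm c$1$2 * S$2$1 - S$1$2 * embm c$2$1 + ?n * det S"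
  have fZ: "?f \<in> zhat"
    using cZ S by (intro is_subringD(3,4,6)[OF Z] nZ Mat2_det[OF Z]) (simp_all add: Mat2_iff)
  have "b = embm c + smul2 ?n S" using bc by (simp add: algebra_simps)
  then have "det b = det (embm c) + ?n * ?f" by (simp add: det_2 algebra_simps)
  then have "?n * ?f = 1 - det (embm c)" using b(2) by (metis add_diff_cancel_left')
  then have "adele_of_rat (1 - det c) = ?n * ?f" by (simp add: embm_simps)
  then have "adele_of_rat (1 / of_nat N) * adele_of_rat (1 - det c) = adele_of_rat (1 / of_nat N) * ?n * ?f"
    by (simp only: mult.assoc)
  also have "adele_of_rat (1 / of_nat N) * ?n = adele_of_rat 1"
    using N0 by (simp only: adele_of_rat_hom(4)[symmetric]) simp
  finally have "adele_of_rat (1 / of_nat N * (1 - det c)) = ?f" by (simp only: adele_of_rat_hom mult_1)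
  then have "1 / of_nat N * (1 - det c) \<in> \<int>" using fZ adele_of_rat_zhat_iff by metis
  then obtain z where z: "1 / of_nat N * (1 - det c) = of_int z" by (elim Ints_cases)
  obtain c11 c12 c21 c22 where cc: "c$1$1 = of_int c11" "c$1$2 = of_int c12" "c$2$1 = of_int c21" "c$2$2 = of_int c22"
    using c unfolding Mat2_iff by (metis Ints_cases)
  have "of_int (c11 * c22 - c12 * c21 - 1) = (of_int (int N * (- z)) :: rat)"
    using z N0 by (simp add: det_2 cc field_simps)
  then have "c11 * c22 - c12 * c21 - 1 = int N * (- z)" by (simp only: of_int_eq_iff)
  then have "int N dvd c11 * c22 - c12 * c21 - 1" by (rule dvdI)
  then obtain d11 d12 d21 d22 where d: "int N dvd c11 - d11" "int N dvd c12 - d12" "int N dvd c21 - d21"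
    "int N dvd c22 - d22" "d11 * d22 - d12 * d21 = 1"
    using N by (auto elim: SL2_lift[rotated])
  let ?d = "mk2 (of_int d11) (of_int d12) (of_int d21) (of_int d22) :: rat^2^2"
  have "\<exists>w\<in>\<int>. of_int x - of_int y = of_nat N * (w :: rat)" if xy: "int N dvd x - y" for x y
  proof -
    obtain w where "x - y = int N * w" using xy by (elim dvdE)
    then have "(of_int (x - y) :: rat) = of_int (int N * w)" by (simp only:)
    then show ?thesis by (intro bexI[of _ "of_int w"]) simp_all
  qed
  then obtain w11 w12 w21 w22 where w: "w11 \<in> \<int>" "w12 \<in> \<int>" "w21 \<in> \<int>" "w22 \<in> \<int>"
    "of_int c11 - of_int d11 = of_nat N * (w11 :: rat)" "of_int c12 - of_int d12 = of_nat N * (w12 :: rat)"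
    "of_int c21 - of_int d21 = of_nat N * (w21 :: rat)" "of_int c22 - of_int d22 = of_nat N * (w22 :: rat)"
    using d(1-4) by metis
  have "c - ?d = smul2 (of_nat N) (mk2 w11 w12 w21 w22)"
    using w(5-8) by (simp add: mat2_eq_iff cc)
  then have cd: "embm c - embm ?d = smul2 ?n (embm (mk2 w11 w12 w21 w22))"
    by (simp only: embm_simps(3)[symmetric] embm_simps(8))
  have "b - embm ?d = (b - embm c) + (embm c - embm ?d)" by simp
  also have "\<dots> = smul2 ?n (S + embm (mk2 w11 w12 w21 w22))" unfolding bc cd by (simp only: smul2_simps(5))
  finally have 1: "b - embm ?d = smul2 ?n (S + embm (mk2 w11 w12 w21 w22))" .
  have "mk2 w11 w12 w21 w22 \<in> Mat2 \<int>" using w(1-4) unfolding Mat2_iff mk2_nth by blast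
  then have 2: "S + embm (mk2 w11 w12 w21 w22) \<in> Mat2 zhat"
    by (intro Mat2_add[OF Z S] embm_zhat_iff[THEN iffD2])
  have "det ?d = of_int (d11 * d22 - d12 * d21)" by (simp add: det_2)
  then have "det ?d = 1" using d(5) by simp
  with 1 2 show thesis by (intro that[of ?d]) (simp_all add: Mat2_iff)
qed

text \<open>Take h in \<open>P0\<close> congruent to k modulo the square of a common denominator of
  m, g and the inverse of g. Then \<open>conj_integral\<close> over the ring \<open>zhat\<close>
  shows that x k and x h differ by a left factor in \<open>Pbar0\<close>.\<close>

lemma Pbar0_approx:
  assumes x: "x \<in> carrier P_grp" and k: "k \<in> Pbar0"
  shows "\<exists>h\<in>P0. \<exists>l\<in>Pbar0. P_embed x \<otimes>\<^bsub>Pbar_grp\<^esub> k = l \<otimes>\<^bsub>Pbar_grp\<^esub> P_embed (x \<otimes>\<^bsub>P_grp\<^esub> h)"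
proof -
  note Z = is_subring_zhat
  obtain m g where mg: "x = block_mat m g" "det g > 0" using x by (rule P_carrierE)
  obtain a b where ab: "k = block_mat a b" "a \<in> Mat2 zhat" "b \<in> Mat2 zhat" "det b = 1"
    using k by (auto simp: Pbar0_def SL2_def elim!: block_setE)
  obtain N1 where N1: "N1 > 0" "smul2 (of_nat N1) m \<in> Mat2 \<int>" by (rule Mat2_denominator)
  obtain N2 where N2: "N2 > 0" "smul2 (of_nat N2) g \<in> Mat2 \<int>" by (rule Mat2_denominator)
  obtain N3 where N3: "N3 > 0" "smul2 (of_nat N3) (rinv g) \<in> Mat2 \<int>" by (rule Mat2_denominator)
  let ?N = "N1 * N2 * N3"
  have I: "smul2 (of_nat ?N) m \<in> Mat2 \<int>" "smul2 (of_nat ?N) g \<in> Mat2 \<int>" "smul2 (of_nat ?N) (rinv g) \<in> Mat2 \<int>"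
    using smul2_Ints_mult[OF N1(2), of "N2 * N3"] smul2_Ints_mult[OF N2(2), of "N1 * N3"]
      smul2_Ints_mult[OF N3(2), of "N1 * N2"] by (simp_all only: mult_ac)
  let ?q = "adele_of_rat (of_nat ?N)"
  have qm: "smul2 ?q (embm m) \<in> Mat2 zhat" "smul2 ?q (embm g) \<in> Mat2 zhat" "smul2 ?q (embm (rinv g)) \<in> Mat2 zhat"
    using I by (simp_all only: embm_simps(8)[symmetric] embm_zhat_iff)
  have NN: "?N * ?N > 0" using N1 N2 N3 by simp
  have qq: "adele_of_rat (of_nat (?N * ?N)) = ?q * ?q" by (simp only: of_nat_mult adele_of_rat_hom(4))
  obtain c R0 where c: "c \<in> Mat2 \<int>" and R0: "R0 \<in> Mat2 zhat" "a - embm c = smul2 (?q * ?q) R0"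
    by (rule zhat_approx[OF ab(2) NN, unfolded qq])
  obtain d S0 where d: "d \<in> Mat2 \<int>" "det d = 1" and S0: "S0 \<in> Mat2 zhat" "b - embm d = smul2 (?q * ?q) S0"
    by (rule SL2_zhat_approx[OF ab(3,4) NN, unfolded qq])
  let ?si = "embm (rinv d)" and ?gi = "embm (rinv g)"
  have si: "embm d ** ?si = mat 1" "?si ** embm d = mat 1" "embm g ** ?gi = mat 1" "?gi ** embm g = mat 1"
    using rinv[of d] rinv[of g] d mg by (simp_all flip: embm_simps(1) add: embm_simps(4))
  have "rinv d \<in> Mat2 \<int>"
    unfolding rinv_def by (rule inv2_Mat2[OF is_subring_Ints]) (use d in simp_all)
  then have siZ: "?si \<in> Mat2 zhat" by (simp add: embm_zhat_iff)
  have qZ: "?q \<in> zhat" using adele_of_rat_zhat_iff Ints_of_nat by blast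
  note C = conj_integral[OF Z qZ qm si(3) si(1) siZ R0(2) S0(2) R0(1) S0(1)]
  let ?h = "block_mat c d"
  have h: "?h \<in> P0" using c d by (simp add: P0_def SL2_def)
  have hP: "?h \<in> carrier P_grp" using d by simp
  have xh: "P_embed (x \<otimes>\<^bsub>P_grp\<^esub> ?h) = block_mat (embm c + embm m ** embm d) (embm g ** embm d)"
    by (simp add: mg P_mult block_mat_mult P_embed_block embm_simps)
  have dgd: "det (embm g ** embm d) = adele_of_rat (det g)" using d by (simp add: det_mul embm_simps)
  have inv: "(?si ** ?gi) ** (embm g ** embm d) = mat 1"
  proof -
    have "(?si ** ?gi) ** (embm g ** embm d) = ?si ** (?gi ** embm g) ** embm d" by (simp only: matrix_mul_assoc)
    then show ?thesis by (simp add: si)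
  qed
  let ?l = "(P_embed x \<otimes>\<^bsub>Pbar_grp\<^esub> k) \<otimes>\<^bsub>Pbar_grp\<^esub> inv\<^bsub>Pbar_grp\<^esub> (P_embed (x \<otimes>\<^bsub>P_grp\<^esub> ?h))"
  have l: "?l = block_mat (((a + embm m ** b) - (embm c + embm m ** embm d)) ** (?si ** ?gi)) ((embm g ** b) ** (?si ** ?gi))"
    unfolding xh by (subst Pbar_quot[OF dgd mg(2) inv, symmetric]) (simp add: mg ab P_embed_block Pbar_mult block_mat_mult)
  have "det ((embm g ** b) ** (?si ** ?gi)) = 1"
    using det_rinv[of d] det_rinv[of g] d mg(2) ab(4)
    by (simp add: det_mul embm_simps flip: adele_of_rat_hom(4))
  then have "?l \<in> Pbar0" unfolding l Pbar0_iff_SL2 using C by blast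
  moreover have "P_embed x \<otimes>\<^bsub>Pbar_grp\<^esub> k = ?l \<otimes>\<^bsub>Pbar_grp\<^esub> P_embed (x \<otimes>\<^bsub>P_grp\<^esub> ?h)"
    using x hP k Pbar0_iff by (simp add: Pbar.m_assoc)
  ultimately show ?thesis using h by blast
qed

lemma GL2_zhat_inverse:
  assumes "r \<in> GL2 zhat"
  shows "matrix_inv r \<in> GL2 zhat" "r ** matrix_inv r = mat 1" "matrix_inv r ** r = mat 1"
    "r \<in> Mat2 zhat" "matrix_inv r \<in> Mat2 zhat" "matrix_inv (matrix_inv r) = r"
proof -
  obtain h where h: "r \<in> Mat2 zhat" "h \<in> Mat2 zhat" "r ** h = mat 1" "h ** r = mat 1"
    using assms by (auto simp: GL2_def)
  have inv: "matrix_inv A = B" if "A ** B = mat 1" "B ** A = mat 1" for A B :: "adele^2^2"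
  proof -
    have "A ** matrix_inv A = mat 1 \<and> matrix_inv A ** A = mat 1"
      unfolding matrix_inv_def by (rule someI[of _ B]) (use that in blast)
    then show ?thesis using matrix_inverse_unique[OF that(2)] by metis
  qed
  have "matrix_inv r = h" "matrix_inv h = r" using inv h by blast+
  with h show "matrix_inv r \<in> GL2 zhat" "r ** matrix_inv r = mat 1" "matrix_inv r ** r = mat 1"
    "r \<in> Mat2 zhat" "matrix_inv r \<in> Mat2 zhat" "matrix_inv (matrix_inv r) = r"
    by (auto simp: GL2_def)
qed

section \<open>The symmetries\<close>

lemma theta_block: "theta r (block_mat m g) = block_mat (m ** matrix_inv r) (r ** g ** matrix_inv r)"
  by (simp add: theta_def diag_mat_def block_mat_mult)

lemma diag_mat_mult: "diag_mat r ** diag_mat s = diag_mat (r ** s)"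
  by (simp add: diag_mat_def block_mat_mult)

lemma diag_mat_one: "diag_mat (mat 1) = mat 1"
  by (simp add: diag_mat_def block_mat_one)

lemma theta_inverse:
  assumes "r \<in> GL2 zhat"
  shows "theta r (theta (matrix_inv r) X) = X" "theta (matrix_inv r) (theta r X) = X"
proof -
  note r = GL2_zhat_inverse[OF assms]
  have "theta a (theta b X) = X" if "a ** b = mat 1" "matrix_inv b ** matrix_inv a = mat 1" for a b
  proof -
    have "theta a (theta b X) = (diag_mat a ** diag_mat b) ** X ** (diag_mat (matrix_inv b) ** diag_mat (matrix_inv a))"
      unfolding theta_def by (simp only: matrix_mul_assoc)
    then show ?thesis by (simp only: diag_mat_mult that diag_mat_one matrix_mul_lid matrix_mul_rid)
  qed
  then show "theta r (theta (matrix_inv r) X) = X" "theta (matrix_inv r) (theta r X) = X"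
    using r by simp_all
qed

lemma theta_comp:
  assumes "r \<in> GL2 zhat" "s \<in> GL2 zhat"
  shows "r ** s \<in> GL2 zhat" "theta (r ** s) X = theta r (theta s X)"
proof -
  note r = GL2_zhat_inverse[OF assms(1)] and s = GL2_zhat_inverse[OF assms(2)]
  have i: "(r ** s) ** (matrix_inv s ** matrix_inv r) = mat 1" "(matrix_inv s ** matrix_inv r) ** (r ** s) = mat 1"
  proof -
    have "(r ** s) ** (matrix_inv s ** matrix_inv r) = r ** (s ** matrix_inv s) ** matrix_inv r" by (simp only: matrix_mul_assoc)
    then show "(r ** s) ** (matrix_inv s ** matrix_inv r) = mat 1" by (simp add: r s)
    have "(matrix_inv s ** matrix_inv r) ** (r ** s) = matrix_inv s ** (matrix_inv r ** r) ** s" by (simp only: matrix_mul_assoc)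
    then show "(matrix_inv s ** matrix_inv r) ** (r ** s) = mat 1" by (simp add: r s)
  qed
  show rs: "r ** s \<in> GL2 zhat"
    using i r s Mat2_mult[OF is_subring_zhat] by (auto simp: GL2_def)
  have "matrix_inv (r ** s) = matrix_inv s ** matrix_inv r"
    by (rule matrix_inverse_unique[OF GL2_zhat_inverse(3)[OF rs] i(1)])
  then show "theta (r ** s) X = theta r (theta s X)"
    unfolding theta_def by (simp only: diag_mat_mult[symmetric] matrix_mul_assoc)
qed

lemma theta_hom:
  assumes "r \<in> GL2 zhat"
  shows "theta r \<in> hom Pbar_grp Pbar_grp"
proof (rule homI)
  note r = GL2_zhat_inverse[OF assms]
  have d: "det r * det (matrix_inv r) = 1" using r(2) by (metis det_I det_mul)
  fix X assume "X \<in> carrier Pbar_grp"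
  then obtain m g q where X: "X = block_mat m g" "q > 0" "det g = adele_of_rat q" by (rule Pbar_carrierE)
  have "det (r ** g ** matrix_inv r) = det g * (det r * det (matrix_inv r))" by (simp add: det_mul mult_ac)
  then show "theta r X \<in> carrier Pbar_grp" using X by (auto simp: theta_block d)
  fix X' assume "X' \<in> carrier Pbar_grp"
  have "theta r X ** theta r X' = diag_mat r ** X ** (diag_mat (matrix_inv r) ** diag_mat r) ** X' ** diag_mat (matrix_inv r)"
    unfolding theta_def by (simp only: matrix_mul_assoc)
  also have "\<dots> = theta r (X ** X')"
    unfolding theta_def diag_mat_mult r(3) diag_mat_one by (simp add: matrix_mul_assoc)
  finally show "theta r (X \<otimes>\<^bsub>Pbar_grp\<^esub> X') = theta r X \<otimes>\<^bsub>Pbar_grp\<^esub> theta r X'" by (simp add: Pbar_mult)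
qed

lemma theta_Pbar0:
  assumes "r \<in> GL2 zhat" "k \<in> Pbar0"
  shows "theta r k \<in> Pbar0"
proof -
  note r = GL2_zhat_inverse[OF assms(1)]
  have d: "det r * det (matrix_inv r) = 1" using r(2) by (metis det_I det_mul)
  obtain m g where k: "k = block_mat m g" "m \<in> Mat2 zhat" "g \<in> Mat2 zhat" "det g = 1"
    using assms(2) by (auto simp: Pbar0_def SL2_def elim!: block_setE)
  show ?thesis
    unfolding k(1) theta_block Pbar0_iff_SL2
    using k d r Mat2_mult[OF is_subring_zhat] by (simp add: det_mul)
qed

text \<open>Nonzero absolute values are powers of p, so a value below 1 is at most 1/p.\<close>

lemma padic_abs_less_1:
  assumes p: "prime p" and x: "padic_abs p x < 1"
  shows "x / of_nat p \<in> Zloc p"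
proof (cases "x = 0")
  case False
  then obtain i where i: "padic_abs p x = real p powi i" by (auto simp: padic_abs_def)
  have p1: "real p > 1" using prime_gt_1_nat[OF p] by simp
  have "i < 0"
  proof (rule ccontr)
    assume "\<not> i < 0"
    then have "real p powi 0 \<le> real p powi i" using p1 by (intro power_int_increasing) auto
    then show False using i x by simp
  qed
  then have "real p powi i \<le> real p powi (- 1)" using p1 by (intro power_int_increasing) auto
  then have "padic_abs p x \<le> 1 / real p ^ 1" using i by (simp add: power_int_minus inverse_eq_divide)
  then show ?thesis using padic_abs_le_iff[OF p, of x 1] by simp
qed (simp add: Zloc_def)

text \<open>Since the determinant of \<rho> need not be rational, \<open>near_one_det\<close> does
  not apply. Instead the relation det s * det r = 1 - p f with an adele f integral at p shows that
  det s is a unit at p.\<close>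

lemma GL2_Rad_approx:
  assumes p: "prime p" and r: "r \<in> Mat2 (Rad p)" and \<rho>: "\<rho> \<in> Mat2 (Rad p)" and inv: "\<rho> ** r = mat 1"
  obtains s S where "s \<in> Mat2 (Zloc p)" "det s > 0" "padic_abs p (det s) = 1" "S \<in> Mat2 (Rad p)"
    "\<rho> - embm s = smul2 (adele_of_rat (of_nat p ^ N)) S"
proof -
  note R = is_subring_Rad[OF p]
  let ?P = "of_nat p ^ Suc N :: rat" and ?\<pi> = "adele_of_rat (of_nat p)" and ?c = "adele_of_rat (of_nat p ^ N)"
  have p0: "(of_nat p :: rat) \<noteq> 0" using p by auto
  have intR: "adele_of_rat (of_nat p ^ n) \<in> Rad p" for n
    using Ints_Zloc[OF p, of "of_nat p ^ n"] by (simp only: adele_of_rat_Rad_iff[OF p]) simp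
  have \<pi>R: "?\<pi> \<in> Rad p" using intR[of 1] by simp
  have smR: "smul2 t F \<in> Mat2 (Rad p)" if "t \<in> Rad p" "F \<in> Mat2 (Rad p)" for t F
    using that is_subringD(4)[OF R] unfolding Mat2_iff smul2_nth by blast
  \<comment> \<open>One power of p more than asked for, so that \<open>embm s ** r\<close> is 1
    modulo p.\<close>
  obtain s where s: "smul2 (adele_of_rat (1 / ?P)) (\<rho> - embm s) \<in> Mat2 (Rad p)"
    using Mat2_adele_approx[OF p] by blast
  define S where "S = smul2 (adele_of_rat (1 / ?P)) (\<rho> - embm s)"
  have SR: "S \<in> Mat2 (Rad p)" using s by (simp only: S_def)
  have PP: "adele_of_rat ?P * adele_of_rat (1 / ?P) = 1"
  proof -
    have "adele_of_rat ?P * adele_of_rat (1 / ?P) = adele_of_rat (?P * (1 / ?P))" by (simp only: adele_of_rat_hom(4))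
    then show ?thesis using p0 by simp
  qed
  have \<rho>s: "\<rho> - embm s = smul2 (adele_of_rat ?P) S"
    unfolding S_def by (simp only: smul2_simps(1,2) PP)
  have P\<pi>: "adele_of_rat ?P = ?\<pi> * ?c" by (simp only: power_Suc adele_of_rat_hom(4))
  have "\<rho> - smul2 (adele_of_rat ?P) S \<in> Mat2 (Rad p)" by (rule Mat2_diff[OF R \<rho> smR[OF intR SR]])
  then have "embm s \<in> Mat2 (Rad p)" unfolding \<rho>s[symmetric] by simp
  then have sZ: "s \<in> Mat2 (Zloc p)" by (simp add: embm_Rad_iff[OF p])
  have "embm s ** r = mat 1 - (\<rho> - embm s) ** r" by (simp add: matrix_diff_right inv)
  also have "\<dots> = mat 1 - smul2 ?\<pi> (smul2 ?c S ** r)"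
    unfolding \<rho>s P\<pi> by (simp only: smul2_simps(1,3))
  finally have sr: "embm s ** r = mat 1 - smul2 ?\<pi> (smul2 ?c S ** r)" .
  have FR: "smul2 ?c S ** r \<in> Mat2 (Rad p)" by (intro Mat2_mult[OF R] smR intR SR r)
  obtain f where f: "f \<in> Rad p" "det (mat 1 - smul2 ?\<pi> (smul2 ?c S ** r)) = 1 - ?\<pi> * f"
    by (rule det_one_minus[OF R \<pi>R FR])
  have dsr: "adele_of_rat (det s) * det r = 1 - ?\<pi> * f"
    unfolding f(2)[symmetric] sr[symmetric] by (simp add: det_mul embm_simps)
  \<comment> \<open>If p divided det s, the relation \<open>dsr\<close> would exhibit 1 as p times
    an adele integral at p.\<close>
  have abs1: "padic_abs p (det s) = 1"
  proof (rule ccontr)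
    assume "padic_abs p (det s) \<noteq> 1"
    moreover have "padic_abs p (det s) \<le> 1"
      using Mat2_det[OF is_subring_Zloc[OF p] sZ] by (simp add: Zloc_def)
    ultimately have "det s / of_nat p \<in> Zloc p" by (intro padic_abs_less_1[OF p]) simp
    then have t: "adele_of_rat (det s / of_nat p) \<in> Rad p" by (simp only: adele_of_rat_Rad_iff[OF p])
    have "adele_of_rat (det s) = ?\<pi> * adele_of_rat (det s / of_nat p)"
      using p0 by (simp only: adele_of_rat_hom(4)[symmetric]) simp
    then have "?\<pi> * (adele_of_rat (det s / of_nat p) * det r + f) = 1"
      using dsr by (simp add: algebra_simps)
    then have "adele_of_rat (1 / of_nat p) * (?\<pi> * (adele_of_rat (det s / of_nat p) * det r + f)) = adele_of_rat (1 / of_nat p)"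
      by (simp only: mult_1_right)
    then have "(adele_of_rat (1 / of_nat p) * ?\<pi>) * (adele_of_rat (det s / of_nat p) * det r + f) = adele_of_rat (1 / of_nat p)"
      by (simp only: mult.assoc)
    moreover have "adele_of_rat (1 / of_nat p) * ?\<pi> = 1"
      using p0 by (simp only: adele_of_rat_hom(4)[symmetric]) simp
    ultimately have "adele_of_rat (1 / of_nat p) = adele_of_rat (det s / of_nat p) * det r + f" by simp
    also have "\<dots> \<in> Rad p" by (intro is_subringD(3,4)[OF R] t f(1) Mat2_det[OF R r])
    finally have "1 / of_nat p \<in> Zloc p" by (simp only: adele_of_rat_Rad_iff[OF p])
    then show False using prime_gt_1_nat[OF p]
      by (simp add: Zloc_def padic_abs_divide[OF p] padic_abs_prime[OF p])
  qed
  txt \<open>Multiplication by \<open>\<sigma>\<close>, which is close to \<open>1\<close>, corrects the sign of the determinant.\<close>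
  define \<sigma> :: "rat^2^2" where "\<sigma> = mk2 (1 - ?P) 0 0 1"
  define E1 :: "rat^2^2" where "E1 = mk2 1 0 0 0"
  have d\<sigma>: "det \<sigma> = 1 - ?P" by (simp add: \<sigma>_def det_2)
  have "?P > 1" using prime_gt_1_nat[OF p] by (intro one_less_power) simp_all
  then have neg: "1 - ?P < 0" by simp
  have "(1 - (1 - ?P)) / of_nat p = of_nat p ^ N" using p0 by simp
  then have \<sigma>1: "padic_abs p (1 - ?P) = 1"
    using Ints_Zloc[OF p, of "of_nat p ^ N"] by (intro padic_abs_near_1[OF p]) simp
  have \<sigma>E: "s ** \<sigma> = s - smul2 ?P (s ** E1)"
    by (simp add: mat2_eq_iff mult2_nth \<sigma>_def E1_def algebra_simps)
  have PZ: "?P \<in> \<int>" by simp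
  have \<sigma>Z: "\<sigma> \<in> Mat2 (Zloc p)"
    using is_subringD[OF is_subring_Zloc[OF p]] Ints_Zloc[OF p PZ] by (simp only: \<sigma>_def Mat2_iff mk2_nth)
  have "E1 \<in> Mat2 (Zloc p)"
    using is_subringD[OF is_subring_Zloc[OF p]] by (simp only: E1_def Mat2_iff mk2_nth)
  then have E1R: "embm E1 \<in> Mat2 (Rad p)" by (rule embm_Rad_iff[OF p, THEN iffD2])
  have nz: "det s \<noteq> 0" using abs1 by auto
  show thesis
  proof (cases "det s > 0")
    case True
    have "\<rho> - embm s = smul2 ?c (smul2 ?\<pi> S)" unfolding \<rho>s P\<pi> smul2_simps(1) by (simp only: mult.commute)
    then show thesis by (rule that[OF sZ True abs1 smR[OF \<pi>R SR]])
  next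
    case False
    have "\<rho> - embm (s ** \<sigma>) = (\<rho> - embm s) + smul2 (adele_of_rat ?P) (embm s ** embm E1)"
      unfolding \<sigma>E by (simp add: embm_simps)
    also have "\<dots> = smul2 ?c (smul2 ?\<pi> (S + embm s ** embm E1))"
      unfolding \<rho>s P\<pi> smul2_simps(1,5) by (simp only: mult.commute)
    finally have 1: "\<rho> - embm (s ** \<sigma>) = smul2 ?c (smul2 ?\<pi> (S + embm s ** embm E1))" .
    have 2: "smul2 ?\<pi> (S + embm s ** embm E1) \<in> Mat2 (Rad p)"
      by (intro smR[OF \<pi>R] Mat2_add[OF R] Mat2_mult[OF R] SR E1R) (simp add: embm_Rad_iff[OF p] sZ)
    have "det (s ** \<sigma>) > 0" unfolding det_mul d\<sigma> using False nz neg by (intro mult_neg_neg) simp_all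
    moreover have "padic_abs p (det (s ** \<sigma>)) = 1" unfolding det_mul d\<sigma> padic_abs_mult[OF p] by (simp only: abs1 \<sigma>1)
    ultimately show thesis using 1 2 Mat2_mult[OF is_subring_Zloc[OF p] sZ \<sigma>Z] by (intro that)
  qed
qed

text \<open>At each prime the adelic matrix \<rho> is replaced by a rational s congruent to it
  modulo a high power of p. Then y and x multiplied on the right by the block matrix of 0 and s lie
  in one coset of \<open>Kp p\<close>.\<close>

lemma theta_cls:
  assumes r: "r \<in> GL2 zhat" and x: "x \<in> carrier P_grp" and y: "y \<in> carrier P_grp" and k: "k \<in> Pbar0"
    and eq: "theta r (P_embed x) = k \<otimes>\<^bsub>Pbar_grp\<^esub> P_embed y"
  shows "y \<in> P.cls x"
proof -
  note r = GL2_zhat_inverse[OF r]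
  define \<rho> where "\<rho> = matrix_inv r"
  note r = r[folded \<rho>_def]
  obtain m g where mg: "x = block_mat m g" "det g > 0" using x by (rule P_carrierE)
  obtain n h where nh: "y = block_mat n h" "det h > 0" using y by (rule P_carrierE)
  obtain a b where ab: "k = block_mat a b" "a \<in> Mat2 zhat" "b \<in> Mat2 zhat" "det b = 1"
    using k by (auto simp: Pbar0_def SL2_def elim!: block_setE)
  have "block_mat (embm m ** \<rho>) (r ** embm g ** \<rho>) = block_mat (embm n + a ** embm h) (b ** embm h)"
    using eq by (simp add: mg nh ab P_embed_block theta_block Pbar_mult block_mat_mult \<rho>_def)
  then have e1: "embm m ** \<rho> = embm n + a ** embm h" and e2: "r ** embm g ** \<rho> = b ** embm h"
    by (simp_all only: block_mat_eq_iff)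
  have "det r * det \<rho> = 1" using r(2) by (metis det_I det_mul)
  then have "det (r ** embm g ** \<rho>) = det (embm g)"
    by (simp add: det_mul mult_ac) (metis mult.commute mult.left_commute mult_1_right)
  \<comment> \<open>Conjugation preserves determinants and b has determinant 1, so g and h have the
    same determinant.\<close>
  then have dgh: "det h = det g" unfolding e2 using ab(4) by (simp add: det_mul embm_simps)
  have "P.lequiv p x y" if p: "prime p" for p
  proof -
    note R = is_subring_Rad[OF p]
    have zR: "A \<in> Mat2 zhat \<Longrightarrow> A \<in> Mat2 (Rad p)" for A using p by (auto simp: Mat2_zhat_iff)
    obtain Nm Ng Nr where N: "\<forall>n\<ge>Nm. smul2 (of_nat p ^ n) m \<in> Mat2 (Zloc p)"
      "\<forall>n\<ge>Ng. smul2 (of_nat p ^ n) g \<in> Mat2 (Zloc p)" "\<forall>n\<ge>Nr. smul2 (of_nat p ^ n) (rinv g) \<in> Mat2 (Zloc p)"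
      using Mat2_bounded[OF p] by metis
    define M where "M = Nm + Ng + Nr"
    define q where "q = adele_of_rat (of_nat p ^ M)"
    have M: "smul2 (of_nat p ^ M) m \<in> Mat2 (Zloc p)" "smul2 (of_nat p ^ M) g \<in> Mat2 (Zloc p)"
      "smul2 (of_nat p ^ M) (rinv g) \<in> Mat2 (Zloc p)"
      using N by (simp_all add: M_def)
    have qM: "smul2 q (embm m) \<in> Mat2 (Rad p)" "smul2 q (embm g) \<in> Mat2 (Rad p)" "smul2 q (embm (rinv g)) \<in> Mat2 (Rad p)"
      unfolding q_def embm_simps(8)[symmetric] embm_Rad_iff[OF p] by (rule M)+
    have "(of_nat p ^ M :: rat) \<in> \<int>" by simp
    then have qR: "q \<in> Rad p" unfolding q_def by (simp only: adele_of_rat_Rad_iff[OF p] Ints_Zloc[OF p])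
    obtain s S where s: "s \<in> Mat2 (Zloc p)" "det s > 0" "padic_abs p (det s) = 1" and S: "S \<in> Mat2 (Rad p)"
      "\<rho> - embm s = smul2 (adele_of_rat (of_nat p ^ (M + M))) S"
      by (rule GL2_Rad_approx[OF p zR[OF r(4)] zR[OF r(5)] r(3)])
    have S2: "\<rho> - embm s = smul2 (q * q) S"
      unfolding S(2) q_def by (simp only: power_add adele_of_rat_hom(4))
    define si gi where "si = embm (rinv s)" and "gi = embm (rinv g)"
    have inv: "embm g ** gi = mat 1" "embm s ** si = mat 1"
      using rinv_right[of g] rinv_right[of s] mg s by (simp_all add: si_def gi_def flip: embm_simps(1)) (simp_all add: embm_simps)
    have siR: "si \<in> Mat2 (Rad p)" unfolding si_def embm_Rad_iff[OF p] by (rule rinv_Zloc[OF p s(1,3)])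
    have zero: "(0 :: adele^2^2) - 0 = smul2 (q * q) 0" "(0 :: adele^2^2) \<in> Mat2 (Rad p)"
      using is_subringD(1)[OF R] by (simp_all add: mat2_eq_iff Mat2_iff)
    \<comment> \<open>The multipliers compared are \<rho> and s; their translation blocks are
      0.\<close>
    note UV = conj_integral[OF R qR qM[folded gi_def] inv siR zero(1) S2 zero(2) S(1)]
    define bi where "bi = inv2 1 b"
    have bi: "bi ** b = mat 1" unfolding bi_def by (rule inv2(2)) (simp add: ab)
    have biR: "bi \<in> Mat2 (Rad p)" unfolding bi_def by (rule inv2_Mat2[OF R is_subringD(2)[OF R] zR[OF ab(3)]])
    have "embm h ** (si ** gi) = (bi ** b) ** embm h ** (si ** gi)" by (simp add: bi)
    also have "\<dots> = bi ** (b ** embm h) ** (si ** gi)" by (simp only: matrix_mul_assoc)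
    also have "\<dots> = bi ** r ** ((embm g ** \<rho>) ** (si ** gi))" unfolding e2[symmetric] by (simp only: matrix_mul_assoc)
    finally have W: "embm h ** (si ** gi) = bi ** r ** ((embm g ** \<rho>) ** (si ** gi))" .
    have WR: "embm h ** (si ** gi) \<in> Mat2 (Rad p)"
      unfolding W by (intro Mat2_mult[OF R] biR zR[OF r(4)] UV(2))
    have n: "embm n = embm m ** \<rho> - a ** embm h" unfolding e1 by simp
    have "(embm n - embm m ** embm s) ** (si ** gi)
        = ((0 + embm m ** \<rho>) - (0 + embm m ** embm s)) ** (si ** gi) - a ** (embm h ** (si ** gi))"
      unfolding n by (simp add: matrix_diff_right matrix_mul_assoc)
    also have "\<dots> \<in> Mat2 (Rad p)" by (intro Mat2_diff[OF R] UV(1) Mat2_mult[OF R] zR[OF ab(2)] WR)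
    finally have VR: "(embm n - embm m ** embm s) ** (si ** gi) \<in> Mat2 (Rad p)" .
    have dgs: "det (g ** s) > 0" using mg s by (simp add: det_mul)
    have rgs: "rinv (g ** s) = rinv s ** rinv g"
    proof (rule matrix_inverse_unique)
      show "rinv (g ** s) ** (g ** s) = mat 1" using dgs by (intro rinv_left) simp
      have "(g ** s) ** (rinv s ** rinv g) = g ** (s ** rinv s) ** rinv g" by (simp only: matrix_mul_assoc)
      then show "(g ** s) ** (rinv s ** rinv g) = mat 1" using rinv_right[of g] rinv_right[of s] mg s by simp
    qed
    let ?l = "block_mat 0 s"
    have l: "?l \<in> Kp p" using s is_subringD(1)[OF is_subring_Zloc[OF p]] by (simp add: Kp_iff[OF p]) (simp add: Mat2_iff)
    have xl: "x \<otimes>\<^bsub>P_grp\<^esub> ?l = block_mat (m ** s) (g ** s)" by (simp add: mg P_mult block_mat_mult)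
    have "embm ((n - m ** s) ** rinv (g ** s)) \<in> Mat2 (Rad p)" "embm (h ** rinv (g ** s)) \<in> Mat2 (Rad p)"
      using VR WR unfolding rgs by (simp_all only: embm_simps si_def gi_def)
    then have *: "(n - m ** s) ** rinv (g ** s) \<in> Mat2 (Zloc p)" "h ** rinv (g ** s) \<in> Mat2 (Zloc p)"
      by (simp_all only: embm_Rad_iff[OF p])
    have d: "det (h ** rinv (g ** s)) = 1 / det s"
      unfolding rgs using mg s dgh by (simp add: det_mul det_rinv)
    have kp: "y \<otimes>\<^bsub>P_grp\<^esub> inv\<^bsub>P_grp\<^esub> (x \<otimes>\<^bsub>P_grp\<^esub> ?l) \<in> Kp p"
      unfolding xl nh(1) P_quot[OF dgs] Kp_iff[OF p] d using * s by (simp add: padic_abs_divide[OF p])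
    have lc: "?l \<in> carrier P_grp" using s by simp
    have "y = (y \<otimes>\<^bsub>P_grp\<^esub> inv\<^bsub>P_grp\<^esub> (x \<otimes>\<^bsub>P_grp\<^esub> ?l)) \<otimes>\<^bsub>P_grp\<^esub> x \<otimes>\<^bsub>P_grp\<^esub> ?l"
      using x y lc by (simp add: P.m_assoc)
    then show ?thesis using kp l unfolding P.lequiv_def by blast
  qed
  then show ?thesis using y by (simp add: P.cls_def)
qed

section \<open>Adelic matrices assembled from rational local ones\<close>

definition adele_matrix :: "(nat \<Rightarrow> rat^2^2) \<Rightarrow> adele^2^2" where
  "adele_matrix A = (\<chi> i j. adele_family (\<lambda>p. A p $ i $ j))"

definition almost_integral_matrix :: "(nat \<Rightarrow> rat^2^2) \<Rightarrow> bool" where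
  "almost_integral_matrix A \<longleftrightarrow> (\<forall>i j. almost_integral (\<lambda>p. A p $ i $ j))"

lemma almost_integral_matrix_closed:
  assumes "almost_integral_matrix A" "almost_integral_matrix B"
  shows "almost_integral_matrix (\<lambda>p. A p + B p)" "almost_integral_matrix (\<lambda>p. A p ** B p)"
  using assms unfolding almost_integral_matrix_def
  by (auto simp: mult2_nth intro!: almost_integral_closed)

lemma almost_integral_matrix_const: "almost_integral_matrix (\<lambda>p. m)"
  by (simp add: almost_integral_matrix_def almost_integral_const)

lemma adele_matrix_hom:
  assumes "almost_integral_matrix A" "almost_integral_matrix B"
  shows "adele_matrix (\<lambda>p. A p + B p) = adele_matrix A + adele_matrix B"
    "adele_matrix (\<lambda>p. A p ** B p) = adele_matrix A ** adele_matrix B"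
proof -
  note AB = assms[unfolded almost_integral_matrix_def, rule_format]
  show "adele_matrix (\<lambda>p. A p + B p) = adele_matrix A + adele_matrix B"
    by (simp add: vec_eq_iff adele_matrix_def adele_family_add AB)
  have "adele_matrix (\<lambda>p. A p ** B p) $ i $ j = (adele_matrix A ** adele_matrix B) $ i $ j" for i j
    unfolding mult2_nth
    by (simp add: adele_matrix_def mult2_nth adele_family_add adele_family_mult almost_integral_closed AB)
  then show "adele_matrix (\<lambda>p. A p ** B p) = adele_matrix A ** adele_matrix B"
    by (simp add: vec_eq_iff)
qed

lemma adele_matrix_const: "adele_matrix (\<lambda>p. m) = embm m"
  by (simp add: vec_eq_iff adele_matrix_def adele_family_const)

lemma adele_matrix_cong:
  assumes "almost_integral_matrix A" "\<And>p. prime p \<Longrightarrow> A p = B p"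
  shows "adele_matrix A = adele_matrix B"
  using assms by (auto simp: vec_eq_iff adele_matrix_def almost_integral_matrix_def intro!: adele_family_cong)

lemma adele_matrix_zhat:
  assumes "\<And>p. prime p \<Longrightarrow> A p \<in> Mat2 (Zloc p)"
  shows "almost_integral_matrix A" "adele_matrix A \<in> Mat2 zhat"
  using assms by (auto simp: almost_integral_matrix_def adele_matrix_def Mat2_def intro!: adele_family_zhat)

text \<open>The local relations y = k x k' are assembled over all primes: the blocks of the factors
  become adelic matrices A, r, C, D, and the symmetry is that of r, formed by the linear blocks of
  the left factors. What remains has determinant 1 and lies in \<open>Pbar0\<close>.\<close>

lemma cls_theta:
  assumes x: "x \<in> carrier P_grp" and y: "y \<in> P.cls x"
  shows "\<exists>\<theta>\<in>theta ` GL2 zhat. \<exists>k\<in>Pbar0. \<exists>l\<in>Pbar0.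
    \<theta> (P_embed x) = k \<otimes>\<^bsub>Pbar_grp\<^esub> P_embed y \<otimes>\<^bsub>Pbar_grp\<^esub> l"
proof -
  note Z = is_subring_zhat
  obtain m g where mg: "x = block_mat m g" "det g > 0" using x by (rule P_carrierE)
  have yG: "y \<in> carrier P_grp" using y by (rule P.cls_carrier)
  obtain n h where nh: "y = block_mat n h" "det h > 0" using yG by (rule P_carrierE)
  have "\<exists>a b c d. prime p \<longrightarrow> block_mat a b \<in> Kp p \<and> block_mat c d \<in> Kp p \<and>
      n = c + (m + a ** g) ** d \<and> h = b ** g ** d" for p
  proof (cases "prime p")
    case True
    then have "P.lequiv p x y" using y by (simp add: P.cls_def)
    then obtain k k' where k: "k \<in> Kp p" "k' \<in> Kp p" "y = k \<otimes>\<^bsub>P_grp\<^esub> x \<otimes>\<^bsub>P_grp\<^esub> k'"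
      unfolding P.lequiv_def by blast
    obtain a b where ab: "k = block_mat a b" using k(1) unfolding Kp_def by (rule block_setE)
    obtain c d where cd: "k' = block_mat c d" using k(2) unfolding Kp_def by (rule block_setE)
    have "block_mat n h = block_mat (c + (m + a ** g) ** d) (b ** g ** d)"
      using k(3) by (simp add: nh mg ab cd P_mult block_mat_mult)
    then show ?thesis using k(1,2) unfolding block_mat_eq_iff ab cd by blast
  qed simp
  then obtain a b c d where *: "\<And>p. prime p \<Longrightarrow> block_mat (a p) (b p) \<in> Kp p \<and> block_mat (c p) (d p) \<in> Kp p \<and>
      n = c p + (m + a p ** g) ** d p \<and> h = b p ** g ** d p" by metis
  have n: "n = c p + (m + a p ** g) ** d p" and h: "h = b p ** g ** d p"
    and aZ: "a p \<in> Mat2 (Zloc p)" and bZ: "b p \<in> Mat2 (Zloc p)" "padic_abs p (det (b p)) = 1"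
    and cZ: "c p \<in> Mat2 (Zloc p)" and dZ: "d p \<in> Mat2 (Zloc p)" "padic_abs p (det (d p)) = 1"
    if p: "prime p" for p
    using *[OF p] unfolding Kp_iff[OF p] by blast+
  have biZ: "rinv (b p) \<in> Mat2 (Zloc p)" if "prime p" for p by (rule rinv_Zloc[OF that bZ[OF that]])
  have bi: "b p ** rinv (b p) = mat 1" "rinv (b p) ** b p = mat 1" if "prime p" for p
    using rinv_right[of "b p"] rinv_left[of "b p"] bZ(2)[OF that] by (metis padic_abs_0 zero_neq_one)+
  define r \<rho> A C D where "r = adele_matrix b" and "\<rho> = adele_matrix (\<lambda>p. rinv (b p))"
    and "A = adele_matrix a" and "C = adele_matrix c" and "D = adele_matrix d"
  have ai: "almost_integral_matrix a" "almost_integral_matrix b" "almost_integral_matrix c" "almost_integral_matrix d"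
    "almost_integral_matrix (\<lambda>p. rinv (b p))"
    by (rule adele_matrix_zhat(1), erule aZ bZ cZ dZ biZ)+
  have int: "A \<in> Mat2 zhat" "r \<in> Mat2 zhat" "C \<in> Mat2 zhat" "D \<in> Mat2 zhat" "\<rho> \<in> Mat2 zhat"
    unfolding r_def \<rho>_def A_def C_def D_def by (rule adele_matrix_zhat(2), erule aZ bZ cZ dZ biZ)+
  note ac = almost_integral_matrix_closed almost_integral_matrix_const
  have inv: "r ** \<rho> = mat 1" "\<rho> ** r = mat 1"
  proof -
    have "r ** \<rho> = adele_matrix (\<lambda>p. b p ** rinv (b p))" unfolding r_def \<rho>_def by (simp only: adele_matrix_hom ai)
    also have "\<dots> = adele_matrix (\<lambda>p. mat 1)" by (rule adele_matrix_cong) (simp_all add: ac ai bi)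
    finally show "r ** \<rho> = mat 1" by (simp add: adele_matrix_const embm_simps)
    have "\<rho> ** r = adele_matrix (\<lambda>p. rinv (b p) ** b p)" unfolding r_def \<rho>_def by (simp only: adele_matrix_hom ai)
    also have "\<dots> = adele_matrix (\<lambda>p. mat 1)" by (rule adele_matrix_cong) (simp_all add: ac ai bi)
    finally show "\<rho> ** r = mat 1" by (simp add: adele_matrix_const embm_simps)
  qed
  have rG: "r \<in> GL2 zhat" using int inv by (auto simp: GL2_def)
  have \<rho>: "matrix_inv r = \<rho>" by (rule matrix_inverse_unique[OF GL2_zhat_inverse(3)[OF rG] inv(1)])
  have N: "embm n = C + (embm m + A ** embm g) ** D"
  proof -
    have "embm n = adele_matrix (\<lambda>p. c p + (m + a p ** g) ** d p)"
      unfolding adele_matrix_const[symmetric] by (rule adele_matrix_cong) (auto intro: ac n)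
    also have "\<dots> = C + (embm m + A ** embm g) ** D"
      unfolding A_def C_def D_def adele_matrix_const[symmetric] by (simp only: adele_matrix_hom ac ai)
    finally show ?thesis .
  qed
  have Hh: "embm h = r ** embm g ** D"
  proof -
    have "embm h = adele_matrix (\<lambda>p. b p ** g ** d p)"
      unfolding adele_matrix_const[symmetric] by (rule adele_matrix_cong) (auto intro: ac h)
    also have "\<dots> = r ** embm g ** D"
      unfolding r_def D_def adele_matrix_const[symmetric] by (simp only: adele_matrix_hom ac ai)
    finally show ?thesis .
  qed
  \<comment> \<open>This equality will force \<open>r ** D\<close> to have determinant 1.\<close>
  have "det h / det g = 1"
  proof (rule rat_unit_eq_1)
    show "det h / det g > 0" using mg nh by simp
    fix p :: nat assume p: "prime p"
    have "det h / det g = det (b p) * det (d p)" using mg by (simp add: h[OF p] det_mul)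
    then show "padic_abs p (det h / det g) = 1" by (simp add: padic_abs_mult[OF p] bZ[OF p] dZ[OF p])
  qed
  then have "det h = det g" using mg by simp
  then have "adele_of_rat (det g) = det r * adele_of_rat (det g) * det D"
    using Hh by (metis det_mul embm_simps(7))
  then have "adele_of_rat (1 / det g) * adele_of_rat (det g) = adele_of_rat (1 / det g) * (det r * adele_of_rat (det g) * det D)"
    by simp
  then have "adele_of_rat (1 / det g) * adele_of_rat (det g) = (adele_of_rat (1 / det g) * adele_of_rat (det g)) * (det r * det D)"
    by (simp only: mult_ac)
  moreover have "adele_of_rat (1 / det g) * adele_of_rat (det g) = 1"
    using mg by (simp only: adele_of_rat_hom(4)[symmetric]) simp
  ultimately have drD: "det (r ** D) = 1" by (simp add: det_mul)
  \<comment> \<open>\<open>theta r\<close> puts \<rho> to the right of g; the block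
    \<open>r ** D\<close> cancels it and inserts D, while \<open>A ** \<rho>\<close> supplies the
    translation by A.\<close>
  let ?k = "block_mat (A ** \<rho>) (mat 1)" and ?l = "block_mat C (r ** D)"
  have k: "?k \<in> Pbar0" unfolding Pbar0_iff_SL2 by (simp add: Mat2_mult[OF Z] Mat2_one[OF Z] int)
  have l: "?l \<in> Pbar0" unfolding Pbar0_iff_SL2 using drD by (simp add: Mat2_mult[OF Z] int)
  let ?X = "theta r (P_embed x)"
  have add: "(X + Y) ** M = X ** M + Y ** M" for X Y M :: "adele^2^2"
    by (simp add: mat2_eq_iff mult2_nth algebra_simps)
  have 1: "embm m ** \<rho> + A ** \<rho> ** (r ** embm g ** \<rho>) = (embm m + A ** embm g) ** \<rho>"
  proof -
    have "A ** \<rho> ** (r ** embm g ** \<rho>) = A ** (\<rho> ** r) ** embm g ** \<rho>" by (simp only: matrix_mul_assoc)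
    then show ?thesis by (simp add: inv add)
  qed
  have 2: "M ** \<rho> ** (r ** D) = M ** D" for M
  proof -
    have "M ** \<rho> ** (r ** D) = M ** (\<rho> ** r) ** D" by (simp only: matrix_mul_assoc)
    then show ?thesis by (simp add: inv)
  qed
  have eq: "?k \<otimes>\<^bsub>Pbar_grp\<^esub> ?X \<otimes>\<^bsub>Pbar_grp\<^esub> ?l = P_embed y"
    by (simp add: mg nh P_embed_block theta_block \<rho> Pbar_mult block_mat_mult 1 2 N Hh)
  have kc: "?k \<in> carrier Pbar_grp" "?l \<in> carrier Pbar_grp" using k l Pbar0_iff by blast+
  have Xc: "?X \<in> carrier Pbar_grp" using theta_hom[OF rG] P_embed_hom x by (auto simp: hom_def)
  have "?X = inv\<^bsub>Pbar_grp\<^esub> ?k \<otimes>\<^bsub>Pbar_grp\<^esub> (?k \<otimes>\<^bsub>Pbar_grp\<^esub> ?X \<otimes>\<^bsub>Pbar_grp\<^esub> ?l) \<otimes>\<^bsub>Pbar_grp\<^esub> inv\<^bsub>Pbar_grp\<^esub> ?l"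
    using kc Xc by (simp add: Pbar.m_assoc) (simp add: Pbar.m_assoc[symmetric])
  then have "?X = inv\<^bsub>Pbar_grp\<^esub> ?k \<otimes>\<^bsub>Pbar_grp\<^esub> P_embed y \<otimes>\<^bsub>Pbar_grp\<^esub> inv\<^bsub>Pbar_grp\<^esub> ?l" unfolding eq .
  moreover have "inv\<^bsub>Pbar_grp\<^esub> ?k \<in> Pbar0" "inv\<^bsub>Pbar_grp\<^esub> ?l \<in> Pbar0"
    using subgroup.m_inv_closed[OF subgroup_Pbar0] k l by blast+
  ultimately show ?thesis using rG by blast
qed

interpretation AC: adelic_completion P_grp "{p. prime p}" Kp Pbar_grp Pbar0 P_embed "theta ` GL2 zhat"
proof (intro adelic_completion.intro adelic_completion_axioms.intro P.local_family_axioms group_Pbar)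
  show "subgroup Pbar0 Pbar_grp" by (rule subgroup_Pbar0)
  show "P_embed \<in> hom P_grp Pbar_grp" by (rule P_embed_hom)
  show "\<exists>y\<in>carrier P_grp. \<exists>k\<in>Pbar0. X = k \<otimes>\<^bsub>Pbar_grp\<^esub> P_embed y" if "X \<in> carrier Pbar_grp" for X
    by (rule Pbar_decomp[OF that])
  show "P_embed x \<in> Pbar0 \<longleftrightarrow> x \<in> P.H" if "x \<in> carrier P_grp" for x
    unfolding P_H by (rule P_embed_Pbar0[OF that])
  show "\<exists>h\<in>P.H. \<exists>l\<in>Pbar0. P_embed x \<otimes>\<^bsub>Pbar_grp\<^esub> k = l \<otimes>\<^bsub>Pbar_grp\<^esub> P_embed (x \<otimes>\<^bsub>P_grp\<^esub> h)"
    if "x \<in> carrier P_grp" "k \<in> Pbar0" for x k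
    unfolding P_H by (rule Pbar0_approx[OF that])
  show "\<theta> \<in> hom Pbar_grp Pbar_grp" if "\<theta> \<in> theta ` GL2 zhat" for \<theta>
    using that theta_hom by blast
  show "\<theta> k \<in> Pbar0" if "\<theta> \<in> theta ` GL2 zhat" "k \<in> Pbar0" for \<theta> k
    using that theta_Pbar0 by blast
  show "\<exists>\<theta>''\<in>theta ` GL2 zhat. \<forall>X\<in>carrier Pbar_grp. \<theta>'' X = \<theta> (\<theta>' X)"
    if "\<theta> \<in> theta ` GL2 zhat" "\<theta>' \<in> theta ` GL2 zhat" for \<theta> \<theta>'
    using that theta_comp by blast
  show "\<exists>\<theta>'\<in>theta ` GL2 zhat. \<forall>X\<in>carrier Pbar_grp. \<theta> (\<theta>' X) = X \<and> \<theta>' (\<theta> X) = X"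
    if "\<theta> \<in> theta ` GL2 zhat" for \<theta>
    using that theta_inverse GL2_zhat_inverse(1) by blast
  show "y \<in> P.cls x"
    if "\<theta> \<in> theta ` GL2 zhat" "x \<in> carrier P_grp" "y \<in> carrier P_grp" "k \<in> Pbar0"
      "\<theta> (P_embed x) = k \<otimes>\<^bsub>Pbar_grp\<^esub> P_embed y" for \<theta> x y k
    using that theta_cls by blast
  show "\<exists>\<theta>\<in>theta ` GL2 zhat. \<exists>k\<in>Pbar0. \<exists>l\<in>Pbar0.
      \<theta> (P_embed x) = k \<otimes>\<^bsub>Pbar_grp\<^esub> P_embed y \<otimes>\<^bsub>Pbar_grp\<^esub> l"
    if "x \<in> carrier P_grp" "y \<in> P.cls x" for x y
    by (rule cls_theta[OF that])
qed

section \<open>The fixed point algebras\<close>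

text \<open>The inverse map of \<open>theta r\<close> is \<open>theta\<close> of the inverse matrix,
  and \<open>AC.extension_\<theta>\<close> evaluates the extended function there in terms of
  \<open>tr\<close>.\<close>

lemma alpha_fun_eq:
  assumes r: "r \<in> GL2 zhat" and f: "f \<in> hecke_algebra P_grp P0"
  shows "alpha_fun r f = AC.symmetries.act (AC.tr (theta (matrix_inv r))) f"
proof
  fix x
  have "inv_into UNIV (theta r) = theta (matrix_inv r)"
    by (rule inv_equality) (simp_all add: theta_inverse[OF r])
  moreover have "theta (matrix_inv r) \<in> theta ` GL2 zhat" using GL2_zhat_inverse(1)[OF r] by blast
  ultimately show "alpha_fun r f x = AC.symmetries.act (AC.tr (theta (matrix_inv r))) f x"
    using AC.extension_\<theta>[unfolded P_H, OF f]
    by (simp add: alpha_fun_def P_extend_def AC.symmetries.act_def)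
qed

lemma alpha_eq:
  assumes "r \<in> GL2 zhat"
  shows "alpha r = AC.symmetries.ext (AC.tr (theta (matrix_inv r)))"
  unfolding alpha_def AC.symmetries.ext_def P_H CrP_def
  by (simp add: alpha_fun_eq[OF assms] cong: ball_cong conj_cong)

text \<open>\<open>alpha r\<close> corresponds to the inverse matrix of r, and inversion permutes
  \<open>GL2 zhat\<close>.\<close>

lemma fixed_points_eq:
  "fixed_points A = {S \<in> A. \<forall>t\<in>AC.tr ` theta ` GL2 zhat. AC.symmetries.ext t S = S}"
proof -
  have "matrix_inv ` GL2 zhat = GL2 zhat"
  proof (intro equalityI subsetI)
    fix r assume "r \<in> GL2 zhat"
    then show "r \<in> matrix_inv ` GL2 zhat" using GL2_zhat_inverse(1,6)[of r] by (metis image_eqI)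
  qed (use GL2_zhat_inverse(1) in blast)
  then have "(\<forall>r\<in>GL2 zhat. alpha r S = S) \<longleftrightarrow> (\<forall>r\<in>GL2 zhat. AC.symmetries.ext (AC.tr (theta r)) S = S)" for S
    by (metis (no_types, lifting) alpha_eq image_iff)
  then show ?thesis by (simp add: fixed_points_def)
qed

lemma fixed_points_CrP: "fixed_points CrP = P.A"
proof -
  have "CrP = closure (hecke_rep P_grp P.H ` {f \<in> hecke_algebra P_grp P.H. P.support f \<subseteq> carrier P_grp})"
    unfolding CrP_def reduced_hecke_algebra_def P_H by (simp add: P.support_def)
  then have "fixed_points CrP = closure (hecke_rep P_grp P.H ` {f \<in> P.locally_invariant. P.support f \<subseteq> carrier P_grp})"
    unfolding fixed_points_eq
    using AC.symmetries.fixed_algebra[of "carrier P_grp"] P.cls_carrier by simp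
  then show ?thesis by (simp add: P.A_def P.support_def)
qed

text \<open>\<open>P.At p\<close> is a union of classes, so \<open>fixed_algebra\<close> applies to
  the functions supported on it.\<close>

lemma fixed_points_Afr:
  assumes p: "prime p"
  shows "fixed_points (Afr p) = P.Aloc p"
proof -
  have "(\<forall>x. f x \<noteq> 0 \<longrightarrow> x \<in> P_at p) \<longleftrightarrow> P.support f \<subseteq> P.At p" if "f \<in> hecke_algebra P_grp P0" for f
    using that P.At_carrier[of _ p] unfolding P_At[OF p, symmetric]
    by (auto simp: P.support_def hecke_algebra_def)
  then have "{f \<in> hecke_algebra P_grp P0. \<forall>x. f x \<noteq> 0 \<longrightarrow> x \<in> P_at p}
      = {f \<in> hecke_algebra P_grp P.H. P.support f \<subseteq> P.At p}"
    unfolding P_H by blast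
  then have "Afr p = closure (hecke_rep P_grp P.H ` {f \<in> hecke_algebra P_grp P.H. P.support f \<subseteq> P.At p})"
    unfolding Afr_def P_H by simp
  moreover have "y \<in> P.At p" if "x \<in> P.At p" "y \<in> P.cls x" for x y
    using that P.lequiv_K_iff[of _ x y] by (auto simp: P.At_def P.cls_def)
  ultimately show ?thesis
    unfolding fixed_points_eq P.Aloc_def using AC.symmetries.fixed_algebra[of "P.At p"] by simp
qed

theorem theorem3p2:
  shows "(\<forall>p q. prime p \<and> prime q \<and> p \<noteq> q \<longrightarrow>
            (\<forall>S\<in>fixed_points (Afr p). \<forall>T\<in>fixed_points (Afr q). S o\<^sub>L T = T o\<^sub>L S)) \<and>
         star_isomorphic (fixed_points CrP)
           (spatial_tensor {p. prime p} (\<lambda>p. rcosets\<^bsub>P_grp\<^esub> P0) (\<lambda>p. P0)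
              (\<lambda>p. fixed_points (Afr p)))"
proof (intro conjI allI impI ballI)
  fix p q S T assume "prime p \<and> prime q \<and> p \<noteq> q" "S \<in> fixed_points (Afr p)" "T \<in> fixed_points (Afr q)"
  then show "S o\<^sub>L T = T o\<^sub>L S" using P.Aloc_commute fixed_points_Afr by blast
next
  have "spatial_tensor {p. prime p} (\<lambda>p. rcosets\<^bsub>P_grp\<^esub> P0) (\<lambda>p. P0) (\<lambda>p. fixed_points (Afr p))
      = spatial_tensor {p. prime p} (\<lambda>p. rcosets\<^bsub>P_grp\<^esub> P0) (\<lambda>p. P0) P.Aloc"
    unfolding spatial_tensor_def by (subst elementary_tensors_cong[where B = P.Aloc]) (simp_all add: fixed_points_Afr)
  then show "star_isomorphic (fixed_points CrP)
      (spatial_tensor {p. prime p} (\<lambda>p. rcosets\<^bsub>P_grp\<^esub> P0) (\<lambda>p. P0) (\<lambda>p. fixed_points (Afr p)))"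
    using P.tensor_decomposition unfolding fixed_points_CrP P_H by simp
qed

end
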